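(* Let $n\ge2$ and $\theta_0\in(0,\pi)$. Let $\Sigma\subset\overline{\mathbb{R}^{n+1}_+}$ be a compact, embedded $C^2$-hypersurface with boundary $\partial\Sigma\subset\partial\mathbb{R}^{n+1}_+$ intersecting $\partial\mathbb{R}^{n+1}_+$ transversally such that $$\langle\nu(x),-E_{n+1}\rangle\ge-\cos\theta_0\quad\text{for any }x\in\partial\Sigma,$$ where $\nu$ is the outward unit normal to $\Sigma$ with respect to $\Omega$, the bounded domain enclosed by $\Sigma$ and $\partial\mathbb{R}^{n+1}_+$. Then $$\frac{1}{n+1}\int_\Sigma\bigl(1-\cos\theta_0\langle\nu,E_{n+1}\rangle\bigr)|H|^n\,dA\ \ge\ |B_{1,\theta_0}|,$$ where $B_{1,\theta_0}=B_1(-\cos\theta_0E_{n+1})\cap\mathbb{R}^{n+1}_+$ is the unit ball with center $-\cos\theta_0E_{n+1}$ truncated by the upper half-space. Moreover, equality holds if and only if $\Sigma$ is a $\theta_0$-capillary spherical cap in $\overline{\mathbb{R}^{n+1}_+}$.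
   Context: $E_1,\dots,E_{n+1}$ is the coordinate basis of $\mathbb{R}^{n+1}$; $\mathbb{R}^{n+1}_+=\{x:\langle x,E_{n+1}\rangle>0\}$ and $\overline{\mathbb{R}^{n+1}_+}$ is its closure. $H$ is the normalized mean curvature of $\Sigma$ with respect to $\nu$ (trace of the second fundamental form divided by $n$). $|\cdot|$ of an open set is Lebesgue measure. A $\theta_0$-capillary spherical cap is the intersection of a sphere with $\overline{\mathbb{R}^{n+1}_+}$, meeting $\partial\mathbb{R}^{n+1}_+$ transversally, with $\langle\nu,-E_{n+1}\rangle=-\cos\theta_0$ along its boundary, where $\nu$ is the outward unit normal of the sphere. *)

theory Defs
  imports "HOL-Analysis.Analysis"
begin

text \<open>
  With \<open>n = CARD('n)\<close>, the space of dimension \<open>n + 1\<close> is the Euclidean product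
  \<open>(real^'n) \<times> real\<close>; the second component is the last coordinate.
\<close>

type_synonym 'n space = "(real^'n) \<times> real"

definition E_last :: "('n::finite) space" where
  "E_last = (0, 1)"

definition upper_half_space :: "('n::finite) space set" where
  "upper_half_space = {x. x \<bullet> E_last > 0}"

definition C2_on :: "('a::real_normed_vector \<Rightarrow> 'b::real_normed_vector) \<Rightarrow> 'a set \<Rightarrow> bool" where
  "C2_on f U \<longleftrightarrow>
     (\<exists>(f' :: 'a \<Rightarrow> 'a \<Rightarrow>\<^sub>L 'b) (f'' :: 'a \<Rightarrow> 'a \<Rightarrow>\<^sub>L 'a \<Rightarrow>\<^sub>L 'b).
        (\<forall>u\<in>U. (f has_derivative blinfun_apply (f' u)) (at u)) \<and>
        (\<forall>u\<in>U. (f' has_derivative blinfun_apply (f'' u)) (at u)) \<and>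
        continuous_on U f'')"

text \<open>
  The parameter domain \<open>W\<close> is open in \<open>real^'n\<close> (interior patch) or relatively open in a closed
  coordinate half-space (boundary patch). In the latter case \<open>\<phi>\<close> is \<open>C\<^sup>2\<close> up to the
  boundary in the sense that it is \<open>C\<^sup>2\<close> on an open set containing \<open>W\<close>; the values of \<open>\<phi>\<close>
  outside \<open>W\<close> play no role.
\<close>

definition local_parametrization ::
    "('n::finite) space set \<Rightarrow> (real^'n) set \<Rightarrow> (real^'n \<Rightarrow> 'n space) \<Rightarrow> bool" where
  "local_parametrization \<Sigma> W \<phi> \<longleftrightarrow>
     (open W \<or> (\<exists>k. openin (top_of_set {u. 0 \<le> u $ k}) W)) \<and>
     (\<exists>U. open U \<and> W \<subseteq> U \<and> C2_on \<phi> U) \<and>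
     (\<forall>u\<in>W. inj (frechet_derivative \<phi> (at u))) \<and>
     openin (top_of_set \<Sigma>) (\<phi> ` W) \<and>
     (\<exists>\<psi>. homeomorphism W (\<phi> ` W) \<phi> \<psi>)"

definition C2_hypersurface :: "('n::finite) space set \<Rightarrow> bool" where
  "C2_hypersurface \<Sigma> \<longleftrightarrow> (\<forall>x\<in>\<Sigma>. \<exists>W \<phi>. local_parametrization \<Sigma> W \<phi> \<and> x \<in> \<phi> ` W)"

text \<open>The manifold boundary (not the topological frontier); it may be empty.\<close>

definition hypersurface_boundary :: "('n::finite) space set \<Rightarrow> 'n space set" where
  "hypersurface_boundary \<Sigma> =
     \<Sigma> - {x. \<exists>W \<phi>. local_parametrization \<Sigma> W \<phi> \<and> open W \<and> x \<in> \<phi> ` W}"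

text \<open>At boundary points this is the full \<open>n\<close>-dimensional tangent space, not a half-space.\<close>

definition tangent_space :: "('n::finite) space set \<Rightarrow> 'n space \<Rightarrow> 'n space set" where
  "tangent_space \<Sigma> x =
     {v. \<exists>W \<phi> u w. local_parametrization \<Sigma> W \<phi> \<and> u \<in> W \<and> \<phi> u = x \<and>
           v = frechet_derivative \<phi> (at u) w}"

text \<open>
  \<open>T\<^sub>x\<Sigma>\<close> and the tangent space of the hyperplane span the whole space at every common point.
  Together with \<open>\<Sigma> \<subseteq> closure upper_half_space\<close> this forbids interior points
  of \<open>\<Sigma>\<close> on the hyperplane, since \<open>\<Sigma>\<close> would be tangent to it there.
\<close>

definition transversal_to_hyperplane :: "('n::finite) space set \<Rightarrow> bool" where
  "transversal_to_hyperplane \<Sigma> \<longleftrightarrow>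
     (\<forall>x \<in> \<Sigma> \<inter> frontier upper_half_space.
        {v + w | v w. v \<in> tangent_space \<Sigma> x \<and> w \<bullet> E_last = 0} = UNIV)"

definition enclosed_domain :: "('n::finite) space set \<Rightarrow> 'n space set \<Rightarrow> bool" where
  "enclosed_domain \<Sigma> \<Omega> \<longleftrightarrow>
     open \<Omega> \<and> connected \<Omega> \<and> \<Omega> \<noteq> {} \<and> bounded \<Omega> \<and> \<Omega> \<subseteq> upper_half_space \<and>
     \<Sigma> \<subseteq> frontier \<Omega> \<and> frontier \<Omega> \<subseteq> \<Sigma> \<union> frontier upper_half_space"

text \<open>
  That \<open>\<nu>\<close> points out of \<open>\<Omega>\<close> is required on the open half-space only: at a point of the
  hyperplane the segment \<open>x - t \<nu>(x)\<close> may leave the half-space. There \<open>\<nu>\<close> is determined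
  by continuity.
\<close>

definition outward_unit_normal ::
    "('n::finite) space set \<Rightarrow> 'n space set \<Rightarrow> ('n space \<Rightarrow> 'n space) \<Rightarrow> bool" where
  "outward_unit_normal \<Sigma> \<Omega> \<nu> \<longleftrightarrow>
     continuous_on \<Sigma> \<nu> \<and>
     (\<forall>x\<in>\<Sigma>. norm (\<nu> x) = 1 \<and> (\<forall>v\<in>tangent_space \<Sigma> x. \<nu> x \<bullet> v = 0)) \<and>
     (\<forall>x \<in> \<Sigma> \<inter> upper_half_space.
        \<forall>\<^sub>F t in at_right 0. x - t *\<^sub>R \<nu> x \<in> \<Omega> \<and> x + t *\<^sub>R \<nu> x \<notin> \<Omega>)"

text \<open>
  The form \<open>\<langle>D\<^sub>v\<nu>, w\<rangle>\<close>, positive on round spheres with outward normal. The derivative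
  of \<open>\<nu>\<close> within \<open>\<Sigma>\<close> is not unique as a linear map on the ambient space, but its
  restriction to \<open>T\<^sub>x\<Sigma>\<close> is, and the form is only used for tangent vectors.
\<close>

definition second_fundamental_form ::
    "('n::finite) space set \<Rightarrow> ('n space \<Rightarrow> 'n space) \<Rightarrow> 'n space \<Rightarrow> 'n space \<Rightarrow> 'n space \<Rightarrow> real" where
  "second_fundamental_form \<Sigma> \<nu> x v w = frechet_derivative \<nu> (at x within \<Sigma>) v \<bullet> w"

definition orthonormal_basis_of :: "'a::euclidean_space set \<Rightarrow> 'a set \<Rightarrow> bool" where
  "orthonormal_basis_of T B \<longleftrightarrow> pairwise orthogonal B \<and> (\<forall>b\<in>B. norm b = 1) \<and> span B = T"

text \<open>Normalized trace; it does not depend on the chosen orthonormal basis.\<close>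

definition mean_curvature ::
    "('n::finite) space set \<Rightarrow> ('n space \<Rightarrow> 'n space) \<Rightarrow> 'n space \<Rightarrow> real" where
  "mean_curvature \<Sigma> \<nu> x =
     (\<Sum>b\<in>(SOME B. orthonormal_basis_of (tangent_space \<Sigma> x) B).
        second_fundamental_form \<Sigma> \<nu> x b b) / real CARD('n)"

definition area_density :: "(real^('n::finite) \<Rightarrow> 'n space) \<Rightarrow> real^'n \<Rightarrow> real" where
  "area_density \<phi> u =
     sqrt (det (\<chi> i j. frechet_derivative \<phi> (at u) (axis i 1)
                      \<bullet> frechet_derivative \<phi> (at u) (axis j 1)))"

text \<open>
  The Riemannian area measure on the Borel sets of \<open>\<Sigma>\<close>: the unique measure given in every
  local parametrization by integrating the square root of the Gram determinant. Its
  underlying space is \<open>\<Sigma>\<close>, so integrands need only be measurable on \<open>\<Sigma>\<close>.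
\<close>

definition area_measure :: "('n::finite) space set \<Rightarrow> 'n space measure" where
  "area_measure \<Sigma> =
     (THE \<mu>. sets \<mu> = sets (restrict_space borel \<Sigma>) \<and>
        (\<forall>W \<phi>. local_parametrization \<Sigma> W \<phi> \<longrightarrow>
           (\<forall>A\<in>sets \<mu>. A \<subseteq> \<phi> ` W \<longrightarrow>
              emeasure \<mu> A = (\<integral>\<^sup>+u\<in>W \<inter> \<phi> -` A. ennreal (area_density \<phi> u) \<partial>lborel))))"

text \<open>
  The cap has to meet the hyperplane, so a full sphere in the open half-space does not count.
  The outward unit normal of the sphere at \<open>x\<close> is \<open>(x - c) / r\<close>.
\<close>

definition capillary_spherical_cap :: "real \<Rightarrow> ('n::finite) space set \<Rightarrow> bool" where
  "capillary_spherical_cap \<theta> \<Sigma> \<longleftrightarrow>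
     (\<exists>c r. r > 0 \<and> \<Sigma> = sphere c r \<inter> closure upper_half_space \<and>
        \<Sigma> \<inter> frontier upper_half_space \<noteq> {} \<and> transversal_to_hyperplane \<Sigma> \<and>
        (\<forall>x \<in> \<Sigma> \<inter> frontier upper_half_space.
           ((x - c) /\<^sub>R r) \<bullet> (- E_last) = - cos \<theta>))"

definition truncated_unit_ball :: "real \<Rightarrow> ('n::finite) space set" where
  "truncated_unit_ball \<theta> = ball (- cos \<theta> *\<^sub>R E_last) 1 \<inter> upper_half_space"

end

theory Submission imports Defs begin

text \<open>
  Write \<open>c = cos \<theta>\<^sub>0\<close>. Every unit vector \<open>y\<close> with \<open>\<langle>y, E\<rangle> > c\<close> is the normal at a point of \<open>\<Sigma>\<close>
  in the open half-space whose tangent hyperplane supports \<open>\<Omega>\<close>: a point of \<open>\<Sigma>\<close> maximizing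
  \<open>\<langle>\<cdot>, y\<rangle>\<close> over \<open>\<Omega>\<close> has this property unless it lies on the hyperplane, and there \<open>y\<close> would
  lie on the arc from \<open>\<nu>\<close> to \<open>-E\<close>, against the angle condition. Hence \<open>(x, t) \<mapsto> t (\<nu>(x) - c E)\<close>
  maps the product of these contact points and \<open>(0, 1)\<close> onto the truncated ball. All principal curvatures are
  nonnegative at contact points, so by the arithmetic-geometric mean inequality the Jacobian
  \<open>t\<^sup>n (1 - c \<langle>\<nu>, E\<rangle>) K\<close> is at most \<open>t\<^sup>n (1 - c \<langle>\<nu>, E\<rangle>) H\<^sup>n\<close>, and integration gives the inequality.

  In the equality case the points of nonzero mean curvature are umbilic contact points. There \<open>H\<close> is locally
  constant, so a component of \<open>{H \<noteq> 0}\<close> is open and closed in \<open>\<Sigma>\<close> and lies on a sphere; being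
  also open in the sphere, it is a whole cap, and the contact and angle conditions force its contact angle to be
  \<open>\<theta>\<^sub>0\<close>. The cap encloses \<open>\<Omega>\<close>, and two such caps coincide. What is left of \<open>\<Sigma>\<close> would be
  compact with \<open>H = 0\<close>, which is impossible at a point farthest from a suitable point far below the hyperplane.
\<close>

section \<open>Analysis and linear algebra\<close>

text \<open>The weight is \<open>(\<nu> - c E) \<bullet> \<nu>\<close>, the normal component of the
  radial derivative of the cone map; this is why the integrand and the Jacobian share it. Three
  difficulties shape the argument. The normal is given as a continuous map only, so its derivative
  has to be produced from the second derivatives of a patch, and \<open>H\<close> is then merely
  continuous: the usual proof that umbilic surfaces are spherical, which differentiates the
  curvature, is replaced by one that does not. Outwardness of the normal is known only above the
  hyperplane, so the position of \<open>\<Omega>\<close> at a boundary point has to be found by a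
  limit. Equality of the integrals yields equality of the integrands almost everywhere; since
  relatively open parts of the surface have positive area, the good points are dense, and every
  property used afterwards survives limits.\<close>

text \<open>Adding a nonnegative multiple of \<open>e\<close> and normalizing turns \<open>y\<close>
  towards \<open>e\<close>. With \<open>p = y \<bullet> e\<close> the claim is
  \<open>a * p \<le> p + b\<close>; where \<open>p\<close> and \<open>p + b\<close> are both
  negative, squares are compared. It serves at a boundary maximum, where \<open>y\<close> plus a
  multiple of \<open>E_last\<close> is a multiple of the normal.\<close>

lemma inner_le_along_arc:
  fixes y z e :: "'a::real_inner"
  assumes "norm y = 1" "norm z = 1" "norm e = 1" "0 \<le> a" "0 \<le> b" "y + b *\<^sub>R e \<noteq> 0"
    and eq: "a *\<^sub>R z = y + b *\<^sub>R e"
  shows "y \<bullet> e \<le> z \<bullet> e"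
proof -
  define p where "p = y \<bullet> e"
  have a: "a > 0" using assms by (cases "a = 0") auto
  have yy: "y \<bullet> y = 1" and ee: "e \<bullet> e = 1" and zz: "z \<bullet> z = 1"
    using assms by (simp_all add: dot_square_norm)
  have p1: "\<bar>p\<bar> \<le> 1" using Cauchy_Schwarz_ineq2[of y e] assms by (simp add: p_def)
  have 1: "a * (z \<bullet> e) = p + b"
  proof -
    have "(a *\<^sub>R z) \<bullet> e = (y + b *\<^sub>R e) \<bullet> e" by (simp only: eq)
    then show ?thesis using ee by (simp add: inner_add_left p_def)
  qed
  have 2: "a^2 = 1 + 2*b*p + b^2"
  proof -
    have "(a *\<^sub>R z) \<bullet> (a *\<^sub>R z) = (y + b *\<^sub>R e) \<bullet> (y + b *\<^sub>R e)" by (simp only: eq)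
    then show ?thesis using yy ee zz
      by (simp add: inner_add_left inner_add_right p_def inner_commute power2_eq_square)
  qed
  have "a * p \<le> p + b"
  proof (cases "p \<ge> 0")
    case True
    have "a^2 \<le> (1+b)^2"
    proof -
      have "b * p \<le> b * 1" using p1 assms(5) by (intro mult_left_mono) auto
      then show ?thesis unfolding 2 by (simp add: power2_eq_square algebra_simps)
    qed
    then have "a \<le> 1 + b" by (rule power2_le_imp_le) (use assms(5) in simp)
    then have "a * p \<le> (1 + b) * p" using True by (rule mult_right_mono)
    also have "\<dots> \<le> p + b" using p1 assms(5) mult_left_mono[of p 1 b] by (simp add: algebra_simps)
    finally show ?thesis .
  next
    case False
    show ?thesis
    proof (cases "p + b \<ge> 0")
      case True
      have "a * p \<le> 0" using False a by (simp add: mult_nonneg_nonpos)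
      then show ?thesis using True by simp
    next
      case F2: False
      have "0 \<le> (1 - p^2) * (b * (- (2*p + b)))"
        using p1 F2 False assms(5) by (intro mult_nonneg_nonneg) (auto simp: abs_square_le_1)
      also have "\<dots> = (a*p)^2 - (p + b)^2"
        unfolding power_mult_distrib 2 by (simp add: power2_eq_square algebra_simps)
      finally have "(- (p + b))^2 \<le> (- (a*p))^2" by (simp only: power2_minus diff_ge_0_iff_ge)
      moreover have "0 \<le> - (a*p)" using False a by (simp add: mult_nonneg_nonpos)
      ultimately have "- (p + b) \<le> - (a*p)" by (rule power2_le_imp_le)
      then show ?thesis by simp
    qed
  qed
  then have "a * p \<le> a * (z \<bullet> e)" using 1 by simp
  then show ?thesis using a by (simp add: p_def)
qed

section \<open>The arithmetic-geometric mean inequality with its equality case\<close>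

lemma exp_gt_add_one:
  fixes x :: real assumes "x \<noteq> 0" shows "1 + x < exp x"
proof (cases "1 + x > 0")
  case True
  have "ln (1 + x) < x" using ln_add_one_self_le_self2[of x] ln_eq_minus_one[of "1+x"] assms True
    by (smt (verit, ccfv_threshold) ln_le_minus_one)
  then show ?thesis using True by (metis exp_less_cancel_iff exp_ln)
next
  case False then show ?thesis by (smt (verit) exp_gt_zero)
qed

text \<open>After division by the mean, the inequality \<open>x \<le> exp (x - 1)\<close> is
  multiplied over all factors; the exponents add up to zero, so the product on the right is 1. A
  factor other than 1 makes one of these inequalities strict, which settles equality.\<close>

lemma prod_le_mean_power:
  fixes l :: "'i \<Rightarrow> real"
  assumes fin: "finite I" and ne: "I \<noteq> {}" and pos: "\<And>i. i \<in> I \<Longrightarrow> 0 \<le> l i"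
  defines "m \<equiv> (\<Sum>i\<in>I. l i) / real (card I)"
  shows "(\<Prod>i\<in>I. l i) \<le> m ^ card I"
    and "(\<Prod>i\<in>I. l i) = m ^ card I \<Longrightarrow> i \<in> I \<Longrightarrow> l i = m"
proof -
  have c: "card I > 0" using fin ne by (simp add: card_gt_0_iff)
  have m0: "m \<ge> 0" unfolding m_def by (simp add: sum_nonneg pos)
  have sm: "(\<Sum>i\<in>I. l i) = m * real (card I)" using c by (simp add: m_def)
  have "(\<Prod>i\<in>I. l i) \<le> m ^ card I \<and> ((\<Prod>i\<in>I. l i) = m ^ card I \<longrightarrow> (\<forall>i\<in>I. l i = m))"
  proof (cases "m = 0")
    case True
    then have "\<forall>i\<in>I. l i = 0" using sm sum_nonneg_eq_0_iff[OF fin, of l] pos by simp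
    then show ?thesis using True c fin ne by auto
  next
    case False
    then have mp: "m > 0" using m0 by simp
    define x where "x i = l i / m" for i
    have x0: "0 \<le> x i" if "i \<in> I" for i using pos[OF that] mp by (simp add: x_def)
    have xe: "x i \<le> exp (x i - 1)" for i using exp_ge_add_one_self[of "x i - 1"] by simp
    have pe: "(\<Prod>i\<in>I. exp (x i - 1)) = 1"
    proof -
      have "(\<Sum>i\<in>I. x i - 1) = 0"
        using sm mp by (simp add: x_def sum_subtractf flip: sum_divide_distrib)
      then show ?thesis by (simp add: exp_sum[OF fin, symmetric])
    qed
    have px: "(\<Prod>i\<in>I. l i) = m ^ card I * (\<Prod>i\<in>I. x i)"
      using mp by (simp add: x_def prod_dividef)
    have "(\<Prod>i\<in>I. x i) \<le> (\<Prod>i\<in>I. exp (x i - 1))"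
      by (intro prod_mono) (use x0 xe in auto)
    then have le: "(\<Prod>i\<in>I. x i) \<le> 1" using pe by simp
    have strict: "(\<Prod>i\<in>I. x i) < 1" if j: "j \<in> I" "x j \<noteq> 1" for j
    proof -
      have "(\<Prod>i\<in>I. x i) = x j * (\<Prod>i\<in>I-{j}. x i)" using fin j by (simp add: prod.remove)
      also have "\<dots> \<le> x j * (\<Prod>i\<in>I-{j}. exp (x i - 1))"
        using x0 xe j by (intro mult_left_mono prod_mono) auto
      also have "\<dots> < exp (x j - 1) * (\<Prod>i\<in>I-{j}. exp (x i - 1))"
        using exp_gt_add_one[of "x j - 1"] j by (intro mult_strict_right_mono prod_pos) auto
      also have "\<dots> = 1" using pe fin j by (simp add: prod.remove[of I j])
      finally show ?thesis .
    qed
    show ?thesis unfolding px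
    proof (intro conjI impI ballI)
      show "m ^ card I * (\<Prod>i\<in>I. x i) \<le> m ^ card I" using le mp by (simp add: mult_left_le)
      fix i assume "m ^ card I * (\<Prod>i\<in>I. x i) = m ^ card I" "i \<in> I"
      then have "(\<Prod>i\<in>I. x i) = 1" using mp by simp
      then have "x i = 1" using strict[OF \<open>i \<in> I\<close>] by auto
      then show "l i = m" using mp by (simp add: x_def)
    qed
  qed
  then show "(\<Prod>i\<in>I. l i) \<le> m ^ card I"
    and "(\<Prod>i\<in>I. l i) = m ^ card I \<Longrightarrow> i \<in> I \<Longrightarrow> l i = m" by auto
qed

section \<open>Eigenbases of symmetric maps on a subspace\<close>

text \<open>A maximizer of \<open>x \<bullet> S x\<close> on the unit sphere of \<open>T\<close> is
  an eigenvector: its first variation in a direction \<open>v\<close> orthogonal to \<open>x\<close>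
  is twice \<open>v \<bullet> S x\<close> by symmetry, so this vanishes and \<open>S x\<close> is
  parallel to \<open>x\<close>.\<close>

lemma symmetric_top_eigenvector:
  fixes S :: "'a::euclidean_space \<Rightarrow> 'a"
  assumes T: "subspace T" "T \<noteq> {0}" and S: "linear S" "\<And>v. v \<in> T \<Longrightarrow> S v \<in> T"
    and sym: "\<And>v w. v \<in> T \<Longrightarrow> w \<in> T \<Longrightarrow> S v \<bullet> w = v \<bullet> S w"
  shows "\<exists>x m. x \<in> T \<and> norm x = 1 \<and> S x = m *\<^sub>R x"
proof -
  let ?K = "T \<inter> sphere 0 1"
  interpret S: linear S by fact
  have "compact ?K" using closed_subspace[OF T(1)] by (metis closed_Int_compact compact_sphere)
  moreover have "?K \<noteq> {}"
  proof -
    obtain v where v: "v \<in> T" "v \<noteq> 0" using T subspace_0 by blast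
    then have "v /\<^sub>R norm v \<in> ?K" using T(1) by (simp add: subspace_scale)
    then show ?thesis by blast
  qed
  moreover have "continuous_on ?K (\<lambda>x. x \<bullet> S x)"
    by (intro continuous_intros linear_continuous_on linear_linear[THEN iffD2] S)
  ultimately obtain x where x: "x \<in> ?K" and mx: "\<And>z. z \<in> ?K \<Longrightarrow> z \<bullet> S z \<le> x \<bullet> S x"
    using continuous_attains_sup[of ?K "\<lambda>x. x \<bullet> S x"] by metis
  define m where "m = x \<bullet> S x"
  have xT: "x \<in> T" and xx: "x \<bullet> x = 1" using x by (auto simp: dot_square_norm)
  have bd: "z \<bullet> S z \<le> m * (z \<bullet> z)" if z: "z \<in> T" for z
  proof (cases "z = 0")
    case False
    then have "z /\<^sub>R norm z \<in> ?K" using T(1) z by (simp add: subspace_scale)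
    from mx[OF this] have "(z \<bullet> S z) / (norm z)^2 \<le> m"
      using False by (simp add: m_def S.scale power2_eq_square divide_inverse mult_ac)
    then show ?thesis using False by (simp add: pos_divide_le_eq power2_norm_eq_inner)
  qed (simp add: S.zero)
  have orth: "v \<bullet> S x = 0" if v: "v \<in> T" "v \<bullet> x = 0" for v
  proof (rule ccontr)
    assume ne: "v \<bullet> S x \<noteq> 0"
    define a where "a = v \<bullet> S x"
    define d where "d = m * (v \<bullet> v) - v \<bullet> S v"
    have ineq: "2 * t * a \<le> t^2 * d" for t
    proof -
      have "x + t *\<^sub>R v \<in> T" using T(1) xT v by (simp add: subspace_add subspace_scale)
      from bd[OF this] have "m + 2 * t * a + t^2 * (v \<bullet> S v) \<le> m * (1 + t^2 * (v \<bullet> v))"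
        using v xx sym[OF xT v(1)]
        by (simp add: S.add S.scale inner_add_left inner_add_right m_def a_def inner_commute
            power2_eq_square algebra_simps)
      then show ?thesis by (simp add: d_def algebra_simps)
    qed
    \<comment> \<open>\<open>D\<close> is positive and exceeds \<open>d\<close>, so
      \<open>t = a / D\<close> turns \<open>ineq\<close> into
      \<open>2 * a * a / D \<le> a * a / D\<close>.\<close>
    define D where "D = \<bar>d\<bar> + 1"
    have Dp: "D > 0" "d < D" by (auto simp: D_def)
    have "2 * (a / D) * a \<le> (a / D)^2 * d" by (rule ineq)
    also have "\<dots> \<le> (a / D)^2 * D" using Dp by (intro mult_left_mono) auto
    also have "\<dots> = (a / D) * a" using Dp by (simp add: power2_eq_square)
    finally have "a * a / D \<le> 0" by simp
    moreover have "a * a / D > 0"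
      using ne Dp(1) unfolding a_def by (intro divide_pos_pos) (metis not_real_square_gt_zero)
    ultimately show False by simp
  qed
  define v where "v = S x - m *\<^sub>R x"
  have vT: "v \<in> T" using T(1) xT S by (simp add: v_def subspace_diff subspace_scale)
  have vx: "v \<bullet> x = 0"
    unfolding v_def inner_diff_left inner_scaleR_left xx by (simp add: m_def inner_commute)
  have "v \<bullet> v = v \<bullet> S x - m * (v \<bullet> x)" by (subst (2) v_def) (simp add: inner_diff_right)
  then have "v = 0" using orth[OF vT vx] vx by simp
  then have Sx: "S x = m *\<^sub>R x" by (simp add: v_def)
  show ?thesis using xT x Sx by auto
qed

text \<open>Induction on the dimension: by symmetry the complement \<open>T'\<close> of an
  eigenvector is again invariant.\<close>

lemma symmetric_orthonormal_eigenbasis: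
  fixes S :: "'a::euclidean_space \<Rightarrow> 'a"
  assumes "subspace T" "linear S" "\<And>v. v \<in> T \<Longrightarrow> S v \<in> T"
    and "\<And>v w. v \<in> T \<Longrightarrow> w \<in> T \<Longrightarrow> S v \<bullet> w = v \<bullet> S w"
  shows "\<exists>B. orthonormal_basis_of T B \<and> (\<forall>b\<in>B. \<exists>m. S b = m *\<^sub>R b)"
  using assms
proof (induction "dim T" arbitrary: T rule: less_induct)
  case (less T)
  show ?case
  proof (cases "T = {0}")
    case True
    then show ?thesis by (intro exI[of _ "{}"]) (simp add: orthonormal_basis_of_def)
  next
    case False
    obtain x m where x: "x \<in> T" "norm x = 1" "S x = m *\<^sub>R x"
      using symmetric_top_eigenvector[OF less.prems(1) False less.prems(2-)] by blast
    define T' where "T' = T \<inter> {v. x \<bullet> v = 0}"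
    have sT': "subspace T'" unfolding T'_def using subspace_inter[OF less.prems(1) subspace_hyperplane[of x]] by simp
    have xn: "x \<notin> T'" using x by (auto simp: T'_def dot_square_norm)
    have "T' \<subseteq> T" "T' \<noteq> T" using x(1) xn unfolding T'_def by blast+
    then have "T' \<subset> T" by blast
    then have dl: "dim T' < dim T"
      using less.prems(1) sT' dim_psubset by (metis span_eq_iff)
    have inv: "S v \<in> T'" if "v \<in> T'" for v
      using that less.prems(3)[of v] less.prems(4)[of x v] x by (auto simp: T'_def)
    obtain B where B: "orthonormal_basis_of T' B" "\<forall>b\<in>B. \<exists>m. S b = m *\<^sub>R b"
      using less.hyps[OF dl sT' less.prems(2) inv] less.prems(4) unfolding T'_def by auto
    have BT: "B \<subseteq> T'" using B(1) unfolding orthonormal_basis_of_def by (metis span_superset)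
    have "span (insert x B) = T"
    proof
      show "span (insert x B) \<subseteq> T"
        using BT x less.prems(1) by (intro span_minimal) (auto simp: T'_def)
      show "T \<subseteq> span (insert x B)"
      proof
        fix v assume v: "v \<in> T"
        have "v - (x \<bullet> v) *\<^sub>R x \<in> T'"
          using v x less.prems(1) by (simp add: T'_def subspace_diff subspace_scale inner_diff_right dot_square_norm)
        then have "v - (x \<bullet> v) *\<^sub>R x \<in> span B" using B(1) by (simp add: orthonormal_basis_of_def)
        then show "v \<in> span (insert x B)" by (auto simp: span_insert)
      qed
    qed
    moreover have "pairwise orthogonal (insert x B)"
      using B(1) BT unfolding orthonormal_basis_of_def pairwise_insert
      by (auto simp: T'_def orthogonal_def inner_commute)
    ultimately show ?thesis
      using B x by (intro exI[of _ "insert x B"]) (auto simp: orthonormal_basis_of_def)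
  qed
qed

section \<open>Symmetry of second derivatives and stability of linear equations\<close>

text \<open>The second difference of \<open>f\<close> over the parallelogram spanned by
  \<open>t h\<close> and \<open>t k\<close> does not change when \<open>h\<close> and
  \<open>k\<close> are exchanged, and it equals \<open>t * t\<close> times \<open>D h k\<close> up
  to a smaller error.\<close>

lemma second_derivative_symmetric:
  fixes f :: "'a::real_normed_vector \<Rightarrow> 'b::real_normed_vector" and f' :: "'a \<Rightarrow> 'a \<Rightarrow>\<^sub>L 'b"
  assumes U: "open U" "x \<in> U"
    and f: "\<And>u. u \<in> U \<Longrightarrow> (f has_derivative blinfun_apply (f' u)) (at u)"
    and f': "(f' has_derivative blinfun_apply D) (at x)"
  shows "D h k = D k h"
proof -
  obtain r where r: "r > 0" "ball x r \<subseteq> U" using U openE by blast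
  have key: "\<exists>d>0. \<forall>t. 0 < t \<and> t < d \<longrightarrow>
      norm (f (x + t *\<^sub>R h + t *\<^sub>R k) - f (x + t *\<^sub>R h) - f (x + t *\<^sub>R k) + f x - (t*t) *\<^sub>R D h k)
        \<le> e * (t * t)" if e: "e > 0" for e h k
  proof -
    define M where "M = norm h + norm k + 1"
    have M: "M > 0" "norm h + norm k \<le> M" "norm k \<le> M" by (auto simp: M_def intro: add_nonneg_pos)
    \<comment> \<open>Two linearization errors of size \<open>e' * (t * M)\<close>, along a segment
      of length at most \<open>t * M\<close>, add up to \<open>e * (t * t)\<close>.\<close>
    define e' where "e' = e / (2 * M * M)"
    have e': "e' > 0" using e M by (simp add: e'_def)
    obtain d0 where d0: "d0 > 0"
      and d0': "\<And>y. norm (y - x) < d0 \<Longrightarrow> norm (f' y - f' x - D (y - x)) \<le> e' * norm (y - x)"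
      using f' e' unfolding has_derivative_at_alt by blast
    define d where "d = min d0 r / M"
    have d: "d > 0" using d0 r M by (simp add: d_def)
    show ?thesis
    proof (intro exI conjI allI impI)
      show "d > 0" by fact
      fix t assume t: "0 < t \<and> t < d"
      have tM: "t * M < min d0 r" using t M by (simp add: d_def pos_less_divide_eq)
      \<comment> \<open>The increment of \<open>f\<close> in direction \<open>h\<close> minus its
        expected linear part. The derivative of \<open>G\<close> is a difference of two
        linearization errors of \<open>f'\<close> at \<open>x\<close>, so the mean value inequality
        bounds \<open>G (t *\<^sub>R k) - G 0\<close>.\<close>
      define G where "G v = f (x + t *\<^sub>R h + v) - f (x + v) - D (t *\<^sub>R h) v" for v
      define S where "S = closed_segment 0 (t *\<^sub>R k)"
      have nv: "norm v \<le> t * norm k" if "v \<in> S" for v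
        using that t segment_bound1[of v 0 "t *\<^sub>R k"] by (simp add: S_def)
      have b1: "norm (t *\<^sub>R h + v) \<le> t * M" if "v \<in> S" for v
      proof -
        have "norm (t *\<^sub>R h + v) \<le> t * norm h + t * norm k"
          using nv[OF that] t norm_triangle_ineq[of "t *\<^sub>R h" v] by simp
        also have "\<dots> \<le> t * M" using t M(2) by (simp add: distrib_left[symmetric])
        finally show ?thesis .
      qed
      have b2: "norm v \<le> t * M" if "v \<in> S" for v
        using nv[OF that] mult_left_mono[OF M(3), of t] t by linarith
      have "norm (G (t *\<^sub>R k) - G 0) \<le> (2 * e' * (t * M)) * norm (t *\<^sub>R k - 0)"
      proof (rule differentiable_bound)
        show "convex S" "t *\<^sub>R k \<in> S" "0 \<in> S" by (auto simp: S_def)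
        fix v assume v: "v \<in> S"
        have i1: "x + t *\<^sub>R h + v \<in> U" "x + v \<in> U"
          proof -
          have "dist (x + (t *\<^sub>R h + v)) x < r" "dist (x + v) x < r"
            using b1[OF v] b2[OF v] tM by (simp_all add: dist_norm)
          then show "x + t *\<^sub>R h + v \<in> U" "x + v \<in> U"
            using r by (auto simp: add.assoc dist_commute)
        qed
        let ?G' = "f' (x + t *\<^sub>R h + v) - f' (x + v) - D (t *\<^sub>R h)"
        have "(G has_derivative blinfun_apply ?G') (at v)"
        proof -
          have a: "((\<lambda>v. c + v) has_derivative (\<lambda>w. w)) (at v)" for c :: 'a
            by (auto intro!: derivative_eq_intros)
          have "((\<lambda>v. f (x + t *\<^sub>R h + v) - f (x + v) - D (t *\<^sub>R h) v) has_derivative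
            (\<lambda>w. f' (x + t *\<^sub>R h + v) w - f' (x + v) w - D (t *\<^sub>R h) w)) (at v)"
            by (intro has_derivative_diff has_derivative_compose[OF a[of "x + t *\<^sub>R h"] f[OF i1(1)]]
                has_derivative_compose[OF a[of x] f[OF i1(2)]]
                bounded_linear_imp_has_derivative blinfun.bounded_linear_right)
          then show ?thesis unfolding G_def by (simp add: blinfun.diff_left fun_eq_iff minus_blinfun.rep_eq)
        qed
        then show "(G has_derivative blinfun_apply ?G') (at v within S)"
          by (rule has_derivative_at_withinI)
        have n1: "norm (f' (x + t *\<^sub>R h + v) - f' x - D (t *\<^sub>R h + v)) \<le> e' * norm (t *\<^sub>R h + v)"
          using d0'[of "x + t *\<^sub>R h + v"] b1[OF v] tM by (simp add: add.assoc)
        have n2: "norm (f' (x + v) - f' x - D v) \<le> e' * norm v"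
          using d0'[of "x + v"] b2[OF v] tM by simp
        have "norm ?G' = norm ((f' (x + t *\<^sub>R h + v) - f' x - D (t *\<^sub>R h + v)) - (f' (x + v) - f' x - D v))"
          by (simp add: blinfun.add_right algebra_simps)
        also have "\<dots> \<le> e' * norm (t *\<^sub>R h + v) + e' * norm v"
          using n1 n2 norm_triangle_ineq4 by (meson add_mono order_trans)
        also have "\<dots> \<le> e' * (t * M) + e' * (t * M)"
          using b1[OF v] b2[OF v] e' by (intro add_mono mult_left_mono) auto
        finally show "onorm (blinfun_apply ?G') \<le> 2 * e' * (t * M)"
          by (simp only: norm_blinfun.rep_eq)
      qed
      also have "\<dots> = 2 * e' * M * norm k * (t * t)" using t by simp
      also have "\<dots> \<le> 2 * e' * M * M * (t * t)"
        using e' M t by (intro mult_right_mono mult_left_mono) auto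
      also have "\<dots> = e * (t * t)" using M by (simp add: e'_def)
      finally show "norm (f (x + t *\<^sub>R h + t *\<^sub>R k) - f (x + t *\<^sub>R h) - f (x + t *\<^sub>R k) + f x - (t*t) *\<^sub>R D h k)
        \<le> e * (t * t)"
        by (simp add: G_def blinfun.scaleR_right blinfun.scaleR_left blinfun.zero_right algebra_simps)
    qed
  qed
  have "norm (D h k - D k h) \<le> e" if e: "e > 0" for e
  proof -
    have e2: "e / 2 > 0" using e by simp
    obtain d1 where d1: "d1 > 0" and k1: "\<forall>t. 0 < t \<and> t < d1 \<longrightarrow> norm (f (x + t *\<^sub>R h + t *\<^sub>R k) - f (x + t *\<^sub>R h) - f (x + t *\<^sub>R k) + f x - (t*t) *\<^sub>R D h k) \<le> e / 2 * (t * t)"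
      using key[OF e2] by metis
    obtain d2 where d2: "d2 > 0" and k2: "\<forall>t. 0 < t \<and> t < d2 \<longrightarrow> norm (f (x + t *\<^sub>R k + t *\<^sub>R h) - f (x + t *\<^sub>R k) - f (x + t *\<^sub>R h) + f x - (t*t) *\<^sub>R D k h) \<le> e / 2 * (t * t)"
      using key[OF e2] by metis
    define t where "t = min d1 d2 / 2"
    have t: "0 < t" "t < d1" "t < d2" using d1 d2 by (auto simp: t_def)
    have "(t*t) *\<^sub>R (D h k - D k h) =
       (f (x + t *\<^sub>R k + t *\<^sub>R h) - f (x + t *\<^sub>R k) - f (x + t *\<^sub>R h) + f x - (t*t) *\<^sub>R D k h)
       - (f (x + t *\<^sub>R h + t *\<^sub>R k) - f (x + t *\<^sub>R h) - f (x + t *\<^sub>R k) + f x - (t*t) *\<^sub>R D h k)"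
      by (simp add: algebra_simps)
    also have "norm \<dots> \<le> e / 2 * (t*t) + e / 2 * (t*t)"
      using k1 k2 t norm_triangle_ineq4 by (meson add_mono order_trans)
    finally have "(t*t) * norm (D h k - D k h) \<le> (t*t) * e"
      unfolding norm_scaleR by (simp add: mult_ac)
    then show ?thesis using t by simp
  qed
  then have "norm (D h k - D k h) \<le> 0" by (meson dense_ge)
  then show ?thesis by simp
qed

text \<open>The injective limit operator is bounded below by some \<open>m\<close>, so nearby
  operators are bounded below by \<open>m / 2\<close> and solutions converge together with the data.
  This yields continuity of the quantities that a chart determines only implicitly.\<close>

lemma tendsto_linear_solution:
  fixes L :: "'x \<Rightarrow> 'b::euclidean_space \<Rightarrow>\<^sub>L 'c::euclidean_space"
  assumes L: "(L \<longlongrightarrow> L0) F" and inj: "inj (blinfun_apply L0)"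
    and c: "((\<lambda>u. L u (X u)) \<longlongrightarrow> L0 X0) F"
  shows "(X \<longlongrightarrow> X0) F"
proof -
  obtain m where m: "m > 0" "\<And>v. m * norm v \<le> norm (L0 v)"
  proof -
    have "bounded_linear (blinfun_apply L0)" by (rule blinfun.bounded_linear_right)
    moreover have "L0 v = 0 \<Longrightarrow> v = 0" for v
      using inj by (metis blinfun.zero_right injD)
    ultimately obtain m where "m > 0" "\<forall>v\<in>UNIV. m * norm v \<le> norm (L0 v)"
      using injective_imp_isometric[of UNIV "blinfun_apply L0"] by (auto simp: mult.commute)
    then show ?thesis using that by blast
  qed
  have ev: "\<forall>\<^sub>F u in F. norm (X u - X0) \<le>
      (norm (L u (X u) - L0 X0) + norm (L u - L0) * norm X0) * (2 / m)"
  proof -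
    have "\<forall>\<^sub>F u in F. norm (L u - L0) < m / 2"
      using L m(1) unfolding tendsto_iff dist_norm by (elim allE[of _ "m / 2"]) simp
    then show ?thesis
    proof eventually_elim
      case (elim u)
      have "m * norm (X u - X0) \<le> norm (L0 (X u - X0))" by (rule m)
      also have "L0 (X u - X0) = (L u (X u) - L0 X0) - (L u - L0) X0 - (L u - L0) (X u - X0)"
        by (simp add: blinfun.diff_left blinfun.diff_right)
      also have "norm \<dots> \<le> norm (L u (X u) - L0 X0) + norm ((L u - L0) X0) + norm ((L u - L0) (X u - X0))"
        by (meson norm_triangle_ineq4 order_trans add_right_mono)
      also have "\<dots> \<le> norm (L u (X u) - L0 X0) + norm (L u - L0) * norm X0 + m / 2 * norm (X u - X0)"
        using elim by (intro add_mono norm_blinfun order_refl order_trans[OF norm_blinfun] mult_right_mono) auto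
      finally have "m / 2 * norm (X u - X0) \<le> norm (L u (X u) - L0 X0) + norm (L u - L0) * norm X0"
        by (simp add: field_simps)
      then show ?case using m(1) by (simp add: field_simps)
    qed
  qed
  have "((\<lambda>u. (norm (L u (X u) - L0 X0) + norm (L u - L0) * norm X0) * (2 / m)) \<longlongrightarrow> (norm (L0 X0 - L0 X0) + norm (L0 - L0) * norm X0) * (2/m)) F"
    by (intro tendsto_intros L c)
  then have "((\<lambda>u. X u - X0) \<longlongrightarrow> 0) F"
    by (intro Lim_null_comparison[OF ev]) simp
  then show ?thesis by (simp add: Lim_null[of X])
qed

section \<open>Change of variables on Euclidean spaces\<close>

text \<open>
  The change of variables theorems of the library are about \<open>real^'n\<close> with a well-ordered finite index type. They are
  transported to an arbitrary Euclidean space along coordinates indexed by the following type.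
\<close>

typedef (overloaded) ('a::euclidean_space) idx = "{..<DIM('a)}"
  by (intro exI[of _ 0]) simp

instantiation idx :: (euclidean_space) wellorder
begin

definition "x \<le> y \<longleftrightarrow> Rep_idx x \<le> Rep_idx y" for x y :: "'a idx"
definition "x < y \<longleftrightarrow> Rep_idx x < Rep_idx y" for x y :: "'a idx"

instance
proof
  fix x y z :: "'a idx"
  show "x < y \<longleftrightarrow> x \<le> y \<and> \<not> y \<le> x" "x \<le> x" "x \<le> y \<Longrightarrow> y \<le> z \<Longrightarrow> x \<le> z" "x \<le> y \<or> y \<le> x"
    "x \<le> y \<Longrightarrow> y \<le> x \<Longrightarrow> x = y"
    by (auto simp: less_eq_idx_def less_idx_def Rep_idx_inject)
next
  fix P :: "'a idx \<Rightarrow> bool" and a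
  assume H: "\<And>x. (\<And>y. y < x \<Longrightarrow> P y) \<Longrightarrow> P x"
  show "P a"
    by (induction "Rep_idx a" arbitrary: a rule: less_induct) (metis H less_idx_def)
qed

end

lemma range_Rep_idx: "range (Rep_idx :: 'a idx \<Rightarrow> nat) = {..<DIM('a::euclidean_space)}"
  by (rule type_definition.Rep_range[OF type_definition_idx])

instance idx :: (euclidean_space) finite
proof
  have "finite (range (Rep_idx :: 'a idx \<Rightarrow> nat))" by (simp add: range_Rep_idx)
  then show "finite (UNIV :: 'a idx set)"
    by (rule finite_imageD) (auto simp: inj_on_def Rep_idx_inject)
qed

lemma CARD_idx: "CARD('a idx) = DIM('a::euclidean_space)"
proof -
  have "CARD('a idx) = card (range (Rep_idx :: 'a idx \<Rightarrow> nat))"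
    by (rule card_image[symmetric]) (auto simp: inj_on_def Rep_idx_inject)
  then show ?thesis by (simp add: range_Rep_idx)
qed

definition basis_idx :: "'a::euclidean_space idx \<Rightarrow> 'a" where
  "basis_idx = (SOME f. bij_betw f UNIV Basis)"

lemma bij_basis_idx: "bij_betw (basis_idx :: 'a idx \<Rightarrow> 'a) UNIV (Basis :: 'a::euclidean_space set)"
proof -
  have "\<exists>f :: 'a idx \<Rightarrow> 'a. bij_betw f UNIV Basis"
    by (rule finite_same_card_bij) (auto simp: CARD_idx)
  then show ?thesis unfolding basis_idx_def by (rule someI_ex)
qed

lemma basis_idx_in [simp]: "basis_idx i \<in> Basis"
  using bij_basis_idx by (auto simp: bij_betw_def)

lemma inner_basis_idx: "basis_idx i \<bullet> basis_idx j = (if i = j then 1 else 0)"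
proof -
  have "basis_idx i = basis_idx j \<longleftrightarrow> i = j"
    using bij_basis_idx by (auto simp: bij_betw_def inj_on_def)
  then show ?thesis using inner_Basis[OF basis_idx_in basis_idx_in, of i j] by simp
qed

definition to_vec :: "'a::euclidean_space \<Rightarrow> real^'a idx" where
  "to_vec x = (\<chi> i. x \<bullet> basis_idx i)"

definition of_vec :: "real^'a idx \<Rightarrow> 'a::euclidean_space" where
  "of_vec v = (\<Sum>i\<in>UNIV. v $ i *\<^sub>R basis_idx i)"

lemma of_vec_inner_basis_idx: "of_vec v \<bullet> basis_idx i = v $ i"
  by (simp add: of_vec_def inner_sum_left inner_basis_idx if_distrib[of "(*) _"] sum.delta cong: if_cong)

lemma to_vec_of_vec [simp]: "to_vec (of_vec v) = v"
  by (simp add: to_vec_def of_vec_inner_basis_idx vec_eq_iff)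

lemma of_vec_to_vec [simp]: "of_vec (to_vec x) = x"
proof -
  have "of_vec (to_vec x) = (\<Sum>b\<in>Basis. (x \<bullet> b) *\<^sub>R b)"
    unfolding of_vec_def to_vec_def using sum.reindex_bij_betw[OF bij_basis_idx, of "\<lambda>b. (x \<bullet> b) *\<^sub>R b"]
    by simp
  then show ?thesis by (simp add: euclidean_representation)
qed

lemma linear_to_vec: "linear to_vec"
  by (auto intro!: linearI simp: to_vec_def vec_eq_iff inner_add_left)

lemma linear_of_vec: "linear of_vec"
  by (auto intro!: linearI simp: of_vec_def scaleR_add_left sum.distrib scaleR_sum_right)

lemma inj_to_vec: "inj to_vec" by (metis injI of_vec_to_vec)
lemma inj_of_vec: "inj of_vec" by (metis injI to_vec_of_vec)

lemma of_vec_axis: "of_vec (axis j 1) = basis_idx j"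
  by (simp add: of_vec_def axis_def if_distrib[of "\<lambda>c. c *\<^sub>R _"] sum.delta cong: if_cong)

lemma image_to_vec: "to_vec ` S = of_vec -` S"
proof
  show "to_vec ` S \<subseteq> of_vec -` S" by auto
  show "of_vec -` S \<subseteq> to_vec ` S"
  proof
    fix v assume "v \<in> of_vec -` S"
    then show "v \<in> to_vec ` S" using image_eqI[of v to_vec "of_vec v" S] by simp
  qed
qed

lemma image_of_vec: "of_vec ` S = to_vec -` S"
proof
  show "of_vec ` S \<subseteq> to_vec -` S" by auto
  show "to_vec -` S \<subseteq> of_vec ` S"
  proof
    fix v assume "v \<in> to_vec -` S"
    then show "v \<in> of_vec ` S" using image_eqI[of v of_vec "to_vec v" S] by simp
  qed
qed

lemma continuous_to_vec: "continuous_on S to_vec" and continuous_of_vec: "continuous_on T of_vec"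
  by (rule linear_continuous_on[OF linear_conv_bounded_linear[THEN iffD1, OF linear_to_vec]]
      linear_continuous_on[OF linear_conv_bounded_linear[THEN iffD1, OF linear_of_vec]])+

lemma measurable_to_vec [measurable]: "to_vec \<in> borel_measurable borel"
  and measurable_of_vec [measurable]: "of_vec \<in> borel_measurable borel"
  by (intro borel_measurable_continuous_onI continuous_to_vec continuous_of_vec)+

text \<open>Coordinates carry boxes to boxes with the same side lengths, and Lebesgue measure is
  determined by boxes.\<close>

lemma distr_lborel_of_vec: "distr lborel borel of_vec = (lborel :: 'a::euclidean_space measure)"
proof (rule lborel_eqI[symmetric])
  fix l u :: 'a assume lu: "\<And>b. b \<in> Basis \<Longrightarrow> l \<bullet> b \<le> u \<bullet> b"
  have "of_vec -` box l u = box (to_vec l) (to_vec u)"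
  proof -
    have "(\<forall>b\<in>Basis. l \<bullet> b < x \<bullet> b \<and> x \<bullet> b < u \<bullet> b) \<longleftrightarrow>
      (\<forall>i. l \<bullet> basis_idx i < x \<bullet> basis_idx i \<and> x \<bullet> basis_idx i < u \<bullet> basis_idx i)" for x
      using bij_basis_idx by (auto simp: bij_betw_def) (metis imageE)+
    then show ?thesis
      by (auto simp: box_def mem_box_cart of_vec_inner_basis_idx to_vec_def Basis_vec_def inner_axis)
  qed
  moreover have "emeasure lborel (box (to_vec l) (to_vec u)) = (\<Prod>b\<in>Basis. (u - l) \<bullet> b)"
  proof -
    have "emeasure lborel (box (to_vec l) (to_vec u)) = (\<Prod>b\<in>Basis. (to_vec u - to_vec l) \<bullet> b)"
      by (subst emeasure_lborel_box) (use lu in \<open>auto simp: Basis_vec_def inner_axis to_vec_def\<close>)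
    also have "(\<Prod>b\<in>Basis. (to_vec u - to_vec l) \<bullet> b) = (\<Prod>i\<in>UNIV. (to_vec u - to_vec l) $ i)"
    proof -
      have "bij_betw (\<lambda>i. axis i (1::real)) (UNIV :: 'a idx set) Basis"
        by (auto simp: bij_betw_def inj_on_def axis_eq_axis Basis_vec_def)
      from prod.reindex_bij_betw[OF this, of "\<lambda>b. (to_vec u - to_vec l) \<bullet> b"]
      show ?thesis by (simp add: inner_axis)
    qed
    also have "\<dots> = (\<Prod>b\<in>Basis. (u - l) \<bullet> b)"
      using prod.reindex_bij_betw[OF bij_basis_idx, of "\<lambda>b. (u - l) \<bullet> b"]
      by (simp add: to_vec_def inner_diff_left)
    finally show ?thesis by simp
  qed
  ultimately show "emeasure (distr lborel borel of_vec) (box l u) = (\<Prod>b\<in>Basis. (u - l) \<bullet> b)"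
    by (subst emeasure_distr) auto
qed auto

lemma emeasure_of_vec_image_borel:
  assumes "A \<in> sets borel"
  shows "emeasure lborel (of_vec ` A) = emeasure lborel (A :: (real^'a::euclidean_space idx) set)"
proof -
  have "of_vec ` A \<in> sets borel"
    unfolding image_of_vec using measurable_sets[OF measurable_to_vec assms] by simp
  then have "emeasure lborel (of_vec ` A) = emeasure lborel (of_vec -` (of_vec ` A))"
    by (subst distr_lborel_of_vec[symmetric], subst emeasure_distr) auto
  then show ?thesis by (simp add: inj_vimage_image_eq[OF inj_of_vec])
qed

text \<open>A Lebesgue set is a Borel set together with a subset of a Borel null set, and
  \<open>of_vec\<close> preserves both kinds of Borel set and their measure.\<close>

lemma lebesgue_of_vec_image:
  fixes A :: "(real^'a::euclidean_space idx) set"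
  assumes "A \<in> sets lebesgue"
  shows "of_vec ` A \<in> sets lebesgue" "emeasure lebesgue (of_vec ` A) = emeasure lebesgue A"
proof -
  have lin: "linear (of_vec :: _ \<Rightarrow> 'a)" by (rule linear_of_vec)
  show 1: "of_vec ` A \<in> sets lebesgue"
    by (intro differentiable_image_in_sets_lebesgue assms linear_imp_differentiable_on lin) (simp add: CARD_idx)
  obtain S N N' where A: "A = S \<union> N" "S \<in> sets lborel" "N \<subseteq> N'" "N' \<in> null_sets lborel"
    using assms by (rule sets_completionE)
  have "emeasure lborel (of_vec ` N') = 0"
    using A(4) emeasure_of_vec_image_borel[of N'] by (auto simp: null_sets_def)
  moreover have "of_vec ` N' \<in> sets lborel"
    unfolding image_of_vec using measurable_sets[OF measurable_to_vec, of N'] A(4) by (auto simp: null_sets_def)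
  ultimately have n: "of_vec ` N' \<in> null_sets lebesgue"
    by (intro null_sets_completionI) (simp add: null_sets_def)
  have oS: "of_vec ` S \<in> sets lborel"
    unfolding image_of_vec using measurable_sets[OF measurable_to_vec, of S] A(2) by auto
  have nN: "N' \<in> null_sets lebesgue" using A(4) by (rule null_sets_completionI)
  have "emeasure lebesgue (of_vec ` A) = emeasure lebesgue (of_vec ` S)"
  proof (rule antisym)
    have "emeasure lebesgue (of_vec ` A) \<le> emeasure lebesgue (of_vec ` S \<union> of_vec ` N')"
      using A oS n by (intro emeasure_mono) (auto simp: null_sets_def)
    also have "\<dots> = emeasure lebesgue (of_vec ` S)"
      using oS n by (intro emeasure_Un_null_set) auto
    finally show "emeasure lebesgue (of_vec ` A) \<le> emeasure lebesgue (of_vec ` S)" .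
    show "emeasure lebesgue (of_vec ` S) \<le> emeasure lebesgue (of_vec ` A)"
      using A 1 by (intro emeasure_mono) auto
  qed
  also have "\<dots> = emeasure lborel S"
    using emeasure_of_vec_image_borel[of S] A(2) oS by simp
  also have "\<dots> = emeasure lebesgue A"
  proof (rule antisym)
    show "emeasure lborel S \<le> emeasure lebesgue A"
      using A assms emeasure_mono[of S A lebesgue] by simp
    have "emeasure lebesgue A \<le> emeasure lebesgue (S \<union> N')"
      using A nN by (intro emeasure_mono) (auto simp: null_sets_def)
    also have "\<dots> = emeasure lebesgue S" using A(2) nN by (intro emeasure_Un_null_set) auto
    finally show "emeasure lebesgue A \<le> emeasure lborel S" using A(2) by simp
  qed
  finally show "emeasure lebesgue (of_vec ` A) = emeasure lebesgue A" .
qed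

lemma lebesgue_to_vec_image:
  fixes A :: "'a::euclidean_space set"
  assumes "A \<in> sets lebesgue"
  shows "to_vec ` A \<in> sets lebesgue" "emeasure lebesgue (to_vec ` A) = emeasure lebesgue A"
proof -
  show 1: "to_vec ` A \<in> sets lebesgue"
    by (intro differentiable_image_in_sets_lebesgue assms linear_imp_differentiable_on linear_to_vec)
      (simp add: CARD_idx)
  show "emeasure lebesgue (to_vec ` A) = emeasure lebesgue A"
    using lebesgue_of_vec_image(2)[OF 1] by (simp add: image_image)
qed

lemma measurable_of_vec_lebesgue: "of_vec \<in> lebesgue \<rightarrow>\<^sub>M (lebesgue :: 'a::euclidean_space measure)"
proof (rule measurableI)
  fix A :: "'a set" assume "A \<in> sets lebesgue"
  from lebesgue_to_vec_image(1)[OF this]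
  show "of_vec -` A \<inter> space lebesgue \<in> sets lebesgue"
    by (simp only: image_to_vec space_completion space_lborel space_borel Int_UNIV_right)
qed simp

lemma distr_lebesgue_of_vec: "distr lebesgue lebesgue of_vec = (lebesgue :: 'a::euclidean_space measure)"
proof (rule measure_eqI)
  fix A :: "'a set" assume "A \<in> sets (distr lebesgue lebesgue of_vec)"
  then have A: "A \<in> sets lebesgue" by simp
  show "emeasure (distr lebesgue lebesgue of_vec) A = emeasure lebesgue A"
    unfolding emeasure_distr[OF measurable_of_vec_lebesgue A] using lebesgue_to_vec_image(2)[OF A]
    by (simp only: image_to_vec space_completion space_lborel space_borel Int_UNIV_right)
qed simp

section \<open>The volume factor of a linear map\<close>

text \<open>The factor by which \<open>f\<close> scales Lebesgue measure. Another enumeration of the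
  basis would conjugate the matrix by a permutation, so the arbitrary choice in
  \<open>basis_idx\<close> does not affect it.\<close>

definition lin_scale :: "('a::euclidean_space \<Rightarrow> 'a) \<Rightarrow> real" where
  "lin_scale f = \<bar>det (matrix (to_vec \<circ> f \<circ> of_vec))\<bar>"

lemma lin_scale_nonneg [simp]: "0 \<le> lin_scale f" by (simp add: lin_scale_def)

lemma lin_scale_entries: "lin_scale f = \<bar>det (\<chi> i j. f (basis_idx j) \<bullet> basis_idx i)\<bar>"
  by (simp add: lin_scale_def matrix_def of_vec_axis to_vec_def)

lemma lin_scale_compose:
  assumes "linear f" "linear g"
  shows "lin_scale (f \<circ> g) = lin_scale f * lin_scale g"
proof -
  have "to_vec \<circ> (f \<circ> g) \<circ> of_vec = (to_vec \<circ> f \<circ> of_vec) \<circ> (to_vec \<circ> g \<circ> of_vec)"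
    by (simp add: fun_eq_iff)
  then show ?thesis
    using matrix_compose[of "to_vec \<circ> g \<circ> of_vec" "to_vec \<circ> f \<circ> of_vec"] assms
    by (simp add: lin_scale_def det_mul abs_mult linear_compose linear_to_vec linear_of_vec)
qed

lemma inner_to_vec: "to_vec x \<bullet> to_vec y = x \<bullet> y"
proof -
  have "to_vec x \<bullet> to_vec y = (\<Sum>b\<in>Basis. (x \<bullet> b) * (y \<bullet> b))"
    using sum.reindex_bij_betw[OF bij_basis_idx, of "\<lambda>b. (x \<bullet> b) * (y \<bullet> b)"]
    by (simp add: to_vec_def inner_vec_def)
  then show ?thesis by (simp only: euclidean_inner[of x y])
qed

lemma lin_scale_isometry:
  assumes "linear f" "\<And>x. norm (f x) = norm x"
  shows "lin_scale f = 1"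
proof -
  have n1: "norm (to_vec x) = norm x" for x :: 'a by (simp add: norm_eq_sqrt_inner inner_to_vec)
  have n2: "norm (of_vec x) = norm x" for x :: "real^'a idx" by (metis n1 to_vec_of_vec)
  have "orthogonal_transformation (to_vec \<circ> f \<circ> of_vec)"
    unfolding orthogonal_transformation
    using assms by (simp add: n1 n2 linear_compose linear_to_vec linear_of_vec)
  then have "orthogonal_matrix (matrix (to_vec \<circ> f \<circ> of_vec))"
    by (simp add: orthogonal_transformation_matrix)
  then show ?thesis unfolding lin_scale_def using det_orthogonal_matrix by fastforce
qed

lemma measure_lin_scale_image:
  assumes "linear f" "S \<in> lmeasurable"
  shows "measure lebesgue (f ` S) = lin_scale f * measure lebesgue S"
proof -
  let ?g = "to_vec \<circ> f \<circ> of_vec"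
  have m: "to_vec ` S \<in> lmeasurable"
    using assms(2) lebesgue_to_vec_image[of S] by (auto simp: fmeasurable_def)
  have lin: "linear ?g" by (intro linear_compose linear_to_vec linear_of_vec assms)
  have "?g ` (to_vec ` S) \<in> lmeasurable" by (rule measurable_linear_image[OF lin m])
  then have "measure lebesgue (of_vec ` ?g ` to_vec ` S) = measure lebesgue (?g ` to_vec ` S)"
    unfolding measure_def by (subst lebesgue_of_vec_image(2)) (auto dest: fmeasurableD)
  also have "\<dots> = lin_scale f * measure lebesgue (to_vec ` S)"
    unfolding lin_scale_def by (rule measure_linear_image[OF lin m])
  also have "measure lebesgue (to_vec ` S) = measure lebesgue S"
    unfolding measure_def by (subst lebesgue_to_vec_image(2)) (use assms(2) in \<open>auto dest: fmeasurableD\<close>)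
  finally show ?thesis by (simp add: image_image)
qed

text \<open>The two index types differ, so the sum over permutations is transported along
  \<open>map_permutation\<close>, which preserves signs.\<close>

lemma det_reindex:
  fixes A :: "real^'n^'n" and f :: "'k::finite \<Rightarrow> 'n::finite"
  assumes f: "bij f"
  shows "det (\<chi> i j. A $ f i $ f j) = det A"
proof -
  let ?m = "map_permutation UNIV f"
  have bij: "bij_betw ?m {p. p permutes (UNIV :: 'k set)} {p. p permutes (UNIV :: 'n set)}"
  proof -
    have "(\<lambda>\<pi> x. if x \<in> UNIV then f (\<pi> (inv_into UNIV f x)) else x) = ?m"
      using f by (auto simp: map_permutation_def restrict_id_def fun_eq_iff bij_def)
    then show ?thesis using bij_betw_permutations[of f UNIV UNIV] f by simp
  qed
  have "det A = (\<Sum>p | p permutes UNIV. of_int (sign p) * (\<Prod>i\<in>UNIV. A $ i $ p i))"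
    by (simp add: det_def)
  also have "\<dots> = (\<Sum>p | p permutes (UNIV :: 'k set). of_int (sign (?m p)) * (\<Prod>i\<in>UNIV. A $ i $ (?m p) i))"
    by (rule sum.reindex_bij_betw[OF bij, symmetric])
  also have "\<dots> = (\<Sum>p | p permutes (UNIV :: 'k set). of_int (sign p) * (\<Prod>i\<in>UNIV. A $ f i $ f (p i)))"
  proof (rule sum.cong[OF refl])
    fix p assume "p \<in> {p. p permutes (UNIV :: 'k set)}"
    then have p: "p permutes UNIV" by simp
    have "(\<Prod>i\<in>UNIV. A $ i $ (?m p) i) = (\<Prod>i\<in>UNIV. A $ f i $ (?m p) (f i))"
      by (rule prod.reindex_bij_betw[OF f, symmetric])
    also have "\<dots> = (\<Prod>i\<in>UNIV. A $ f i $ f (p i))"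
      using f by (simp add: map_permutation_def restrict_id_def bij_def inv_f_f)
    finally show "of_int (sign (?m p)) * (\<Prod>i\<in>UNIV. A $ i $ (?m p) i) =
        of_int (sign p) * (\<Prod>i\<in>UNIV. A $ f i $ f (p i))"
      using sign_map_permutation[of f UNIV p] p f by (simp add: bij_def)
  qed
  also have "\<dots> = det (\<chi> i j. A $ f i $ f j)" by (simp add: det_def)
  finally show ?thesis by simp
qed

text \<open>Both matrices have the same entries under two enumerations of the axes. This links
  \<open>lin_scale\<close> with the Gram determinants of parametrizations.\<close>

lemma lin_scale_vec: "lin_scale (f :: real^'n::finite \<Rightarrow> real^'n) = \<bar>det (matrix f)\<bar>"
proof -
  have "\<exists>k. basis_idx i = axis k (1::real)" for i :: "(real^'n) idx"
    using basis_idx_in[of i] by (auto simp: Basis_vec_def)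
  then obtain p where p: "\<And>i. (basis_idx i :: real^'n) = axis (p i) 1" by metis
  have "bij p"
  proof (rule bijI)
    show "inj p"
      using bij_basis_idx[where 'a="real^'n"] by (auto simp: inj_on_def bij_betw_def p axis_eq_axis)
    show "surj p"
    proof (rule surjI)
      fix k :: 'n
      have "axis k (1::real) \<in> range basis_idx"
        using bij_basis_idx[where 'a="real^'n"] by (auto simp: bij_betw_def Basis_vec_def)
      then have "\<exists>i. basis_idx i = axis k (1::real)" by (metis imageE)
      then have "\<exists>i. p i = k" by (auto simp: p axis_eq_axis)
      then show "p (SOME i. p i = k) = k" by (rule someI_ex)
    qed
  qed
  have "(\<chi> i j. f (basis_idx j) \<bullet> basis_idx i) = (\<chi> i j. matrix f $ p i $ p j)"
    by (simp add: matrix_def p inner_axis vec_eq_iff)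
  then show ?thesis unfolding lin_scale_entries using det_reindex[OF \<open>bij p\<close>, of "matrix f"] by simp
qed

section \<open>Jacobian formulas for images\<close>

text \<open>Translates between the gauge integral, in which the change of variables theorems are
  stated, and the nonnegative Lebesgue integral used for measures.\<close>

lemma nn_integral_iff_integrable_on:
  fixes f :: "'a::euclidean_space \<Rightarrow> real"
  assumes S: "S \<in> sets lebesgue" and f: "f \<in> borel_measurable (lebesgue_on S)" "\<And>x. x \<in> S \<Longrightarrow> 0 \<le> f x"
  shows "(f has_integral r) S \<longleftrightarrow> 0 \<le> r \<and> (\<integral>\<^sup>+x\<in>S. ennreal (f x) \<partial>lebesgue) = ennreal r"
proof -
  let ?g = "\<lambda>x. if x \<in> S then f x else 0"
  have g: "?g \<in> borel_measurable lebesgue"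
    using borel_measurable_if_I[OF f(1) S] .
  have "(f has_integral r) S \<longleftrightarrow> (?g has_integral r) UNIV" by (simp add: has_integral_restrict_UNIV)
  also have "\<dots> \<longleftrightarrow> 0 \<le> r \<and> (\<integral>\<^sup>+x. ennreal (?g x) \<partial>lebesgue) = ennreal r"
    using has_integral_iff_nn_integral_lebesgue[of ?g r] f(2) g
      has_integral_nonneg[of ?g r UNIV] by (auto split: if_splits)
  also have "(\<integral>\<^sup>+x. ennreal (?g x) \<partial>lebesgue) = (\<integral>\<^sup>+x\<in>S. ennreal (f x) \<partial>lebesgue)"
    by (intro nn_integral_cong) (simp add: indicator_def)
  finally show ?thesis .
qed

text \<open>Each fact is the corresponding one for the conjugate
  \<open>to_vec \<circ> g \<circ> of_vec\<close>: coordinates preserve measure, and the Jacobian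
  integral is transported along \<open>of_vec\<close>.\<close>

lemma
  fixes g :: "'a::euclidean_space \<Rightarrow> 'a"
  assumes S: "S \<in> sets lebesgue" and der: "\<And>x. x \<in> S \<Longrightarrow> (g has_derivative g' x) (at x within S)"
  shows borel_measurable_lin_scale: "(\<lambda>x. lin_scale (g' x)) \<in> borel_measurable (lebesgue_on S)"
    and emeasure_image_le_lin_scale:
      "emeasure lebesgue (g ` S) \<le> (\<integral>\<^sup>+x\<in>S. ennreal (lin_scale (g' x)) \<partial>lebesgue)"
    and emeasure_image_eq_lin_scale:
      "inj_on g S \<Longrightarrow> emeasure lebesgue (g ` S) = (\<integral>\<^sup>+x\<in>S. ennreal (lin_scale (g' x)) \<partial>lebesgue)"
    and image_sets_lebesgue: "g ` S \<in> sets lebesgue"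
proof -
  let ?S = "to_vec ` S" and ?g = "to_vec \<circ> g \<circ> of_vec"
  define D where "D v = to_vec \<circ> g' (of_vec v) \<circ> of_vec" for v
  have S': "?S \<in> sets lebesgue" by (rule lebesgue_to_vec_image[OF S])
  have der': "(?g has_derivative D v) (at v within ?S)" if "v \<in> ?S" for v
  proof -
    have im: "of_vec ` ?S = S" by (simp add: image_image)
    have "(g has_derivative g' (of_vec v)) (at (of_vec v) within of_vec ` ?S)"
      unfolding im using that by (intro der) auto
    from diff_chain_within[OF linear_imp_has_derivative[OF linear_of_vec] this]
    have "(g \<circ> of_vec has_derivative g' (of_vec v) \<circ> of_vec) (at v within ?S)" .
    from diff_chain_within[OF this linear_imp_has_derivative[OF linear_to_vec]]
    show ?thesis by (simp add: D_def o_assoc)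
  qed
  have ls: "lin_scale (g' (of_vec v)) = \<bar>det (matrix (D v))\<bar>" for v
    by (simp add: lin_scale_def D_def)
  have meas: "(\<lambda>v. \<bar>det (matrix (D v))\<bar>) \<in> borel_measurable (lebesgue_on ?S)"
    using borel_measurable_det_Jacobian[OF S' der'] by measurable
  have gS: "g ` S = of_vec ` ?g ` ?S" by (simp add: image_image)
  have "?g differentiable_on ?S" using der' by (auto simp: differentiable_on_def differentiable_def)
  then have gS': "?g ` ?S \<in> sets lebesgue"
    by (intro differentiable_image_in_sets_lebesgue S') auto
  then show "g ` S \<in> sets lebesgue" unfolding gS by (rule lebesgue_of_vec_image)
  have eg: "emeasure lebesgue (g ` S) = emeasure lebesgue (?g ` ?S)"
    unfolding gS by (rule lebesgue_of_vec_image[OF gS'])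
  show ms: "(\<lambda>x. lin_scale (g' x)) \<in> borel_measurable (lebesgue_on S)"
  proof -
    have "to_vec \<in> lebesgue_on S \<rightarrow>\<^sub>M lebesgue_on ?S"
    proof (rule measurable_restrict_space2)
      show "to_vec \<in> lebesgue_on S \<rightarrow>\<^sub>M lebesgue"
      proof (rule measurable_restrict_space1, rule measurableI)
        fix A :: "(real^'a idx) set" assume "A \<in> sets lebesgue"
        from lebesgue_of_vec_image(1)[OF this]
        show "to_vec -` A \<inter> space lebesgue \<in> sets lebesgue"
          by (simp only: image_of_vec space_completion space_lborel space_borel Int_UNIV_right)
      qed simp
    qed auto
    from measurable_compose[OF this meas] show ?thesis by (simp add: ls[symmetric])
  qed
  have ie: "(\<integral>\<^sup>+x\<in>S. ennreal (lin_scale (g' x)) \<partial>lebesgue) = (\<integral>\<^sup>+v\<in>?S. ennreal \<bar>det (matrix (D v))\<bar> \<partial>lebesgue)"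
  proof -
    have m1: "(\<lambda>x. ennreal (lin_scale (g' x)) * indicator S x) \<in> borel_measurable lebesgue"
      by (rule borel_measurable_restrict_space_iff_ennreal[THEN iffD1, OF _ measurable_compose[OF ms measurable_ennreal]])
        (use S in simp)
    have "(\<integral>\<^sup>+x\<in>S. ennreal (lin_scale (g' x)) \<partial>lebesgue)
      = (\<integral>\<^sup>+x\<in>S. ennreal (lin_scale (g' x)) \<partial>(distr lebesgue lebesgue of_vec))"
      by (simp only: distr_lebesgue_of_vec)
    also have "\<dots> = (\<integral>\<^sup>+v. ennreal (lin_scale (g' (of_vec v))) * indicator S (of_vec v) \<partial>lebesgue)"
    proof (rule nn_integral_distr[OF measurable_of_vec_lebesgue])
      show "(\<lambda>x. ennreal (lin_scale (g' x)) * indicator S x) \<in> borel_measurable (distr lebesgue lebesgue of_vec)"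
        unfolding distr_lebesgue_of_vec by (rule m1)
    qed
    also have "\<dots> = (\<integral>\<^sup>+v\<in>?S. ennreal \<bar>det (matrix (D v))\<bar> \<partial>lebesgue)"
    proof (rule nn_integral_cong)
      fix v :: "real^'a idx"
      show "ennreal (lin_scale (g' (of_vec v))) * indicator S (of_vec v) =
          ennreal \<bar>det (matrix (D v))\<bar> * indicator (to_vec ` S) v"
        unfolding image_to_vec by (simp add: ls indicator_def)
    qed
    finally show ?thesis .
  qed
  let ?I = "\<integral>\<^sup>+v\<in>?S. ennreal \<bar>det (matrix (D v))\<bar> \<partial>lebesgue"
  have int: "(\<lambda>v. \<bar>det (matrix (D v))\<bar>) integrable_on ?S" "integral ?S (\<lambda>v. \<bar>det (matrix (D v))\<bar>) = enn2real ?I"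
    if "?I < \<infinity>"
  proof -
    have "((\<lambda>v. \<bar>det (matrix (D v))\<bar>) has_integral enn2real ?I) ?S"
      using nn_integral_iff_integrable_on[OF S' meas, of "enn2real ?I"] that by simp
    then show "(\<lambda>v. \<bar>det (matrix (D v))\<bar>) integrable_on ?S" "integral ?S (\<lambda>v. \<bar>det (matrix (D v))\<bar>) = enn2real ?I"
      by (auto simp: integrable_on_def integral_unique)
  qed
  \<comment> \<open>An infinite integral makes the bound trivial; a finite one supplies the
    integrability on which the real-valued estimate depends.\<close>
  have le: "emeasure lebesgue (?g ` ?S) \<le> ?I"
  proof (cases "?I < \<infinity>")
    case True
    have "?g ` ?S \<in> lmeasurable"
      using measurable_differentiable_image[OF S' der'] int(1)[OF True] by blast
    then have "emeasure lebesgue (?g ` ?S) = ennreal (measure lebesgue (?g ` ?S))"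
      by (simp add: emeasure_eq_measure2)
    also have "\<dots> \<le> ennreal (enn2real ?I)"
      using measure_differentiable_image[OF S' der'] int[OF True] by (intro ennreal_leI) auto
    finally show ?thesis using True by simp
  qed (simp add: not_less top_unique)
  then show "emeasure lebesgue (g ` S) \<le> (\<integral>\<^sup>+x\<in>S. ennreal (lin_scale (g' x)) \<partial>lebesgue)"
    unfolding ie eg .
  assume inj: "inj_on g S"
  have inj': "inj_on ?g ?S"
    using inj by (auto simp: inj_on_def inj_eq[OF inj_to_vec])
  \<comment> \<open>If the image has infinite measure, then \<open>le\<close> makes the integral
    infinite too.\<close>
  have "emeasure lebesgue (?g ` ?S) = ?I"
  proof (cases "?g ` ?S \<in> lmeasurable")
    case True
    then have i: "(\<lambda>v. \<bar>det (matrix (D v))\<bar>) integrable_on ?S"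
      using measurable_differentiable_image_eq[OF S' der' inj'] by blast
    have "emeasure lebesgue (?g ` ?S) = ennreal (measure lebesgue (?g ` ?S))"
      using True by (simp add: emeasure_eq_measure2)
    also have "measure lebesgue (?g ` ?S) = integral ?S (\<lambda>v. \<bar>det (matrix (D v))\<bar>)"
      by (rule measure_differentiable_image_eq[OF S' der' inj' i])
    also have "ennreal \<dots> = ?I"
      using nn_integral_iff_integrable_on[OF S' meas, of "integral ?S (\<lambda>v. \<bar>det (matrix (D v))\<bar>)"]
        integrable_integral[OF i] by simp
    finally show ?thesis .
  next
    case False
    then have e: "emeasure lebesgue (?g ` ?S) = top"
      using gS' by (simp add: fmeasurable_def less_top[symmetric] del: emeasure_completion)
    have "top \<le> ?I" using le unfolding e .
    then have "?I = top" by (rule top.extremum_uniqueI)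
    with e show ?thesis by (rule trans[OF _ sym])
  qed
  then show "emeasure lebesgue (g ` S) = (\<integral>\<^sup>+x\<in>S. ennreal (lin_scale (g' x)) \<partial>lebesgue)"
    unfolding ie eg .
qed

text \<open>The reflection of the last coordinate conjugates the shear by \<open>q\<close> to the
  shear by \<open>- q\<close>, which is its inverse. The reflection is an isometry, so the factor of
  the shear has square 1.\<close>

lemma lin_scale_shear: "lin_scale (\<lambda>(h, s). (h + s *\<^sub>R q, s)) = 1" for q :: "'a::euclidean_space"
proof -
  let ?S = "\<lambda>q::'a. \<lambda>(h, s::real). (h + s *\<^sub>R q, s)" and ?D = "\<lambda>(h::'a, s::real). (h, - s)"
  have lS: "linear (?S q)" for q by (auto intro!: linearI simp: algebra_simps)
  have lD: "linear ?D" by (auto intro!: linearI)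
  have D1: "lin_scale ?D = 1" by (rule lin_scale_isometry[OF lD]) (auto simp: norm_prod_def)
  have "?S q = ?D \<circ> (?S (- q) \<circ> ?D)" by (auto simp: fun_eq_iff)
  then have 1: "lin_scale (?S q) = lin_scale (?S (- q))"
    using lin_scale_compose[OF lD linear_compose[OF lD lS[of "-q"]]] lin_scale_compose[OF lS[of "-q"] lD] D1 by simp
  have "?S q \<circ> ?S (- q) = id" by (auto simp: fun_eq_iff)
  moreover have "lin_scale (id :: 'a \<times> real \<Rightarrow> _) = 1" by (rule lin_scale_isometry) (auto simp: linear_id)
  ultimately have "lin_scale (?S q) * lin_scale (?S (- q)) = 1"
    using lin_scale_compose[OF lS[of q] lS[of "-q"]] by simp
  then have "lin_scale (?S q) * lin_scale (?S q) = 1" using 1 by simp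
  then have "lin_scale (?S q) = 1 \<or> lin_scale (?S q) = - 1" by (simp only: square_eq_1_iff)
  then show ?thesis using lin_scale_nonneg[of "?S q"] by linarith
qed

text \<open>Both sides are the volume of the image of the unit cube, which is a product of images;
  no block determinant has to be expanded.\<close>

lemma lin_scale_prod:
  fixes A :: "'a::euclidean_space \<Rightarrow> 'a"
  assumes A: "linear A"
  shows "lin_scale (\<lambda>(h, s). (A h, c * s)) = lin_scale A * \<bar>c\<bar>"
proof -
  let ?f = "\<lambda>(h, s). (A h, c * s)"
  have lf: "linear ?f" by (auto intro!: linearI simp: linear_add[OF A] linear_scale[OF A] algebra_simps)
  have lc: "linear (\<lambda>s::real. c * s)" by (auto intro!: linearI simp: algebra_simps)
  let ?Q = "cbox (0::'a) One" and ?I = "cbox (0::real) 1"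
  have mQ: "measure lebesgue ?Q = 1" by (simp add: content_cbox_if)
  have ti: "measure lebesgue (X \<times> Y) = measure lebesgue X * measure lebesgue Y"
    if "compact X" "compact Y" for X :: "'a set" and Y :: "real set"
  proof -
    have B: "X \<in> sets borel" "Y \<in> sets borel" using that by (auto simp: compact_imp_closed borel_closed)
    have "measure lebesgue (X \<times> Y) = measure lborel (X \<times> Y)"
      using B borel_Times[OF B] by simp
    also have "\<dots> = enn2real (emeasure lborel X * emeasure lborel Y)"
      unfolding lborel_prod[symmetric] measure_def using B by (subst lborel.emeasure_pair_measure_Times) auto
    also have "\<dots> = measure lebesgue X * measure lebesgue Y"
      using B by (simp add: enn2real_mult measure_def)
    finally show ?thesis .
  qed
  have "measure lebesgue (?f ` (?Q \<times> ?I)) = lin_scale ?f * measure lebesgue (?Q \<times> ?I)"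
    by (rule measure_lin_scale_image[OF lf lmeasurable_compact]) (intro compact_Times compact_cbox)
  also have "?f ` (?Q \<times> ?I) = A ` ?Q \<times> (\<lambda>s. c * s) ` ?I" by (auto simp: image_iff)
  also have "measure lebesgue (A ` ?Q \<times> (\<lambda>s. c * s) ` ?I) = measure lebesgue (A ` ?Q) * measure lebesgue ((\<lambda>s. c * s) ` ?I)"
    using A lc by (intro ti compact_continuous_image linear_continuous_on compact_cbox)
      (auto simp: linear_conv_bounded_linear)
  also have "measure lebesgue (A ` ?Q) = lin_scale A"
    using measure_lin_scale_image[OF A lmeasurable_cbox, of 0 One] mQ by simp
  also have "measure lebesgue ((\<lambda>s. c * s) ` ?I) = \<bar>c\<bar>"
  proof (cases "c \<ge> 0")
    case True then show ?thesis using image_mult_atLeastAtMost_if[of c 0 1] by simp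
  next
    case False then show ?thesis using image_mult_atLeastAtMost_if[of c 0 1] by simp
  qed
  finally show ?thesis using ti[of ?Q ?I] mQ by simp
qed

text \<open>A block triangular map is a product map followed by a shear; dividing \<open>q\<close>
  by \<open>c\<close> compensates for the scaling of \<open>s\<close>.\<close>

lemma lin_scale_block:
  fixes A :: "'a::euclidean_space \<Rightarrow> 'a"
  assumes A: "linear A" and c: "c \<noteq> 0"
  shows "lin_scale (\<lambda>(h, s). (A h + s *\<^sub>R q, c * s)) = lin_scale A * \<bar>c\<bar>"
proof -
  let ?S = "\<lambda>(h, s::real). (h + s *\<^sub>R (q /\<^sub>R c), s)" and ?P = "\<lambda>(h, s). (A h, c * s)"
  have lS: "linear ?S" by (auto intro!: linearI simp: algebra_simps)
  have lP: "linear ?P" by (auto intro!: linearI simp: linear_add[OF A] linear_scale[OF A] algebra_simps)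
  have "(\<lambda>(h, s). (A h + s *\<^sub>R q, c * s)) = ?S \<circ> ?P"
    using c by (auto simp: fun_eq_iff)
  then show ?thesis
    using lin_scale_compose[OF lS lP] lin_scale_shear[of "q /\<^sub>R c"] lin_scale_prod[OF A, of c] by simp
qed

text \<open>In finite dimension, convergence on a basis is convergence in operator norm, so
  \<open>tendsto_linear_solution\<close> applies to plain linear maps.\<close>

lemma tendsto_linear_solution_componentwise:
  fixes L :: "'x \<Rightarrow> 'b::euclidean_space \<Rightarrow> 'c::euclidean_space"
  assumes lin: "\<And>u. linear (L u)" "linear L0" and inj: "inj L0"
    and L: "\<And>b. b \<in> Basis \<Longrightarrow> ((\<lambda>u. L u b) \<longlongrightarrow> L0 b) F"
    and c: "((\<lambda>u. L u (X u)) \<longlongrightarrow> L0 X0) F"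
  shows "(X \<longlongrightarrow> X0) F"
proof -
  have B: "blinfun_apply (Blinfun (L u)) = L u" "blinfun_apply (Blinfun L0) = L0" for u
    using lin by (auto intro!: bounded_linear_Blinfun_apply simp: linear_conv_bounded_linear)
  show ?thesis
  proof (rule tendsto_linear_solution[of "\<lambda>u. Blinfun (L u)" "Blinfun L0"])
    show "((\<lambda>u. Blinfun (L u)) \<longlongrightarrow> Blinfun L0) F"
      by (rule tendsto_componentwise1) (simp add: B L)
  qed (use inj c in \<open>simp_all add: B\<close>)
qed

text \<open>Expanding each basis in the other one turns both traces into the double sum of
  \<open>(b \<bullet> c) * (S c \<bullet> b)\<close>.\<close>

lemma trace_orthonormal_basis_indep:
  fixes S :: "'a::euclidean_space \<Rightarrow> 'a"
  assumes S: "linear S" and B: "orthonormal_basis_of T B" and C: "orthonormal_basis_of T C"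
  shows "(\<Sum>b\<in>B. S b \<bullet> b) = (\<Sum>c\<in>C. S c \<bullet> c)"
proof -
  have exp: "finite B" "v \<in> T \<Longrightarrow> v = (\<Sum>b\<in>B. (v \<bullet> b) *\<^sub>R b)" if B: "orthonormal_basis_of T B" for B and v
  proof -
    have po: "pairwise orthogonal B" and n1: "\<And>b. b \<in> B \<Longrightarrow> norm b = 1" and sp: "span B = T"
      using B by (auto simp: orthonormal_basis_of_def)
    show fin: "finite B" using pairwise_orthogonal_imp_finite[OF po] .
    assume "v \<in> T"
    then have v: "v \<in> span B" by (simp add: sp)
    then obtain u where u: "v = (\<Sum>b\<in>B. u b *\<^sub>R b)" using span_finite[OF fin] by auto
    have "v \<bullet> c = u c" if c: "c \<in> B" for c
    proof -
      have "v \<bullet> c = (\<Sum>b\<in>B. if b = c then u c else 0)"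
        unfolding u inner_sum_left
        using po n1 c by (intro sum.cong) (auto simp: pairwise_def orthogonal_def dot_square_norm)
      then show ?thesis using fin c by simp
    qed
    then show "v = (\<Sum>b\<in>B. (v \<bullet> b) *\<^sub>R b)" by (subst u) (simp cong: sum.cong)
  qed
  interpret linear S by fact
  have BT: "b \<in> B \<Longrightarrow> b \<in> T" and CT: "c \<in> C \<Longrightarrow> c \<in> T" for b c
    using B C by (auto simp: orthonormal_basis_of_def span_base)
  have "(\<Sum>b\<in>B. S b \<bullet> b) = (\<Sum>b\<in>B. \<Sum>c\<in>C. (b \<bullet> c) * (S c \<bullet> b))"
  proof (rule sum.cong[OF refl])
    fix b assume b: "b \<in> B"
    have "S b = (\<Sum>c\<in>C. (b \<bullet> c) *\<^sub>R S c)"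
      by (subst exp(2)[OF C BT[OF b]]) (simp add: sum scale)
    then show "S b \<bullet> b = (\<Sum>c\<in>C. (b \<bullet> c) * (S c \<bullet> b))" by (simp add: inner_sum_left)
  qed
  also have "\<dots> = (\<Sum>c\<in>C. \<Sum>b\<in>B. (b \<bullet> c) * (S c \<bullet> b))" by (rule sum.swap)
  also have "\<dots> = (\<Sum>c\<in>C. S c \<bullet> c)"
  proof (rule sum.cong[OF refl])
    fix c assume c: "c \<in> C"
    have "S c \<bullet> c = S c \<bullet> (\<Sum>b\<in>B. (c \<bullet> b) *\<^sub>R b)" using exp(2)[OF B CT[OF c]] by simp
    then show "(\<Sum>b\<in>B. (b \<bullet> c) * (S c \<bullet> b)) = S c \<bullet> c"
      by (simp add: inner_sum_right inner_commute)
  qed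
  finally show ?thesis .
qed

lemma orthonormal_basis_of_Basis: "orthonormal_basis_of UNIV (Basis :: 'a::euclidean_space set)"
  by (auto simp: orthonormal_basis_of_def pairwise_def orthogonal_def inner_not_same_Basis)

lemma orthonormal_basis_of_card:
  assumes "orthonormal_basis_of T B" shows "finite B" "card B = dim T" "B \<subseteq> T"
proof -
  have po: "pairwise orthogonal B" and sp: "span B = T" and n0: "0 \<notin> B"
    using assms by (auto simp: orthonormal_basis_of_def)
  have "independent B" by (rule pairwise_orthogonal_independent[OF po n0])
  then show "finite B" "card B = dim T"
    using sp dim_span[of B] dim_eq_card_independent[of B] by (auto simp: independent_imp_finite)
  show "B \<subseteq> T" using span_superset[of B] sp by simp
qed

section \<open>Local geometry of hypersurfaces\<close>

text \<open>Names the witnesses inside \<open>local_parametrization\<close>: the derivatives as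
  bounded linear maps, the neighbourhood \<open>U\<close> on which they exist, and the inverse
  \<open>\<psi>\<close>. Both kinds of domain are written as an open set, possibly cut by a
  coordinate half-space.\<close>

locale patch =
  fixes \<Sigma> :: "('n::finite) space set" and W U :: "(real^'n) set" and \<phi> :: "real^'n \<Rightarrow> 'n space"
    and \<phi>' :: "real^'n \<Rightarrow> (real^'n) \<Rightarrow>\<^sub>L 'n space"
    and \<phi>'' :: "real^'n \<Rightarrow> (real^'n) \<Rightarrow>\<^sub>L (real^'n) \<Rightarrow>\<^sub>L 'n space"
    and \<psi> :: "'n space \<Rightarrow> real^'n"
  assumes shape: "\<exists>T. open T \<and> (W = T \<or> (\<exists>k. W = T \<inter> {u. 0 \<le> u $ k}))"
    and open_U: "open U" and W_U: "W \<subseteq> U"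
    and deriv: "\<And>u. u \<in> U \<Longrightarrow> (\<phi> has_derivative blinfun_apply (\<phi>' u)) (at u)"
    and deriv2: "\<And>u. u \<in> U \<Longrightarrow> (\<phi>' has_derivative blinfun_apply (\<phi>'' u)) (at u)"
    and cont2: "continuous_on U \<phi>''"
    and inj_deriv: "\<And>u. u \<in> W \<Longrightarrow> inj (blinfun_apply (\<phi>' u))"
    and homeo: "homeomorphism W (\<phi> ` W) \<phi> \<psi>"
    and openin_image: "openin (top_of_set \<Sigma>) (\<phi> ` W)"

lemma local_parametrization_imp_patch:
  assumes "local_parametrization \<Sigma> W \<phi>"
  shows "\<exists>U \<phi>' \<phi>'' \<psi>. patch \<Sigma> W U \<phi> \<phi>' \<phi>'' \<psi>"
proof -
  from assms obtain U \<psi> where U: "open U" "W \<subseteq> U" "C2_on \<phi> U"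
    and sh: "open W \<or> (\<exists>k. openin (top_of_set {u. 0 \<le> u $ k}) W)"
    and inj: "\<And>u. u \<in> W \<Longrightarrow> inj (frechet_derivative \<phi> (at u))"
    and op: "openin (top_of_set \<Sigma>) (\<phi> ` W)" and hom: "homeomorphism W (\<phi> ` W) \<phi> \<psi>"
    unfolding local_parametrization_def by blast
  from U(3) obtain \<phi>' \<phi>'' where d: "\<forall>u\<in>U. (\<phi> has_derivative blinfun_apply (\<phi>' u)) (at u)"
    "\<forall>u\<in>U. (\<phi>' has_derivative blinfun_apply (\<phi>'' u)) (at u)" "continuous_on U \<phi>''"
    unfolding C2_on_def by blast
  have "\<exists>T. open T \<and> (W = T \<or> (\<exists>k. W = T \<inter> {u. 0 \<le> u $ k}))"
    using sh by (auto simp: openin_open Int_commute)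
  moreover have "inj (blinfun_apply (\<phi>' u))" if "u \<in> W" for u
    using inj[OF that] frechet_derivative_at[of \<phi> "\<phi>' u" u] d(1) that U(2) by auto
  ultimately have "patch \<Sigma> W U \<phi> \<phi>' \<phi>'' \<psi>"
    using U d op hom by unfold_locales auto
  then show ?thesis by blast
qed

context patch
begin

lemma frechet: "u \<in> U \<Longrightarrow> frechet_derivative \<phi> (at u) = blinfun_apply (\<phi>' u)"
  using frechet_derivative_at[OF deriv] by simp

lemma local_parametrization: "local_parametrization \<Sigma> W \<phi>"
proof -
  have "open W \<or> (\<exists>k. openin (top_of_set {u. 0 \<le> u $ k}) W)"
    using shape by (auto simp: openin_open Int_commute)
  moreover have "C2_on \<phi> U" unfolding C2_on_def using deriv deriv2 cont2 by blast
  moreover have "\<forall>u\<in>W. inj (frechet_derivative \<phi> (at u))" using inj_deriv frechet W_U by auto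
  ultimately show ?thesis
    unfolding local_parametrization_def using open_U W_U homeo openin_image by blast
qed

lemma W_borel [measurable]: "W \<in> sets borel"
proof -
  have "closed {u :: real^'n. 0 \<le> u $ k}" for k by (intro closed_Collect_le continuous_intros)
  then show ?thesis using shape by (auto intro: borel_closed)
qed

text \<open>A positive step along a coordinate axis never leaves the half-space, so even at the edge
  there are enough directions to make derivatives within \<open>W\<close> unique.\<close>

lemma feasible:
  assumes "u \<in> W" "i \<in> Basis" "0 < e"
  shows "\<exists>d. 0 < \<bar>d\<bar> \<and> \<bar>d\<bar> < e \<and> u + d *\<^sub>R i \<in> W"
proof -
  obtain T where T: "open T" "W = T \<or> (\<exists>k. W = T \<inter> {u. 0 \<le> u $ k})" using shape by blast
  then have "u \<in> T" using assms by auto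
  then obtain r where r: "r > 0" "ball u r \<subseteq> T" using T(1) openE by blast
  define d where "d = min r e / 2"
  have d: "0 < d" "d < r" "d < e" using r assms by (auto simp: d_def)
  have "u + d *\<^sub>R i \<in> T" using d r assms(2) by (intro subsetD[OF r(2)]) (simp add: dist_norm)
  moreover have "0 \<le> u $ k \<Longrightarrow> 0 \<le> (u + d *\<^sub>R i) $ k" for k
    using assms(2) d by (auto simp: Basis_vec_def axis_def)
  ultimately have "u + d *\<^sub>R i \<in> W" using T assms(1) by auto
  then show ?thesis using d by (intro exI[of _ d]) auto
qed

lemma derivative_unique:
  fixes f :: "real^'n \<Rightarrow> 'b::real_normed_vector"
  assumes "(f has_derivative D) (at u within W)" "(f has_derivative D') (at u within W)" "u \<in> W"
  shows "D = D'"
  by (rule frechet_derivative_unique_within[OF assms(1,2)]) (use feasible assms(3) in blast)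

lemma psi_phi [simp]: "u \<in> W \<Longrightarrow> \<psi> (\<phi> u) = u"
  and phi_psi: "x \<in> \<phi> ` W \<Longrightarrow> \<phi> (\<psi> x) = x" and psi_in: "x \<in> \<phi> ` W \<Longrightarrow> \<psi> x \<in> W"
  and cont_psi: "continuous_on (\<phi> ` W) \<psi>"
  using homeo by (auto simp: homeomorphism_def)

lemma image_subset: "\<phi> ` W \<subseteq> \<Sigma>" using openin_image openin_imp_subset by blast

lemma cont_phi: "continuous_on U \<phi>"
  by (intro continuous_at_imp_continuous_on ballI has_derivative_continuous[OF deriv])

lemma cont_phi': "continuous_on U \<phi>'"
  by (intro continuous_at_imp_continuous_on ballI has_derivative_continuous[OF deriv2])

lemma hess_symmetric: "u \<in> U \<Longrightarrow> \<phi>'' u a b = \<phi>'' u b a"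
  by (rule second_derivative_symmetric[OF open_U _ deriv deriv2])

text \<open>The mean value inequality for \<open>\<phi> - \<phi>' u\<close>, whose derivative is
  small near \<open>u\<close> because \<open>\<phi>'\<close> is continuous. Both points vary, as is
  required for chords between two nearby surface points.\<close>

lemma strict_derivative:
  assumes "u \<in> U" "0 < \<eta>"
  shows "\<exists>r>0. ball u r \<subseteq> U \<and> (\<forall>v\<in>ball u r. \<forall>w\<in>ball u r.
    norm (\<phi> v - \<phi> w - \<phi>' u (v - w)) \<le> \<eta> * norm (v - w))"
proof -
  obtain r1 where r1: "r1 > 0" "ball u r1 \<subseteq> U" using open_U assms(1) openE by blast
  have "continuous (at u) \<phi>'" using cont_phi' assms(1) open_U continuous_on_eq_continuous_at by blast
  then obtain r2 where r2: "r2 > 0" "\<And>v. dist v u < r2 \<Longrightarrow> dist (\<phi>' v) (\<phi>' u) < \<eta>"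
    using assms(2) unfolding continuous_at_eps_delta by blast
  define r where "r = min r1 r2"
  have "norm ((\<phi> v - \<phi>' u v) - (\<phi> w - \<phi>' u w)) \<le> \<eta> * norm (v - w)"
    if "v \<in> ball u r" "w \<in> ball u r" for v w
  proof (rule differentiable_bound[of "ball u r" "\<lambda>v. \<phi> v - \<phi>' u v" "\<lambda>x. blinfun_apply (\<phi>' x - \<phi>' u)" \<eta> v w])
    fix x assume x: "x \<in> ball u r"
    then have "x \<in> U" using r1 by (auto simp: r_def)
    have dx: "((\<lambda>v. \<phi> v - \<phi>' u v) has_derivative (\<lambda>h. \<phi>' x h - \<phi>' u h)) (at x)"
      by (intro has_derivative_diff deriv \<open>x \<in> U\<close> bounded_linear_imp_has_derivative blinfun.bounded_linear_right)
    then show "((\<lambda>v. \<phi> v - \<phi>' u v) has_derivative blinfun_apply (\<phi>' x - \<phi>' u)) (at x within ball u r)"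
    proof -
      have "blinfun_apply (\<phi>' x - \<phi>' u) = (\<lambda>h. \<phi>' x h - \<phi>' u h)"
        by (rule ext) (rule blinfun.diff_left)
      then show ?thesis by (simp only: has_derivative_at_withinI[OF dx])
    qed
    have "norm (\<phi>' x - \<phi>' u) \<le> \<eta>" using x r2(2)[of x] by (auto simp: r_def dist_norm norm_minus_commute)
    then show "onorm (blinfun_apply (\<phi>' x - \<phi>' u)) \<le> \<eta>" by (simp only: norm_blinfun.rep_eq)
  qed (use that in auto)
  moreover have "(\<phi> v - \<phi>' u v) - (\<phi> w - \<phi>' u w) = \<phi> v - \<phi> w - \<phi>' u (v - w)" for v w
    by (simp add: blinfun.diff_right)
  ultimately have "\<forall>v\<in>ball u r. \<forall>w\<in>ball u r. norm (\<phi> v - \<phi> w - \<phi>' u (v - w)) \<le> \<eta> * norm (v - w)"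
    by metis
  moreover have "r > 0" "ball u r \<subseteq> U" using r1 r2 by (auto simp: r_def)
  ultimately show ?thesis by blast
qed

lemma deriv_lower_bound:
  assumes "u \<in> W"
  shows "\<exists>c>0. \<forall>h. c * norm h \<le> norm (\<phi>' u h)"
proof -
  obtain c where "c > 0" "\<And>h. c * norm h \<le> norm (\<phi>' u h)"
    using linear_inj_bounded_below_pos[of "blinfun_apply (\<phi>' u)"] inj_deriv[OF assms]
    by (auto simp: blinfun.bounded_linear_right bounded_linear.linear mult.commute)
  then show ?thesis by blast
qed

lemma psi_tendsto:
  assumes "u \<in> W" shows "(\<psi> \<longlongrightarrow> u) (at (\<phi> u) within \<Sigma>)"
proof -
  have "(\<psi> \<longlongrightarrow> \<psi> (\<phi> u)) (at (\<phi> u) within \<phi> ` W)"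
    using cont_psi assms by (auto simp: continuous_on)
  moreover have "at (\<phi> u) within \<phi> ` W = at (\<phi> u) within \<Sigma>"
  proof -
    obtain T where T: "open T" "\<phi> ` W = \<Sigma> \<inter> T" using openin_image by (auto simp: openin_open)
    then have "\<phi> u \<in> T" using assms by auto
    show ?thesis by (rule at_within_nhd[OF \<open>\<phi> u \<in> T\<close> T(1)]) (use T(2) in auto)
  qed
  ultimately show ?thesis using assms by simp
qed

lemma eventually_in_image:
  assumes "u \<in> W" shows "\<forall>\<^sub>F x in at (\<phi> u) within \<Sigma>. x \<in> \<phi> ` W"
proof -
  obtain T where T: "open T" "\<phi> ` W = \<Sigma> \<inter> T" using openin_image by (auto simp: openin_open)
  then have "\<phi> u \<in> T" using assms by auto
  then show ?thesis unfolding eventually_at_topological using T by auto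
qed

text \<open>Any left inverse of \<open>\<phi>' u\<close> serves: surface points near
  \<open>\<phi> u\<close> differ from it by tangent vectors up to higher order, and on tangent
  vectors all left inverses agree.\<close>

lemma psi_has_derivative:
  assumes u: "u \<in> W" and L: "bounded_linear L" "\<And>h. L (\<phi>' u h) = h"
  shows "(\<psi> has_derivative L) (at (\<phi> u) within \<Sigma>)"
proof -
  obtain c where c: "c > 0" "\<And>h. c * norm h \<le> norm (\<phi>' u h)" using deriv_lower_bound[OF u] by blast
  obtain K where K: "K > 0" "\<And>x. norm (L x) \<le> norm x * K"
    using bounded_linear.pos_bounded[OF L(1)] by blast
  have uU: "u \<in> U" using u W_U by auto
  show ?thesis unfolding has_derivative_within_alt
  proof (intro conjI L(1) allI impI)
    fix e :: real assume e: "e > 0"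
    \<comment> \<open>\<open>\<eta> \<le> c / 2\<close> bounds parameter distances by
      \<open>2 / c\<close> times surface distances; the other term brings the final error below
      \<open>e\<close>.\<close>
    define \<eta> where "\<eta> = min (c / 2) (e * c / (2 * K))"
    have \<eta>: "\<eta> > 0" "\<eta> \<le> c / 2" "K * \<eta> * 2 / c \<le> e" using c K e by (auto simp: \<eta>_def min_def field_simps)
    obtain r where r: "r > 0" "\<And>v w. v \<in> ball u r \<Longrightarrow> w \<in> ball u r \<Longrightarrow>
        norm (\<phi> v - \<phi> w - \<phi>' u (v - w)) \<le> \<eta> * norm (v - w)"
      using strict_derivative[OF uU \<eta>(1)] by blast
    have "\<forall>\<^sub>F x in at (\<phi> u) within \<Sigma>. dist (\<psi> x) u < r"
      using psi_tendsto[OF u] r(1) by (rule tendstoD)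
    from eventually_conj[OF this eventually_in_image[OF u]]
    obtain d where d: "d > 0" "\<And>x. x \<in> \<Sigma> \<Longrightarrow> x \<noteq> \<phi> u \<Longrightarrow> dist x (\<phi> u) < d \<Longrightarrow> dist (\<psi> x) u < r \<and> x \<in> \<phi> ` W"
      unfolding eventually_at by auto
    show "\<exists>d>0. \<forall>x\<in>\<Sigma>. norm (x - \<phi> u) < d \<longrightarrow>
        norm (\<psi> x - \<psi> (\<phi> u) - L (x - \<phi> u)) \<le> e * norm (x - \<phi> u)"
    proof (intro exI[of _ d] conjI ballI impI)
      show "0 < d" by (fact d(1))
      fix x assume x: "x \<in> \<Sigma>" "norm (x - \<phi> u) < d"
      show "norm (\<psi> x - \<psi> (\<phi> u) - L (x - \<phi> u)) \<le> e * norm (x - \<phi> u)"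
      proof (cases "x = \<phi> u")
        case True then show ?thesis by (simp add: linear_0[OF bounded_linear.linear[OF L(1)]])
      next
        case False
        then have 1: "dist (\<psi> x) u < r" "x \<in> \<phi> ` W" using d(2) x by (auto simp: dist_norm)
        define v where "v = \<psi> x"
        have v: "\<phi> v = x" "v \<in> ball u r" using 1 phi_psi by (auto simp: v_def dist_commute)
        have b: "norm (x - \<phi> u - \<phi>' u (v - u)) \<le> \<eta> * norm (v - u)"
          using r(2)[OF v(2), of u] r(1) v(1) by simp
        have "c * norm (v - u) \<le> norm (\<phi>' u (v - u))" by (rule c)
        also have "\<dots> \<le> norm (x - \<phi> u) + norm (x - \<phi> u - \<phi>' u (v - u))"
          using norm_triangle_ineq4[of "x - \<phi> u" "x - \<phi> u - \<phi>' u (v - u)"] by simp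
        also have "\<dots> \<le> norm (x - \<phi> u) + c / 2 * norm (v - u)"
          using b mult_right_mono[OF \<eta>(2), of "norm (v - u)"] by simp
        finally have vb: "norm (v - u) \<le> 2 / c * norm (x - \<phi> u)" using c(1) by (simp add: field_simps)
        have "\<psi> x - \<psi> (\<phi> u) - L (x - \<phi> u) = L (\<phi>' u (v - u)) - L (x - \<phi> u)"
          using u by (simp add: v_def L(2))
        also have "\<dots> = - L (x - \<phi> u - \<phi>' u (v - u))"
          using linear_diff[OF bounded_linear.linear[OF L(1)]] by simp
        finally have "norm (\<psi> x - \<psi> (\<phi> u) - L (x - \<phi> u)) \<le> norm (x - \<phi> u - \<phi>' u (v - u)) * K"
          using K(2) by simp
        also have "\<dots> \<le> (\<eta> * (2 / c * norm (x - \<phi> u))) * K"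
          using b vb \<eta>(1) K(1) by (intro mult_right_mono order_trans[OF b] mult_left_mono) auto
        also have "\<dots> = (K * \<eta> * 2 / c) * norm (x - \<phi> u)" by simp
        also have "\<dots> \<le> e * norm (x - \<phi> u)" using \<eta>(3) by (intro mult_right_mono) auto
        finally show ?thesis .
      qed
    qed
  qed
qed

lemma left_inverse_exists:
  assumes "u \<in> W" shows "\<exists>L. bounded_linear L \<and> (\<forall>h. L (\<phi>' u h) = h)"
proof -
  have "linear (blinfun_apply (\<phi>' u))" by (simp add: blinfun.bounded_linear_right bounded_linear.linear)
  then obtain g where "linear g" "g \<circ> blinfun_apply (\<phi>' u) = id"
    using linear_injective_left_inverse inj_deriv[OF assms] by blast
  then show ?thesis by (intro exI[of _ g]) (auto simp: linear_conv_bounded_linear fun_eq_iff)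
qed

lemma deriv_within: "u \<in> W \<Longrightarrow> (\<phi> has_derivative blinfun_apply (\<phi>' u)) (at u within W)"
  using deriv W_U by (auto intro: has_derivative_at_withinI)

lemma has_derivative_within_surface:
  fixes f :: "'n space \<Rightarrow> 'b::real_normed_vector"
  assumes u: "u \<in> W" and L: "bounded_linear L" "\<And>h. L (\<phi>' u h) = h"
    and f: "((\<lambda>v. f (\<phi> v)) has_derivative D) (at u within W)"
  shows "(f has_derivative (\<lambda>x. D (L x))) (at (\<phi> u) within \<Sigma>)"
proof -
  obtain T where T: "open T" "\<phi> ` W = \<Sigma> \<inter> T" using openin_image by (auto simp: openin_open)
  then have uT: "\<phi> u \<in> T" using u by auto
  have eq: "at (\<phi> u) within \<phi> ` W = at (\<phi> u) within \<Sigma>"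
    by (rule at_within_nhd[OF uT T(1)]) (use T(2) in auto)
  have im: "\<psi> ` \<phi> ` W = W" using psi_phi by (force simp: image_iff)
  have p: "(\<psi> has_derivative L) (at (\<phi> u) within \<phi> ` W)"
    unfolding eq by (rule psi_has_derivative[OF u L])
  have f': "((\<lambda>v. f (\<phi> v)) has_derivative D) (at (\<psi> (\<phi> u)) within \<psi> ` \<phi> ` W)" using f u im by simp
  have "((\<lambda>v. f (\<phi> v)) \<circ> \<psi> has_derivative D \<circ> L) (at (\<phi> u) within \<phi> ` W)"
    by (rule diff_chain_within[OF p f'])
  then have "(f has_derivative D \<circ> L) (at (\<phi> u) within \<phi> ` W)"
    by (rule has_derivative_transform[rotated -1]) (use u phi_psi in auto)
  then show ?thesis unfolding eq by (simp add: o_def)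
qed

lemma derivative_along_patch:
  fixes f :: "'n space \<Rightarrow> 'b::real_normed_vector"
  assumes u: "u \<in> W" and f: "(f has_derivative D') (at (\<phi> u) within \<Sigma>)"
  shows "((\<lambda>v. f (\<phi> v)) has_derivative (\<lambda>h. D' (\<phi>' u h))) (at u within W)"
  using diff_chain_within[OF deriv_within[OF u] has_derivative_subset[OF f image_subset]] by (simp add: o_def)

end

section \<open>Transition maps and tangent spaces\<close>

text \<open>Near \<open>u1\<close> the map \<open>\<phi>1\<close> equals
  \<open>\<phi>2 \<circ> \<psi>2 \<circ> \<phi>1\<close>. The chain rule and uniqueness of the
  derivative within \<open>W1\<close> then place the range of \<open>\<phi>1' u1\<close> inside that
  of \<open>\<phi>2' u2\<close>.\<close>

lemma patch_range_subset:
  assumes "patch \<Sigma> W1 U1 \<phi>1 \<phi>1' \<phi>1'' \<psi>1" "patch \<Sigma> W2 U2 \<phi>2 \<phi>2' \<phi>2'' \<psi>2"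
    and u: "u1 \<in> W1" "u2 \<in> W2" "\<phi>1 u1 = \<phi>2 u2"
    and L: "bounded_linear L" "\<And>h. L (\<phi>2' u2 h) = h"
  shows "\<phi>2' u2 (L (\<phi>1' u1 h)) = \<phi>1' u1 h"
    and "((\<lambda>v. \<psi>2 (\<phi>1 v)) has_derivative (\<lambda>h. L (\<phi>1' u1 h))) (at u1 within W1)"
proof -
  interpret P1: patch \<Sigma> W1 U1 \<phi>1 \<phi>1' \<phi>1'' \<psi>1 by fact
  interpret P2: patch \<Sigma> W2 U2 \<phi>2 \<phi>2' \<phi>2'' \<psi>2 by fact
  have p: "(\<psi>2 has_derivative L) (at (\<phi>1 u1) within \<Sigma>)"
    unfolding u(3) by (rule P2.psi_has_derivative[OF u(2) L])
  show d: "((\<lambda>v. \<psi>2 (\<phi>1 v)) has_derivative (\<lambda>h. L (\<phi>1' u1 h))) (at u1 within W1)"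
    by (rule P1.derivative_along_patch[OF u(1) p])
  have "((\<lambda>v. \<phi>2 (\<psi>2 (\<phi>1 v))) has_derivative (\<lambda>h. \<phi>2' u2 (L (\<phi>1' u1 h)))) (at u1 within W1)"
  proof (rule has_derivative_compose[OF d])
    have "\<psi>2 (\<phi>1 u1) = u2" using u by simp
    then show "(\<phi>2 has_derivative blinfun_apply (\<phi>2' u2)) (at (\<psi>2 (\<phi>1 u1)))"
      using P2.deriv u P2.W_U by auto
  qed
  moreover have "\<forall>\<^sub>F v in at u1 within W1. \<phi>1 v \<in> \<phi>2 ` W2"
  proof -
    obtain T where T: "open T" "\<phi>2 ` W2 = \<Sigma> \<inter> T" using P2.openin_image by (auto simp: openin_open)
    have "(\<phi>1 \<longlongrightarrow> \<phi>1 u1) (at u1 within W1)"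
      using P1.deriv_within[OF u(1)] has_derivative_continuous continuous_within by blast
    moreover have "\<phi>1 u1 \<in> T" using T u by auto
    ultimately have "\<forall>\<^sub>F v in at u1 within W1. \<phi>1 v \<in> T" using T(1) by (metis topological_tendstoD)
    moreover have "\<forall>\<^sub>F v in at u1 within W1. v \<in> W1" by (simp add: eventually_at_filter)
    ultimately show ?thesis
      by eventually_elim (use T(2) P1.image_subset in auto)
  qed
  then have "\<forall>\<^sub>F v in at u1 within W1. \<phi>2 (\<psi>2 (\<phi>1 v)) = \<phi>1 v"
    by eventually_elim (rule P2.phi_psi)
  ultimately have "(\<phi>1 has_derivative (\<lambda>h. \<phi>2' u2 (L (\<phi>1' u1 h)))) (at u1 within W1)"
    by (rule has_derivative_transform_eventually) (use u in auto)
  from P1.derivative_unique[OF this P1.deriv_within[OF u(1)] u(1)]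
  show "\<phi>2' u2 (L (\<phi>1' u1 h)) = \<phi>1' u1 h" by (simp add: fun_eq_iff)
qed

context patch
begin

text \<open>\<open>tangent_space\<close> collects vectors from all parametrizations through the
  point; \<open>patch_range_subset\<close> puts each of them into the range of the present
  one.\<close>

lemma tangent_space_eq:
  assumes u: "u \<in> W" shows "tangent_space \<Sigma> (\<phi> u) = range (blinfun_apply (\<phi>' u))"
proof
  show "tangent_space \<Sigma> (\<phi> u) \<subseteq> range (blinfun_apply (\<phi>' u))"
  proof
    fix v assume "v \<in> tangent_space \<Sigma> (\<phi> u)"
    then obtain W1 \<phi>1 u1 w where 1: "local_parametrization \<Sigma> W1 \<phi>1" "u1 \<in> W1" "\<phi>1 u1 = \<phi> u"
      "v = frechet_derivative \<phi>1 (at u1) w" unfolding tangent_space_def by blast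
    obtain U1 \<phi>1' \<phi>1'' \<psi>1 where P1: "patch \<Sigma> W1 U1 \<phi>1 \<phi>1' \<phi>1'' \<psi>1"
      using local_parametrization_imp_patch[OF 1(1)] by blast
    interpret P1: patch \<Sigma> W1 U1 \<phi>1 \<phi>1' \<phi>1'' \<psi>1 by fact
    obtain L where L: "bounded_linear L" "\<And>h. L (\<phi>' u h) = h" using left_inverse_exists[OF u] by blast
    have "v = \<phi>1' u1 w" using 1 P1.frechet P1.W_U by auto
    also have "\<dots> = \<phi>' u (L (\<phi>1' u1 w))"
      using patch_range_subset(1)[OF P1 patch_axioms 1(2) u 1(3) L] by simp
    finally show "v \<in> range (blinfun_apply (\<phi>' u))" by blast
  qed
  show "range (blinfun_apply (\<phi>' u)) \<subseteq> tangent_space \<Sigma> (\<phi> u)"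
    unfolding tangent_space_def using local_parametrization u frechet W_U by fastforce
qed

lemma tangent_subspace: "u \<in> W \<Longrightarrow> subspace (tangent_space \<Sigma> (\<phi> u))"
  by (simp add: tangent_space_eq linear_subspace_image blinfun.bounded_linear_right bounded_linear.linear)

lemma dim_tangent: "u \<in> W \<Longrightarrow> dim (tangent_space \<Sigma> (\<phi> u)) = CARD('n)"
  using dim_image_eq[of "blinfun_apply (\<phi>' u)" UNIV] inj_deriv[of u]
  by (simp add: tangent_space_eq blinfun.bounded_linear_right bounded_linear.linear)

end

lemma hyperplane_eqI:
  fixes v :: "'a::euclidean_space"
  assumes "subspace T" "\<And>x. x \<in> T \<Longrightarrow> v \<bullet> x = 0" "v \<noteq> 0" "dim T + 1 = DIM('a)"
  shows "T = {x. v \<bullet> x = 0}"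
  by (rule subspace_dim_equal) (use assms in \<open>auto simp: subspace_hyperplane dim_hyperplane\<close>)

lemma dim_space: "DIM('n space) = CARD('n::finite) + 1"
  by simp

section \<open>The derivative of the normal, the shape operator and the mean curvature\<close>

text \<open>The only regularity required of \<open>\<nu>\<close> is continuity; its
  differentiability will follow from the second derivative of \<open>\<phi>\<close>.\<close>

locale patch_normal = patch \<Sigma> W U \<phi> \<phi>' \<phi>'' \<psi>
  for \<Sigma> :: "('n::finite) space set" and W U \<phi> \<phi>' \<phi>'' \<psi> +
  fixes \<nu> :: "'n space \<Rightarrow> 'n space"
  assumes cont_nu: "continuous_on \<Sigma> \<nu>"
    and nu_norm: "\<And>x. x \<in> \<Sigma> \<Longrightarrow> norm (\<nu> x) = 1"
    and nu_orth: "\<And>x v. x \<in> \<Sigma> \<Longrightarrow> v \<in> tangent_space \<Sigma> x \<Longrightarrow> \<nu> x \<bullet> v = 0"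
begin

lemma phi_in: "u \<in> W \<Longrightarrow> \<phi> u \<in> \<Sigma>" using image_subset by blast

lemma nu_nu: "u \<in> W \<Longrightarrow> \<nu> (\<phi> u) \<bullet> \<nu> (\<phi> u) = 1"
  using nu_norm[OF phi_in] by (simp add: dot_square_norm)

lemma nu_deriv: "u \<in> W \<Longrightarrow> \<nu> (\<phi> u) \<bullet> \<phi>' u h = 0"
  using nu_orth[OF phi_in] tangent_space_eq by auto

lemma deriv_nu: "u \<in> W \<Longrightarrow> \<phi>' u h \<bullet> \<nu> (\<phi> u) = 0"
  using nu_deriv by (simp add: inner_commute)

lemma tangent_space_hyperplane: "u \<in> W \<Longrightarrow> tangent_space \<Sigma> (\<phi> u) = {x. \<nu> (\<phi> u) \<bullet> x = 0}"
  by (intro hyperplane_eqI tangent_subspace nu_orth phi_in)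
    (use nu_nu[of u] in \<open>auto simp: dim_tangent\<close>)

lemma tangentE:
  assumes "u \<in> W" "\<nu> (\<phi> u) \<bullet> x = 0" obtains h where "x = \<phi>' u h"
  using assms tangent_space_hyperplane tangent_space_eq by blast

text \<open>Inner products with the coordinate tangent vectors and with the normal. The map is
  injective, so a vector can be defined and estimated through these numbers.\<close>

definition frame_map :: "real^'n \<Rightarrow> 'n space \<Rightarrow> 'n space" where
  "frame_map u X = ((\<Sum>i\<in>Basis. (\<phi>' u i \<bullet> X) *\<^sub>R i), \<nu> (\<phi> u) \<bullet> X)"

lemma linear_frame_map: "linear (frame_map u)"
  by (rule linearI) (simp_all add: frame_map_def inner_add_right scaleR_add_left sum.distrib scaleR_sum_right)

lemma deriv_expand: "\<phi>' u h = (\<Sum>i\<in>Basis. (h \<bullet> i) *\<^sub>R \<phi>' u i)"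
  by (subst euclidean_representation[of h, symmetric]) (simp add: blinfun.sum_right blinfun.scaleR_right)

lemma hess_expand: "\<phi>'' u g h = (\<Sum>i\<in>Basis. (h \<bullet> i) *\<^sub>R \<phi>'' u g i)"
  by (subst euclidean_representation[of h, symmetric]) (simp add: blinfun.sum_right blinfun.scaleR_right)

lemma frame_map_comps:
  assumes "frame_map u X = ((\<Sum>i\<in>Basis. c i *\<^sub>R i), d)"
  shows "i \<in> Basis \<Longrightarrow> \<phi>' u i \<bullet> X = c i" "\<nu> (\<phi> u) \<bullet> X = d"
proof -
  show "\<nu> (\<phi> u) \<bullet> X = d" using assms by (simp add: frame_map_def)
  assume i: "i \<in> Basis"
  have "(\<Sum>i\<in>Basis. (\<phi>' u i \<bullet> X) *\<^sub>R i) \<bullet> i = (\<Sum>i\<in>Basis. c i *\<^sub>R i) \<bullet> i"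
    using assms by (simp add: frame_map_def)
  then show "\<phi>' u i \<bullet> X = c i" using i by simp
qed

lemma inj_frame_map:
  assumes u: "u \<in> W" shows "inj (frame_map u)"
proof -
  have "X = 0" if "frame_map u X = 0" for X
  proof -
    have "frame_map u X = ((\<Sum>i\<in>Basis. 0 *\<^sub>R i), 0)" using that by (simp add: zero_prod_def)
    note c = frame_map_comps[OF this]
    then obtain h where h: "X = \<phi>' u h" using tangentE[OF u] by blast
    have "X \<bullet> X = (\<Sum>i\<in>Basis. (h \<bullet> i) * (\<phi>' u i \<bullet> X))"
      by (subst h, subst deriv_expand) (simp add: inner_sum_left)
    then show "X = 0" using c(1) by simp
  qed
  then show ?thesis by (simp add: linear_injective_0[OF linear_frame_map])
qed

text \<open>Solves the equations that result from formally differentiating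
  \<open>\<phi>' u k \<bullet> \<nu> = 0\<close> and \<open>\<nu> \<bullet> \<nu> = 1\<close> in
  direction \<open>h\<close>; it is therefore the only candidate for the derivative of
  \<open>\<nu> \<circ> \<phi>\<close>.\<close>

definition weingarten :: "real^'n \<Rightarrow> real^'n \<Rightarrow> 'n space" where
  "weingarten u h = inv (frame_map u) ((\<Sum>i\<in>Basis. (- (\<phi>'' u h i \<bullet> \<nu> (\<phi> u))) *\<^sub>R i), 0)"

lemma frame_map_weingarten:
  assumes "u \<in> W"
  shows "frame_map u (weingarten u h) = ((\<Sum>i\<in>Basis. (- (\<phi>'' u h i \<bullet> \<nu> (\<phi> u))) *\<^sub>R i), 0)"
  unfolding weingarten_def
  by (rule surj_f_inv_f[OF linear_injective_imp_surjective[OF linear_frame_map inj_frame_map[OF assms] refl]])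

lemma weingarten_nu: "u \<in> W \<Longrightarrow> \<nu> (\<phi> u) \<bullet> weingarten u h = 0"
  using frame_map_comps(2)[OF frame_map_weingarten] .

lemma weingarten_inner:
  assumes u: "u \<in> W" shows "\<phi>' u k \<bullet> weingarten u h = - (\<phi>'' u h k \<bullet> \<nu> (\<phi> u))"
proof -
  have "\<phi>' u k \<bullet> weingarten u h = (\<Sum>i\<in>Basis. (k \<bullet> i) * (\<phi>' u i \<bullet> weingarten u h))"
    by (subst deriv_expand) (simp add: inner_sum_left)
  also have "\<dots> = (\<Sum>i\<in>Basis. (k \<bullet> i) * (- (\<phi>'' u h i \<bullet> \<nu> (\<phi> u))))"
    using frame_map_comps(1)[OF frame_map_weingarten[OF u]] by (intro sum.cong) auto
  also have "\<dots> = - (\<phi>'' u h k \<bullet> \<nu> (\<phi> u))"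
    by (subst (2) hess_expand) (simp add: inner_sum_left sum_negf)
  finally show ?thesis .
qed

lemma linear_weingarten: assumes u: "u \<in> W" shows "linear (weingarten u)"
proof -
  have inj: "frame_map u x = frame_map u y \<Longrightarrow> x = y" for x y
    using inj_frame_map[OF u] by (simp add: inj_eq)
  show ?thesis
  proof (rule linearI; rule inj)
    fix a b
    have "(- (\<phi>'' u (a + b) i \<bullet> \<nu> (\<phi> u))) *\<^sub>R i =
        (- (\<phi>'' u a i \<bullet> \<nu> (\<phi> u))) *\<^sub>R i + (- (\<phi>'' u b i \<bullet> \<nu> (\<phi> u))) *\<^sub>R i" for i
      unfolding scaleR_add_left[symmetric] by (simp add: blinfun.add_left blinfun.add_right inner_add_left)
    then show "frame_map u (weingarten u (a + b)) = frame_map u (weingarten u a + weingarten u b)"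
      by (simp only: linear_add[OF linear_frame_map] frame_map_weingarten[OF u] sum.distrib add_Pair add_0)
  next
    fix r :: real and a
    have "(- (\<phi>'' u (r *\<^sub>R a) i \<bullet> \<nu> (\<phi> u))) *\<^sub>R i = r *\<^sub>R (- (\<phi>'' u a i \<bullet> \<nu> (\<phi> u))) *\<^sub>R i" for i
      by (simp add: blinfun.scaleR_left blinfun.scaleR_right)
    then show "frame_map u (weingarten u (r *\<^sub>R a)) = frame_map u (r *\<^sub>R weingarten u a)"
      by (simp only: linear_scale[OF linear_frame_map] frame_map_weingarten[OF u] scaleR_sum_right scaleR_Pair scaleR_zero_right)
  qed
qed

text \<open>The increment \<open>D\<close> of the normal is controlled in frame coordinates:
  tangentially by orthogonality at both ends, normally because two unit vectors give
  \<open>- norm D ^ 2 / 2\<close>. Continuity of \<open>\<nu>\<close> absorbs this quadratic term,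
  which yields a Lipschitz bound and, with it, an error of smaller order.\<close>

lemma nu_along_has_derivative:
  assumes u: "u \<in> W"
  shows "((\<lambda>v. \<nu> (\<phi> v)) has_derivative weingarten u) (at u within W)"
proof -
  define n where "n = real CARD('n)"
  have n: "n \<ge> 1" by (simp add: n_def Suc_le_eq)
  obtain c where c: "c > 0" "\<And>X. c * norm X \<le> norm (frame_map u X)"
    by (rule linear_inj_bounded_below_pos[OF linear_frame_map inj_frame_map[OF u]], rule that)
  have fb: "c * norm X \<le> n * m + \<bar>\<nu> (\<phi> u) \<bullet> X\<bar>"
    if "\<And>i. i \<in> Basis \<Longrightarrow> \<bar>\<phi>' u i \<bullet> X\<bar> \<le> m" for X m
  proof -
    have "c * norm X \<le> norm (frame_map u X)" by (rule c)
    also have "\<dots> \<le> norm (\<Sum>i\<in>Basis. (\<phi>' u i \<bullet> X) *\<^sub>R i) + norm (\<nu> (\<phi> u) \<bullet> X)"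
      unfolding frame_map_def by (rule norm_Pair_le)
    also have "norm (\<Sum>i\<in>Basis. (\<phi>' u i \<bullet> X) *\<^sub>R i) \<le> (\<Sum>i\<in>(Basis :: (real^'n) set). m)"
      by (rule sum_norm_le) (use that in auto)
    also have "\<dots> = n * m" by (simp add: n_def)
    finally show ?thesis by simp
  qed
  define K where "K = norm (\<phi>'' u)"
  have K: "K \<ge> 0" by (simp add: K_def)
  define C where "C = (n * (1 + K) + n * (1 + K) / c) / c"
  have "n * (1 + K) > 0" using n K by (intro mult_pos_pos) linarith+
  then have C: "C > 0" unfolding C_def using c(1) by (intro divide_pos_pos add_pos_pos)
  have uU: "u \<in> U" using u W_U by auto
  have contN: "continuous_on W (\<lambda>v. \<nu> (\<phi> v))"
    by (rule continuous_on_compose2[OF cont_nu continuous_on_subset[OF cont_phi W_U] image_subset])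
  show ?thesis unfolding has_derivative_within_alt
  proof (intro conjI allI impI)
    show "bounded_linear (weingarten u)" using linear_weingarten[OF u] by (simp add: linear_conv_bounded_linear)
    fix e :: real assume e: "e > 0"
    \<comment> \<open>\<open>e1 \<le> c\<close> allows the quadratic term to be absorbed,
      \<open>e1 \<le> 1\<close> makes the Lipschitz bound independent of \<open>e\<close>, and
      \<open>e1 \<le> e / C\<close> gives the required error.\<close>
    define e1 where "e1 = min 1 (min c (e / C))"
    have e1: "e1 > 0" "e1 \<le> 1" "e1 \<le> c" using e c(1) C by (simp_all add: e1_def)
    have "e1 \<le> e / C" by (simp add: e1_def)
    then have e1C: "e1 * C \<le> e" using C by (simp only: pos_le_divide_eq)
    obtain d1 where d1: "d1 > 0" "\<And>v. v \<in> W \<Longrightarrow> dist v u < d1 \<Longrightarrow> dist (\<nu> (\<phi> v)) (\<nu> (\<phi> u)) < e1"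
      using contN u e1(1) unfolding continuous_on_iff by blast
    obtain d2 where d2: "d2 > 0" "\<And>v. norm (v - u) < d2 \<Longrightarrow> norm (\<phi>' v - \<phi>' u - \<phi>'' u (v - u)) \<le> e1 * norm (v - u)"
      using deriv2[OF uU] e1(1) unfolding has_derivative_at_alt by blast
    show "\<exists>d>0. \<forall>y\<in>W. norm (y - u) < d \<longrightarrow>
        norm (\<nu> (\<phi> y) - \<nu> (\<phi> u) - weingarten u (y - u)) \<le> e * norm (y - u)"
    proof (intro exI[of _ "min d1 d2"] conjI ballI impI)
      show "0 < min d1 d2" using d1 d2 by simp
      fix v assume v: "v \<in> W" "norm (v - u) < min d1 d2"
      define h where "h = v - u"
      define D where "D = \<nu> (\<phi> v) - \<nu> (\<phi> u)"
      define R where "R = D - weingarten u h"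
      have Ds: "norm D \<le> e1" using d1(2)[OF v(1)] v(2) by (simp add: D_def dist_norm)
      have dd: "norm (\<phi>' v - \<phi>' u - \<phi>'' u h) \<le> e1 * norm h" using d2(2)[of v] v(2) by (simp add: h_def)
      have Nv: "norm (\<nu> (\<phi> v)) = 1" using nu_norm[OF phi_in[OF v(1)]] .
      have nD: "\<nu> (\<phi> u) \<bullet> D = - ((norm D)^2 / 2)"
        using nu_nu[OF u] nu_nu[OF v(1)]
        by (simp add: D_def power2_norm_eq_inner inner_diff_left inner_diff_right inner_commute field_simps)
      have b1: "norm (\<phi>'' u h i) \<le> K * norm h" if "i \<in> Basis" for i
      proof -
        have "norm (\<phi>'' u h i) \<le> norm (\<phi>'' u h)"
          using norm_blinfun[of "\<phi>'' u h" i] unfolding norm_Basis[OF that] mult_1_right .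
        from order_trans[OF this norm_blinfun] show ?thesis unfolding K_def .
      qed
      have b2: "norm ((\<phi>' v - \<phi>' u - \<phi>'' u h) i) \<le> e1 * norm h" if "i \<in> Basis" for i
      proof -
        have "norm ((\<phi>' v - \<phi>' u - \<phi>'' u h) i) \<le> norm (\<phi>' v - \<phi>' u - \<phi>'' u h)"
          using norm_blinfun[of "\<phi>' v - \<phi>' u - \<phi>'' u h" i] unfolding norm_Basis[OF that] mult_1_right .
        from order_trans[OF this dd] show ?thesis .
      qed
      \<comment> \<open>Orthogonality at \<open>u\<close> and at \<open>v\<close> replaces
        \<open>\<phi>' u i \<bullet> D\<close> by minus the increment of \<open>\<phi>'\<close>
        paired with the new normal; the increment is split into its remainder and the second
        derivative.\<close>
      have Dd: "\<phi>' u i \<bullet> D = - (((\<phi>' v - \<phi>' u - \<phi>'' u h) i) \<bullet> \<nu> (\<phi> v)) - (\<phi>'' u h i) \<bullet> \<nu> (\<phi> v)" for i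
        using deriv_nu[OF u] deriv_nu[OF v(1)]
        by (simp add: D_def inner_diff_right inner_diff_left blinfun.diff_left)
      have cs: "\<bar>x \<bullet> \<nu> (\<phi> v)\<bar> \<le> norm x" for x
        using Cauchy_Schwarz_ineq2[of x "\<nu> (\<phi> v)"] unfolding Nv mult_1_right .
      have tri: "\<bar>- x - y\<bar> \<le> a + b" if "\<bar>x\<bar> \<le> a" "\<bar>y\<bar> \<le> b" for x y a b :: real
        using that by linarith
      \<comment> \<open>The Lipschitz bound for \<open>D\<close> comes first, because the normal
        component of the remainder \<open>R\<close> is quadratic in \<open>D\<close>.\<close>
      have "\<bar>\<phi>' u i \<bullet> D\<bar> \<le> (e1 + K) * norm h" if i: "i \<in> Basis" for i
        unfolding Dd distrib_right by (rule tri[OF order_trans[OF cs b2[OF i]] order_trans[OF cs b1[OF i]]])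
      from fb[OF this] have "c * norm D \<le> n * ((e1 + K) * norm h) + (norm D)^2 / 2" by (simp add: nD)
      also have "(norm D)^2 / 2 \<le> c * norm D / 2"
        using Ds e1(3) by (simp add: power2_eq_square mult_right_mono)
      finally have "c * norm D \<le> 2 * n * ((e1 + K) * norm h)" by simp
      also have "\<dots> \<le> 2 * n * ((1 + K) * norm h)"
        using e1(2) n by (intro mult_left_mono mult_right_mono) auto
      finally have DL: "norm D \<le> 2 * n * (1 + K) / c * norm h" using c(1) by (simp add: field_simps)
      have "\<bar>\<phi>' u i \<bullet> R\<bar> \<le> e1 * (1 + K) * norm h" if i: "i \<in> Basis" for i
      proof -
        have "\<phi>' u i \<bullet> R = - (((\<phi>' v - \<phi>' u - \<phi>'' u h) i) \<bullet> \<nu> (\<phi> v)) - (\<phi>'' u h i) \<bullet> D"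
          unfolding R_def inner_diff_right Dd weingarten_inner[OF u] by (simp add: D_def inner_diff_right)
        also have "\<bar>\<dots>\<bar> \<le> e1 * norm h + (K * norm h) * e1"
        proof (rule tri[OF order_trans[OF cs b2[OF i]]])
          show "\<bar>\<phi>'' u h i \<bullet> D\<bar> \<le> K * norm h * e1"
            using b1[OF i] Ds K by (intro order_trans[OF Cauchy_Schwarz_ineq2] mult_mono) auto
        qed
        finally show ?thesis by (simp only: distrib_right distrib_left mult_ac mult_1_right)
      qed
      from fb[OF this] have "c * norm R \<le> n * (e1 * (1 + K) * norm h) + (norm D)^2 / 2"
        using weingarten_nu[OF u] by (simp add: R_def inner_diff_right nD)
      also have "(norm D)^2 / 2 \<le> e1 * (2 * n * (1 + K) / c * norm h) / 2"
        using mult_mono[OF Ds DL] e1(1) unfolding power2_eq_square by (intro divide_right_mono) auto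
      also have "n * (e1 * (1 + K) * norm h) + e1 * (2 * n * (1 + K) / c * norm h) / 2 = e1 * (n * (1 + K) + n * (1 + K) / c) * norm h"
        by (simp add: algebra_simps add_divide_distrib)
      also have "n * (1 + K) + n * (1 + K) / c = c * C" using c(1) by (simp add: C_def)
      also have "e1 * (c * C) * norm h = c * (e1 * C * norm h)" by (simp only: mult_ac)
      finally have "norm R \<le> e1 * C * norm h" using c(1) by (simp only: mult_le_cancel_left_pos)
      also have "\<dots> \<le> e * norm h" using e1C by (intro mult_right_mono) auto
      finally show "norm (\<nu> (\<phi> v) - \<nu> (\<phi> u) - weingarten u (v - u)) \<le> e * norm (v - u)"
        by (simp add: R_def D_def h_def)
    qed
  qed
qed

text \<open>\<open>frechet_derivative\<close> chooses one of possibly many derivatives within the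
  surface; on tangent vectors every choice gives \<open>weingarten\<close>.\<close>

lemma shape_operator:
  assumes u: "u \<in> W"
  defines "S \<equiv> frechet_derivative \<nu> (at (\<phi> u) within \<Sigma>)"
  shows "(\<nu> has_derivative S) (at (\<phi> u) within \<Sigma>)" "linear S" "S (\<phi>' u h) = weingarten u h"
proof -
  obtain L where L: "bounded_linear L" "\<And>h. L (\<phi>' u h) = h" using left_inverse_exists[OF u] by blast
  have "\<nu> differentiable (at (\<phi> u) within \<Sigma>)"
    using has_derivative_within_surface[OF u L nu_along_has_derivative[OF u]] by (rule differentiableI)
  then show d: "(\<nu> has_derivative S) (at (\<phi> u) within \<Sigma>)"
    by (simp add: S_def frechet_derivative_works)
  then show "linear S" by (rule has_derivative_linear)
  show "S (\<phi>' u h) = weingarten u h"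
    using derivative_unique[OF derivative_along_patch[OF u d] nu_along_has_derivative[OF u] u]
    by (simp add: fun_eq_iff)
qed

text \<open>Invariance holds because \<open>weingarten\<close> has no normal component; symmetry is
  that of the second derivative of \<open>\<phi>\<close>.\<close>

lemma shape_operator_tangent:
  assumes u: "u \<in> W"
  defines "S \<equiv> frechet_derivative \<nu> (at (\<phi> u) within \<Sigma>)"
  shows "v \<in> tangent_space \<Sigma> (\<phi> u) \<Longrightarrow> S v \<in> tangent_space \<Sigma> (\<phi> u)"
    and "v \<in> tangent_space \<Sigma> (\<phi> u) \<Longrightarrow> w \<in> tangent_space \<Sigma> (\<phi> u) \<Longrightarrow> S v \<bullet> w = v \<bullet> S w"
proof -
  show "S v \<in> tangent_space \<Sigma> (\<phi> u)" if "v \<in> tangent_space \<Sigma> (\<phi> u)"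
  proof -
    obtain h where "v = \<phi>' u h" using \<open>v \<in> _\<close> tangent_space_eq[OF u] by blast
    then show ?thesis
      unfolding S_def tangent_space_hyperplane[OF u] by (simp add: shape_operator(3)[OF u] weingarten_nu[OF u])
  qed
  show "S v \<bullet> w = v \<bullet> S w" if "v \<in> tangent_space \<Sigma> (\<phi> u)" "w \<in> tangent_space \<Sigma> (\<phi> u)"
    using that u W_U unfolding tangent_space_eq[OF u] S_def
    by (auto simp: shape_operator[OF u] weingarten_inner[OF u] inner_commute[of "weingarten _ _"] hess_symmetric)
qed

lemma mean_curvature_eq:
  assumes u: "u \<in> W" and B: "orthonormal_basis_of (tangent_space \<Sigma> (\<phi> u)) B"
  shows "real CARD('n) * mean_curvature \<Sigma> \<nu> (\<phi> u)
    = (\<Sum>b\<in>B. frechet_derivative \<nu> (at (\<phi> u) within \<Sigma>) b \<bullet> b)"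
proof -
  have "orthonormal_basis_of (tangent_space \<Sigma> (\<phi> u)) (SOME B. orthonormal_basis_of (tangent_space \<Sigma> (\<phi> u)) B)"
    using B by (rule someI)
  from trace_orthonormal_basis_indep[OF shape_operator(2)[OF u] this B]
  show ?thesis by (simp add: mean_curvature_def second_fundamental_form_def)
qed

text \<open>The frame is indexed by \<open>'n\<close>, so that products of principal curvatures and
  matrices on \<open>real^'n\<close> share their index type.\<close>

lemma principal_frame:
  assumes u: "u \<in> W"
  defines "S \<equiv> frechet_derivative \<nu> (at (\<phi> u) within \<Sigma>)"
  obtains e :: "'n \<Rightarrow> 'n space" and l :: "'n \<Rightarrow> real"
  where "\<And>i. S (e i) = l i *\<^sub>R e i" "\<And>i j. e i \<bullet> e j = (if i = j then 1 else 0)"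
    "\<And>i. \<nu> (\<phi> u) \<bullet> e i = 0" "real CARD('n) * mean_curvature \<Sigma> \<nu> (\<phi> u) = (\<Sum>i\<in>UNIV. l i)"
    "\<And>v. \<nu> (\<phi> u) \<bullet> v = 0 \<Longrightarrow> v = (\<Sum>i\<in>UNIV. (v \<bullet> e i) *\<^sub>R e i)"
proof -
  let ?T = "tangent_space \<Sigma> (\<phi> u)"
  obtain B where B: "orthonormal_basis_of ?T B" "\<And>b. b \<in> B \<Longrightarrow> \<exists>m. S b = m *\<^sub>R b"
    using symmetric_orthonormal_eigenbasis[OF tangent_subspace[OF u], of S]
      shape_operator(2)[OF u] shape_operator_tangent[OF u] unfolding S_def by blast
  have cB: "finite B" "card B = CARD('n)" "B \<subseteq> ?T"
    using orthonormal_basis_of_card[OF B(1)] dim_tangent[OF u] by auto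
  obtain e :: "'n \<Rightarrow> 'n space" where e: "bij_betw e UNIV B"
    using finite_same_card_bij[of "UNIV :: 'n set" B] cB by auto
  have eB: "e i \<in> B" for i using e by (auto simp: bij_betw_def)
  obtain l where l: "\<And>i. S (e i) = l i *\<^sub>R e i" using B(2)[OF eB] by metis
  have on: "e i \<bullet> e j = (if i = j then 1 else 0)" for i j
  proof (cases "i = j")
    case True then show ?thesis using B(1) eB[of i] by (auto simp: orthonormal_basis_of_def dot_square_norm)
  next
    case False
    then have "e i \<noteq> e j" using e by (auto simp: bij_betw_def inj_on_def)
    then show ?thesis using B(1) eB False by (auto simp: orthonormal_basis_of_def pairwise_def orthogonal_def)
  qed
  have nu_e: "\<nu> (\<phi> u) \<bullet> e i = 0" for i using cB(3) eB nu_orth[OF phi_in[OF u]] by blast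
  have tr: "real CARD('n) * mean_curvature \<Sigma> \<nu> (\<phi> u) = (\<Sum>i\<in>UNIV. l i)"
    unfolding mean_curvature_eq[OF u B(1)] S_def[symmetric]
    using sum.reindex_bij_betw[OF e, of "\<lambda>b. S b \<bullet> b"] by (simp add: l on)
  have ex: "v = (\<Sum>i\<in>UNIV. (v \<bullet> e i) *\<^sub>R e i)" if v: "\<nu> (\<phi> u) \<bullet> v = 0" for v
  proof -
    have "v \<in> span B" using v B(1) tangent_space_hyperplane[OF u] by (auto simp: orthonormal_basis_of_def)
    then obtain c where "v = (\<Sum>b\<in>B. c b *\<^sub>R b)" using span_finite[OF cB(1)] by auto
    also have "\<dots> = (\<Sum>i\<in>UNIV. c (e i) *\<^sub>R e i)"
      using sum.reindex_bij_betw[OF e, of "\<lambda>b. c b *\<^sub>R b"] by simp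
    finally have v: "v = (\<Sum>i\<in>UNIV. c (e i) *\<^sub>R e i)" .
    have "v \<bullet> e j = c (e j)" for j
      unfolding v inner_sum_left by (simp add: on if_distrib[of "(*) _"] sum.delta cong: if_cong)
    then show ?thesis using v by simp
  qed
  show ?thesis by (rule that[OF l on nu_e tr ex])
qed

lemma continuous_on_solution:
  fixes L :: "real^'n \<Rightarrow> 'b::euclidean_space \<Rightarrow> 'c::euclidean_space"
  assumes lin: "\<And>u. linear (L u)" and inj: "\<And>u. u \<in> W \<Longrightarrow> inj (L u)"
    and L: "\<And>b. b \<in> Basis \<Longrightarrow> continuous_on W (\<lambda>u. L u b)"
    and c: "continuous_on W (\<lambda>u. L u (X u))"
  shows "continuous_on W X"
  unfolding continuous_on_def
proof
  fix u assume u: "u \<in> W"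
  show "(X \<longlongrightarrow> X u) (at u within W)"
    by (rule tendsto_linear_solution_componentwise[of L "L u"])
      (use assms u in \<open>auto simp: continuous_on_def\<close>)
qed

lemma cont_nu_phi: "continuous_on W (\<lambda>u. \<nu> (\<phi> u))"
  by (rule continuous_on_compose2[OF cont_nu continuous_on_subset[OF cont_phi W_U] image_subset])

lemma cont_deriv: "continuous_on W h \<Longrightarrow> continuous_on W (\<lambda>u. \<phi>' u (h u))"
  by (intro bounded_bilinear.continuous_on[OF bounded_bilinear_blinfun_apply] continuous_on_subset[OF cont_phi' W_U])

lemma cont_hess: "continuous_on W h \<Longrightarrow> continuous_on W k \<Longrightarrow> continuous_on W (\<lambda>u. \<phi>'' u (h u) (k u))"
  by (intro bounded_bilinear.continuous_on[OF bounded_bilinear_blinfun_apply] continuous_on_subset[OF cont2 W_U])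

lemma cont_weingarten:
  assumes "continuous_on W h" shows "continuous_on W (\<lambda>u. weingarten u (h u))"
proof (rule continuous_on_solution[of frame_map])
  show "continuous_on W (\<lambda>u. frame_map u b)" for b
    unfolding frame_map_def by (intro continuous_intros cont_deriv cont_nu_phi)
  have "continuous_on W (\<lambda>u. ((\<Sum>i\<in>Basis. (- (\<phi>'' u (h u) i \<bullet> \<nu> (\<phi> u))) *\<^sub>R i), 0::real))"
    by (intro continuous_intros cont_hess assms cont_nu_phi)
  then show "continuous_on W (\<lambda>u. frame_map u (weingarten u (h u)))"
    by (rule continuous_on_eq) (simp add: frame_map_weingarten)
qed (use linear_frame_map inj_frame_map in auto)

text \<open>The trace is taken over the fixed ambient basis after projection to the tangent space,
  so continuity of the mean curvature needs no continuous choice of tangent bases. The normal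
  contributes nothing, since its projection is zero.\<close>

lemma mean_curvature_trace:
  assumes u: "u \<in> W"
  shows "real CARD('n) * mean_curvature \<Sigma> \<nu> (\<phi> u)
    = (\<Sum>b\<in>Basis. frechet_derivative \<nu> (at (\<phi> u) within \<Sigma>) (b - (b \<bullet> \<nu> (\<phi> u)) *\<^sub>R \<nu> (\<phi> u)) \<bullet> b)"
proof -
  let ?T = "tangent_space \<Sigma> (\<phi> u)" and ?n = "\<nu> (\<phi> u)"
  define S where "S = frechet_derivative \<nu> (at (\<phi> u) within \<Sigma>)"
  define Q where "Q v = S (v - (v \<bullet> ?n) *\<^sub>R ?n)" for v
  obtain B where B: "orthonormal_basis_of ?T B"
    using orthonormal_basis_subspace[OF tangent_subspace[OF u]] unfolding orthonormal_basis_of_def by metis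
  have BT: "B \<subseteq> ?T" "finite B" using orthonormal_basis_of_card[OF B] by auto
  have Bn: "b \<bullet> ?n = 0" "?n \<bullet> b = 0" if "b \<in> B" for b
    using nu_orth[OF phi_in[OF u], of b] BT(1) that by (auto simp only: inner_commute[of b])
  have linS: "linear S" unfolding S_def by (rule shape_operator(2)[OF u])
  have linQ: "linear Q"
    by (rule linearI) (simp_all add: Q_def linear_diff[OF linS] linear_add[OF linS] linear_scale[OF linS]
        inner_add_left algebra_simps)
  have nB: "?n \<notin> B" using Bn nu_nu[OF u] by fastforce
  have "orthonormal_basis_of UNIV (insert ?n B)"
    unfolding orthonormal_basis_of_def
  proof (intro conjI ballI)
    show "pairwise orthogonal (insert ?n B)"
      using B Bn unfolding orthonormal_basis_of_def pairwise_insert by (auto simp: orthogonal_def)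
    show "norm b = 1" if "b \<in> insert ?n B" for b
      using that B nu_norm[OF phi_in[OF u]] by (auto simp: orthonormal_basis_of_def)
    show "span (insert ?n B) = UNIV"
    proof -
      have "x \<in> span (insert ?n B)" for x
      proof -
        have "x - (x \<bullet> ?n) *\<^sub>R ?n \<in> ?T"
          using nu_nu[OF u] by (simp add: tangent_space_hyperplane[OF u] inner_diff_right inner_commute)
        then have "x - (x \<bullet> ?n) *\<^sub>R ?n \<in> span B" using B by (simp add: orthonormal_basis_of_def)
        then show ?thesis by (auto simp: span_insert)
      qed
      then show ?thesis by blast
    qed
  qed
  from trace_orthonormal_basis_indep[OF linQ orthonormal_basis_of_Basis this]
  have "(\<Sum>b\<in>Basis. Q b \<bullet> b) = (\<Sum>b\<in>insert ?n B. Q b \<bullet> b)" .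
  also have "\<dots> = (\<Sum>b\<in>B. S b \<bullet> b)"
    using BT(2) nB nu_nu[OF u] linear_0[OF linS] Bn by (simp add: Q_def)
  finally show ?thesis unfolding mean_curvature_eq[OF u B] by (simp add: Q_def S_def)
qed

text \<open>Each projected basis vector is \<open>\<phi>' u (h u b)\<close>, and \<open>h\<close> is
  continuous in \<open>u\<close> as the solution of a linear equation with injective
  coefficients.\<close>

lemma cont_mean_curvature: "continuous_on W (\<lambda>u. mean_curvature \<Sigma> \<nu> (\<phi> u))"
proof -
  define P where "P u b = b - (b \<bullet> \<nu> (\<phi> u)) *\<^sub>R \<nu> (\<phi> u)" for u b
  have "\<exists>h. u \<in> W \<longrightarrow> P u b = \<phi>' u h" for u b
    using nu_nu[of u] tangentE[of u "P u b"] by (cases "u \<in> W") (auto simp: P_def inner_diff_right inner_commute)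
  then obtain h where h: "\<And>u b. u \<in> W \<Longrightarrow> P u b = \<phi>' u (h u b)" by metis
  have contP: "continuous_on W (\<lambda>u. P u b)" for b
    unfolding P_def by (intro continuous_intros cont_nu_phi)
  have conth: "continuous_on W (\<lambda>u. h u b)" for b
  proof (rule continuous_on_solution[of "\<lambda>u. blinfun_apply (\<phi>' u)"])
    show "linear (blinfun_apply (\<phi>' u))" for u by (simp add: blinfun.bounded_linear_right bounded_linear.linear)
    show "continuous_on W (\<lambda>u. \<phi>' u (h u b))"
      using contP[of b] by (rule continuous_on_eq) (simp add: h)
  qed (auto intro: inj_deriv cont_deriv continuous_on_const)
  have "continuous_on W (\<lambda>u. (\<Sum>b\<in>Basis. weingarten u (h u b) \<bullet> b) / real CARD('n))"
    by (intro continuous_intros cont_weingarten conth) auto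
  then show ?thesis
  proof (rule continuous_on_eq)
    fix u assume u: "u \<in> W"
    have "real CARD('n) * mean_curvature \<Sigma> \<nu> (\<phi> u) = (\<Sum>b\<in>Basis. weingarten u (h u b) \<bullet> b)"
      unfolding mean_curvature_trace[OF u] P_def[symmetric] by (simp add: h[OF u] shape_operator(3)[OF u])
    then show "(\<Sum>b\<in>Basis. weingarten u (h u b) \<bullet> b) / real CARD('n) = mean_curvature \<Sigma> \<nu> (\<phi> u)"
      by (simp add: field_simps)
  qed
qed

end

context patch_normal
begin

text \<open>In a principal frame the derivative of the cone map with offset \<open>a\<close> is
  block triangular: \<open>t\<close> times the diagonal of curvatures, composed with
  \<open>G\<close>, on the tangential part, and \<open>(\<nu> - a) \<bullet> \<nu>\<close> on the
  last coordinate. \<open>G\<close> expresses \<open>\<phi>' u\<close> in the frame, and its volume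
  factor is the area density.\<close>

lemma principal_curvatures:
  assumes u: "u \<in> W"
  obtains l :: "'n \<Rightarrow> real"
  where "real CARD('n) * mean_curvature \<Sigma> \<nu> (\<phi> u) = (\<Sum>i\<in>UNIV. l i)"
    "\<And>t a. 1 - a \<bullet> \<nu> (\<phi> u) \<noteq> 0 \<Longrightarrow>
      lin_scale (\<lambda>(h, s). t *\<^sub>R weingarten u h + s *\<^sub>R (\<nu> (\<phi> u) - a)) =
      \<bar>t\<bar> ^ CARD('n) * \<bar>\<Prod>i\<in>UNIV. l i\<bar> * area_density \<phi> u * \<bar>1 - a \<bullet> \<nu> (\<phi> u)\<bar>"
    "\<And>i. \<exists>h. norm (\<phi>' u h) = 1 \<and> l i = - (\<phi>'' u h h \<bullet> \<nu> (\<phi> u))"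
    "\<And>m h. (\<And>i. l i = m) \<Longrightarrow> weingarten u h = m *\<^sub>R \<phi>' u h"
    "0 < area_density \<phi> u"
proof -
  define S where "S = frechet_derivative \<nu> (at (\<phi> u) within \<Sigma>)"
  let ?n = "\<nu> (\<phi> u)"
  obtain e :: "'n \<Rightarrow> 'n space" and l :: "'n \<Rightarrow> real" where Se: "\<And>i. S (e i) = l i *\<^sub>R e i"
    and on: "\<And>i j. e i \<bullet> e j = (if i = j then 1 else (0::real))"
    and ne: "\<And>i. ?n \<bullet> e i = 0" and tr: "real CARD('n) * mean_curvature \<Sigma> \<nu> (\<phi> u) = (\<Sum>i\<in>UNIV. l i)"
    and ex: "\<And>v. ?n \<bullet> v = 0 \<Longrightarrow> v = (\<Sum>i\<in>UNIV. (v \<bullet> e i) *\<^sub>R e i)"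
  proof (rule principal_frame[OF u, folded S_def], goal_cases)
    case (1 e l)
    show ?case by (rule 1(1)[of e l]; fact 1)
  qed
  have linS: "linear S" and Sw: "\<And>h. S (\<phi>' u h) = weingarten u h"
    unfolding S_def using shape_operator[OF u] by auto
  have uU: "u \<in> U" using u W_U by auto
  define G :: "real^'n \<Rightarrow> real^'n" where "G h = (\<chi> i. \<phi>' u h \<bullet> e i)" for h
  have linG: "linear G"
    by (rule linearI) (simp_all add: G_def blinfun.add_right blinfun.scaleR_right inner_add_left vec_eq_iff)
  have phe: "\<phi>' u h = (\<Sum>i\<in>UNIV. G h $ i *\<^sub>R e i)" for h
    unfolding G_def vec_lambda_beta by (rule ex[OF nu_deriv[OF u]])
  have wh: "weingarten u h = (\<Sum>i\<in>UNIV. (G h $ i * l i) *\<^sub>R e i)" for h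
    unfolding Sw[symmetric] by (subst phe) (simp add: linear_sum[OF linS] linear_scale[OF linS] Se)
  have we: "weingarten u h \<bullet> e i = l i * G h $ i" for h i
    unfolding wh inner_sum_left by (simp add: on if_distrib[of "(*) _"] sum.delta cong: if_cong)
  have dens: "area_density \<phi> u = lin_scale G"
  proof -
    have "(\<chi> i j. frechet_derivative \<phi> (at u) (axis i 1) \<bullet> frechet_derivative \<phi> (at u) (axis j 1))
        = transpose (matrix G) ** matrix G"
    proof -
      have "\<phi>' u h \<bullet> \<phi>' u k = (\<Sum>i\<in>UNIV. G h $ i * G k $ i)" for h k
        by (subst (2) phe) (simp add: inner_sum_right G_def mult.commute)
      then show ?thesis
        by (simp add: frechet[OF uU] vec_eq_iff matrix_matrix_mult_def transpose_def matrix_def)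
    qed
    then show ?thesis
      by (simp add: area_density_def det_mul det_transpose lin_scale_vec flip: power2_eq_square)
  qed
  have "inj G"
  proof -
    have "h = 0" if "G h = 0" for h
    proof -
      have "\<phi>' u h = \<phi>' u 0" unfolding phe[of h] that by (simp add: blinfun.zero_right)
      then show ?thesis by (rule injD[OF inj_deriv[OF u]])
    qed
    then show ?thesis by (simp add: linear_injective_0[OF linG])
  qed
  then have dens_pos: "0 < area_density \<phi> u"
    using det_nz_iff_inj[OF linG] by (simp add: dens lin_scale_vec)
  \<comment> \<open>An isometry that turns the frame and the normal into coordinate axes, hence
    without effect on volume factors.\<close>
  define R :: "'n space \<Rightarrow> 'n space" where "R x = ((\<chi> i. x \<bullet> e i), x \<bullet> ?n)" for x
  have linR: "linear R"
    by (rule linearI) (simp_all add: R_def inner_add_left vec_eq_iff)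
  have normR: "norm (R x) = norm x" for x
  proof -
    have "?n \<bullet> (x - (x \<bullet> ?n) *\<^sub>R ?n) = 0" using nu_nu[OF u] by (simp add: inner_diff_right inner_commute)
    from ex[OF this] have "x - (x \<bullet> ?n) *\<^sub>R ?n = (\<Sum>i\<in>UNIV. (x \<bullet> e i) *\<^sub>R e i)"
      by (simp add: inner_diff_left ne)
    then have "x = (\<Sum>i\<in>UNIV. (x \<bullet> e i) *\<^sub>R e i) + (x \<bullet> ?n) *\<^sub>R ?n" by (simp add: algebra_simps)
    then have "x \<bullet> x = ((\<Sum>i\<in>UNIV. (x \<bullet> e i) *\<^sub>R e i) + (x \<bullet> ?n) *\<^sub>R ?n) \<bullet> x" by simp
    also have "\<dots> = (\<Sum>i\<in>UNIV. (x \<bullet> e i)^2) + (x \<bullet> ?n)^2"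
      unfolding inner_add_left inner_sum_left inner_scaleR_left power2_eq_square by (simp only: inner_commute)
    finally have "(norm (R x))^2 = (norm x)^2"
      unfolding R_def norm_Pair power2_norm_eq_inner real_sqrt_pow2_iff
      by (simp add: sum_nonneg inner_vec_def power2_eq_square power2_norm_eq_inner)
    then show ?thesis by simp
  qed
  show ?thesis
  proof (rule that[OF tr _ _ _ dens_pos])
    fix t :: real and a assume w: "1 - a \<bullet> ?n \<noteq> 0"
    let ?D = "\<lambda>(h, s). t *\<^sub>R weingarten u h + s *\<^sub>R (?n - a)"
    have linw: "linear (weingarten u)" by (rule linear_weingarten[OF u])
    have linD: "linear ?D"
      by (rule linearI) (auto simp: linear_add[OF linw] linear_scale[OF linw] algebra_simps)
    define D1 :: "real^'n \<Rightarrow> real^'n" where "D1 x = (\<chi> i. t * l i * x $ i)" for x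
    have linD1: "linear D1" by (rule linearI) (simp_all add: D1_def vec_eq_iff algebra_simps)
    \<comment> \<open>The tangential part of \<open>a\<close> only fills the off-diagonal
      block.\<close>
    have "R \<circ> ?D = (\<lambda>(h, s). ((D1 \<circ> G) h + s *\<^sub>R (\<chi> i. - (a \<bullet> e i)), (1 - a \<bullet> ?n) * s))"
    proof (rule ext, clarify)
      fix h :: "real^'n" and s :: real
      have "weingarten u h \<bullet> ?n = 0" using weingarten_nu[OF u] by (simp add: inner_commute)
      then show "(R \<circ> ?D) (h, s) = ((D1 \<circ> G) h + s *\<^sub>R (\<chi> i. - (a \<bullet> e i)), (1 - a \<bullet> ?n) * s)"
        using nu_nu[OF u]
        by (simp add: R_def D1_def vec_eq_iff inner_add_left inner_diff_left ne we)
    qed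
    then have "lin_scale (R \<circ> ?D) = lin_scale (D1 \<circ> G) * \<bar>1 - a \<bullet> ?n\<bar>"
      using lin_scale_block[OF linear_compose[OF linG linD1] w] by simp
    moreover have "lin_scale (R \<circ> ?D) = lin_scale ?D"
      using lin_scale_compose[OF linR linD] lin_scale_isometry[OF linR normR] by simp
    moreover have "lin_scale D1 = \<bar>t\<bar> ^ CARD('n) * \<bar>\<Prod>i\<in>UNIV. l i\<bar>"
    proof -
      have "matrix D1 = (\<chi> i j. if i = j then t * l i else 0)"
        by (simp add: matrix_def D1_def vec_eq_iff axis_def)
      then have "det (matrix D1) = (\<Prod>i\<in>UNIV. t * l i)" by (subst det_diagonal) auto
      then show ?thesis by (simp add: lin_scale_vec prod.distrib abs_mult power_abs)
    qed
    ultimately show "lin_scale ?D = \<bar>t\<bar> ^ CARD('n) * \<bar>\<Prod>i\<in>UNIV. l i\<bar> * area_density \<phi> u * \<bar>1 - a \<bullet> ?n\<bar>"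
      using lin_scale_compose[OF linD1 linG] dens by simp
  next
    fix i
    obtain h where h: "e i = \<phi>' u h" using tangentE[OF u ne] .
    have "norm (e i) = 1" using on[of i i] by (simp add: norm_eq_1)
    moreover have "l i = \<phi>' u h \<bullet> weingarten u h"
      unfolding Sw[symmetric] h[symmetric] Se by (simp add: on)
    ultimately show "\<exists>h. norm (\<phi>' u h) = 1 \<and> l i = - (\<phi>'' u h h \<bullet> ?n)"
      using weingarten_inner[OF u] h by metis
  next
    fix m h assume "\<And>i. l i = m"
    then show "weingarten u h = m *\<^sub>R \<phi>' u h"
      unfolding wh by (subst phe) (simp add: scaleR_sum_right mult.commute)
  qed
qed

end

section \<open>Integrals under injective maps and independence of the parametrization\<close>

text \<open>Applied to the parts of \<open>S\<close> over Borel sets, the volume formula says that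
  two Borel measures coincide: the push-forward of the Jacobian density under \<open>g\<close>, and
  Lebesgue measure on the image. \<open>F\<close> is integrated against both.\<close>

lemma nn_integral_change_of_variables:
  fixes g :: "'a::euclidean_space \<Rightarrow> 'a"
  assumes S: "S \<in> sets lebesgue" and der: "\<And>x. x \<in> S \<Longrightarrow> (g has_derivative g' x) (at x within S)"
    and inj: "inj_on g S" and F: "F \<in> borel_measurable borel"
  shows "(\<integral>\<^sup>+x\<in>S. ennreal (lin_scale (g' x)) * F (g x) \<partial>lebesgue) = (\<integral>\<^sup>+y\<in>g ` S. F y \<partial>lebesgue)"
proof -
  have gS: "g ` S \<in> sets lebesgue" by (rule image_sets_lebesgue[OF S der])
  have ls: "(\<lambda>x. ennreal (lin_scale (g' x))) \<in> borel_measurable (lebesgue_on S)"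
    by (rule measurable_compose[OF borel_measurable_lin_scale[OF S der] measurable_ennreal])
  have g: "g \<in> borel_measurable (lebesgue_on S)"
    by (rule continuous_imp_measurable_on_sets_lebesgue[OF _ S])
      (auto simp: continuous_on_eq_continuous_within intro: has_derivative_continuous[OF der])
  let ?M1 = "distr (density (lebesgue_on S) (\<lambda>x. ennreal (lin_scale (g' x)))) borel g"
  let ?M2 = "distr (lebesgue_on (g ` S)) borel (\<lambda>y. y)"
  have id: "(\<lambda>y. y) \<in> lebesgue_on (g ` S) \<rightarrow>\<^sub>M borel"
    by (intro measurable_restrict_space1 measurable_completion) simp
  have g': "g \<in> density (lebesgue_on S) (\<lambda>x. ennreal (lin_scale (g' x))) \<rightarrow>\<^sub>M borel" using g by simp
  have eq: "?M1 = ?M2"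
  proof (rule measure_eqI)
    fix B assume "B \<in> sets ?M1"
    then have B: "B \<in> sets borel" by simp
    let ?S = "S \<inter> g -` B"
    have "g -` B \<inter> space (lebesgue_on S) \<in> sets (lebesgue_on S)" by (rule measurable_sets[OF g B])
    then have S1: "?S \<in> sets (lebesgue_on S)" by (simp add: space_restrict_space Int_commute)
    then have S2: "?S \<in> sets lebesgue" using S by (auto simp: sets_restrict_space)
    have "emeasure ?M1 B = emeasure (density (lebesgue_on S) (\<lambda>x. ennreal (lin_scale (g' x)))) ?S"
      by (subst emeasure_distr[OF g' B]) (simp add: space_restrict_space Int_commute)
    also have "\<dots> = (\<integral>\<^sup>+x\<in>?S. ennreal (lin_scale (g' x)) \<partial>lebesgue_on S)"
      by (rule emeasure_density[OF ls S1])
    also have "\<dots> = (\<integral>\<^sup>+x. (ennreal (lin_scale (g' x)) * indicator ?S x) * indicator S x \<partial>lebesgue)"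
      by (rule nn_integral_restrict_space) (use S in simp)
    also have "\<dots> = (\<integral>\<^sup>+x\<in>?S. ennreal (lin_scale (g' x)) \<partial>lebesgue)"
      by (intro nn_integral_cong) (auto simp: indicator_def)
    also have "\<dots> = emeasure lebesgue (g ` ?S)"
      by (rule emeasure_image_eq_lin_scale[symmetric, OF S2])
        (use der inj in \<open>auto intro: has_derivative_subset inj_on_subset\<close>)
    also have "g ` ?S = B \<inter> g ` S" by auto
    also have "emeasure lebesgue (B \<inter> g ` S) = emeasure (lebesgue_on (g ` S)) (B \<inter> g ` S)"
      by (rule emeasure_restrict_space[symmetric]) (use gS in auto)
    also have "\<dots> = emeasure ?M2 B"
      by (subst emeasure_distr[OF id B]) (simp add: space_restrict_space)
    finally show "emeasure ?M1 B = emeasure ?M2 B" .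
  qed simp
  have "(\<integral>\<^sup>+x\<in>S. ennreal (lin_scale (g' x)) * F (g x) \<partial>lebesgue)
      = (\<integral>\<^sup>+x. ennreal (lin_scale (g' x)) * F (g x) \<partial>lebesgue_on S)"
    by (rule nn_integral_restrict_space[symmetric]) (use S in simp)
  also have "\<dots> = (\<integral>\<^sup>+x. F (g x) \<partial>density (lebesgue_on S) (\<lambda>x. ennreal (lin_scale (g' x))))"
    by (rule nn_integral_density[symmetric, OF ls measurable_compose[OF g F]])
  also have "\<dots> = integral\<^sup>N ?M1 F"
    by (rule nn_integral_distr[symmetric, OF g']) (use F in simp)
  also have "\<dots> = integral\<^sup>N ?M2 F" by (simp only: eq)
  also have "\<dots> = (\<integral>\<^sup>+y. F y \<partial>lebesgue_on (g ` S))"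
    by (rule nn_integral_distr[OF id]) (use F in simp)
  also have "\<dots> = (\<integral>\<^sup>+y\<in>g ` S. F y \<partial>lebesgue)"
    by (rule nn_integral_restrict_space) (use gS in simp)
  finally show ?thesis .
qed

context patch
begin

lemma cont_area_density: "continuous_on U (area_density \<phi>)"
proof -
  have "continuous_on U (\<lambda>u. \<phi>' u h)" for h
    by (intro bounded_bilinear.continuous_on[OF bounded_bilinear_blinfun_apply] cont_phi' continuous_on_const)
  then have "continuous_on U (\<lambda>u. sqrt (det (\<chi> i j. \<phi>' u (axis i 1) \<bullet> \<phi>' u (axis j 1))))"
    unfolding det_def vec_lambda_beta
    by (intro continuous_on_real_sqrt continuous_on_sum continuous_on_mult continuous_on_prod
        continuous_on_const continuous_on_inner)
  then show ?thesis
    by (rule continuous_on_eq) (simp add: area_density_def frechet)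
qed

lemma phi_vimage_borel:
  assumes "A \<in> sets borel" shows "W \<inter> \<phi> -` A \<in> sets borel"
proof -
  have "continuous_on W \<phi>" using continuous_on_subset[OF cont_phi W_U] .
  then have "\<phi> \<in> borel_measurable (restrict_space borel W)" by (rule borel_measurable_continuous_on_restrict)
  from measurable_sets[OF this assms] have "\<phi> -` A \<inter> W \<in> sets (restrict_space borel W)"
    by (simp add: space_restrict_space)
  then show ?thesis using W_borel by (auto simp: sets_restrict_space Int_commute)
qed

lemma measurable_on_patch:
  fixes f :: "real^'n \<Rightarrow> real"
  assumes "continuous_on W f" "X \<in> sets borel" "X \<subseteq> W"
  shows "(\<lambda>u. f u * indicator X u) \<in> borel_measurable (borel :: (real^'n) measure)"
proof -
  have "f \<in> borel_measurable (restrict_space borel W)" by (rule borel_measurable_continuous_on_restrict[OF assms(1)])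
  then have "(\<lambda>u. indicator W u * f u) \<in> borel_measurable borel"
    using borel_measurable_restrict_space_iff[of W borel f] by simp
  then have "(\<lambda>u. (indicator W u * f u) * indicator X u) \<in> borel_measurable borel"
    using assms(2) by measurable
  moreover have "(\<lambda>u. (indicator W u * f u) * indicator X u) = (\<lambda>u. f u * indicator X u)"
    using assms(3) by (auto simp: fun_eq_iff indicator_def)
  ultimately show ?thesis by simp
qed

end

text \<open>The Gram matrix of \<open>\<phi>1\<close> is that of \<open>\<phi>2\<close>, multiplied
  by the derivative of the transition map on one side and by its transpose on the other. Hence the
  densities differ by the Jacobian of the transition map, and the change of variables formula
  applies.\<close>

lemma area_patch_consistent:
  assumes "patch \<Sigma> W1 U1 \<phi>1 \<phi>1' \<phi>1'' \<psi>1" "patch \<Sigma> W2 U2 \<phi>2 \<phi>2' \<phi>2'' \<psi>2"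
    and A: "A \<in> sets borel" "A \<subseteq> \<phi>1 ` W1" "A \<subseteq> \<phi>2 ` W2"
  shows "(\<integral>\<^sup>+u\<in>W1 \<inter> \<phi>1 -` A. ennreal (area_density \<phi>1 u) \<partial>lborel)
    = (\<integral>\<^sup>+u\<in>W2 \<inter> \<phi>2 -` A. ennreal (area_density \<phi>2 u) \<partial>lborel)"
proof -
  interpret P1: patch \<Sigma> W1 U1 \<phi>1 \<phi>1' \<phi>1'' \<psi>1 by fact
  interpret P2: patch \<Sigma> W2 U2 \<phi>2 \<phi>2' \<phi>2'' \<psi>2 by fact
  let ?S = "W1 \<inter> \<phi>1 -` A" and ?S2 = "W2 \<inter> \<phi>2 -` A"
  define t where "t u = \<psi>2 (\<phi>1 u)" for u
  have t: "t u \<in> W2" "\<phi>2 (t u) = \<phi>1 u" if "u \<in> ?S" for u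
    using that A P2.psi_in[of "\<phi>1 u"] P2.phi_psi[of "\<phi>1 u"] by (auto simp: t_def)
  have t_eq: "t = (\<lambda>v. \<psi>2 (\<phi>1 v))" by (simp add: t_def fun_eq_iff)
  have "\<exists>T. \<forall>u\<in>?S. (t has_derivative T u) (at u within ?S) \<and> (\<forall>h. \<phi>2' (t u) (T u h) = \<phi>1' u h)"
  proof (rule bchoice, rule ballI)
    fix u assume u: "u \<in> ?S"
    obtain L where L: "bounded_linear L" "\<And>h. L (\<phi>2' (t u) h) = h"
      using P2.left_inverse_exists[OF t(1)[OF u]] by blast
    have u1: "u \<in> W1" using u by simp
    have "(t has_derivative (\<lambda>h. L (\<phi>1' u h))) (at u within W1)"
      using patch_range_subset(2)[OF assms(1,2) u1 t(1)[OF u] t(2)[OF u, symmetric] L] unfolding t_eq .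
    then have "(t has_derivative (\<lambda>h. L (\<phi>1' u h))) (at u within ?S)"
      by (rule has_derivative_subset) auto
    then show "\<exists>T. (t has_derivative T) (at u within ?S) \<and> (\<forall>h. \<phi>2' (t u) (T h) = \<phi>1' u h)"
      using patch_range_subset(1)[OF assms(1,2) u1 t(1)[OF u] t(2)[OF u, symmetric] L] by blast
  qed
  then obtain T where T: "\<And>u. u \<in> ?S \<Longrightarrow> (t has_derivative T u) (at u within ?S)"
    "\<And>u h. u \<in> ?S \<Longrightarrow> \<phi>2' (t u) (T u h) = \<phi>1' u h" by blast
  have inj: "inj_on t ?S"
  proof (rule inj_onI)
    fix u v assume "u \<in> ?S" "v \<in> ?S" "t u = t v"
    then have "\<phi>1 u = \<phi>1 v" "u \<in> W1" "v \<in> W1" using t(2) by (metis, auto)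
    then show "u = v" using P1.psi_phi by metis
  qed
  have im: "t ` ?S = ?S2"
  proof
    show "t ` ?S \<subseteq> ?S2" using t by auto
    show "?S2 \<subseteq> t ` ?S"
    proof
      fix v assume v: "v \<in> ?S2"
      then obtain u where u: "u \<in> W1" "\<phi>1 u = \<phi>2 v" using A(2) by auto
      then have "u \<in> ?S" "t u = v" using v by (auto simp: t_def)
      then show "v \<in> t ` ?S" by blast
    qed
  qed
  have S: "?S \<in> sets borel" "?S2 \<in> sets borel" using P1.phi_vimage_borel P2.phi_vimage_borel A(1) by auto
  define F where "F v = ennreal (area_density \<phi>2 v * indicator ?S2 v)" for v
  have F: "F \<in> borel_measurable borel"
    unfolding F_def
    by (intro measurable_compose[OF _ measurable_ennreal] P2.measurable_on_patch S
        continuous_on_subset[OF P2.cont_area_density P2.W_U]) auto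
  have dens: "area_density \<phi>1 u = lin_scale (T u) * area_density \<phi>2 (t u)" if u: "u \<in> ?S" for u
  proof -
    have linT: "linear (T u)" using T(1)[OF u] by (rule has_derivative_linear)
    have uU: "u \<in> U1" "t u \<in> U2" using u t(1)[OF u] P1.W_U P2.W_U by auto
    let ?G1 = "\<chi> i j. \<phi>1' u (axis i 1) \<bullet> \<phi>1' u (axis j 1)"
    let ?G2 = "\<chi> i j. \<phi>2' (t u) (axis i 1) \<bullet> \<phi>2' (t u) (axis j 1)"
    have ex: "\<phi>1' u h = (\<Sum>k\<in>UNIV. (T u h $ k) *\<^sub>R \<phi>2' (t u) (axis k 1))" for h
    proof -
      have "T u h = (\<Sum>k\<in>UNIV. T u h $ k *\<^sub>R axis k 1)"
        using basis_expansion[of "T u h"] by (simp add: scalar_mult_eq_scaleR)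
      then have "\<phi>2' (t u) (T u h) = \<phi>2' (t u) (\<Sum>k\<in>UNIV. T u h $ k *\<^sub>R axis k 1)" by (rule arg_cong)
      then show ?thesis using T(2)[OF u] by (simp add: blinfun.sum_right blinfun.scaleR_right)
    qed
    have "?G1 = transpose (matrix (T u)) ** ?G2 ** matrix (T u)"
      unfolding vec_eq_iff
    proof (intro allI)
      fix i j
      have "?G1 $ i $ j = (\<Sum>k\<in>UNIV. \<Sum>m\<in>UNIV. T u (axis i 1) $ m * T u (axis j 1) $ k * ?G2 $ m $ k)"
        by (simp add: ex inner_sum_left inner_sum_right sum_distrib_left mult_ac)
      then show "?G1 $ i $ j = (transpose (matrix (T u)) ** ?G2 ** matrix (T u)) $ i $ j"
        by (simp add: matrix_matrix_mult_def transpose_def matrix_def sum_distrib_right sum_distrib_left mult_ac)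
    qed
    then have "det ?G1 = (det (matrix (T u)))^2 * det ?G2"
      by (simp add: det_mul det_transpose power2_eq_square)
    then show ?thesis
      by (simp add: area_density_def P1.frechet[OF uU(1)] P2.frechet[OF uU(2)] real_sqrt_mult lin_scale_vec)
  qed
  have "(\<integral>\<^sup>+u\<in>?S. ennreal (area_density \<phi>1 u) \<partial>lborel) = (\<integral>\<^sup>+u\<in>?S. ennreal (lin_scale (T u)) * F (t u) \<partial>lborel)"
  proof (rule nn_integral_cong)
    fix u
    show "ennreal (area_density \<phi>1 u) * indicator ?S u = ennreal (lin_scale (T u)) * F (t u) * indicator ?S u"
    proof (cases "u \<in> ?S")
      case True
      then have "t u \<in> ?S2" using im by blast
      then show ?thesis using True dens[OF True] by (simp add: F_def ennreal_mult')
    qed simp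
  qed
  also have "\<dots> = (\<integral>\<^sup>+u\<in>?S. ennreal (lin_scale (T u)) * F (t u) \<partial>lebesgue)"
    by (simp only: nn_integral_completion)
  also have "\<dots> = (\<integral>\<^sup>+v\<in>t ` ?S. F v \<partial>lebesgue)"
    by (rule nn_integral_change_of_variables[OF _ T(1) inj F]) (use S in auto)
  also have "\<dots> = (\<integral>\<^sup>+v\<in>?S2. F v \<partial>lborel)" by (simp only: im nn_integral_completion)
  also have "\<dots> = (\<integral>\<^sup>+u\<in>?S2. ennreal (area_density \<phi>2 u) \<partial>lborel)"
    by (intro nn_integral_cong) (auto simp: F_def indicator_def)
  finally show ?thesis .
qed

section \<open>The area measure\<close>

lemma patch_restrict:
  assumes "patch \<Sigma> W U \<phi> \<phi>' \<phi>'' \<psi>" "open T"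
  shows "patch \<Sigma> (W \<inter> T) U \<phi> \<phi>' \<phi>'' \<psi>"
proof -
  interpret P: patch \<Sigma> W U \<phi> \<phi>' \<phi>'' \<psi> by fact
  show ?thesis
  proof
    obtain T0 where T0: "open T0" "W = T0 \<or> (\<exists>k. W = T0 \<inter> {u. 0 \<le> u $ k})" using P.shape by blast
    show "\<exists>T'. open T' \<and> (W \<inter> T = T' \<or> (\<exists>k. W \<inter> T = T' \<inter> {u. 0 \<le> u $ k}))"
      using T0 assms(2) by (intro exI[of _ "T0 \<inter> T"]) auto
    show "homeomorphism (W \<inter> T) (\<phi> ` (W \<inter> T)) \<phi> \<psi>"
      by (rule homeomorphism_of_subsets[OF P.homeo]) auto
    have "openin (top_of_set W) (W \<inter> T)" using assms(2) by (simp add: openin_open_Int)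
    from homeomorphism_imp_open_map[OF P.homeo this] show "openin (top_of_set \<Sigma>) (\<phi> ` (W \<inter> T))"
      using P.openin_image openin_trans by blast
  qed (use P.open_U P.W_U P.deriv P.deriv2 P.cont2 P.inj_deriv in auto)
qed

text \<open>Each patch is cut down to a ball whose closure lies in \<open>U\<close>, where the
  density is bounded; bounded domains and densities later give finite area.\<close>

lemma finite_atlas:
  fixes \<Sigma> :: "('n::finite) space set"
  assumes "compact \<Sigma>" "C2_hypersurface \<Sigma>"
  obtains N :: nat and W :: "nat \<Rightarrow> (real^'n) set" and \<phi>
  where "\<And>i. i < N \<Longrightarrow> local_parametrization \<Sigma> (W i) (\<phi> i)"
    "\<And>i. i < N \<Longrightarrow> bounded (W i)" "\<And>i. i < N \<Longrightarrow> \<exists>K. \<forall>u\<in>W i. area_density (\<phi> i) u \<le> K"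
    "\<Sigma> = (\<Union>i<N. \<phi> i ` W i)"
proof -
  have "\<exists>W \<phi>. local_parametrization \<Sigma> W \<phi> \<and> bounded W \<and> (\<exists>K. \<forall>u\<in>W. area_density \<phi> u \<le> K) \<and> x \<in> \<phi> ` W"
    if "x \<in> \<Sigma>" for x
  proof -
    obtain W \<phi> where lp: "local_parametrization \<Sigma> W \<phi>" "x \<in> \<phi> ` W"
      using assms(2) \<open>x \<in> \<Sigma>\<close> unfolding C2_hypersurface_def by blast
    obtain U \<phi>' \<phi>'' \<psi> where P: "patch \<Sigma> W U \<phi> \<phi>' \<phi>'' \<psi>" using local_parametrization_imp_patch[OF lp(1)] by blast
    interpret P: patch \<Sigma> W U \<phi> \<phi>' \<phi>'' \<psi> by fact
    obtain u where u: "u \<in> W" "x = \<phi> u" using lp(2) by blast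
    obtain r where r: "r > 0" "cball u r \<subseteq> U" using P.open_U P.W_U u open_contains_cball by blast
    have "compact (area_density \<phi> ` cball u r)"
      by (intro compact_continuous_image continuous_on_subset[OF P.cont_area_density] r compact_cball)
    then obtain K where K: "\<And>v. v \<in> cball u r \<Longrightarrow> area_density \<phi> v \<le> K"
      using compact_imp_bounded bounded_real by (metis abs_le_D1 image_eqI)
    have "patch \<Sigma> (W \<inter> ball u r) U \<phi> \<phi>' \<phi>'' \<psi>" by (rule patch_restrict[OF P]) simp
    then have "local_parametrization \<Sigma> (W \<inter> ball u r) \<phi>" by (rule patch.local_parametrization)
    moreover have "x \<in> \<phi> ` (W \<inter> ball u r)" using u r by auto
    moreover have "\<forall>v\<in>W \<inter> ball u r. area_density \<phi> v \<le> K" using K by auto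
    ultimately show ?thesis by (metis bounded_Int bounded_ball)
  qed
  then obtain W \<phi> where c: "\<And>x. x \<in> \<Sigma> \<Longrightarrow> local_parametrization \<Sigma> (W x) (\<phi> x)" "\<And>x. x \<in> \<Sigma> \<Longrightarrow> bounded (W x)"
    "\<And>x. x \<in> \<Sigma> \<Longrightarrow> \<exists>K. \<forall>u\<in>W x. area_density (\<phi> x) u \<le> K" "\<And>x. x \<in> \<Sigma> \<Longrightarrow> x \<in> \<phi> x ` W x"
    by metis
  have "\<exists>T. open T \<and> \<phi> x ` W x = \<Sigma> \<inter> T" if "x \<in> \<Sigma>" for x
    using c(1)[OF that] by (auto simp: local_parametrization_def openin_open)
  then obtain T where T: "\<And>x. x \<in> \<Sigma> \<Longrightarrow> open (T x)" "\<And>x. x \<in> \<Sigma> \<Longrightarrow> \<phi> x ` W x = \<Sigma> \<inter> T x" by metis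
  have "\<Sigma> \<subseteq> (\<Union>x\<in>\<Sigma>. T x)" using c(4) T(2) by blast
  then obtain C where C: "C \<subseteq> \<Sigma>" "finite C" "\<Sigma> \<subseteq> (\<Union>x\<in>C. T x)"
    using compactE_image[OF assms(1), of \<Sigma> T] T(1) by blast
  obtain h where h: "bij_betw h {0..<card C} C" using ex_bij_betw_nat_finite[OF C(2)] by blast
  have hC: "h i \<in> \<Sigma>" if "i < card C" for i using h C(1) that by (auto simp: bij_betw_def)
  have "\<Sigma> = (\<Union>x\<in>C. \<phi> x ` W x)" using C T(2) by blast
  also have "C = h ` {..<card C}" using h by (auto simp: bij_betw_def lessThan_atLeast0)
  finally have "\<Sigma> = (\<Union>i<card C. \<phi> (h i) ` W (h i))" by simp
  then show ?thesis using hC c by (intro that[of "card C" "\<lambda>i. W (h i)" "\<lambda>i. \<phi> (h i)"]) auto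
qed

lemma local_parametrization_image_borel:
  assumes "\<Sigma> \<in> sets borel" "local_parametrization \<Sigma> W \<phi>"
  shows "\<phi> ` W \<in> sets borel" "\<phi> ` W \<subseteq> \<Sigma>"
  using assms by (auto simp: local_parametrization_def openin_open)

text \<open>Each piece keeps what earlier patches miss, so integrals over the surface become finite
  sums of integrals over single patches.\<close>

lemma emeasure_patch_sum:
  fixes W :: "nat \<Rightarrow> (real^'n::finite) set"
  assumes \<Sigma>: "\<Sigma> \<in> sets borel"
    and lp: "\<And>i. i < N \<Longrightarrow> local_parametrization \<Sigma> (W i) (\<phi> i)" and cov: "\<Sigma> = (\<Union>i<N. \<phi> i ` W i)"
  defines "B \<equiv> \<lambda>i. \<phi> i ` W i - (\<Union>j<i. \<phi> j ` W j)"
  shows "\<And>i. i < N \<Longrightarrow> B i \<in> sets borel" "\<And>i. B i \<subseteq> \<phi> i ` W i" "(\<Union>i<N. B i) = \<Sigma>" "disjoint_family_on B {..<N}"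
proof -
  show "B i \<in> sets borel" if "i < N" for i
    unfolding B_def using that by (intro sets.Diff sets.finite_UN local_parametrization_image_borel[OF \<Sigma> lp]) auto
  show "B i \<subseteq> \<phi> i ` W i" for i by (auto simp: B_def)
  show "disjoint_family_on B {..<N}"
    unfolding disjoint_family_on_def B_def by (metis (no_types, lifting) DiffE UN_I disjoint_iff lessThan_iff nat_neq_iff)
  show "(\<Union>i<N. B i) = \<Sigma>"
  proof
    show "(\<Union>i<N. B i) \<subseteq> \<Sigma>" using cov by (auto simp: B_def)
    show "\<Sigma> \<subseteq> (\<Union>i<N. B i)"
    proof
      fix x assume "x \<in> \<Sigma>"
      then have ex: "\<exists>i. i < N \<and> x \<in> \<phi> i ` W i" using cov by auto
      define i where "i = (LEAST i. i < N \<and> x \<in> \<phi> i ` W i)"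
      have i: "i < N \<and> x \<in> \<phi> i ` W i" unfolding i_def by (rule LeastI_ex[OF ex])
      have "x \<notin> \<phi> j ` W j" if "j < i" for j
        using not_less_Least[of j "\<lambda>i. i < N \<and> x \<in> \<phi> i ` W i"] that i unfolding i_def[symmetric] by auto
      then have "x \<in> B i" using i by (auto simp: B_def)
      then show "x \<in> (\<Union>i<N. B i)" using i by auto
    qed
  qed
qed

lemma countably_additive_patch_sum:
  fixes W :: "nat \<Rightarrow> (real^'n::finite) set"
  assumes \<Sigma>: "\<Sigma> \<in> sets borel" and lp: "\<And>i. i < N \<Longrightarrow> local_parametrization \<Sigma> (W i) (\<phi> i)"
    and B: "\<And>i. i < N \<Longrightarrow> B i \<in> sets borel"
  shows "countably_additive (sets (restrict_space borel \<Sigma>))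
    (\<lambda>A. \<Sum>i<N. \<integral>\<^sup>+u\<in>W i \<inter> \<phi> i -` (A \<inter> B i). ennreal (area_density (\<phi> i) u) \<partial>lborel)"
  unfolding countably_additive_def
proof (intro allI impI)
  fix A :: "nat \<Rightarrow> 'n space set"
  assume A: "range A \<subseteq> sets (restrict_space borel \<Sigma>)" "disjoint_family A"
  have Ab: "A k \<in> sets borel" for k
    using A(1) \<Sigma> by (auto simp: sets_restrict_space_iff image_subset_iff)
  have "(\<Sum>k. \<integral>\<^sup>+u\<in>W i \<inter> \<phi> i -` (A k \<inter> B i). ennreal (area_density (\<phi> i) u) \<partial>lborel)
     = (\<integral>\<^sup>+u\<in>W i \<inter> \<phi> i -` ((\<Union>k. A k) \<inter> B i). ennreal (area_density (\<phi> i) u) \<partial>lborel)" if i: "i < N" for i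
  proof -
    obtain U \<phi>' \<phi>'' \<psi> where "patch \<Sigma> (W i) U (\<phi> i) \<phi>' \<phi>'' \<psi>" using local_parametrization_imp_patch[OF lp[OF i]] by blast
    then interpret P: patch \<Sigma> "W i" U "\<phi> i" \<phi>' \<phi>'' \<psi> .
    have m: "(\<lambda>u. ennreal (area_density (\<phi> i) u) * indicator (W i \<inter> \<phi> i -` (A k \<inter> B i)) u) \<in> borel_measurable lborel" for k
    proof -
      have X: "W i \<inter> \<phi> i -` (A k \<inter> B i) \<in> sets borel" by (rule P.phi_vimage_borel[OF sets.Int[OF Ab B[OF i]]])
      have "(\<lambda>u. ennreal (area_density (\<phi> i) u * indicator (W i \<inter> \<phi> i -` (A k \<inter> B i)) u)) \<in> borel_measurable borel"
        by (intro measurable_compose[OF _ measurable_ennreal] P.measurable_on_patch X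
            continuous_on_subset[OF P.cont_area_density P.W_U]) auto
      moreover have "(\<lambda>u. ennreal (area_density (\<phi> i) u * indicator (W i \<inter> \<phi> i -` (A k \<inter> B i)) u))
         = (\<lambda>u. ennreal (area_density (\<phi> i) u) * indicator (W i \<inter> \<phi> i -` (A k \<inter> B i)) u)"
        by (auto simp: fun_eq_iff indicator_def)
      ultimately show ?thesis by simp
    qed
    have "(\<Sum>k. \<integral>\<^sup>+u\<in>W i \<inter> \<phi> i -` (A k \<inter> B i). ennreal (area_density (\<phi> i) u) \<partial>lborel)
      = (\<integral>\<^sup>+u. (\<Sum>k. ennreal (area_density (\<phi> i) u) * indicator (W i \<inter> \<phi> i -` (A k \<inter> B i)) u) \<partial>lborel)"
      by (rule nn_integral_suminf[symmetric]) (rule m)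
    also have "\<dots> = (\<integral>\<^sup>+u\<in>W i \<inter> \<phi> i -` ((\<Union>k. A k) \<inter> B i). ennreal (area_density (\<phi> i) u) \<partial>lborel)"
    proof (rule nn_integral_cong)
      fix u
      have dj: "disjoint_family (\<lambda>k. W i \<inter> \<phi> i -` (A k \<inter> B i))"
        using A(2) unfolding disjoint_family_on_def by blast
      have "(\<Sum>k. indicator (W i \<inter> \<phi> i -` (A k \<inter> B i)) u :: ennreal) = indicator (\<Union>k. W i \<inter> \<phi> i -` (A k \<inter> B i)) u"
        by (rule suminf_indicator[OF dj])
      moreover have "(\<Union>k. W i \<inter> \<phi> i -` (A k \<inter> B i)) = W i \<inter> \<phi> i -` ((\<Union>k. A k) \<inter> B i)" by auto
      ultimately show "(\<Sum>k. ennreal (area_density (\<phi> i) u) * indicator (W i \<inter> \<phi> i -` (A k \<inter> B i)) u)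
        = ennreal (area_density (\<phi> i) u) * indicator (W i \<inter> \<phi> i -` ((\<Union>k. A k) \<inter> B i)) u"
        by simp
    qed
    finally show ?thesis .
  qed
  then show "(\<Sum>k. \<Sum>i<N. \<integral>\<^sup>+u\<in>W i \<inter> \<phi> i -` (A k \<inter> B i). ennreal (area_density (\<phi> i) u) \<partial>lborel)
     = (\<Sum>i<N. \<integral>\<^sup>+u\<in>W i \<inter> \<phi> i -` ((\<Union>k. A k) \<inter> B i). ennreal (area_density (\<phi> i) u) \<partial>lborel)"
    by (subst suminf_sum) auto
qed

text \<open>\<open>area_measure\<close> is a definite description, so existence and uniqueness have
  to be settled. The sum over a Borel partition subordinate to a finite atlas is such a measure by
  \<open>area_patch_consistent\<close>, and every other one agrees with it on each piece.\<close>

lemma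
  fixes \<Sigma> :: "('n::finite) space set"
  assumes \<Sigma>: "compact \<Sigma>" "C2_hypersurface \<Sigma>"
  shows sets_area_measure: "sets (area_measure \<Sigma>) = sets (restrict_space borel \<Sigma>)"
    and emeasure_area_measure: "local_parametrization \<Sigma> W \<phi> \<Longrightarrow> A \<in> sets borel \<Longrightarrow> A \<subseteq> \<phi> ` W \<Longrightarrow>
      emeasure (area_measure \<Sigma>) A = (\<integral>\<^sup>+u\<in>W \<inter> \<phi> -` A. ennreal (area_density \<phi> u) \<partial>lborel)"
proof -
  have \<Sigma>b: "\<Sigma> \<in> sets borel" using \<Sigma>(1) by (simp add: compact_imp_closed borel_closed)
  have setsD: "A \<in> sets (restrict_space borel \<Sigma>) \<longleftrightarrow> A \<in> sets borel \<and> A \<subseteq> \<Sigma>" for A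
    using \<Sigma>b by (auto simp: sets_restrict_space_iff)
  obtain N :: nat and Wi :: "nat \<Rightarrow> (real^'n) set" and \<phi>i where
    lp: "\<And>i. i < N \<Longrightarrow> local_parametrization \<Sigma> (Wi i) (\<phi>i i)" and cov: "\<Sigma> = (\<Union>i<N. \<phi>i i ` Wi i)"
    using finite_atlas[OF \<Sigma>] by metis
  define B where "B i = \<phi>i i ` Wi i - (\<Union>j<i. \<phi>i j ` Wi j)" for i
  have BB: "\<And>i. i < N \<Longrightarrow> B i \<in> sets borel" "\<And>i. B i \<subseteq> \<phi>i i ` Wi i" "(\<Union>i<N. B i) = \<Sigma>"
    "disjoint_family_on B {..<N}"
    by (rule emeasure_patch_sum[OF \<Sigma>b lp cov, folded B_def]; assumption)+
  let ?m = "\<lambda>A. \<Sum>i<N. \<integral>\<^sup>+u\<in>Wi i \<inter> \<phi>i i -` (A \<inter> B i). ennreal (area_density (\<phi>i i) u) \<partial>lborel"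
  define good where "good \<mu> \<longleftrightarrow> sets \<mu> = sets (restrict_space borel \<Sigma>) \<and>
        (\<forall>W \<phi>. local_parametrization \<Sigma> W \<phi> \<longrightarrow>
           (\<forall>A\<in>sets \<mu>. A \<subseteq> \<phi> ` W \<longrightarrow>
              emeasure \<mu> A = (\<integral>\<^sup>+u\<in>W \<inter> \<phi> -` A. ennreal (area_density \<phi> u) \<partial>lborel)))" for \<mu>
  have split: "emeasure \<mu> A = (\<Sum>i<N. emeasure \<mu> (A \<inter> B i))"
    if "sets \<mu> = sets (restrict_space borel \<Sigma>)" "A \<in> sets borel" "A \<subseteq> \<Sigma>" for \<mu> A
  proof -
    have "A = (\<Union>i<N. A \<inter> B i)" using BB(3) that(3) by auto
    also have "emeasure \<mu> \<dots> = (\<Sum>i<N. emeasure \<mu> (A \<inter> B i))"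
    proof (rule sum_emeasure[symmetric])
      show "(\<lambda>i. A \<inter> B i) ` {..<N} \<subseteq> sets \<mu>" using that BB(1) setsD by auto
      show "disjoint_family_on (\<lambda>i. A \<inter> B i) {..<N}" using BB(4) by (auto simp: disjoint_family_on_def)
    qed simp
    finally show ?thesis .
  qed
  have uniq: "emeasure \<mu> A = ?m A" if "good \<mu>" "A \<in> sets borel" "A \<subseteq> \<Sigma>" for \<mu> A
  proof -
    have s: "sets \<mu> = sets (restrict_space borel \<Sigma>)" using that(1) by (simp add: good_def)
    have "emeasure \<mu> (A \<inter> B i) = (\<integral>\<^sup>+u\<in>Wi i \<inter> \<phi>i i -` (A \<inter> B i). ennreal (area_density (\<phi>i i) u) \<partial>lborel)"
      if i: "i < N" for i
    proof -
      have "A \<inter> B i \<in> sets \<mu>" "A \<inter> B i \<subseteq> \<phi>i i ` Wi i"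
        using s setsD \<open>A \<in> sets borel\<close> \<open>A \<subseteq> \<Sigma>\<close> BB(1)[OF i] BB(2)[of i] by auto
      then show ?thesis using \<open>good \<mu>\<close> lp[OF i] unfolding good_def by blast
    qed
    then show ?thesis unfolding split[OF s that(2,3)] by simp
  qed
  define \<mu>0 where "\<mu>0 = measure_of \<Sigma> (sets (restrict_space borel \<Sigma>)) ?m"
  have sp: "sets (restrict_space borel \<Sigma>) = sigma_sets \<Sigma> (sets (restrict_space borel \<Sigma>))"
    using sets.sigma_sets_eq[of "restrict_space borel \<Sigma>"] by (simp add: space_restrict_space)
  have sub: "sets (restrict_space borel \<Sigma>) \<subseteq> Pow \<Sigma>" using setsD by auto
  have sets0: "sets \<mu>0 = sets (restrict_space borel \<Sigma>)"
    unfolding \<mu>0_def using sub sp by simp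
  have em0: "emeasure \<mu>0 A = ?m A" if "A \<in> sets (restrict_space borel \<Sigma>)" for A
  proof (rule emeasure_measure_of[OF \<mu>0_def sub _ _ that[folded sets0]])
    show "positive (sets \<mu>0) ?m" by (simp add: positive_def)
    show "countably_additive (sets \<mu>0) ?m"
      unfolding sets0 by (rule countably_additive_patch_sum[OF \<Sigma>b lp BB(1)])
  qed
  have good0: "good \<mu>0"
    unfolding good_def
  proof (intro conjI allI impI ballI sets0)
    fix W \<phi> A assume l: "local_parametrization \<Sigma> W \<phi>" and A: "A \<in> sets \<mu>0" "A \<subseteq> \<phi> ` W"
    have Ab: "A \<in> sets borel" "A \<subseteq> \<Sigma>" using A(1) sets0 setsD by auto
    obtain U \<phi>' \<phi>'' \<psi> where P: "patch \<Sigma> W U \<phi> \<phi>' \<phi>'' \<psi>" using local_parametrization_imp_patch[OF l] by blast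
    interpret P: patch \<Sigma> W U \<phi> \<phi>' \<phi>'' \<psi> by fact
    have "emeasure \<mu>0 A = (\<Sum>i<N. \<integral>\<^sup>+u\<in>W \<inter> \<phi> -` (A \<inter> B i). ennreal (area_density \<phi> u) \<partial>lborel)"
      unfolding em0[OF A(1)[unfolded sets0]]
    proof (rule sum.cong[OF refl])
      fix i assume "i \<in> {..<N}"
      then have i: "i < N" by simp
      obtain U1 \<phi>1' \<phi>1'' \<psi>1 where P1: "patch \<Sigma> (Wi i) U1 (\<phi>i i) \<phi>1' \<phi>1'' \<psi>1"
        using local_parametrization_imp_patch[OF lp[OF i]] by blast
      show "(\<integral>\<^sup>+u\<in>Wi i \<inter> \<phi>i i -` (A \<inter> B i). ennreal (area_density (\<phi>i i) u) \<partial>lborel)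
        = (\<integral>\<^sup>+u\<in>W \<inter> \<phi> -` (A \<inter> B i). ennreal (area_density \<phi> u) \<partial>lborel)"
        by (rule area_patch_consistent[OF P1 P]) (use Ab A(2) BB(1)[OF i] BB(2)[of i] in auto)
    qed
    also have "\<dots> = (\<integral>\<^sup>+u. (\<Sum>i<N. ennreal (area_density \<phi> u) * indicator (W \<inter> \<phi> -` (A \<inter> B i)) u) \<partial>lborel)"
    proof (rule nn_integral_sum[symmetric])
      fix i assume "i \<in> {..<N}"
      then have X: "W \<inter> \<phi> -` (A \<inter> B i) \<in> sets borel" using P.phi_vimage_borel[OF sets.Int[OF Ab(1) BB(1)]] by simp
      have "(\<lambda>u. ennreal (area_density \<phi> u * indicator (W \<inter> \<phi> -` (A \<inter> B i)) u)) \<in> borel_measurable borel"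
        by (intro measurable_compose[OF _ measurable_ennreal] P.measurable_on_patch X
            continuous_on_subset[OF P.cont_area_density P.W_U]) auto
      moreover have "(\<lambda>u. ennreal (area_density \<phi> u * indicator (W \<inter> \<phi> -` (A \<inter> B i)) u))
         = (\<lambda>u. ennreal (area_density \<phi> u) * indicator (W \<inter> \<phi> -` (A \<inter> B i)) u)"
        by (auto simp: fun_eq_iff indicator_def)
      ultimately show "(\<lambda>u. ennreal (area_density \<phi> u) * indicator (W \<inter> \<phi> -` (A \<inter> B i)) u) \<in> borel_measurable lborel"
        by simp
    qed
    also have "\<dots> = (\<integral>\<^sup>+u\<in>W \<inter> \<phi> -` A. ennreal (area_density \<phi> u) \<partial>lborel)"
    proof (rule nn_integral_cong)
      fix u
      have dj: "disjoint_family_on (\<lambda>i. W \<inter> \<phi> -` (A \<inter> B i)) {..<N}"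
        using BB(4) unfolding disjoint_family_on_def by blast
      have "(\<Sum>i<N. indicator (W \<inter> \<phi> -` (A \<inter> B i)) u :: ennreal) = indicator (\<Union>i<N. W \<inter> \<phi> -` (A \<inter> B i)) u"
        by (rule indicator_UN_disjoint[symmetric, OF _ dj]) simp
      moreover have "(\<Union>i<N. W \<inter> \<phi> -` (A \<inter> B i)) = W \<inter> \<phi> -` A" using BB(3) Ab(2) by blast
      ultimately show "(\<Sum>i<N. ennreal (area_density \<phi> u) * indicator (W \<inter> \<phi> -` (A \<inter> B i)) u)
        = ennreal (area_density \<phi> u) * indicator (W \<inter> \<phi> -` A) u"
        by (simp flip: sum_distrib_left)
    qed
    finally show "emeasure \<mu>0 A = (\<integral>\<^sup>+u\<in>W \<inter> \<phi> -` A. ennreal (area_density \<phi> u) \<partial>lborel)" .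
  qed
  have "area_measure \<Sigma> = \<mu>0"
    unfolding area_measure_def good_def[symmetric]
  proof (rule the_equality)
    show "good \<mu>0" by (rule good0)
    fix \<mu> assume g: "good \<mu>"
    show "\<mu> = \<mu>0"
    proof (rule measure_eqI)
      show "sets \<mu> = sets \<mu>0" using g sets0 by (simp add: good_def)
      fix A assume "A \<in> sets \<mu>"
      then have "A \<in> sets borel" "A \<subseteq> \<Sigma>" using g setsD by (auto simp: good_def)
      then show "emeasure \<mu> A = emeasure \<mu>0 A" using uniq g good0 by simp
    qed
  qed
  then have g: "good (area_measure \<Sigma>)" using good0 by simp
  then show s: "sets (area_measure \<Sigma>) = sets (restrict_space borel \<Sigma>)" by (simp add: good_def)
  assume l: "local_parametrization \<Sigma> W \<phi>" and A: "A \<in> sets borel" "A \<subseteq> \<phi> ` W"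
  have "A \<in> sets (area_measure \<Sigma>)"
    unfolding s setsD using A local_parametrization_image_borel(2)[OF \<Sigma>b l] by blast
  then show "emeasure (area_measure \<Sigma>) A = (\<integral>\<^sup>+u\<in>W \<inter> \<phi> -` A. ennreal (area_density \<phi> u) \<partial>lborel)"
    using g l A(2) unfolding good_def by blast
qed

lemma space_area_measure:
  assumes "compact \<Sigma>" "C2_hypersurface \<Sigma>" shows "space (area_measure \<Sigma>) = \<Sigma>"
  using sets_eq_imp_space_eq[OF sets_area_measure[OF assms]] by (simp add: space_restrict_space)

text \<open>Area restricted to \<open>A\<close> is the push-forward of the density under the
  parametrization; \<open>f\<close> is integrated against this measure in its two forms.\<close>

lemma nn_integral_area_measure_patch:
  fixes f :: "('n::finite) space \<Rightarrow> ennreal"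
  assumes \<Sigma>: "compact \<Sigma>" "C2_hypersurface \<Sigma>" and P: "patch \<Sigma> W U \<phi> \<phi>' \<phi>'' \<psi>"
    and A: "A \<in> sets borel" "A \<subseteq> \<phi> ` W" and f: "f \<in> borel_measurable (restrict_space borel \<Sigma>)"
  shows "(\<integral>\<^sup>+x\<in>A. f x \<partial>area_measure \<Sigma>)
    = (\<integral>\<^sup>+u\<in>W \<inter> \<phi> -` A. ennreal (area_density \<phi> u) * f (\<phi> u) \<partial>lborel)"
proof (cases "A = {}")
  case False
  interpret P: patch \<Sigma> W U \<phi> \<phi>' \<phi>'' \<psi> by fact
  let ?R = "restrict_space borel \<Sigma>" and ?\<mu> = "area_measure \<Sigma>" and ?S = "W \<inter> \<phi> -` A"
  have \<Sigma>b: "\<Sigma> \<in> sets borel" using \<Sigma>(1) by (simp add: compact_imp_closed borel_closed)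
  have se: "sets ?\<mu> = sets ?R" by (rule sets_area_measure[OF \<Sigma>])
  obtain x0 where x0: "x0 \<in> A" using False by blast
  have A\<Sigma>: "A \<subseteq> \<Sigma>" using A(2) P.image_subset by blast
  define g where "g u = (if u \<in> ?S then \<phi> u else x0)" for u
  have S: "?S \<in> sets borel" by (rule P.phi_vimage_borel[OF A(1)])
  have gb: "g \<in> borel_measurable borel"
    unfolding g_def
    by (rule borel_measurable_continuous_on_if[OF S continuous_on_subset[OF P.cont_phi]])
      (use P.W_U in auto)
  have g: "g \<in> borel \<rightarrow>\<^sub>M ?R"
    by (rule measurable_restrict_space2[OF _ gb]) (use A\<Sigma> x0 in \<open>auto simp: g_def\<close>)
  have dm: "(\<lambda>u. ennreal (area_density \<phi> u * indicator ?S u)) \<in> borel_measurable lborel"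
    using P.measurable_on_patch[OF continuous_on_subset[OF P.cont_area_density P.W_U] S] by simp
  let ?D = "density lborel (\<lambda>u. ennreal (area_density \<phi> u * indicator ?S u))"
  let ?M1 = "density ?\<mu> (indicator A)" and ?M2 = "distr ?D ?R g"
  have gD: "g \<in> ?D \<rightarrow>\<^sub>M ?R" using g by simp
  have AR: "A \<in> sets ?\<mu>" using A(1) A\<Sigma> \<Sigma>b se by (simp add: sets_restrict_space_iff)
  have iA: "indicator A \<in> borel_measurable ?\<mu>" using AR by simp
  have eq: "?M1 = ?M2"
  proof (rule measure_eqI)
    fix X assume "X \<in> sets ?M1"
    then have X: "X \<in> sets ?\<mu>" by simp
    then have Xb: "X \<in> sets borel" "X \<subseteq> \<Sigma>" using se \<Sigma>b by (auto simp: sets_restrict_space_iff)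
    have "emeasure ?M1 X = (\<integral>\<^sup>+x\<in>X. indicator A x \<partial>?\<mu>)" by (rule emeasure_density[OF iA X])
    also have "\<dots> = (\<integral>\<^sup>+x. indicator (A \<inter> X) x \<partial>?\<mu>)" by (intro nn_integral_cong) (simp add: indicator_inter_arith)
    also have "\<dots> = emeasure ?\<mu> (A \<inter> X)" by (rule nn_integral_indicator) (use AR X in auto)
    also have "\<dots> = (\<integral>\<^sup>+u\<in>W \<inter> \<phi> -` (A \<inter> X). ennreal (area_density \<phi> u) \<partial>lborel)"
      by (rule emeasure_area_measure[OF \<Sigma> P.local_parametrization]) (use A Xb in auto)
    also have "\<dots> = (\<integral>\<^sup>+u\<in>g -` X. ennreal (area_density \<phi> u * indicator ?S u) \<partial>lborel)"
      by (intro nn_integral_cong) (auto simp: g_def indicator_def)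
    also have "\<dots> = emeasure ?D (g -` X)"
      by (rule emeasure_density[symmetric, OF dm]) (use measurable_sets[OF gb Xb(1)] in simp)
    also have "\<dots> = emeasure ?M2 X"
      by (subst emeasure_distr[OF gD]) (use X se in simp_all)
    finally show "emeasure ?M1 X = emeasure ?M2 X" .
  qed (simp add: se)
  have f\<mu>: "f \<in> borel_measurable ?\<mu>" using f by (simp cong: measurable_cong_sets add: measurable_cong_sets[OF se refl])
  have "(\<integral>\<^sup>+x\<in>A. f x \<partial>?\<mu>) = (\<integral>\<^sup>+x. indicator A x * f x \<partial>?\<mu>)" by (simp add: mult.commute)
  also have "\<dots> = integral\<^sup>N ?M1 f" by (rule nn_integral_density[symmetric, OF iA f\<mu>])
  also have "\<dots> = integral\<^sup>N ?M2 f" by (simp only: eq)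
  also have "\<dots> = (\<integral>\<^sup>+u. f (g u) \<partial>?D)" by (rule nn_integral_distr[OF gD]) (use f in simp)
  also have "\<dots> = (\<integral>\<^sup>+u. ennreal (area_density \<phi> u * indicator ?S u) * f (g u) \<partial>lborel)"
    by (rule nn_integral_density[OF dm]) (use measurable_compose[OF g f] in simp)
  also have "\<dots> = (\<integral>\<^sup>+u\<in>?S. ennreal (area_density \<phi> u) * f (\<phi> u) \<partial>lborel)"
    by (intro nn_integral_cong) (auto simp: g_def indicator_def)
  finally show ?thesis .
qed simp

lemma emeasure_area_measure_finite:
  fixes \<Sigma> :: "('n::finite) space set"
  assumes \<Sigma>: "compact \<Sigma>" "C2_hypersurface \<Sigma>"
  shows "emeasure (area_measure \<Sigma>) \<Sigma> < \<infinity>"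
proof -
  have \<Sigma>b: "\<Sigma> \<in> sets borel" using \<Sigma>(1) by (simp add: compact_imp_closed borel_closed)
  obtain N :: nat and W :: "nat \<Rightarrow> (real^'n) set" and \<phi> :: "nat \<Rightarrow> real^'n \<Rightarrow> 'n space" where
    lp: "\<And>i. i < N \<Longrightarrow> local_parametrization \<Sigma> (W i) (\<phi> i)" and bd: "\<And>i. i < N \<Longrightarrow> bounded (W i)"
    and dK: "\<And>i. i < N \<Longrightarrow> \<exists>K. \<forall>u\<in>W i. area_density (\<phi> i) u \<le> K" and cov: "\<Sigma> = (\<Union>i<N. \<phi> i ` W i)"
    by (rule finite_atlas[OF \<Sigma>], rule that)
  have im: "\<phi> i ` W i \<in> sets borel" "\<phi> i ` W i \<subseteq> \<Sigma>" if "i < N" for i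
    using local_parametrization_image_borel[OF \<Sigma>b lp[OF that]] by auto
  have "emeasure (area_measure \<Sigma>) (\<phi> i ` W i) < \<infinity>" if i: "i < N" for i
  proof -
    obtain K where K: "\<And>u. u \<in> W i \<Longrightarrow> area_density (\<phi> i) u \<le> K" using dK[OF i] by blast
    obtain r where "\<forall>u\<in>W i. norm u \<le> r" using bd[OF i] bounded_iff by blast
    then have r: "W i \<subseteq> cball 0 r" by auto
    have "emeasure (area_measure \<Sigma>) (\<phi> i ` W i)
        = (\<integral>\<^sup>+u\<in>W i \<inter> \<phi> i -` (\<phi> i ` W i). ennreal (area_density (\<phi> i) u) \<partial>lborel)"
      by (rule emeasure_area_measure[OF \<Sigma> lp[OF i] im(1)[OF i]]) simp
    also have "\<dots> \<le> (\<integral>\<^sup>+u. ennreal K * indicator (cball 0 r :: (real^'n) set) u \<partial>lborel)"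
    proof (rule nn_integral_mono)
      fix u
      show "ennreal (area_density (\<phi> i) u) * indicator (W i \<inter> \<phi> i -` \<phi> i ` W i) u \<le> ennreal K * indicator (cball 0 r) u"
        using K[of u] r by (auto simp: indicator_def intro!: ennreal_leI)
    qed
    also have "\<dots> = ennreal K * emeasure lborel (cball 0 r :: (real^'n) set)"
      by (rule nn_integral_cmult_indicator) simp
    also have "\<dots> < \<infinity>"
      using emeasure_bounded_finite[of "cball 0 r :: (real^'n) set"] by (simp add: ennreal_mult_less_top)
    finally show ?thesis .
  qed
  then have "(\<Sum>i<N. emeasure (area_measure \<Sigma>) (\<phi> i ` W i)) < \<infinity>" by (simp add: less_top[symmetric])
  moreover have "emeasure (area_measure \<Sigma>) (\<Union>i<N. \<phi> i ` W i) \<le> (\<Sum>i<N. emeasure (area_measure \<Sigma>) (\<phi> i ` W i))"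
    by (rule emeasure_subadditive_finite)
      (use im \<Sigma>b in \<open>auto simp: sets_area_measure[OF \<Sigma>] sets_restrict_space_iff\<close>)
  ultimately have "emeasure (area_measure \<Sigma>) (\<Union>i<N. \<phi> i ` W i) < \<infinity>" by (rule order_le_less_trans[rotated])
  then show ?thesis unfolding cov[symmetric] .
qed

section \<open>Contact points\<close>

text \<open>The maximum is one-sided, because at the edge of a patch a curve may be available only
  inward. This suffices since \<open>g' 0 = 0\<close> is given: a positive \<open>c\<close> would
  make \<open>g\<close> increase to the right of 0.\<close>

lemma second_derivative_nonpos_at_max:
  fixes g g' :: "real \<Rightarrow> real"
  assumes d: "d > 0" and g: "\<And>t. \<bar>t\<bar> < d \<Longrightarrow> (g has_real_derivative g' t) (at t)"
    and g': "(g' has_real_derivative c) (at 0)" and 0: "g' 0 = 0"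
    and mx: "\<And>t. 0 \<le> t \<Longrightarrow> t < d \<Longrightarrow> g t \<le> g 0"
  shows "c \<le> 0"
proof (rule ccontr)
  assume "\<not> c \<le> 0"
  then obtain e where e: "e > 0" "\<And>h. 0 < h \<Longrightarrow> h < e \<Longrightarrow> g' 0 < g' (0 + h)"
    using DERIV_pos_inc_right[OF g'] by auto
  define t where "t = min d e / 2"
  have t: "0 < t" "t < d" "t < e" using d e by (auto simp: t_def)
  obtain z where z: "0 < z" "z < t" "g t - g 0 = (t - 0) * g' z"
    using MVT2[of 0 t g g'] g t by (metis abs_of_nonneg order_le_less_trans)
  have "g' z > 0" using e(2)[of z] z t 0 by simp
  then have "t * g' z > 0" using t by (intro mult_pos_pos)
  then have "g t > g 0" using z(3) by simp
  then show False using mx[of t] t by simp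
qed

lemma inner_E_last [simp]: "(x :: ('n::finite) space) \<bullet> E_last = snd x"
  by (simp add: E_last_def inner_prod_def)

lemma norm_E_last [simp]: "norm (E_last :: ('n::finite) space) = 1"
  by (simp add: E_last_def norm_Pair)

lemma upper_half_space_eq: "upper_half_space = {x :: ('n::finite) space. 0 < snd x}"
  by (simp add: upper_half_space_def)

lemma E_last_nonzero: "E_last \<noteq> (0 :: ('n::finite) space)"
  by (simp add: E_last_def zero_prod_def)

lemma closure_upper_half_space: "closure upper_half_space = {x :: ('n::finite) space. 0 \<le> snd x}"
  using closure_halfspace_gt[of "E_last :: 'n space" 0] E_last_nonzero
  by (simp add: upper_half_space_def inner_commute[of E_last])

lemma frontier_upper_half_space: "frontier upper_half_space = {x :: ('n::finite) space. snd x = 0}"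
  using frontier_halfspace_gt[of "E_last :: 'n space" 0] E_last_nonzero
  by (simp add: upper_half_space_def inner_commute[of E_last])

context patch
begin

text \<open>At the edge at least one of \<open>h\<close> and \<open>- h\<close> points into the
  half-space. Second-order conditions are even in \<open>h\<close>, so either sign serves.\<close>

lemma feasible_direction:
  assumes "u \<in> W" shows "\<exists>\<sigma> d. (\<sigma> = 1 \<or> \<sigma> = -1) \<and> 0 < d \<and> (\<forall>t. 0 \<le> t \<and> t < d \<longrightarrow> u + t *\<^sub>R (\<sigma> *\<^sub>R h) \<in> W)"
proof -
  obtain T where T: "open T" "W = T \<or> (\<exists>k. W = T \<inter> {u. 0 \<le> u $ k})" using shape by blast
  have uT: "u \<in> T" using T(2) assms by auto
  have *: "\<exists>d>0. \<forall>t. 0 \<le> t \<and> t < d \<longrightarrow> u + t *\<^sub>R g \<in> T" for g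
  proof -
    obtain r where r: "r > 0" "ball u r \<subseteq> T" using T(1) uT openE by blast
    have "u + t *\<^sub>R g \<in> T" if "0 \<le> t" "t < r / (norm g + 1)" for t
    proof -
      have "t * (norm g + 1) < r" using that(2) by (simp add: pos_less_divide_eq add_nonneg_pos)
      then have "t * norm g < r" using that(1) by (simp add: algebra_simps)
      then show ?thesis using r(2) that(1) by (auto simp: dist_norm subset_iff)
    qed
    then show ?thesis using r(1) by (intro exI[of _ "r / (norm g + 1)"]) (auto simp: add_nonneg_pos)
  qed
  from T(2) show ?thesis
  proof
    assume W: "W = T"
    obtain d where "d > 0" "\<forall>t. 0 \<le> t \<and> t < d \<longrightarrow> u + t *\<^sub>R h \<in> T" using *[of h] by blast
    then show ?thesis using W by (intro exI[of _ 1] exI[of _ d]) auto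
  next
    assume "\<exists>k. W = T \<inter> {u. 0 \<le> u $ k}"
    then obtain k where k: "W = T \<inter> {u. 0 \<le> u $ k}" by blast
    define \<sigma> :: real where "\<sigma> = (if h $ k \<ge> 0 then 1 else -1)"
    have "0 \<le> \<sigma> * h $ k" by (auto simp: \<sigma>_def)
    then have "0 \<le> (u + t *\<^sub>R (\<sigma> *\<^sub>R h)) $ k" if "0 \<le> t" for t
      using assms k mult_nonneg_nonneg[OF that \<open>0 \<le> \<sigma> * h $ k\<close>] by auto
    moreover have "\<sigma> = 1 \<or> \<sigma> = -1" by (auto simp: \<sigma>_def)
    moreover obtain d where "d > 0" "\<And>t. 0 \<le> t \<Longrightarrow> t < d \<Longrightarrow> u + t *\<^sub>R (\<sigma> *\<^sub>R h) \<in> T"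
      using *[of "\<sigma> *\<^sub>R h"] by blast
    ultimately show ?thesis unfolding k by (intro exI[of _ \<sigma>] exI[of _ d]) simp
  qed
qed

lemma curve_derivatives:
  assumes "u \<in> W"
  obtains d where "d > 0" "\<And>t. \<bar>t\<bar> < d \<Longrightarrow> u + t *\<^sub>R h \<in> U"
    "\<And>t. \<bar>t\<bar> < d \<Longrightarrow> ((\<lambda>t. \<phi> (u + t *\<^sub>R h)) has_vector_derivative \<phi>' (u + t *\<^sub>R h) h) (at t)"
    "((\<lambda>t. \<phi>' (u + t *\<^sub>R h) h) has_vector_derivative \<phi>'' u h h) (at 0)"
proof -
  have uU: "u \<in> U" using assms W_U by auto
  obtain r where r: "r > 0" "ball u r \<subseteq> U" using open_U uU openE by blast
  define d where "d = r / (norm h + 1)"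
  have d: "d > 0" using r by (simp add: d_def add_nonneg_pos)
  have inU: "u + t *\<^sub>R h \<in> U" if "\<bar>t\<bar> < d" for t
  proof -
    have "\<bar>t\<bar> * (norm h + 1) < r" using that by (simp add: d_def pos_less_divide_eq add_nonneg_pos)
    then have "\<bar>t\<bar> * norm h < r" by (simp add: algebra_simps)
    then show ?thesis using r(2) by (auto simp: dist_norm subset_iff)
  qed
  have lin: "((\<lambda>t. u + t *\<^sub>R h) has_derivative (\<lambda>s. s *\<^sub>R h)) (at t)" for t
    by (auto intro!: derivative_eq_intros)
  show ?thesis
  proof (rule that[OF d inU])
    fix t assume t: "\<bar>t\<bar> < d"
    show "((\<lambda>t. \<phi> (u + t *\<^sub>R h)) has_vector_derivative \<phi>' (u + t *\<^sub>R h) h) (at t)"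
      using has_derivative_compose[OF lin[of t] deriv[OF inU[OF t]]]
      by (simp add: has_vector_derivative_def blinfun.scaleR_right)
  next
    have "((\<lambda>t. \<phi>' (u + t *\<^sub>R h)) has_derivative (\<lambda>s. \<phi>'' u (s *\<^sub>R h))) (at 0)"
      using has_derivative_compose[OF lin[of 0], of \<phi>' "\<phi>'' u"] deriv2[OF uU] by simp
    from bounded_linear.has_derivative[OF blinfun.bounded_linear_left this, of h]
    show "((\<lambda>t. \<phi>' (u + t *\<^sub>R h) h) has_vector_derivative \<phi>'' u h h) (at 0)"
      by (simp add: has_vector_derivative_def blinfun.scaleR_right blinfun.scaleR_left)
  qed
qed

lemma hess_nonpos_at_max:
  assumes u: "u \<in> W" and y: "\<And>h. y \<bullet> \<phi>' u h = 0" and mx: "\<And>v. v \<in> W \<Longrightarrow> y \<bullet> \<phi> v \<le> y \<bullet> \<phi> u"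
  shows "y \<bullet> \<phi>'' u h h \<le> 0"
proof -
  obtain \<sigma> d1 where s: "\<sigma> = 1 \<or> \<sigma> = (-1::real)" "0 < d1"
    "\<And>t. 0 \<le> t \<Longrightarrow> t < d1 \<Longrightarrow> u + t *\<^sub>R (\<sigma> *\<^sub>R h) \<in> W" using feasible_direction[OF u, of h] by blast
  define k where "k = \<sigma> *\<^sub>R h"
  obtain d2 where d2: "d2 > 0" "\<And>t. \<bar>t\<bar> < d2 \<Longrightarrow> u + t *\<^sub>R k \<in> U"
    "\<And>t. \<bar>t\<bar> < d2 \<Longrightarrow> ((\<lambda>t. \<phi> (u + t *\<^sub>R k)) has_vector_derivative \<phi>' (u + t *\<^sub>R k) k) (at t)"
    "((\<lambda>t. \<phi>' (u + t *\<^sub>R k) k) has_vector_derivative \<phi>'' u k k) (at 0)"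
    using curve_derivatives[OF u] by blast
  have "y \<bullet> \<phi>'' u k k \<le> 0"
  proof (rule second_derivative_nonpos_at_max[of "min d1 d2" "\<lambda>t. y \<bullet> \<phi> (u + t *\<^sub>R k)" "\<lambda>t. y \<bullet> \<phi>' (u + t *\<^sub>R k) k"])
    show "0 < min d1 d2" using s d2 by simp
    show "((\<lambda>t. y \<bullet> \<phi> (u + t *\<^sub>R k)) has_real_derivative y \<bullet> \<phi>' (u + t *\<^sub>R k) k) (at t)" if "\<bar>t\<bar> < min d1 d2" for t
      using bounded_linear.has_vector_derivative[OF bounded_linear_inner_right d2(3)] that
      by (simp add: has_real_derivative_iff_has_vector_derivative)
    show "((\<lambda>t. y \<bullet> \<phi>' (u + t *\<^sub>R k) k) has_real_derivative y \<bullet> \<phi>'' u k k) (at 0)"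
      using bounded_linear.has_vector_derivative[OF bounded_linear_inner_right d2(4)]
      by (simp add: has_real_derivative_iff_has_vector_derivative)
    show "y \<bullet> \<phi>' (u + 0 *\<^sub>R k) k = 0" using y by simp
    show "y \<bullet> \<phi> (u + t *\<^sub>R k) \<le> y \<bullet> \<phi> (u + 0 *\<^sub>R k)" if "0 \<le> t" "t < min d1 d2" for t
      using mx[of "u + t *\<^sub>R k"] s(3)[of t] that by (simp add: k_def)
  qed
  moreover have "\<phi>'' u k k = (\<sigma> * \<sigma>) *\<^sub>R \<phi>'' u h h"
    by (simp add: k_def blinfun.scaleR_right blinfun.scaleR_left)
  ultimately show ?thesis using s(1) by auto
qed

lemma deriv_nonpos_at_max:
  assumes u: "u \<in> W" and d: "d > 0" "\<And>t. 0 < t \<Longrightarrow> t < d \<Longrightarrow> u + t *\<^sub>R h \<in> W"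
    and mx: "\<And>v. v \<in> W \<Longrightarrow> y \<bullet> \<phi> v \<le> y \<bullet> \<phi> u"
  shows "y \<bullet> \<phi>' u h \<le> 0"
proof (rule ccontr)
  assume "\<not> y \<bullet> \<phi>' u h \<le> 0"
  obtain d2 where d2: "d2 > 0"
    "\<And>t. \<bar>t\<bar> < d2 \<Longrightarrow> ((\<lambda>t. \<phi> (u + t *\<^sub>R h)) has_vector_derivative \<phi>' (u + t *\<^sub>R h) h) (at t)"
    using curve_derivatives[OF u] by metis
  have "((\<lambda>t. y \<bullet> \<phi> (u + t *\<^sub>R h)) has_real_derivative y \<bullet> \<phi>' u h) (at 0)"
    using bounded_linear.has_vector_derivative[OF bounded_linear_inner_right d2(2)[of 0]] d2(1)
    by (simp add: has_real_derivative_iff_has_vector_derivative)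
  from DERIV_pos_inc_right[OF this] \<open>\<not> y \<bullet> \<phi>' u h \<le> 0\<close>
  obtain e where e: "e > 0" "\<And>t. 0 < t \<Longrightarrow> t < e \<Longrightarrow> y \<bullet> \<phi> u < y \<bullet> \<phi> (u + t *\<^sub>R h)" by auto
  define t where "t = min d e / 2"
  have t: "0 < t" "t < d" "t < e" using d e by (auto simp: t_def)
  show False using mx[OF d(2)[OF t(1,2)]] e(2)[OF t(1,3)] by simp
qed

lemma deriv_zero_at_interior_max:
  assumes u: "u \<in> W" "open W" and mx: "\<And>v. v \<in> W \<Longrightarrow> y \<bullet> \<phi> v \<le> y \<bullet> \<phi> u"
  shows "y \<bullet> \<phi>' u h = 0"
proof -
  have "y \<bullet> \<phi>' u h \<le> 0" for h
  proof -
    obtain r where r: "r > 0" "ball u r \<subseteq> W" using u openE by blast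
    define d where "d = r / (norm h + 1)"
    have d: "d > 0" using r by (simp add: d_def add_nonneg_pos)
    have "u + t *\<^sub>R h \<in> W" if "0 < t" "t < d" for t
    proof -
      have "t * (norm h + 1) < r" using that by (simp add: d_def pos_less_divide_eq add_nonneg_pos)
      then have "t * norm h < r" using that(1) by (simp add: algebra_simps)
      then show ?thesis using r(2) that(1) by (auto simp: dist_norm subset_iff)
    qed
    then show ?thesis using deriv_nonpos_at_max[OF u(1) d _ mx] by blast
  qed
  from this[of h] this[of "- h"] show ?thesis by (simp add: blinfun.minus_right)
qed

end

context patch_normal
begin

text \<open>Short chords of the surface are tangent up to a small relative error. Both end points
  vary, since near a boundary point \<open>x\<close> the surface will be seen from points
  \<open>p\<close> other than \<open>x\<close> but measured against the normal at
  \<open>x\<close>.\<close>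

lemma strict_cone:
  assumes u: "u \<in> W" and e: "0 < e"
  shows "\<exists>\<rho>>0. \<forall>q\<in>\<Sigma> \<inter> ball (\<phi> u) \<rho>. \<forall>q'\<in>\<Sigma> \<inter> ball (\<phi> u) \<rho>. \<bar>(q - q') \<bullet> \<nu> (\<phi> u)\<bar> \<le> e * norm (q - q')"
proof -
  have uU: "u \<in> U" using u W_U by auto
  obtain c where c: "c > 0" "\<And>h. c * norm h \<le> norm (\<phi>' u h)" using deriv_lower_bound[OF u] by blast
  define \<eta> where "\<eta> = min (c / 2) (e * c / 2)"
  have \<eta>: "\<eta> > 0" "\<eta> \<le> c / 2" "2 / c * \<eta> \<le> e" using c e by (auto simp: \<eta>_def min_def field_simps)
  obtain r where r: "r > 0" "\<And>v w. v \<in> ball u r \<Longrightarrow> w \<in> ball u r \<Longrightarrow>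
      norm (\<phi> v - \<phi> w - \<phi>' u (v - w)) \<le> \<eta> * norm (v - w)"
    using strict_derivative[OF uU \<eta>(1)] by blast
  have "\<forall>\<^sub>F x in at (\<phi> u) within \<Sigma>. dist (\<psi> x) u < r" using psi_tendsto[OF u] r(1) by (rule tendstoD)
  from eventually_conj[OF this eventually_in_image[OF u]]
  obtain \<rho> where \<rho>: "\<rho> > 0" "\<And>x. x \<in> \<Sigma> \<Longrightarrow> x \<noteq> \<phi> u \<Longrightarrow> dist x (\<phi> u) < \<rho> \<Longrightarrow> dist (\<psi> x) u < r \<and> x \<in> \<phi> ` W"
    unfolding eventually_at by auto
  have pt: "\<exists>v\<in>ball u r. q = \<phi> v" if "q \<in> \<Sigma> \<inter> ball (\<phi> u) \<rho>" for q
  proof (cases "q = \<phi> u")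
    case False
    then have "dist (\<psi> q) u < r" "q \<in> \<phi> ` W" using \<rho>(2)[of q] that by (auto simp: dist_commute)
    then show ?thesis using phi_psi[of q] by (intro bexI[of _ "\<psi> q"]) (auto simp: dist_commute)
  qed (use r in auto)
  have "\<bar>(q - q') \<bullet> \<nu> (\<phi> u)\<bar> \<le> e * norm (q - q')"
    if qq: "q \<in> \<Sigma> \<inter> ball (\<phi> u) \<rho>" "q' \<in> \<Sigma> \<inter> ball (\<phi> u) \<rho>" for q q'
  proof -
    obtain v w where vw: "v \<in> ball u r" "q = \<phi> v" "w \<in> ball u r" "q' = \<phi> w"
      using pt[OF qq(1)] pt[OF qq(2)] by blast
    define D where "D = \<phi>' u (v - w)"
    have b: "norm (q - q' - D) \<le> \<eta> * norm (v - w)" using r(2)[OF vw(1,3)] vw by (simp add: D_def)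
    have "c * norm (v - w) \<le> norm D" unfolding D_def by (rule c)
    also have "\<dots> \<le> norm (q - q') + norm (q - q' - D)"
      using norm_triangle_ineq4[of "q - q'" "q - q' - D"] by simp
    also have "\<dots> \<le> norm (q - q') + c / 2 * norm (v - w)"
      using b mult_right_mono[OF \<eta>(2), of "norm (v - w)"] by simp
    finally have vb: "norm (v - w) \<le> 2 / c * norm (q - q')" using c(1) by (simp add: field_simps)
    have "(q - q') \<bullet> \<nu> (\<phi> u) = (q - q' - D) \<bullet> \<nu> (\<phi> u)"
      using deriv_nu[OF u] by (simp add: D_def inner_diff_left)
    then have "\<bar>(q - q') \<bullet> \<nu> (\<phi> u)\<bar> \<le> norm (q - q' - D)"
      using Cauchy_Schwarz_ineq2[of "q - q' - D" "\<nu> (\<phi> u)"] nu_norm[OF phi_in[OF u]] by simp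
    also have "\<dots> \<le> \<eta> * (2 / c * norm (q - q'))"
      using b vb \<eta>(1) by (meson mult_left_mono order_trans less_imp_le)
    also have "\<dots> = (2 / c * \<eta>) * norm (q - q')" by simp
    also have "\<dots> \<le> e * norm (q - q')" using \<eta>(3) by (intro mult_right_mono) auto
    finally show ?thesis .
  qed
  then show ?thesis using \<rho>(1) by blast
qed

lemma orth_tangent_imp_multiple:
  assumes u: "u \<in> W" and y: "\<And>h. y \<bullet> \<phi>' u h = 0" shows "y = (y \<bullet> \<nu> (\<phi> u)) *\<^sub>R \<nu> (\<phi> u)"
proof -
  define z where "z = y - (y \<bullet> \<nu> (\<phi> u)) *\<^sub>R \<nu> (\<phi> u)"
  have "\<nu> (\<phi> u) \<bullet> z = 0" using nu_nu[OF u] by (simp add: z_def inner_diff_right inner_commute)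
  then obtain h where h: "z = \<phi>' u h" using tangentE[OF u] by blast
  have "y \<bullet> z = 0" unfolding h by (rule y)
  moreover have "z \<bullet> z = y \<bullet> z - (y \<bullet> \<nu> (\<phi> u)) * (\<nu> (\<phi> u) \<bullet> z)"
    by (subst (1) z_def) (simp add: inner_diff_left)
  ultimately have "z = 0" using \<open>\<nu> (\<phi> u) \<bullet> z = 0\<close> by simp
  then show ?thesis by (simp add: z_def)
qed

end

section \<open>The surface at the hyperplane and the supporting points of the enclosed
  domain\<close>

locale enclosing_surface =
  fixes \<Sigma> \<Omega> :: "('n::finite) space set" and \<nu> :: "'n space \<Rightarrow> 'n space"
  assumes in_half: "\<Sigma> \<subseteq> closure upper_half_space"
    and compact_surface: "compact \<Sigma>" and C2_surface: "C2_hypersurface \<Sigma>"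
    and bdry: "hypersurface_boundary \<Sigma> \<subseteq> frontier upper_half_space"
    and transversal: "transversal_to_hyperplane \<Sigma>"
    and encl: "enclosed_domain \<Sigma> \<Omega>"
    and normal: "outward_unit_normal \<Sigma> \<Omega> \<nu>"
begin

lemma snd_nonneg: "x \<in> \<Sigma> \<Longrightarrow> 0 \<le> snd x" using in_half by (auto simp: closure_upper_half_space)

lemma nu_facts: "continuous_on \<Sigma> \<nu>" "x \<in> \<Sigma> \<Longrightarrow> norm (\<nu> x) = 1"
  "x \<in> \<Sigma> \<Longrightarrow> v \<in> tangent_space \<Sigma> x \<Longrightarrow> \<nu> x \<bullet> v = 0"
  "x \<in> \<Sigma> \<Longrightarrow> 0 < snd x \<Longrightarrow> \<forall>\<^sub>F t in at_right 0. x - t *\<^sub>R \<nu> x \<in> \<Omega> \<and> x + t *\<^sub>R \<nu> x \<notin> \<Omega>"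
  using normal by (auto simp: outward_unit_normal_def upper_half_space_eq)

lemma omega_facts: "open \<Omega>" "connected \<Omega>" "\<Omega> \<noteq> {}" "bounded \<Omega>" "\<And>x. x \<in> \<Omega> \<Longrightarrow> 0 < snd x"
  "\<Sigma> \<subseteq> frontier \<Omega>" "\<And>x. x \<in> frontier \<Omega> \<Longrightarrow> x \<in> \<Sigma> \<or> snd x = 0"
proof -
  have e: "open \<Omega>" "connected \<Omega>" "\<Omega> \<noteq> {}" "bounded \<Omega>" "\<Omega> \<subseteq> upper_half_space" "\<Sigma> \<subseteq> frontier \<Omega>"
    "frontier \<Omega> \<subseteq> \<Sigma> \<union> {x. snd x = 0}"
    using encl by (auto simp only: enclosed_domain_def frontier_upper_half_space)
  show "open \<Omega>" "connected \<Omega>" "\<Omega> \<noteq> {}" "bounded \<Omega>" "\<Sigma> \<subseteq> frontier \<Omega>" by (fact e)+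
  show "0 < snd x" if "x \<in> \<Omega>" for x using e(5) that unfolding upper_half_space_eq by blast
  show "x \<in> \<Sigma> \<or> snd x = 0" if "x \<in> frontier \<Omega>" for x using e(7) that by blast
qed

lemma patch_normalI:
  assumes "patch \<Sigma> W U \<phi> \<phi>' \<phi>'' \<psi>" shows "patch_normal \<Sigma> W U \<phi> \<phi>' \<phi>'' \<psi> \<nu>"
  using assms nu_facts by (auto simp: patch_normal_def patch_normal_axioms_def)

lemma chart:
  assumes "x \<in> \<Sigma>"
  obtains W U \<phi> \<phi>' \<phi>'' \<psi> u where "patch_normal \<Sigma> W U \<phi> \<phi>' \<phi>'' \<psi> \<nu>" "u \<in> W" "\<phi> u = x"
proof -
  obtain W \<phi> where l: "local_parametrization \<Sigma> W \<phi>" "x \<in> \<phi> ` W"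
    using C2_surface assms unfolding C2_hypersurface_def by blast
  obtain U \<phi>' \<phi>'' \<psi> where "patch \<Sigma> W U \<phi> \<phi>' \<phi>'' \<psi>" using local_parametrization_imp_patch[OF l(1)] by blast
  moreover obtain u where "u \<in> W" "\<phi> u = x" using l(2) by blast
  ultimately show ?thesis using that[OF patch_normalI] by blast
qed

lemma interior_chart:
  assumes "x \<in> \<Sigma>" "x \<notin> hypersurface_boundary \<Sigma>"
  obtains W U \<phi> \<phi>' \<phi>'' \<psi> u where "patch_normal \<Sigma> W U \<phi> \<phi>' \<phi>'' \<psi> \<nu>" "open W" "u \<in> W" "\<phi> u = x"
proof -
  obtain W \<phi> where l: "local_parametrization \<Sigma> W \<phi>" "open W" "x \<in> \<phi> ` W"
    using assms unfolding hypersurface_boundary_def by blast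
  obtain U \<phi>' \<phi>'' \<psi> where "patch \<Sigma> W U \<phi> \<phi>' \<phi>'' \<psi>" using local_parametrization_imp_patch[OF l(1)] by blast
  moreover obtain u where "u \<in> W" "\<phi> u = x" using l(3) by blast
  ultimately show ?thesis using that[OF patch_normalI] l(2) by blast
qed

lemma not_boundary: "0 < snd x \<Longrightarrow> x \<notin> hypersurface_boundary \<Sigma>"
  using bdry by (auto simp: frontier_upper_half_space)

lemma transversal_tangent:
  assumes "x \<in> \<Sigma>" "snd x = 0" obtains v where "v \<in> tangent_space \<Sigma> x" "snd v \<noteq> 0"
proof -
  have "E_last \<in> {v + w | v w. v \<in> tangent_space \<Sigma> x \<and> w \<bullet> E_last = 0}"
    using transversal assms by (auto simp: transversal_to_hyperplane_def frontier_upper_half_space)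
  then obtain v w where vw: "E_last = v + w" "v \<in> tangent_space \<Sigma> x" "snd w = 0" by auto
  have "snd (E_last :: 'n space) = snd v + snd w" by (subst vw(1)) simp
  then have "snd v = 1" using vw(3) by (simp add: E_last_def)
  then show ?thesis using that vw(2) by auto
qed

text \<open>At an interior parameter over the hyperplane the height is minimal, so the tangent space
  would be horizontal, against transversality.\<close>

lemma boundary_iff: assumes "x \<in> \<Sigma>" shows "x \<in> hypersurface_boundary \<Sigma> \<longleftrightarrow> snd x = 0"
proof
  show "x \<in> hypersurface_boundary \<Sigma> \<Longrightarrow> snd x = 0" using bdry by (auto simp: frontier_upper_half_space)
  assume x0: "snd x = 0"
  show "x \<in> hypersurface_boundary \<Sigma>"
  proof (rule ccontr)
    assume "x \<notin> hypersurface_boundary \<Sigma>"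
    then obtain W U \<phi> \<phi>' \<phi>'' \<psi> u where P: "patch_normal \<Sigma> W U \<phi> \<phi>' \<phi>'' \<psi> \<nu>" and W: "open W" "u \<in> W" "\<phi> u = x"
      using interior_chart[OF assms] by metis
    interpret P: patch_normal \<Sigma> W U \<phi> \<phi>' \<phi>'' \<psi> \<nu> by fact
    have "(- E_last) \<bullet> \<phi>' u h = 0" for h
      by (rule P.deriv_zero_at_interior_max[OF W(2,1)])
        (use W(3) x0 snd_nonneg[OF P.phi_in] in \<open>auto simp: inner_commute[of E_last]\<close>)
    then have "snd (\<phi>' u h) = 0" for h by (simp add: inner_commute[of E_last])
    moreover obtain v where "v \<in> tangent_space \<Sigma> x" "snd v \<noteq> 0" using transversal_tangent[OF assms x0] .
    moreover have "tangent_space \<Sigma> x = range (blinfun_apply (\<phi>' u))" using P.tangent_space_eq[OF W(2)] W(3) by simp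
    ultimately show False by auto
  qed
qed

text \<open>A normal form at the boundary. The parameter lies on the edge of a half-space patch,
  since otherwise \<open>x\<close> would be an interior point of the surface. The height is minimal
  there, so its derivatives vanish along the edge, and transversality makes the derivative across
  the edge positive.\<close>

lemma boundary_chart:
  assumes x: "x \<in> \<Sigma>" "snd x = 0"
  obtains W U \<phi> \<phi>' \<phi>'' \<psi> u k r where "patch_normal \<Sigma> W U \<phi> \<phi>' \<phi>'' \<psi> \<nu>" "u \<in> W" "\<phi> u = x"
    "0 < r" "\<And>v. v \<in> ball u r \<Longrightarrow> v \<in> W \<longleftrightarrow> 0 \<le> v $ k" "u $ k = 0"
    "\<And>i. i \<noteq> k \<Longrightarrow> snd (\<phi>' u (axis i 1)) = 0" "0 < snd (\<phi>' u (axis k 1))"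
proof -
  obtain W U \<phi> \<phi>' \<phi>'' \<psi> u where P: "patch_normal \<Sigma> W U \<phi> \<phi>' \<phi>'' \<psi> \<nu>" and u: "u \<in> W" "\<phi> u = x"
    using chart[OF x(1)] by metis
  interpret P: patch_normal \<Sigma> W U \<phi> \<phi>' \<phi>'' \<psi> \<nu> by fact
  have noopen: "\<not> (\<exists>T. open T \<and> open (W \<inter> T) \<and> u \<in> T)"
  proof
    assume "\<exists>T. open T \<and> open (W \<inter> T) \<and> u \<in> T"
    then obtain T where T: "open T" "open (W \<inter> T)" "u \<in> T" by blast
    have "local_parametrization \<Sigma> (W \<inter> T) \<phi>"
      by (rule patch.local_parametrization[OF patch_restrict[OF P.patch_axioms T(1)]])
    then have "x \<notin> hypersurface_boundary \<Sigma>"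
      using T u unfolding hypersurface_boundary_def by blast
    then show False using boundary_iff x by blast
  qed
  obtain T where T: "open T" "W = T \<or> (\<exists>k. W = T \<inter> {u. 0 \<le> u $ k})" using P.shape by blast
  have "W \<noteq> T" using noopen T(1) u(1) by (metis Int_absorb)
  then obtain k where k: "W = T \<inter> {u. 0 \<le> u $ k}" using T(2) by blast
  have uk: "u $ k = 0"
  proof (rule ccontr)
    assume "u $ k \<noteq> 0"
    then have "u $ k > 0" using u(1) k by auto
    moreover have op: "open {v :: real^'n. 0 < v $ k}" by (intro open_Collect_less continuous_intros)
    moreover have "W \<inter> {v. 0 < v $ k} = T \<inter> {v. 0 < v $ k}" using k by auto
    moreover have "open (T \<inter> {v. 0 < v $ k})" using T(1) op by (rule open_Int)
    ultimately show False using noopen by (metis mem_Collect_eq)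
  qed
  have "u \<in> T" using u k by auto
  then obtain r where r: "r > 0" "ball u r \<subseteq> T" using T(1) openE by blast
  have Wiff: "v \<in> W \<longleftrightarrow> 0 \<le> v $ k" if "v \<in> ball u r" for v using that r k by auto
  have step: "u + t *\<^sub>R h \<in> W" if "0 < t" "t < r" "norm h = 1" "0 \<le> h $ k" for t h
    using Wiff[of "u + t *\<^sub>R h"] that uk by (auto simp: dist_norm)
  have mx: "(- E_last) \<bullet> \<phi> v \<le> (- E_last) \<bullet> \<phi> u" if "v \<in> W" for v
    using snd_nonneg[OF P.phi_in[OF that]] u x by (simp add: inner_commute[of E_last])
  have dn: "0 \<le> snd (\<phi>' u h)" if "norm h = 1" "0 \<le> h $ k" for h
    using P.deriv_nonpos_at_max[OF u(1) r(1) step[OF _ _ that] mx] by (simp add: inner_commute[of E_last])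
  have z: "snd (\<phi>' u (axis i 1)) = 0" if "i \<noteq> k" for i
  proof -
    have "norm (axis i (1::real)) = 1" "axis i (1::real) $ k = 0" using that by (simp_all add: axis_def norm_axis_1[unfolded axis_def])
    then show ?thesis using dn[of "axis i 1"] dn[of "- axis i 1"] by (simp add: blinfun.minus_right)
  qed
  have "snd (\<phi>' u (axis k 1)) \<noteq> 0"
  proof
    assume z': "snd (\<phi>' u (axis k 1)) = 0"
    have "snd (\<phi>' u h) = 0" for h
    proof -
      have "snd (\<phi>' u h) = (\<Sum>b\<in>Basis. (h \<bullet> b) * snd (\<phi>' u b))"
        by (subst P.deriv_expand) (simp add: snd_sum)
      also have "\<dots> = 0" proof (rule sum.neutral, rule ballI)
        fix b :: "real^'n" assume "b \<in> Basis"
        then obtain i where "b = axis i 1" by (auto simp: Basis_vec_def)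
        then show "(h \<bullet> b) * snd (\<phi>' u b) = 0" using z z' by (cases "i = k") auto
      qed
      finally show ?thesis .
    qed
    moreover obtain v where "v \<in> tangent_space \<Sigma> x" "snd v \<noteq> 0" using transversal_tangent[OF x] .
    moreover have "tangent_space \<Sigma> x = range (blinfun_apply (\<phi>' u))" using P.tangent_space_eq[OF u(1)] u(2) by simp
    ultimately show False by auto
  qed
  then have "0 < snd (\<phi>' u (axis k 1))" using dn[of "axis k 1"] norm_axis_1[of k] by simp
  then show ?thesis using that[OF P u r(1) Wiff uk z] by blast
qed

end

lemma E_last_inner [simp]: "E_last \<bullet> (x :: ('n::finite) space) = snd x"
  by (simp add: inner_commute[of E_last])

lemma snd_E_last [simp]: "snd E_last = 1"
  by (simp add: E_last_def)

context enclosing_surface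
begin

lemma nu_nu: "x \<in> \<Sigma> \<Longrightarrow> \<nu> x \<bullet> \<nu> x = 1" using nu_facts(2) by (simp add: dot_square_norm)

lemma connected_in_omega:
  assumes "connected C" "C \<inter> \<Omega> \<noteq> {}" "C \<inter> frontier \<Omega> = {}" shows "C \<subseteq> \<Omega>"
  using connected_Int_frontier[OF assms(1,2)] assms(3) by blast

lemma frontier_upper: "x \<in> frontier \<Omega> \<Longrightarrow> 0 < snd x \<Longrightarrow> x \<in> \<Sigma>"
  using omega_facts(7) by fastforce

text \<open>Moving from the edge into the patch raises the height to first order. Since the normal
  is known to be outward only above the hyperplane, facts at the boundary are drawn from such nearby
  points.\<close>

lemma boundary_limit:
  assumes x: "x \<in> \<Sigma>" "snd x = 0" and e: "0 < e"
  shows "\<exists>p\<in>\<Sigma>. 0 < snd p \<and> dist p x < e"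
proof -
  obtain W U \<phi> \<phi>' \<phi>'' \<psi> u k r where P: "patch_normal \<Sigma> W U \<phi> \<phi>' \<phi>'' \<psi> \<nu>" and u: "u \<in> W" "\<phi> u = x"
    and r: "0 < r" "\<And>v. v \<in> ball u r \<Longrightarrow> v \<in> W \<longleftrightarrow> 0 \<le> v $ k" "u $ k = 0"
    and pos: "0 < snd (\<phi>' u (axis k 1))"
    by (rule boundary_chart[OF x]) (rule that)
  interpret P: patch_normal \<Sigma> W U \<phi> \<phi>' \<phi>'' \<psi> \<nu> by fact
  obtain d where d: "d > 0"
    "\<And>t. \<bar>t\<bar> < d \<Longrightarrow> ((\<lambda>t. \<phi> (u + t *\<^sub>R axis k 1)) has_vector_derivative \<phi>' (u + t *\<^sub>R axis k 1) (axis k 1)) (at t)"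
    using P.curve_derivatives[OF u(1), of "axis k 1"] by metis
  have v0: "((\<lambda>t. \<phi> (u + t *\<^sub>R axis k 1)) has_vector_derivative \<phi>' u (axis k 1)) (at 0)" using d(2)[of 0] d(1) by simp
  have "((\<lambda>t. snd (\<phi> (u + t *\<^sub>R axis k 1))) has_real_derivative snd (\<phi>' u (axis k 1))) (at 0)"
    using bounded_linear.has_vector_derivative[OF bounded_linear_snd v0]
    by (simp add: has_real_derivative_iff_has_vector_derivative)
  from DERIV_pos_inc_right[OF this pos] obtain e1 where e1: "e1 > 0"
    "\<And>t. 0 < t \<Longrightarrow> t < e1 \<Longrightarrow> snd (\<phi> u) < snd (\<phi> (u + t *\<^sub>R axis k 1))" by auto
  have "isCont (\<lambda>t. \<phi> (u + t *\<^sub>R axis k 1)) 0"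
    using has_derivative_continuous[OF v0[unfolded has_vector_derivative_def]] .
  then obtain e2 where e2: "e2 > 0" "\<And>t. dist t 0 < e2 \<Longrightarrow> dist (\<phi> (u + t *\<^sub>R axis k 1)) (\<phi> u) < e"
    using e unfolding continuous_at_eps_delta by auto
  define t where "t = min r (min e1 e2) / 2"
  have t: "0 < t" "t < r" "t < e1" "t < e2" using r e1 e2 by (auto simp: t_def)
  have "u + t *\<^sub>R axis k 1 \<in> W"
    using r(2)[of "u + t *\<^sub>R axis k 1"] r(3) t by (simp add: dist_norm norm_axis_1)
  then show ?thesis
    using e1(2)[OF t(1,3)] e2(2)[of t] t u x P.phi_in by (intro bexI[of _ "\<phi> (u + t *\<^sub>R axis k 1)"]) auto
qed

lemma nu_not_vertical:
  assumes x: "x \<in> \<Sigma>" "snd x = 0" shows "(snd (\<nu> x))^2 < 1"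
proof -
  have le: "\<bar>snd (\<nu> x)\<bar> \<le> 1" using Cauchy_Schwarz_ineq2[of "\<nu> x" E_last] nu_facts(2)[OF x(1)] by simp
  have "(snd (\<nu> x))^2 \<noteq> 1"
  proof
    assume s: "(snd (\<nu> x))^2 = 1"
    define z where "z = \<nu> x - snd (\<nu> x) *\<^sub>R E_last"
    have "z \<bullet> z = 1 - (snd (\<nu> x))^2"
      using nu_nu[OF x(1)] by (simp add: z_def inner_diff_left inner_diff_right power2_eq_square)
    then have "z = 0" using s by simp
    then have nE: "\<nu> x = snd (\<nu> x) *\<^sub>R E_last" by (simp add: z_def)
    obtain v where v: "v \<in> tangent_space \<Sigma> x" "snd v \<noteq> 0" using transversal_tangent[OF x] .
    have "\<nu> x \<bullet> v = snd (\<nu> x) * snd v" using arg_cong[OF nE, of "\<lambda>z. z \<bullet> v"] by simp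
    then show False using nu_facts(3)[OF x(1) v(1)] v(2) s by simp
  qed
  moreover have "(snd (\<nu> x))^2 \<le> 1" using le by (simp add: abs_square_le_1)
  ultimately show ?thesis by simp
qed

text \<open>
  Near a boundary point \<open>x\<close> the surface lies in a thin two-sided cone around its tangent hyperplane. A surface point
  \<open>p\<close> close to \<open>x\<close> in the open half-space has points \<open>p - s \<nu>(p)\<close> of \<open>\<Omega>\<close> nearby, and moving from
  there to \<open>p + s d\<close> does not meet the surface again.
\<close>

lemma boundary_inward:
  assumes x: "x \<in> \<Sigma>" "snd x = 0" and d: "snd d = 0" "d \<bullet> \<nu> x < 0"
  shows "\<exists>s>0. x + s *\<^sub>R d \<in> closure \<Omega>"
proof -
  obtain W U \<phi> \<phi>' \<phi>'' \<psi> u where P: "patch_normal \<Sigma> W U \<phi> \<phi>' \<phi>'' \<psi> \<nu>" and u: "u \<in> W" "\<phi> u = x"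
    using chart[OF x(1)] by metis
  interpret P: patch_normal \<Sigma> W U \<phi> \<phi>' \<phi>'' \<psi> \<nu> by fact
  \<comment> \<open>A common bound for the slopes, against the normal at \<open>x\<close>, of the
    two directions used below: \<open>d\<close> itself, and \<open>- \<nu> p\<close>, for which
    \<open>\<nu> p \<bullet> \<nu> x\<close> is at least 1/2.\<close>
  define m where "m = min (1/2) (- (d \<bullet> \<nu> x))"
  have m: "m > 0" "m \<le> 1/2" "m \<le> - (d \<bullet> \<nu> x)" using d by (auto simp: m_def)
  define K where "K = 1 + norm d"
  have K: "K \<ge> 1" by (simp add: K_def)
  \<comment> \<open>Makes the cone so thin that no direction of length at most \<open>K\<close> and
    slope at least \<open>m\<close> lies in it.\<close>
  define e where "e = m / (2 * K)"
  have e: "e > 0" "e * K < m" using m K by (auto simp: e_def)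
  obtain \<rho> where "\<rho> > 0" and \<rho>0: "\<forall>q\<in>\<Sigma> \<inter> ball x \<rho>. \<forall>q'\<in>\<Sigma> \<inter> ball x \<rho>. \<bar>(q - q') \<bullet> \<nu> x\<bar> \<le> e * norm (q - q')"
    using P.strict_cone[OF u(1) e(1)] unfolding u(2) by blast
  have \<rho>: "\<rho> > 0" "\<And>q q'. q \<in> \<Sigma> \<Longrightarrow> q' \<in> \<Sigma> \<Longrightarrow> dist q x < \<rho> \<Longrightarrow> dist q' x < \<rho> \<Longrightarrow>
      \<bar>(q - q') \<bullet> \<nu> x\<bar> \<le> e * norm (q - q')"
    using \<open>\<rho> > 0\<close> \<rho>0 by (auto simp only: mem_ball dist_commute Int_iff)
  have "\<forall>x\<in>\<Sigma>. \<forall>e>0. \<exists>d>0. \<forall>x'\<in>\<Sigma>. dist x' x < d \<longrightarrow> dist (\<nu> x') (\<nu> x) < e"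
    using nu_facts(1) unfolding continuous_on_iff .
  from this[rule_format, OF x(1), of "1/2"]
  obtain \<rho>' where \<rho>': "\<rho>' > 0" "\<And>p. p \<in> \<Sigma> \<Longrightarrow> dist p x < \<rho>' \<Longrightarrow> dist (\<nu> p) (\<nu> x) < 1/2"
    by auto
  define s0 where "s0 = \<rho> / (2 * K)"
  have s0: "s0 > 0" "s0 * K \<le> \<rho> / 2" using \<rho> K by (auto simp: s0_def)
  have key: "p + s0 *\<^sub>R d \<in> \<Omega>" if p: "p \<in> \<Sigma>" "0 < snd p" "dist p x < min (\<rho> / 2) \<rho>'" for p
  proof -
    have nupx: "1/2 \<le> \<nu> p \<bullet> \<nu> x"
    proof -
      have "norm (\<nu> p - \<nu> x) < 1/2" using \<rho>'(2)[of p] p by (simp add: dist_norm)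
      then have "\<bar>(\<nu> p - \<nu> x) \<bullet> \<nu> x\<bar> < 1/2"
        using Cauchy_Schwarz_ineq2[of "\<nu> p - \<nu> x" "\<nu> x"] nu_facts(2)[OF x(1)] by simp
      then have "\<bar>\<nu> p \<bullet> \<nu> x - 1\<bar> < 1/2" by (simp only: inner_diff_left nu_nu[OF x(1)])
      then show ?thesis by linarith
    qed
    have notin: "p + s *\<^sub>R g \<notin> \<Sigma>" if g: "g \<bullet> \<nu> x \<le> - m" "norm g \<le> K" and s: "0 < s" "s \<le> s0" for s g
    proof
      assume q: "p + s *\<^sub>R g \<in> \<Sigma>"
      have "norm (s *\<^sub>R g) \<le> s0 * K" using g s K by (simp add: mult_mono)
      then have "norm (s *\<^sub>R g) \<le> \<rho> / 2" using s0 by simp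
      then have "dist (p + s *\<^sub>R g) x < \<rho>"
        using p(3) norm_triangle_ineq[of "p - x" "s *\<^sub>R g"] by (simp add: dist_norm algebra_simps)
      moreover have "dist p x < \<rho>" using p(3) \<rho>(1) by simp
      ultimately have "\<bar>(p + s *\<^sub>R g - p) \<bullet> \<nu> x\<bar> \<le> e * norm (p + s *\<^sub>R g - p)" using \<rho>(2)[OF q p(1)] by simp
      then have "s * \<bar>g \<bullet> \<nu> x\<bar> \<le> s * (e * norm g)" using s by (simp add: abs_mult)
      then have "\<bar>g \<bullet> \<nu> x\<bar> \<le> e * norm g" using s by simp
      also have "\<dots> \<le> e * K" using e g by (intro mult_left_mono) auto
      finally show False using e(2) g(1) by linarith
    qed
    have "\<forall>\<^sub>F t in at_right 0. p - t *\<^sub>R \<nu> p \<in> \<Omega> \<and> p + t *\<^sub>R \<nu> p \<notin> \<Omega>" by (rule nu_facts(4)[OF p(1,2)])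
    then obtain b where b: "b > 0" "\<And>t. 0 < t \<Longrightarrow> t < b \<Longrightarrow> p - t *\<^sub>R \<nu> p \<in> \<Omega>"
      unfolding eventually_at_right_field by auto
    \<comment> \<open>\<open>s1 < snd p\<close> keeps the first segment above the hyperplane, where
      frontier points of \<open>\<Omega>\<close> belong to the surface.\<close>
    define s1 where "s1 = min b (min s0 (snd p)) / 2"
    have s1: "0 < s1" "s1 < b" "s1 < s0" "s1 < snd p" using b s0 p by (auto simp: s1_def)
    let ?C1 = "closed_segment (p - s1 *\<^sub>R \<nu> p) (p + s1 *\<^sub>R d)"
    have "?C1 \<subseteq> \<Omega>"
    proof (rule connected_in_omega)
      show "?C1 \<inter> \<Omega> \<noteq> {}" using b(2)[OF s1(1,2)] by (metis IntI ends_in_segment(1) empty_iff)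
      show "?C1 \<inter> frontier \<Omega> = {}"
      proof (rule ccontr)
        assume "?C1 \<inter> frontier \<Omega> \<noteq> {}"
        then obtain z where z: "z \<in> ?C1" "z \<in> frontier \<Omega>" by blast
        then obtain l where l: "0 \<le> l" "l \<le> 1" "z = (1 - l) *\<^sub>R (p - s1 *\<^sub>R \<nu> p) + l *\<^sub>R (p + s1 *\<^sub>R d)"
          by (auto simp: in_segment)
        define g where "g = - (1 - l) *\<^sub>R \<nu> p + l *\<^sub>R d"
        have zg: "z = p + s1 *\<^sub>R g" by (simp add: l(3) g_def algebra_simps)
        have "snd g = - (1 - l) * snd (\<nu> p)" using d(1) by (simp add: g_def)
        moreover have "\<bar>snd (\<nu> p)\<bar> \<le> 1" using Cauchy_Schwarz_ineq2[of "\<nu> p" E_last] nu_facts(2)[OF p(1)] by simp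
        ultimately have "\<bar>snd g\<bar> \<le> 1" using l by (simp add: abs_mult mult_le_one)
        then have "\<bar>s1 * snd g\<bar> \<le> s1" using s1 by (simp add: abs_mult mult_left_le)
        then have "snd z > 0" using s1 by (simp add: zg)
        then have zS: "z \<in> \<Sigma>" using frontier_upper z by blast
        have "g \<bullet> \<nu> x = - ((1 - l) * (\<nu> p \<bullet> \<nu> x)) + l * (d \<bullet> \<nu> x)" by (simp add: g_def inner_add_left algebra_simps)
        also have "\<dots> \<le> - ((1 - l) * m) + l * (- m)"
          using l nupx m by (intro add_mono le_imp_neg_le mult_left_mono) auto
        also have "\<dots> = - m" by (simp add: algebra_simps)
        finally have g1: "g \<bullet> \<nu> x \<le> - m" .
        have "norm g \<le> norm (- (1 - l) *\<^sub>R \<nu> p) + norm (l *\<^sub>R d)" unfolding g_def by (rule norm_triangle_ineq)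
        also have "\<dots> \<le> 1 + norm d"
          using l nu_facts(2)[OF p(1)] by (intro add_mono) (auto simp: mult_left_le_one_le)
        finally have g2: "norm g \<le> K" by (simp add: K_def)
        show False using notin[OF g1 g2 s1(1)] s1(3) zS zg by simp
      qed
    qed simp
    then have a1: "p + s1 *\<^sub>R d \<in> \<Omega>" using ends_in_segment(2) by blast
    let ?C2 = "closed_segment (p + s1 *\<^sub>R d) (p + s0 *\<^sub>R d)"
    have "?C2 \<subseteq> \<Omega>"
    proof (rule connected_in_omega)
      show "?C2 \<inter> \<Omega> \<noteq> {}" using a1 by (metis IntI ends_in_segment(1) empty_iff)
      show "?C2 \<inter> frontier \<Omega> = {}"
      proof (rule ccontr)
        assume "?C2 \<inter> frontier \<Omega> \<noteq> {}"
        then obtain z where z: "z \<in> ?C2" "z \<in> frontier \<Omega>" by blast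
        then obtain l where l: "0 \<le> l" "l \<le> 1" "z = (1 - l) *\<^sub>R (p + s1 *\<^sub>R d) + l *\<^sub>R (p + s0 *\<^sub>R d)"
          by (auto simp: in_segment)
        define s where "s = (1 - l) * s1 + l * s0"
        have zs: "z = p + s *\<^sub>R d" by (simp add: l(3) s_def algebra_simps)
        have "(1 - l) * s1 + l * s1 \<le> s" unfolding s_def using l s1 by (intro add_mono mult_left_mono) auto
        then have "s1 \<le> s" by (simp add: algebra_simps)
        moreover have "s \<le> (1 - l) * s0 + l * s0" unfolding s_def using l s1 by (intro add_mono mult_left_mono) auto
        then have "s \<le> s0" by (simp add: algebra_simps)
        moreover have "snd z > 0" using d(1) p(2) by (simp add: zs)
        then have "z \<in> \<Sigma>" using frontier_upper z by blast
        ultimately show False using notin[of d s] m(3) s1(1) zs by (simp add: K_def)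
      qed
    qed simp
    then show ?thesis using ends_in_segment(2) by blast
  qed
  have "x + s0 *\<^sub>R d \<in> closure \<Omega>"
    unfolding closure_approachable
  proof (intro allI impI)
    fix \<epsilon> :: real assume "\<epsilon> > 0"
    then have "0 < min \<epsilon> (min (\<rho> / 2) \<rho>')" using \<rho> \<rho>' by simp
    from boundary_limit[OF x this] obtain p where p: "p \<in> \<Sigma>" "0 < snd p" "dist p x < min \<epsilon> (min (\<rho> / 2) \<rho>')" by blast
    then have "p + s0 *\<^sub>R d \<in> \<Omega>" using key by simp
    moreover have "dist (p + s0 *\<^sub>R d) (x + s0 *\<^sub>R d) < \<epsilon>" using p(3) by (simp add: dist_norm)
    ultimately show "\<exists>y\<in>\<Omega>. dist y (x + s0 *\<^sub>R d) < \<epsilon>" by blast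
  qed
  then show ?thesis using s0(1) by blast
qed

text \<open>A maximizer over the closure of \<open>\<Omega>\<close> lies on the frontier. Off the
  surface it would lie on the hyperplane with an upper half ball inside \<open>\<Omega>\<close>, so
  \<open>y\<close> would be nonpositive on all upward directions; the only such unit vector is
  \<open>- E_last\<close>.\<close>

lemma sup_attained_on_surface:
  assumes y: "norm y = 1" "y \<noteq> - E_last"
  shows "\<exists>x\<in>\<Sigma>. \<forall>q\<in>closure \<Omega>. y \<bullet> q \<le> y \<bullet> x"
proof -
  have "compact (closure \<Omega>)" using omega_facts(4) by (simp add: compact_closure)
  moreover have "closure \<Omega> \<noteq> {}" using omega_facts(3) by simp
  moreover have "continuous_on (closure \<Omega>) (\<lambda>q. y \<bullet> q)" by (intro continuous_intros)
  ultimately have "\<exists>x\<in>closure \<Omega>. \<forall>q\<in>closure \<Omega>. y \<bullet> q \<le> y \<bullet> x"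
    by (rule continuous_attains_sup)
  then obtain x where x: "x \<in> closure \<Omega>" "\<And>q. q \<in> closure \<Omega> \<Longrightarrow> y \<bullet> q \<le> y \<bullet> x"
    by blast
  have yy: "y \<bullet> y = 1" using y by (simp add: dot_square_norm)
  have "x \<notin> \<Omega>"
  proof
    assume "x \<in> \<Omega>"
    then obtain r where r: "r > 0" "ball x r \<subseteq> \<Omega>" using omega_facts(1) openE by blast
    have "x + (r/2) *\<^sub>R y \<in> \<Omega>" using r y by (intro subsetD[OF r(2)]) (simp add: dist_norm)
    then have "y \<bullet> (x + (r/2) *\<^sub>R y) \<le> y \<bullet> x" using x(2) closure_subset by blast
    then show False using r yy by (simp add: inner_add_right)
  qed
  then have xf: "x \<in> frontier \<Omega>" using x(1) omega_facts(1) by (simp add: frontier_def interior_open)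
  have "x \<in> \<Sigma>"
  proof (rule ccontr)
    assume n: "x \<notin> \<Sigma>"
    then have x0: "snd x = 0" using omega_facts(7)[OF xf] by simp
    have "open (- \<Sigma>)" using compact_imp_closed[OF compact_surface] by (simp add: open_Compl)
    then obtain r where r: "r > 0" "ball x r \<subseteq> - \<Sigma>" using n openE by blast
    let ?C = "ball x r \<inter> {z. 0 < snd z}"
    have conv: "convex {z :: 'n space. 0 < snd z}"
      using convex_halfspace_gt[of 0 "E_last :: 'n space"] by simp
    have "?C \<subseteq> \<Omega>"
    proof (rule connected_in_omega)
      show "connected ?C" by (intro convex_connected convex_Int convex_ball conv)
      obtain q where "q \<in> \<Omega>" "dist q x < r" using x(1) r(1) unfolding closure_approachable by blast
      then have "q \<in> ?C" using omega_facts(5) by (simp add: dist_commute)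
      then show "?C \<inter> \<Omega> \<noteq> {}" using \<open>q \<in> \<Omega>\<close> by blast
      show "?C \<inter> frontier \<Omega> = {}" using frontier_upper r(2) by blast
    qed
    have neg: "y \<bullet> v \<le> 0" if "0 < snd v" for v
    proof -
      define t where "t = r / (2 * (norm v + 1))"
      have t: "t > 0" using r by (simp add: t_def add_nonneg_pos)
      have "t * norm v < r"
      proof -
        have "t * norm v < t * (norm v + 1)" using t by simp
        also have "\<dots> = r / 2"
        proof -
          have "norm v + 1 \<noteq> 0" using norm_ge_zero[of v] by linarith
          moreover have "r / (2 * c) * c = r / 2" if "c \<noteq> 0" for c :: real using that by simp
          ultimately show ?thesis unfolding t_def by blast
        qed
        finally show ?thesis using r by simp
      qed
      then have "x + t *\<^sub>R v \<in> ?C" using t that x0 by (simp add: dist_norm)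
      then have "x + t *\<^sub>R v \<in> closure \<Omega>" using \<open>?C \<subseteq> \<Omega>\<close> closure_subset by blast
      then have "t * (y \<bullet> v) \<le> 0" using x(2)[of "x + t *\<^sub>R v"] by (simp add: inner_add_right)
      then show ?thesis using t by (simp add: mult_le_0_iff)
    qed
    define z where "z = y - snd y *\<^sub>R E_last"
    have zz: "y \<bullet> z = z \<bullet> z" "snd z = 0"
      by (simp_all add: z_def E_last_def inner_diff_left inner_diff_right inner_prod_def power2_eq_square)
    \<comment> \<open>The horizontal part \<open>z\<close> of \<open>y\<close> is only a limit of
      upward vectors, so it is tilted up by \<open>\<delta>\<close>.\<close>
    have "z \<bullet> z \<le> \<epsilon>" if "\<epsilon> > 0" for \<epsilon>
    proof -
      define \<delta> where "\<delta> = \<epsilon> / (\<bar>snd y\<bar> + 1)"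
      have \<delta>: "\<delta> > 0" using that by (simp add: \<delta>_def add_nonneg_pos)
      have "y \<bullet> (z + \<delta> *\<^sub>R E_last) \<le> 0" using \<delta> zz(2) by (intro neg) (simp add: E_last_def)
      then have "z \<bullet> z \<le> - (\<delta> * snd y)" using zz(1) by (simp add: inner_add_right)
      also have "\<dots> \<le> \<delta> * (\<bar>snd y\<bar> + 1)" using \<delta> by (simp add: algebra_simps) (smt (verit) mult_minus_right mult_left_mono)
      also have "\<dots> = \<epsilon>" by (simp add: \<delta>_def add_nonneg_eq_0_iff)
      finally show ?thesis .
    qed
    then have "z \<bullet> z \<le> 0" by (meson dense_ge)
    then have "z \<bullet> z = 0" using inner_ge_zero[of z] by linarith
    then have "z = 0" by simp
    then have yE: "y = snd y *\<^sub>R E_last" by (simp add: z_def)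
    have "snd y \<le> 0" using neg[of E_last] by simp
    moreover have "\<bar>snd y\<bar> = 1" using arg_cong[OF yE, of norm] y(1) by simp
    ultimately have "snd y = -1" by simp
    then show False using yE y(2) by simp
  qed
  then show ?thesis using x(2) by blast
qed

text \<open>At a boundary maximum the edge directions give equations and the inward direction an
  inequality, which together say \<open>y + b E = a \<nu>\<close> with \<open>b \<ge> 0\<close>.
  These conditions leave the sign of \<open>a\<close> open; it is found by testing with a horizontal
  direction that enters the closure of \<open>\<Omega>\<close>.\<close>

lemma contact_point:
  assumes y: "norm y = 1" "c < snd y" "-1 < c"
    and angle: "\<And>x. x \<in> hypersurface_boundary \<Sigma> \<Longrightarrow> snd (\<nu> x) \<le> c"
  shows "\<exists>x\<in>\<Sigma>. 0 < snd x \<and> \<nu> x = y \<and> (\<forall>q\<in>closure \<Omega>. \<nu> x \<bullet> (q - x) \<le> 0)"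
proof -
  have yE: "y \<noteq> - E_last" using y by (auto simp: E_last_def)
  obtain x where x: "x \<in> \<Sigma>" "\<And>q. q \<in> closure \<Omega> \<Longrightarrow> y \<bullet> q \<le> y \<bullet> x"
    using sup_attained_on_surface[OF y(1) yE] by blast
  have Sc: "q \<in> \<Sigma> \<Longrightarrow> q \<in> closure \<Omega>" for q using omega_facts(6) by (auto simp: frontier_def)
  show ?thesis
  proof (cases "snd x = 0")
    case False
    then have sx: "0 < snd x" using snd_nonneg[OF x(1)] by simp
    obtain W U \<phi> \<phi>' \<phi>'' \<psi> u where P: "patch_normal \<Sigma> W U \<phi> \<phi>' \<phi>'' \<psi> \<nu>" and W: "open W" "u \<in> W" "\<phi> u = x"
      using interior_chart[OF x(1) not_boundary[OF sx]] by metis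
    interpret P: patch_normal \<Sigma> W U \<phi> \<phi>' \<phi>'' \<psi> \<nu> by fact
    have "y \<bullet> \<phi>' u h = 0" for h
      by (rule P.deriv_zero_at_interior_max[OF W(2,1)]) (use x Sc P.phi_in W(3) in auto)
    from P.orth_tangent_imp_multiple[OF W(2) this] have yn: "y = (y \<bullet> \<nu> x) *\<^sub>R \<nu> x" using W(3) by simp
    have a1: "\<bar>y \<bullet> \<nu> x\<bar> = 1"
    proof -
      have "norm y = \<bar>y \<bullet> \<nu> x\<bar> * norm (\<nu> x)" using arg_cong[OF yn, of norm] by simp
      then show ?thesis using y(1) nu_facts(2)[OF x(1)] by simp
    qed
    obtain b where b: "b > 0" "\<And>t. 0 < t \<Longrightarrow> t < b \<Longrightarrow> x - t *\<^sub>R \<nu> x \<in> \<Omega>"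
      using nu_facts(4)[OF x(1) sx] unfolding eventually_at_right_field by auto
    have "x - (b/2) *\<^sub>R \<nu> x \<in> closure \<Omega>" using b(2)[of "b/2"] b(1) closure_subset by auto
    from x(2)[OF this] have "y \<bullet> \<nu> x \<ge> 0" using b(1) by (simp add: inner_diff_right zero_le_mult_iff)
    then have "y = \<nu> x" using yn a1 by simp
    then show ?thesis using x sx by (intro bexI[of _ x]) (auto simp: inner_diff_right)
  next
    case True
    have xb: "x \<in> hypersurface_boundary \<Sigma>" using boundary_iff[OF x(1)] True by simp
    obtain W U \<phi> \<phi>' \<phi>'' \<psi> u k r where P: "patch_normal \<Sigma> W U \<phi> \<phi>' \<phi>'' \<psi> \<nu>" and u: "u \<in> W" "\<phi> u = x"
      and r: "0 < r" "\<And>v. v \<in> ball u r \<Longrightarrow> v \<in> W \<longleftrightarrow> 0 \<le> v $ k" "u $ k = 0"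
      and z: "\<And>i. i \<noteq> k \<Longrightarrow> snd (\<phi>' u (axis i 1)) = 0" and pos: "0 < snd (\<phi>' u (axis k 1))"
      by (rule boundary_chart[OF x(1) True]) (rule that)
    interpret P: patch_normal \<Sigma> W U \<phi> \<phi>' \<phi>'' \<psi> \<nu> by fact
    have dn: "y \<bullet> \<phi>' u h \<le> 0" if h: "norm h = 1" "0 \<le> h $ k" for h
    proof (rule P.deriv_nonpos_at_max[OF u(1) r(1)])
      show "u + t *\<^sub>R h \<in> W" if "0 < t" "t < r" for t
        using r(2)[of "u + t *\<^sub>R h"] that h r(3) by (simp add: dist_norm)
      show "y \<bullet> \<phi> v \<le> y \<bullet> \<phi> u" if "v \<in> W" for v using x(2) Sc P.phi_in[OF that] u(2) by simp
    qed
    have yz: "y \<bullet> \<phi>' u (axis i 1) = 0" if "i \<noteq> k" for i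
    proof -
      have "norm (axis i (1::real)) = 1" "axis i (1::real) $ k = 0" using that by (simp_all add: axis_def norm_axis_1[unfolded axis_def])
      then show ?thesis using dn[of "axis i 1"] dn[of "- axis i 1"] by (simp add: blinfun.minus_right)
    qed
    have yk: "y \<bullet> \<phi>' u (axis k 1) \<le> 0" using dn[of "axis k 1"] norm_axis_1[of k] by simp
    \<comment> \<open>Chosen to make \<open>y + b *\<^sub>R E_last\<close> orthogonal to the inward
      coordinate vector as well.\<close>
    define b where "b = - (y \<bullet> \<phi>' u (axis k 1)) / snd (\<phi>' u (axis k 1))"
    have b: "b \<ge> 0" using yk pos by (simp add: b_def divide_nonpos_pos)
    have ob: "(y + b *\<^sub>R E_last) \<bullet> \<phi>' u i = 0" if i: "i \<in> Basis" for i
    proof -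
      obtain j where j: "i = axis j 1" using i by (auto simp: Basis_vec_def)
      show ?thesis using yz[of j] z[of j] pos
        by (cases "j = k") (auto simp: j inner_add_left inner_diff_left b_def)
    qed
    have "(y + b *\<^sub>R E_last) \<bullet> \<phi>' u h = 0" for h
      by (subst P.deriv_expand) (simp add: inner_sum_right ob)
    from P.orth_tangent_imp_multiple[OF u(1) this]
    obtain a where a: "y + b *\<^sub>R E_last = a *\<^sub>R \<nu> x" using u(2) by blast
    \<comment> \<open>Minus the horizontal part of the normal, a direction to which
      \<open>boundary_inward\<close> applies.\<close>
    define d where "d = - \<nu> x + snd (\<nu> x) *\<^sub>R E_last"
    have d: "snd d = 0" "d \<bullet> \<nu> x = (snd (\<nu> x))^2 - 1"
      using nu_nu[OF x(1)] by (simp_all add: d_def E_last_def inner_diff_left inner_prod_def power2_eq_square)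
    then have dneg: "d \<bullet> \<nu> x < 0" using nu_not_vertical[OF x(1) True] by simp
    obtain s where s: "s > 0" "x + s *\<^sub>R d \<in> closure \<Omega>" using boundary_inward[OF x(1) True d(1) dneg] by blast
    from x(2)[OF s(2)] have "y \<bullet> d \<le> 0" using s(1) by (simp add: inner_add_right mult_le_0_iff)
    moreover have "y \<bullet> d = a * (d \<bullet> \<nu> x)"
    proof -
      have "(y + b *\<^sub>R E_last) \<bullet> d = a * (\<nu> x \<bullet> d)" by (simp add: a)
      then show ?thesis using d(1) by (simp add: inner_add_left inner_commute[of d])
    qed
    ultimately have "a \<ge> 0" using dneg by (simp add: mult_le_0_iff)
    moreover have "y + b *\<^sub>R E_last \<noteq> 0"
    proof
      assume "y + b *\<^sub>R E_last = 0"
      then have yb: "y = - (b *\<^sub>R E_last)" by (simp add: eq_neg_iff_add_eq_0)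
      then have "norm y = b" using b by simp
      then show False using yb y(1) yE by simp
    qed
    ultimately have "y \<bullet> E_last \<le> \<nu> x \<bullet> E_last"
      by (intro inner_le_along_arc[OF y(1) nu_facts(2)[OF x(1)] norm_E_last _ b _ a[symmetric]])
    then show ?thesis using angle[OF xb] y(2) by simp
  qed
qed

end

section \<open>The Jacobian of the cone map\<close>

context patch
begin

lemma at_within_image: "u \<in> W \<Longrightarrow> at (\<phi> u) within \<phi> ` W = at (\<phi> u) within \<Sigma>"
proof -
  assume u: "u \<in> W"
  obtain T where T: "open T" "\<phi> ` W = \<Sigma> \<inter> T" using openin_image by (auto simp: openin_open)
  then have "\<phi> u \<in> T" using u by auto
  then show ?thesis by (rule at_within_nhd[OF _ T(1)]) (use T(2) in auto)
qed

text \<open>From an edge parameter a small shift into the half-space reaches interior parameters, so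
  every relatively open part of the surface contains the image of an open set.\<close>

lemma nonempty_open_subset:
  assumes "u \<in> W" "0 < r" shows "\<exists>X. open X \<and> X \<noteq> {} \<and> X \<subseteq> W \<inter> ball u r"
proof -
  obtain T where T: "open T" "W = T \<or> (\<exists>k. W = T \<inter> {u. 0 \<le> u $ k})" using shape by blast
  from T(2) show ?thesis
  proof
    assume "W = T"
    then show ?thesis using T(1) assms by (intro exI[of _ "T \<inter> ball u r"]) auto
  next
    assume "\<exists>k. W = T \<inter> {u. 0 \<le> u $ k}"
    then obtain k where k: "W = T \<inter> {u. 0 \<le> u $ k}" by blast
    have op: "open {v :: real^'n. 0 < v $ k}" by (intro open_Collect_less continuous_intros)
    have uT: "u \<in> T \<inter> ball u r" using assms k by auto
    have "open (T \<inter> ball u r)" using T(1) by auto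
    then obtain s where s: "s > 0" "ball u s \<subseteq> T \<inter> ball u r" using uT openE by blast
    have "u + (s/2) *\<^sub>R axis k 1 \<in> ball u s" using s by (simp add: dist_norm norm_axis_1)
    moreover have "0 < (u + (s/2) *\<^sub>R axis k 1) $ k" using s k assms(1) by (auto intro: add_nonneg_pos)
    ultimately show ?thesis using s(2) k op
      by (intro exI[of _ "ball u s \<inter> {v. 0 < v $ k}"]) (auto intro: less_imp_le)
  qed
qed

end

context patch_normal
begin

text \<open>The supporting hyperplane makes all principal curvatures nonnegative, so their product
  is bounded by the power of their mean, and equality means that they all coincide.\<close>

lemma lin_scale_cone_le:
  assumes u: "u \<in> W" and mx: "\<And>v. v \<in> W \<Longrightarrow> \<nu> (\<phi> u) \<bullet> \<phi> v \<le> \<nu> (\<phi> u) \<bullet> \<phi> u"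
    and w: "0 < 1 - a \<bullet> \<nu> (\<phi> u)"
  defines "D \<equiv> \<lambda>t. lin_scale (\<lambda>(h, s). t *\<^sub>R weingarten u h + s *\<^sub>R (\<nu> (\<phi> u) - a))"
    and "H \<equiv> mean_curvature \<Sigma> \<nu> (\<phi> u)"
  shows "0 \<le> H" "0 < area_density \<phi> u"
    "0 \<le> t \<Longrightarrow> D t \<le> t ^ CARD('n) * (area_density \<phi> u * ((1 - a \<bullet> \<nu> (\<phi> u)) * \<bar>H\<bar> ^ CARD('n)))"
    "0 < t \<Longrightarrow> D t = t ^ CARD('n) * (area_density \<phi> u * ((1 - a \<bullet> \<nu> (\<phi> u)) * \<bar>H\<bar> ^ CARD('n)))
      \<longleftrightarrow> (\<forall>h. weingarten u h = H *\<^sub>R \<phi>' u h)"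
proof -
  obtain l :: "'n \<Rightarrow> real" where tr: "real CARD('n) * mean_curvature \<Sigma> \<nu> (\<phi> u) = (\<Sum>i\<in>UNIV. l i)"
    and ls: "\<And>t a. 1 - a \<bullet> \<nu> (\<phi> u) \<noteq> 0 \<Longrightarrow>
      lin_scale (\<lambda>(h, s). t *\<^sub>R weingarten u h + s *\<^sub>R (\<nu> (\<phi> u) - a)) =
      \<bar>t\<bar> ^ CARD('n) * \<bar>\<Prod>i\<in>UNIV. l i\<bar> * area_density \<phi> u * \<bar>1 - a \<bullet> \<nu> (\<phi> u)\<bar>"
    and lh: "\<And>i. \<exists>h. norm (\<phi>' u h) = 1 \<and> l i = - (\<phi>'' u h h \<bullet> \<nu> (\<phi> u))"
    and um: "\<And>m h. (\<And>i. l i = m) \<Longrightarrow> weingarten u h = m *\<^sub>R \<phi>' u h"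
    and dp: "0 < area_density \<phi> u"
  proof (rule principal_curvatures[OF u], goal_cases)
    case (1 l)
    show ?case by (rule 1(1)[of l]; fact 1)
  qed
  show "0 < area_density \<phi> u" by (fact dp)
  have l0: "0 \<le> l i" for i
  proof -
    obtain h where "l i = - (\<phi>'' u h h \<bullet> \<nu> (\<phi> u))" using lh by blast
    moreover have "\<nu> (\<phi> u) \<bullet> \<phi>'' u h h \<le> 0" by (rule hess_nonpos_at_max[OF u nu_deriv[OF u] mx])
    ultimately show ?thesis by (simp add: inner_commute)
  qed
  have Hm: "H = (\<Sum>i\<in>UNIV. l i) / real CARD('n)" unfolding H_def tr[symmetric] by simp
  then show H0: "0 \<le> H" by (simp add: l0 sum_nonneg)
  have am: "(\<Prod>i\<in>UNIV. l i) \<le> H ^ CARD('n)" "(\<Prod>i\<in>UNIV. l i) = H ^ CARD('n) \<Longrightarrow> l i = H" for i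
    using prod_le_mean_power(1)[of "UNIV :: 'n set" l, OF finite UNIV_not_empty l0, folded Hm]
      prod_le_mean_power(2)[of "UNIV :: 'n set" l, OF finite UNIV_not_empty l0, folded Hm, OF _ UNIV_I]
    by blast+
  have p0: "0 \<le> (\<Prod>i\<in>UNIV. l i)" by (intro prod_nonneg) (use l0 in auto)
  have Dt: "D t = t ^ CARD('n) * (area_density \<phi> u * ((1 - a \<bullet> \<nu> (\<phi> u)) * (\<Prod>i\<in>UNIV. l i)))" if "0 \<le> t" for t
    unfolding D_def using ls[of a t] w p0 that by simp
  show "D t \<le> t ^ CARD('n) * (area_density \<phi> u * ((1 - a \<bullet> \<nu> (\<phi> u)) * \<bar>H\<bar> ^ CARD('n)))" if "0 \<le> t"
    unfolding Dt[OF that] using am(1) H0 dp w that by (intro mult_left_mono) auto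
  assume t: "0 < t"
  have "D t = t ^ CARD('n) * (area_density \<phi> u * ((1 - a \<bullet> \<nu> (\<phi> u)) * \<bar>H\<bar> ^ CARD('n)))
      \<longleftrightarrow> (\<Prod>i\<in>UNIV. l i) = H ^ CARD('n)"
    using Dt[of t] t dp w H0 by simp
  also have "\<dots> \<longleftrightarrow> (\<forall>h. weingarten u h = H *\<^sub>R \<phi>' u h)"
  proof
    assume "(\<Prod>i\<in>UNIV. l i) = H ^ CARD('n)"
    then show "\<forall>h. weingarten u h = H *\<^sub>R \<phi>' u h" using am(2) um by blast
  next
    assume um': "\<forall>h. weingarten u h = H *\<^sub>R \<phi>' u h"
    have "l i = H" for i
    proof -
      obtain h where h: "norm (\<phi>' u h) = 1" "l i = - (\<phi>'' u h h \<bullet> \<nu> (\<phi> u))" using lh by blast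
      have "l i = \<phi>' u h \<bullet> weingarten u h" using weingarten_inner[OF u] h(2) by simp
      also have "\<dots> = H * (\<phi>' u h \<bullet> \<phi>' u h)" using um' by simp
      finally show ?thesis using h(1) by (simp add: dot_square_norm)
    qed
    then show "(\<Prod>i\<in>UNIV. l i) = H ^ CARD('n)" by simp
  qed
  finally show "D t = t ^ CARD('n) * (area_density \<phi> u * ((1 - a \<bullet> \<nu> (\<phi> u)) * \<bar>H\<bar> ^ CARD('n)))
      \<longleftrightarrow> (\<forall>h. weingarten u h = H *\<^sub>R \<phi>' u h)" .
qed

lemma cone_map_has_derivative:
  assumes u: "u \<in> W" and S: "S \<subseteq> W"
  shows "((\<lambda>(v, s). s *\<^sub>R (\<nu> (\<phi> v) - a)) has_derivative
    (\<lambda>(h, s). t *\<^sub>R weingarten u h + s *\<^sub>R (\<nu> (\<phi> u) - a))) (at (u, t) within S \<times> I)"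
proof -
  have f: "(fst has_derivative fst) (at (u, t) within S \<times> I)" by (rule bounded_linear_imp_has_derivative[OF bounded_linear_fst])
  have s: "(snd has_derivative snd) (at (u, t) within S \<times> I)" by (rule bounded_linear_imp_has_derivative[OF bounded_linear_snd])
  have "((\<lambda>v. \<nu> (\<phi> v)) has_derivative weingarten u) (at (fst (u, t)) within fst ` (S \<times> I))"
    using has_derivative_subset[OF nu_along_has_derivative[OF u]] S by auto
  from has_derivative_in_compose[OF f this]
  have n: "((\<lambda>p. \<nu> (\<phi> (fst p))) has_derivative (\<lambda>p. weingarten u (fst p))) (at (u, t) within S \<times> I)" .
  have "((\<lambda>p. snd p *\<^sub>R (\<nu> (\<phi> (fst p)) - a)) has_derivative
    (\<lambda>p. snd (u, t) *\<^sub>R (weingarten u (fst p) - 0) + snd p *\<^sub>R (\<nu> (\<phi> (fst (u, t))) - a))) (at (u, t) within S \<times> I)"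
    by (intro has_derivative_scaleR s has_derivative_diff n has_derivative_const)
  then show ?thesis by (simp add: case_prod_unfold)
qed

end

text \<open>The origin of the factor \<open>1 / (n + 1)\<close>: the Jacobian of the cone map is
  proportional to the \<open>n\<close>-th power of the dilation parameter.\<close>

lemma nn_integral_power_unit: "(\<integral>\<^sup>+t\<in>{0<..<1}. ennreal (t ^ n) \<partial>lborel) = ennreal (1 / (real n + 1))"
proof -
  have "(\<integral>\<^sup>+t\<in>{0<..<1}. ennreal (t ^ n) \<partial>lborel) = (\<integral>\<^sup>+t\<in>{0..1}. ennreal (t ^ n) \<partial>lborel)"
  proof (rule nn_integral_cong_AE)
    have "AE t in lborel. t \<noteq> (0::real)" "AE t in lborel. t \<noteq> (1::real)" by (rule AE_lborel_singleton)+
    then show "AE t in lborel. ennreal (t ^ n) * indicator {0<..<1} t = ennreal (t ^ n) * indicator {0..1} t"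
      by eventually_elim (auto simp: indicator_def)
  qed
  also have "\<dots> = ennreal (1 ^ Suc n / (real n + 1) - 0 ^ Suc n / (real n + 1))"
  proof (rule nn_integral_FTC_Icc[where F = "\<lambda>t. t ^ Suc n / (real n + 1)"])
    fix t :: real
    show "((\<lambda>t. t ^ Suc n / (real n + 1)) has_real_derivative t ^ n) (at t)"
      by (rule DERIV_cong[OF DERIV_cdivide[OF DERIV_pow]]) (simp add: add.commute)
  qed auto
  finally show ?thesis by simp
qed

lemma nn_integral_cone:
  fixes G :: "'a::euclidean_space \<Rightarrow> real"
  assumes G: "(\<lambda>u. G u * indicator S u) \<in> borel_measurable borel" and S: "S \<in> sets borel" and pos: "\<And>u. u \<in> S \<Longrightarrow> 0 \<le> G u"
  shows "(\<integral>\<^sup>+p\<in>S \<times> {0<..<1}. ennreal (snd p ^ n * G (fst p)) \<partial>lborel)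
    = ennreal (1 / (real n + 1)) * (\<integral>\<^sup>+u\<in>S. ennreal (G u) \<partial>lborel)"
proof -
  let ?g = "\<lambda>u. ennreal (G u * indicator S u)" and ?f = "\<lambda>t::real. ennreal (t ^ n) * indicator {0<..<1} t"
  have g: "?g \<in> borel_measurable borel" using measurable_compose[OF G measurable_ennreal] .
  have "(\<integral>\<^sup>+p\<in>S \<times> {0<..<1}. ennreal (snd p ^ n * G (fst p)) \<partial>lborel)
      = (\<integral>\<^sup>+p. ?g (fst p) * ?f (snd p) \<partial>(lborel \<Otimes>\<^sub>M lborel))"
    unfolding lborel_prod[symmetric]
    by (intro nn_integral_cong) (auto simp: indicator_def ennreal_mult pos mult.commute)
  also have "\<dots> = (\<integral>\<^sup>+u. (\<integral>\<^sup>+t. ?g u * ?f t \<partial>lborel) \<partial>lborel)"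
  proof (subst lborel.nn_integral_fst[symmetric])
    have f: "?f \<in> borel_measurable borel" by measurable
    show "(\<lambda>p. ?g (fst p) * ?f (snd p)) \<in> borel_measurable (lborel \<Otimes>\<^sub>M lborel)"
      by (intro borel_measurable_times_ennreal measurable_compose[OF measurable_fst] measurable_compose[OF measurable_snd])
        (use g f in simp_all)
  qed simp
  also have "\<dots> = (\<integral>\<^sup>+u. ?g u * ennreal (1 / (real n + 1)) \<partial>lborel)"
    by (subst nn_integral_cmult) (simp_all add: nn_integral_power_unit)
  also have "\<dots> = (\<integral>\<^sup>+u. ?g u \<partial>lborel) * ennreal (1 / (real n + 1))"
    by (rule nn_integral_multc) (use g in simp)
  also have "(\<integral>\<^sup>+u. ?g u \<partial>lborel) = (\<integral>\<^sup>+u\<in>S. ennreal (G u) \<partial>lborel)"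
    by (intro nn_integral_cong) (auto simp: indicator_def)
  finally show ?thesis by (simp add: mult.commute)
qed

context enclosing_surface
begin

lemma cont_mean_curvature: "continuous_on \<Sigma> (mean_curvature \<Sigma> \<nu>)"
  unfolding continuous_on_def
proof
  fix x assume "x \<in> \<Sigma>"
  then obtain W U \<phi> \<phi>' \<phi>'' \<psi> u where P: "patch_normal \<Sigma> W U \<phi> \<phi>' \<phi>'' \<psi> \<nu>" and u: "u \<in> W" "\<phi> u = x"
    using chart by metis
  interpret P: patch_normal \<Sigma> W U \<phi> \<phi>' \<phi>'' \<psi> \<nu> by fact
  have "continuous_on (\<phi> ` W) (\<lambda>x. mean_curvature \<Sigma> \<nu> (\<phi> (\<psi> x)))"
    by (rule continuous_on_compose2[OF P.cont_mean_curvature P.cont_psi]) (use P.psi_in in auto)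
  then have "continuous_on (\<phi> ` W) (mean_curvature \<Sigma> \<nu>)"
    by (rule continuous_on_eq) (simp add: P.phi_psi)
  then show "(mean_curvature \<Sigma> \<nu> \<longlongrightarrow> mean_curvature \<Sigma> \<nu> x) (at x within \<Sigma>)"
    using u P.at_within_image[OF u(1)] by (auto simp: continuous_on_def)
qed

lemma surface_borel: "\<Sigma> \<in> sets borel"
  using compact_surface by (simp add: compact_imp_closed borel_closed)

lemma surface_in_closure: "x \<in> \<Sigma> \<Longrightarrow> x \<in> closure \<Omega>"
  using omega_facts(6) by (auto simp: frontier_def)

text \<open>The density is positive, and it is integrated over a nonempty open set of parameters.
  This turns statements that hold almost everywhere into statements on a dense set.\<close>

lemma area_measure_open_pos:
  assumes "open V" "x \<in> V" "x \<in> \<Sigma>" shows "0 < emeasure (area_measure \<Sigma>) (V \<inter> \<Sigma>)"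
proof -
  obtain W U \<phi> \<phi>' \<phi>'' \<psi> u where P: "patch_normal \<Sigma> W U \<phi> \<phi>' \<phi>'' \<psi> \<nu>" and u: "u \<in> W" "\<phi> u = x"
    using chart[OF assms(3)] by metis
  interpret P: patch_normal \<Sigma> W U \<phi> \<phi>' \<phi>'' \<psi> \<nu> by fact
  have imb: "\<phi> ` W \<in> sets borel" by (rule local_parametrization_image_borel(1)[OF surface_borel P.local_parametrization])
  let ?A = "V \<inter> \<phi> ` W"
  have Ab: "?A \<in> sets borel" using assms(1) imb by auto
  have "isCont \<phi> u" using has_derivative_continuous[OF P.deriv] u P.W_U by auto
  then obtain r where r: "r > 0" "\<And>v. dist v u < r \<Longrightarrow> \<phi> v \<in> V"
    using assms(1,2) u(2) continuous_at_open by (metis (no_types, lifting) continuous_at_ball mem_ball dist_commute openE subset_iff image_subset_iff)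
  obtain X where X: "open X" "X \<noteq> {}" "X \<subseteq> W \<inter> ball u r" using P.nonempty_open_subset[OF u(1) r(1)] by blast
  have XA: "X \<subseteq> W \<inter> \<phi> -` ?A" using X r by (auto simp: dist_commute)
  have SA: "W \<inter> \<phi> -` ?A \<in> sets borel" by (rule P.phi_vimage_borel[OF Ab])
  have "emeasure (area_measure \<Sigma>) ?A \<noteq> 0"
  proof
    assume "emeasure (area_measure \<Sigma>) ?A = 0"
    then have "(\<integral>\<^sup>+u\<in>W \<inter> \<phi> -` ?A. ennreal (area_density \<phi> u) \<partial>lborel) = 0"
      using emeasure_area_measure[OF compact_surface C2_surface P.local_parametrization Ab] by simp
    then have z: "(\<integral>\<^sup>+u. ennreal (area_density \<phi> u * indicator (W \<inter> \<phi> -` ?A) u) \<partial>lborel) = 0"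
      by (subst (asm) nn_integral_cong[where v="\<lambda>u. ennreal (area_density \<phi> u * indicator (W \<inter> \<phi> -` ?A) u)"]) (auto simp: indicator_def)
    have m: "(\<lambda>u. ennreal (area_density \<phi> u * indicator (W \<inter> \<phi> -` ?A) u)) \<in> borel_measurable lborel"
      using P.measurable_on_patch[OF continuous_on_subset[OF P.cont_area_density P.W_U] SA] by simp
    have "AE u in lborel. ennreal (area_density \<phi> u * indicator (W \<inter> \<phi> -` ?A) u) = 0"
      using z nn_integral_0_iff_AE[OF m] by simp
    then have "AE u in lborel. u \<notin> X"
    proof eventually_elim
      case (elim v)
      show ?case
      proof
        assume "v \<in> X"
        then have v: "v \<in> W \<inter> \<phi> -` ?A" using XA by blast
        have "0 < area_density \<phi> v" using P.principal_curvatures[of v] v by blast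
        then show False using elim v by simp
      qed
    qed
    then have "X \<in> null_sets lborel" using X(1) by (subst AE_iff_null_sets) auto
    then have "negligible X" by (metis negligible_iff_null_sets null_sets_completionI)
    then show False using open_not_negligible X by blast
  qed
  moreover have "emeasure (area_measure \<Sigma>) ?A \<le> emeasure (area_measure \<Sigma>) (V \<inter> \<Sigma>)"
  proof (rule emeasure_mono)
    show "?A \<subseteq> V \<inter> \<Sigma>" using P.image_subset by blast
    show "V \<inter> \<Sigma> \<in> sets (area_measure \<Sigma>)"
      using assms(1) surface_borel by (auto simp: sets_area_measure[OF compact_surface C2_surface] sets_restrict_space_iff)
  qed
  ultimately show ?thesis by (metis not_gr_zero le_zero_eq)
qed

end

section \<open>The inequality\<close>

text \<open>\<open>c\<close> stands for \<open>cos \<theta>\<^sub>0\<close>, and the angle condition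
  is written with \<open>E_last\<close> instead of its negative, which reverses the
  inequality.\<close>

locale capillary_surface = enclosing_surface \<Sigma> \<Omega> \<nu>
  for \<Sigma> \<Omega> :: "('n::finite) space set" and \<nu> :: "'n space \<Rightarrow> 'n space" +
  fixes c :: real
  assumes c: "-1 < c" "c < 1"
    and angle: "\<And>x. x \<in> hypersurface_boundary \<Sigma> \<Longrightarrow> snd (\<nu> x) \<le> c"
begin

definition weight :: "'n space \<Rightarrow> real" where "weight x = 1 - c * snd (\<nu> x)"

definition energy :: "'n space \<Rightarrow> real" where
  "energy x = weight x * \<bar>mean_curvature \<Sigma> \<nu> x\<bar> ^ CARD('n)"

definition contact :: "'n space set" where
  "contact = {x \<in> \<Sigma>. 0 < snd x \<and> c < snd (\<nu> x) \<and> (\<forall>q\<in>closure \<Omega>. \<nu> x \<bullet> (q - x) \<le> 0)}"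

text \<open>The cone map in the parameters of one patch, where the change of variables formula for
  flat space is available.\<close>

definition cone_map :: "(real^'n \<Rightarrow> 'n space) \<Rightarrow> (real^'n) \<times> real \<Rightarrow> 'n space" where
  "cone_map \<phi> = (\<lambda>(v, s). s *\<^sub>R (\<nu> (\<phi> v) - c *\<^sub>R E_last))"

lemma weight_pos: assumes "x \<in> \<Sigma>" shows "0 < weight x"
proof -
  have "\<bar>snd (\<nu> x)\<bar> \<le> 1" using Cauchy_Schwarz_ineq2[of "\<nu> x" E_last] nu_facts(2)[OF assms] by simp
  then have "\<bar>c * snd (\<nu> x)\<bar> \<le> \<bar>c\<bar>" by (simp add: abs_mult mult_left_le)
  then show ?thesis using c by (simp add: weight_def)
qed

lemma weight_eq: "1 - (c *\<^sub>R E_last) \<bullet> \<nu> x = weight x" by (simp add: weight_def)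

lemma cont_weight: "continuous_on \<Sigma> weight"
  unfolding weight_def by (intro continuous_intros nu_facts(1))

lemma cont_energy: "continuous_on \<Sigma> energy"
  unfolding energy_def by (intro continuous_intros cont_weight cont_mean_curvature)

lemma energy_nonneg: "x \<in> \<Sigma> \<Longrightarrow> 0 \<le> energy x"
  using weight_pos[of x] by (simp add: energy_def)

lemma energy_zero_iff: "x \<in> \<Sigma> \<Longrightarrow> energy x = 0 \<longleftrightarrow> mean_curvature \<Sigma> \<nu> x = 0"
  using weight_pos[of x] by (simp add: energy_def)

lemma measurable_energy: "(\<lambda>x. ennreal (energy x)) \<in> borel_measurable (restrict_space borel \<Sigma>)"
  by (rule measurable_compose[OF borel_measurable_continuous_on_restrict[OF cont_energy] measurable_ennreal])

text \<open>The support condition without the two strict inequalities of \<open>contact\<close>; in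
  this form it passes to limits, which the equality case relies on.\<close>

lemma closed_contact: "closed {x \<in> \<Sigma>. \<forall>q\<in>closure \<Omega>. \<nu> x \<bullet> (q - x) \<le> 0}"
proof -
  have "closed {x \<in> \<Sigma>. \<nu> x \<bullet> (q - x) \<le> 0}" for q
  proof -
    have "continuous_on \<Sigma> (\<lambda>x. \<nu> x \<bullet> (q - x))" by (intro continuous_intros nu_facts(1))
    from continuous_closed_preimage[OF this compact_imp_closed[OF compact_surface], of "{..0}"]
    have "closed (\<Sigma> \<inter> (\<lambda>x. \<nu> x \<bullet> (q - x)) -` {..0})" by simp
    moreover have "\<Sigma> \<inter> (\<lambda>x. \<nu> x \<bullet> (q - x)) -` {..0} = {x \<in> \<Sigma>. \<nu> x \<bullet> (q - x) \<le> 0}" by auto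
    ultimately show ?thesis by simp
  qed
  then have "closed (\<Inter>q\<in>closure \<Omega>. {x \<in> \<Sigma>. \<nu> x \<bullet> (q - x) \<le> 0})" by blast
  moreover have "(\<Inter>q\<in>closure \<Omega>. {x \<in> \<Sigma>. \<nu> x \<bullet> (q - x) \<le> 0}) = {x \<in> \<Sigma>. \<forall>q\<in>closure \<Omega>. \<nu> x \<bullet> (q - x) \<le> 0}"
    using omega_facts(3) by (auto dest: subsetD[OF closure_subset])
  ultimately show ?thesis by simp
qed

lemma contact_borel: "contact \<in> sets borel"
proof -
  have n: "(\<lambda>x. snd (\<nu> x)) \<in> borel_measurable (restrict_space borel \<Sigma>)"
    by (intro borel_measurable_continuous_on_restrict continuous_intros nu_facts(1))
  have "{c<..} \<in> sets borel" by simp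
  from measurable_sets[OF n this] have "(\<lambda>x. snd (\<nu> x)) -` {c<..} \<inter> \<Sigma> \<in> sets borel"
    using surface_borel by (auto simp: space_restrict_space sets_restrict_space_iff)
  moreover have "open {x :: 'n space. 0 < snd x}" by (intro open_Collect_less continuous_intros)
  ultimately have "((\<lambda>x. snd (\<nu> x)) -` {c<..} \<inter> \<Sigma>) \<inter> {x. 0 < snd x} \<inter> {x \<in> \<Sigma>. \<forall>q\<in>closure \<Omega>. \<nu> x \<bullet> (q - x) \<le> 0} \<in> sets borel"
    by (rule sets.Int[OF sets.Int[OF _ borel_open] borel_closed[OF closed_contact]])
  moreover have "contact = ((\<lambda>x. snd (\<nu> x)) -` {c<..} \<inter> \<Sigma>) \<inter> {x. 0 < snd x} \<inter> {x \<in> \<Sigma>. \<forall>q\<in>closure \<Omega>. \<nu> x \<bullet> (q - x) \<le> 0}"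
    by (auto simp: contact_def)
  ultimately show ?thesis by simp
qed

abbreviation truncated_ball :: "'n space set" where
  "truncated_ball \<equiv> ball (- c *\<^sub>R E_last) 1 \<inter> upper_half_space"

text \<open>The ray from the origin through \<open>z\<close> leaves the ball around
  \<open>- c E\<close> at \<open>s z\<close> with some \<open>s > 1\<close>. Then
  \<open>s z + c E\<close> is a unit vector of height above \<open>c\<close>, so
  \<open>contact_point\<close> realizes it as a normal, with dilation parameter
  \<open>1 / s\<close>.\<close>

lemma truncated_ball_covered:
  assumes z: "z \<in> truncated_ball"
  shows "\<exists>x\<in>contact. \<exists>t\<in>{0<..<1}. z = t *\<^sub>R (\<nu> x - c *\<^sub>R E_last)"
proof -
  have z1: "norm (z + c *\<^sub>R E_last) < 1" "0 < snd z"
    using z by (auto simp: upper_half_space_eq dist_norm norm_minus_commute algebra_simps)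
  define f where "f s = norm (s *\<^sub>R z + c *\<^sub>R E_last)" for s
  have nz: "norm z > 0" using z1(2) by auto
  \<comment> \<open>The vector \<open>s1 *\<^sub>R z\<close> has norm at least 2, hence lies outside
    the ball, whose centre has norm below 1.\<close>
  define s1 where "s1 = 1 + 2 / norm z"
  have s1: "1 \<le> s1" using nz by (simp add: s1_def)
  have "2 \<le> norm (s1 *\<^sub>R z)" using nz s1 by (simp add: s1_def distrib_right)
  also have "\<dots> \<le> f s1 + norm (c *\<^sub>R (E_last :: 'n space))" unfolding f_def
    using norm_triangle_ineq4[of "s1 *\<^sub>R z + c *\<^sub>R E_last" "c *\<^sub>R E_last"] by simp
  finally have "1 \<le> f s1" using c by simp
  moreover have "f 1 \<le> 1" using z1 by (simp add: f_def)
  moreover have "continuous_on {1..s1} f" unfolding f_def by (intro continuous_intros)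
  ultimately obtain s where s: "1 \<le> s" "s \<le> s1" "f s = 1" using IVT'[of f 1 1 s1] s1 by auto
  have "s \<noteq> 1" using s(3) z1(1) by (auto simp: f_def)
  then have s': "1 < s" using s(1) by simp
  define y where "y = s *\<^sub>R z + c *\<^sub>R E_last"
  have "norm y = 1" using s(3) by (simp add: y_def f_def)
  moreover have sy: "c < snd y" using s' z1(2) by (simp add: y_def)
  ultimately obtain x where x: "x \<in> \<Sigma>" "0 < snd x" "\<nu> x = y" "\<forall>q\<in>closure \<Omega>. \<nu> x \<bullet> (q - x) \<le> 0"
    using contact_point[OF _ _ c(1) angle, of y] by blast
  have "x \<in> contact" using x sy by (simp add: contact_def)
  moreover have "z = (1 / s) *\<^sub>R (\<nu> x - c *\<^sub>R E_last)" using s' by (simp add: x(3) y_def)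
  moreover have "1 / s \<in> {0<..<1}" using s' by simp
  ultimately show ?thesis by blast
qed

lemma truncated_ball_finite: "emeasure lborel truncated_ball < \<infinity>" "truncated_ball \<in> sets borel"
proof -
  show "truncated_ball \<in> sets borel"
    by (intro sets.Int borel_open open_ball) (simp add: upper_half_space_eq open_Collect_less continuous_on_snd continuous_on_id)
  have "bounded truncated_ball" by (rule bounded_subset[OF bounded_ball]) auto
  then show "emeasure lborel truncated_ball < \<infinity>" by (rule emeasure_bounded_finite)
qed

text \<open>\<open>X\<close> is a Borel piece of the surface within one patch. The volume of the
  cone over it is expressed through the true Jacobian \<open>D\<close>, while the integral of the
  upper bound for \<open>D\<close> splits into a radial factor and the energy of
  \<open>X\<close>.\<close>

lemma
  assumes P: "patch_normal \<Sigma> W U \<phi> \<phi>' \<phi>'' \<psi> \<nu>" and X: "X \<in> sets borel" "X \<subseteq> \<phi> ` W"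
  defines "S \<equiv> W \<inter> \<phi> -` X"
    and "D \<equiv> \<lambda>(u, t). lin_scale (\<lambda>(h, s). t *\<^sub>R patch_normal.weingarten \<phi> \<phi>' \<phi>'' \<nu> u h + s *\<^sub>R (\<nu> (\<phi> u) - c *\<^sub>R E_last))"
  shows cone_map_measurable: "cone_map \<phi> ` (S \<times> {0<..<1}) \<in> sets lebesgue"
    and cone_map_emeasure_le: "emeasure lebesgue (cone_map \<phi> ` (S \<times> {0<..<1})) \<le> (\<integral>\<^sup>+p\<in>S \<times> {0<..<1}. ennreal (D p) \<partial>lebesgue)"
    and cone_map_emeasure_eq: "inj_on (cone_map \<phi>) (S \<times> {0<..<1}) \<Longrightarrow>
      emeasure lebesgue (cone_map \<phi> ` (S \<times> {0<..<1})) = (\<integral>\<^sup>+p\<in>S \<times> {0<..<1}. ennreal (D p) \<partial>lebesgue)"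
    and cone_map_jacobian_measurable: "(\<lambda>p. ennreal (D p) * indicator (S \<times> {0<..<1}) p) \<in> borel_measurable lebesgue"
    and nn_integral_energy_cone: "(\<integral>\<^sup>+p\<in>S \<times> {0<..<1}. ennreal (snd p ^ CARD('n) * (area_density \<phi> (fst p) * energy (\<phi> (fst p)))) \<partial>lebesgue)
      = ennreal (1 / (real CARD('n) + 1)) * (\<integral>\<^sup>+x\<in>X. ennreal (energy x) \<partial>area_measure \<Sigma>)"
    and energy_cone_measurable: "(\<lambda>p. ennreal (snd p ^ CARD('n) * (area_density \<phi> (fst p) * energy (\<phi> (fst p)))) * indicator (S \<times> {0<..<1}) p) \<in> borel_measurable lebesgue"
proof -
  interpret P: patch_normal \<Sigma> W U \<phi> \<phi>' \<phi>'' \<psi> \<nu> by fact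
  let ?I = "{0<..<1::real}"
  have S: "S \<in> sets borel" unfolding S_def by (rule P.phi_vimage_borel[OF X(1)])
  have SW: "S \<subseteq> W" by (auto simp: S_def)
  have SIb: "S \<times> ?I \<in> sets borel" using S by (intro borel_Times) auto
  then have SI: "S \<times> ?I \<in> sets lebesgue" by simp
  define g' where "g' p = (\<lambda>(h, s). snd p *\<^sub>R P.weingarten (fst p) h + s *\<^sub>R (\<nu> (\<phi> (fst p)) - c *\<^sub>R E_last))" for p
  have der: "(cone_map \<phi> has_derivative g' p) (at p within S \<times> ?I)" if "p \<in> S \<times> ?I" for p
    using P.cone_map_has_derivative[of "fst p" S "c *\<^sub>R E_last" "snd p" ?I] that SW
    by (auto simp: cone_map_def g'_def)
  have Dg: "D = (\<lambda>p. lin_scale (g' p))" by (simp add: D_def g'_def case_prod_unfold)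
  show "cone_map \<phi> ` (S \<times> ?I) \<in> sets lebesgue" by (rule image_sets_lebesgue[OF SI der])
  show "emeasure lebesgue (cone_map \<phi> ` (S \<times> ?I)) \<le> (\<integral>\<^sup>+p\<in>S \<times> ?I. ennreal (D p) \<partial>lebesgue)"
    unfolding Dg by (rule emeasure_image_le_lin_scale[OF SI der])
  show "emeasure lebesgue (cone_map \<phi> ` (S \<times> ?I)) = (\<integral>\<^sup>+p\<in>S \<times> ?I. ennreal (D p) \<partial>lebesgue)"
    if "inj_on (cone_map \<phi>) (S \<times> ?I)"
    unfolding Dg by (rule emeasure_image_eq_lin_scale[OF SI der that])
  show "(\<lambda>p. ennreal (D p) * indicator (S \<times> ?I) p) \<in> borel_measurable lebesgue"
    unfolding Dg
    by (rule borel_measurable_restrict_space_iff_ennreal[THEN iffD1, OF _ measurable_compose[OF borel_measurable_lin_scale[OF SI der] measurable_ennreal]])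
      (use SI in simp)
  let ?G = "\<lambda>u. area_density \<phi> u * energy (\<phi> u)"
  have contG: "continuous_on W ?G"
    by (intro continuous_intros continuous_on_subset[OF P.cont_area_density P.W_U]
        continuous_on_compose2[OF cont_energy continuous_on_subset[OF P.cont_phi P.W_U] P.image_subset])
  have G: "(\<lambda>u. ?G u * indicator S u) \<in> borel_measurable borel" by (rule P.measurable_on_patch[OF contG S SW])
  have G0: "0 \<le> ?G u" "0 \<le> area_density \<phi> u" if "u \<in> S" for u
  proof -
    have u: "u \<in> W" using that SW by auto
    have "0 < area_density \<phi> u" by (rule P.principal_curvatures[OF u])
    then show "0 \<le> ?G u" "0 \<le> area_density \<phi> u" using energy_nonneg[OF P.phi_in[OF u]] by simp_all
  qed
  have "(\<integral>\<^sup>+p\<in>S \<times> ?I. ennreal (snd p ^ CARD('n) * ?G (fst p)) \<partial>lebesgue)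
      = ennreal (1 / (real CARD('n) + 1)) * (\<integral>\<^sup>+u\<in>S. ennreal (?G u) \<partial>lborel)"
    unfolding nn_integral_completion by (rule nn_integral_cone[OF G S G0(1)])
  also have "(\<integral>\<^sup>+u\<in>S. ennreal (?G u) \<partial>lborel) = (\<integral>\<^sup>+u\<in>S. ennreal (area_density \<phi> u) * ennreal (energy (\<phi> u)) \<partial>lborel)"
    by (intro nn_integral_cong) (auto simp: indicator_def ennreal_mult' G0)
  also have "\<dots> = (\<integral>\<^sup>+x\<in>X. ennreal (energy x) \<partial>area_measure \<Sigma>)"
    unfolding S_def by (rule nn_integral_area_measure_patch[OF compact_surface C2_surface P.patch_axioms X measurable_energy, symmetric])
  finally show "(\<integral>\<^sup>+p\<in>S \<times> ?I. ennreal (snd p ^ CARD('n) * ?G (fst p)) \<partial>lebesgue)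
      = ennreal (1 / (real CARD('n) + 1)) * (\<integral>\<^sup>+x\<in>X. ennreal (energy x) \<partial>area_measure \<Sigma>)" .
  have "(\<lambda>p. ennreal (snd p ^ CARD('n) * (?G (fst p) * indicator S (fst p))) * indicator (UNIV \<times> ?I) p) \<in> borel_measurable borel"
  proof -
    have h: "(\<lambda>p :: (real^'n) \<times> real. ?G (fst p) * indicator S (fst p)) \<in> borel_measurable borel"
      unfolding borel_prod[symmetric] by (rule measurable_compose[OF measurable_fst G])
    have "snd \<in> borel_measurable (borel :: ((real^'n) \<times> real) measure)"
      by (simp add: borel_measurable_continuous_onI continuous_on_snd continuous_on_id)
    then have "(\<lambda>p :: (real^'n) \<times> real. ennreal (snd p ^ CARD('n) * (?G (fst p) * indicator S (fst p)))) \<in> borel_measurable borel"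
      by (rule measurable_compose[OF borel_measurable_times[OF borel_measurable_power h] measurable_ennreal])
    moreover have "(UNIV :: (real^'n) set) \<times> ?I \<in> sets borel" by (intro borel_Times) auto
    ultimately show ?thesis by (intro borel_measurable_times_ennreal borel_measurable_indicator)
  qed
  then have "(\<lambda>p. ennreal (snd p ^ CARD('n) * (?G (fst p) * indicator S (fst p))) * indicator (UNIV \<times> ?I) p) \<in> borel_measurable lebesgue"
    by (intro measurable_completion) simp
  moreover have "(\<lambda>p. ennreal (snd p ^ CARD('n) * (?G (fst p) * indicator S (fst p))) * indicator (UNIV \<times> ?I) p)
      = (\<lambda>p. ennreal (snd p ^ CARD('n) * ?G (fst p)) * indicator (S \<times> ?I) p)"
    by (auto simp: fun_eq_iff indicator_def)
  ultimately show "(\<lambda>p. ennreal (snd p ^ CARD('n) * ?G (fst p)) * indicator (S \<times> ?I) p) \<in> borel_measurable lebesgue" by simp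
qed

text \<open>Restates \<open>lin_scale_cone_le\<close> through the energy, with the equality
  condition freed from the patch so that it can be compared between charts.\<close>

lemma jacobian_le_energy:
  assumes P: "patch_normal \<Sigma> W U \<phi> \<phi>' \<phi>'' \<psi> \<nu>" and u: "u \<in> W" and t: "0 < t"
    and mx: "\<And>q. q \<in> \<Sigma> \<Longrightarrow> \<nu> (\<phi> u) \<bullet> (q - \<phi> u) \<le> 0"
  defines "D \<equiv> lin_scale (\<lambda>(h, s). t *\<^sub>R patch_normal.weingarten \<phi> \<phi>' \<phi>'' \<nu> u h + s *\<^sub>R (\<nu> (\<phi> u) - c *\<^sub>R E_last))"
  shows "D \<le> t ^ CARD('n) * (area_density \<phi> u * energy (\<phi> u))" "0 \<le> mean_curvature \<Sigma> \<nu> (\<phi> u)"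
    and "D = t ^ CARD('n) * (area_density \<phi> u * energy (\<phi> u)) \<longleftrightarrow>
      (\<forall>v\<in>tangent_space \<Sigma> (\<phi> u). frechet_derivative \<nu> (at (\<phi> u) within \<Sigma>) v = mean_curvature \<Sigma> \<nu> (\<phi> u) *\<^sub>R v)"
proof -
  interpret P: patch_normal \<Sigma> W U \<phi> \<phi>' \<phi>'' \<psi> \<nu> by fact
  have mx': "\<nu> (\<phi> u) \<bullet> \<phi> v \<le> \<nu> (\<phi> u) \<bullet> \<phi> u" if "v \<in> W" for v
    using mx[OF P.phi_in[OF that]] by (simp add: inner_diff_right)
  have w: "0 < 1 - (c *\<^sub>R E_last) \<bullet> \<nu> (\<phi> u)" unfolding weight_eq by (rule weight_pos[OF P.phi_in[OF u]])
  note L = P.lin_scale_cone_le[OF u mx' w, unfolded weight_eq, folded energy_def]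
  show "0 \<le> mean_curvature \<Sigma> \<nu> (\<phi> u)" by (rule L(1)) auto
  show "D \<le> t ^ CARD('n) * (area_density \<phi> u * energy (\<phi> u))"
    unfolding D_def by (rule L(3)) (use t in auto)
  have "D = t ^ CARD('n) * (area_density \<phi> u * energy (\<phi> u)) \<longleftrightarrow>
      (\<forall>h. P.weingarten u h = mean_curvature \<Sigma> \<nu> (\<phi> u) *\<^sub>R \<phi>' u h)"
    unfolding D_def by (rule L(4)) (use t in auto)
  also have "\<dots> \<longleftrightarrow> (\<forall>v\<in>tangent_space \<Sigma> (\<phi> u). frechet_derivative \<nu> (at (\<phi> u) within \<Sigma>) v = mean_curvature \<Sigma> \<nu> (\<phi> u) *\<^sub>R v)"
    unfolding P.tangent_space_eq[OF u] using P.shape_operator(3)[OF u] by simp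
  finally show "D = t ^ CARD('n) * (area_density \<phi> u * energy (\<phi> u)) \<longleftrightarrow>
      (\<forall>v\<in>tangent_space \<Sigma> (\<phi> u). frechet_derivative \<nu> (at (\<phi> u) within \<Sigma>) v = mean_curvature \<Sigma> \<nu> (\<phi> u) *\<^sub>R v)" .
qed

end

lemma AE_eq_of_nn_integral_eq:
  assumes f: "f \<in> borel_measurable M" and g: "g \<in> borel_measurable M" and le: "\<And>x. f x \<le> g x"
    and eq: "integral\<^sup>N M f = integral\<^sup>N M g" and fin: "integral\<^sup>N M f < \<infinity>"
  shows "AE x in M. f x = g x"
proof -
  have "(\<integral>\<^sup>+x. g x - f x \<partial>M) = integral\<^sup>N M g - integral\<^sup>N M f"
    by (rule nn_integral_diff[OF g f]) (use fin le in auto)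
  also have "\<dots> = 0" using eq fin by simp
  finally have "AE x in M. g x - f x = 0" by (subst (asm) nn_integral_0_iff_AE) (use f g in measurable)
  then show ?thesis
  proof eventually_elim
    case (elim x)
    then have "g x \<le> f x" by (simp add: diff_eq_0_iff_ennreal)
    then show ?case using le[of x] by simp
  qed
qed

section \<open>Summation over an atlas\<close>

context enclosing_surface
begin

lemma chart_partition:
  obtains N :: nat and W U :: "nat \<Rightarrow> (real^'n) set" and \<phi> :: "nat \<Rightarrow> real^'n \<Rightarrow> 'n space" and \<phi>' \<phi>'' \<psi> B
  where "\<And>i. i < N \<Longrightarrow> patch_normal \<Sigma> (W i) (U i) (\<phi> i) (\<phi>' i) (\<phi>'' i) (\<psi> i) \<nu>"
    "\<And>i. i < N \<Longrightarrow> B i \<in> sets borel" "\<And>i. B i \<subseteq> \<phi> i ` W i" "(\<Union>i<N. B i) = \<Sigma>" "disjoint_family_on B {..<N}"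
proof -
  obtain N :: nat and W :: "nat \<Rightarrow> (real^'n) set" and \<phi> :: "nat \<Rightarrow> real^'n \<Rightarrow> 'n space" where
    lp: "\<And>i. i < N \<Longrightarrow> local_parametrization \<Sigma> (W i) (\<phi> i)" and bd: "\<And>i. i < N \<Longrightarrow> bounded (W i)"
    and dK: "\<And>i. i < N \<Longrightarrow> \<exists>K. \<forall>u\<in>W i. area_density (\<phi> i) u \<le> K" and cov: "\<Sigma> = (\<Union>i<N. \<phi> i ` W i)"
    by (rule finite_atlas[OF compact_surface C2_surface], rule that)
  have "\<exists>U \<phi>' \<phi>'' \<psi>. patch_normal \<Sigma> (W i) U (\<phi> i) \<phi>' \<phi>'' \<psi> \<nu>" if "i < N" for i
    using local_parametrization_imp_patch[OF lp[OF that]] patch_normalI by blast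
  then obtain U \<phi>' \<phi>'' \<psi> where P: "\<And>i. i < N \<Longrightarrow> patch_normal \<Sigma> (W i) (U i) (\<phi> i) (\<phi>' i) (\<phi>'' i) (\<psi> i) \<nu>"
    by metis
  define B where "B i = \<phi> i ` W i - (\<Union>j<i. \<phi> j ` W j)" for i
  have BB: "\<And>i. i < N \<Longrightarrow> B i \<in> sets borel" "\<And>i. B i \<subseteq> \<phi> i ` W i" "(\<Union>i<N. B i) = \<Sigma>"
    "disjoint_family_on B {..<N}"
    by (rule emeasure_patch_sum[OF surface_borel lp cov, folded B_def]; assumption)+
  show ?thesis by (rule that[OF P BB])
qed

lemma sets_area_iff: "A \<in> sets (area_measure \<Sigma>) \<longleftrightarrow> A \<in> sets borel \<and> A \<subseteq> \<Sigma>"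
  using surface_borel by (auto simp: sets_area_measure[OF compact_surface C2_surface] sets_restrict_space_iff)

end

context capillary_surface
begin

abbreviation jac :: "(real^'n \<Rightarrow> 'n space) \<Rightarrow> (real^'n \<Rightarrow> (real^'n) \<Rightarrow>\<^sub>L 'n space)
    \<Rightarrow> (real^'n \<Rightarrow> (real^'n) \<Rightarrow>\<^sub>L (real^'n) \<Rightarrow>\<^sub>L 'n space) \<Rightarrow> (real^'n) \<times> real \<Rightarrow> real" where
  "jac \<phi> \<phi>' \<phi>'' \<equiv> \<lambda>(u, t). lin_scale (\<lambda>(h, s). t *\<^sub>R patch_normal.weingarten \<phi> \<phi>' \<phi>'' \<nu> u h + s *\<^sub>R (\<nu> (\<phi> u) - c *\<^sub>R E_last))"

abbreviation umbilic :: "'n space \<Rightarrow> bool" where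
  "umbilic x \<equiv> 0 \<le> mean_curvature \<Sigma> \<nu> x \<and>
    (\<forall>v\<in>tangent_space \<Sigma> x. frechet_derivative \<nu> (at x within \<Sigma>) v = mean_curvature \<Sigma> \<nu> x *\<^sub>R v)"

lemma measurable_energy_area: "(\<lambda>x. ennreal (energy x)) \<in> borel_measurable (area_measure \<Sigma>)"
  using measurable_energy measurable_cong_sets[OF sets_area_measure[OF compact_surface C2_surface] refl] by blast

lemma energy_integrable: "integrable (area_measure \<Sigma>) energy"
proof -
  have m: "energy \<in> borel_measurable (area_measure \<Sigma>)"
    using borel_measurable_continuous_on_restrict[OF cont_energy]
      measurable_cong_sets[OF sets_area_measure[OF compact_surface C2_surface] refl] by blast
  have "compact (energy ` \<Sigma>)" by (rule compact_continuous_image[OF cont_energy compact_surface])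
  then have "bounded (energy ` \<Sigma>)" by (rule compact_imp_bounded)
  then obtain K where K: "\<And>x. x \<in> \<Sigma> \<Longrightarrow> norm (energy x) \<le> K" unfolding bounded_iff by blast
  show ?thesis
  proof (rule integrableI_bounded[OF m])
    have "(\<integral>\<^sup>+x. ennreal (norm (energy x)) \<partial>area_measure \<Sigma>) \<le> (\<integral>\<^sup>+x. ennreal K \<partial>area_measure \<Sigma>)"
      by (rule nn_integral_mono) (use K in \<open>auto simp: space_area_measure[OF compact_surface C2_surface] intro!: ennreal_leI\<close>)
    also have "\<dots> = ennreal K * emeasure (area_measure \<Sigma>) \<Sigma>"
      by (simp add: space_area_measure[OF compact_surface C2_surface])
    also have "\<dots> < \<infinity>"
      using emeasure_area_measure_finite[OF compact_surface C2_surface] by (simp add: ennreal_mult_less_top)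
    finally show "(\<integral>\<^sup>+x. ennreal (norm (energy x)) \<partial>area_measure \<Sigma>) < \<infinity>" .
  qed
qed

lemma nn_integral_energy: "(\<integral>\<^sup>+x\<in>\<Sigma>. ennreal (energy x) \<partial>area_measure \<Sigma>) = ennreal (\<integral>x. energy x \<partial>area_measure \<Sigma>)"
proof -
  have "(\<integral>\<^sup>+x\<in>\<Sigma>. ennreal (energy x) \<partial>area_measure \<Sigma>) = (\<integral>\<^sup>+x. ennreal (energy x) \<partial>area_measure \<Sigma>)"
    by (rule nn_integral_cong) (simp add: space_area_measure[OF compact_surface C2_surface])
  also have "\<dots> = ennreal (\<integral>x. energy x \<partial>area_measure \<Sigma>)"
    by (rule nn_integral_eq_integral[OF energy_integrable])
      (rule AE_I2, simp add: space_area_measure[OF compact_surface C2_surface] energy_nonneg)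
  finally show ?thesis .
qed

lemma nn_integral_energy_split:
  fixes B :: "nat \<Rightarrow> 'n space set"
  assumes B: "\<And>i. i < N \<Longrightarrow> B i \<in> sets borel" "(\<Union>i<N. B i) = \<Sigma>" "disjoint_family_on B {..<N}" and X: "X \<in> sets borel" "X \<subseteq> \<Sigma>"
  shows "(\<Sum>i<N. \<integral>\<^sup>+x\<in>B i \<inter> X. ennreal (energy x) \<partial>area_measure \<Sigma>) + (\<integral>\<^sup>+x\<in>\<Sigma> - X. ennreal (energy x) \<partial>area_measure \<Sigma>)
    = (\<integral>\<^sup>+x\<in>\<Sigma>. ennreal (energy x) \<partial>area_measure \<Sigma>)"
proof -
  have sB: "B i \<inter> X \<in> sets (area_measure \<Sigma>)" if "i < N" for i
    using B(1)[OF that] X by (auto simp: sets_area_iff)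
  have sX: "\<Sigma> - X \<in> sets (area_measure \<Sigma>)" using X surface_borel by (auto simp: sets_area_iff)
  have mB: "(\<lambda>x. ennreal (energy x) * indicator (B i \<inter> X) x) \<in> borel_measurable (area_measure \<Sigma>)" if "i < N" for i
    by (intro borel_measurable_times_ennreal measurable_energy_area borel_measurable_indicator sB that)
  have "(\<Sum>i<N. \<integral>\<^sup>+x\<in>B i \<inter> X. ennreal (energy x) \<partial>area_measure \<Sigma>) + (\<integral>\<^sup>+x\<in>\<Sigma> - X. ennreal (energy x) \<partial>area_measure \<Sigma>)
      = (\<integral>\<^sup>+x. (\<Sum>i<N. ennreal (energy x) * indicator (B i \<inter> X) x) + ennreal (energy x) * indicator (\<Sigma> - X) x \<partial>area_measure \<Sigma>)"
  proof -
    have mS: "(\<lambda>x. \<Sum>i<N. ennreal (energy x) * indicator (B i \<inter> X) x) \<in> borel_measurable (area_measure \<Sigma>)"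
      by (rule borel_measurable_sum) (use mB in simp)
    have mX: "(\<lambda>x. ennreal (energy x) * indicator (\<Sigma> - X) x) \<in> borel_measurable (area_measure \<Sigma>)"
      by (intro borel_measurable_times_ennreal measurable_energy_area borel_measurable_indicator sX)
    show ?thesis unfolding nn_integral_add[OF mS mX] by (subst nn_integral_sum) (use mB in auto)
  qed
  also have "\<dots> = (\<integral>\<^sup>+x\<in>\<Sigma>. ennreal (energy x) \<partial>area_measure \<Sigma>)"
  proof (rule nn_integral_cong)
    fix x assume "x \<in> space (area_measure \<Sigma>)"
    then have x: "x \<in> \<Sigma>" by (simp add: space_area_measure[OF compact_surface C2_surface])
    have dj: "disjoint_family_on (\<lambda>i. B i \<inter> X) {..<N}" using B(3) unfolding disjoint_family_on_def by blast
    have "(\<Sum>i<N. indicator (B i \<inter> X) x :: ennreal) = indicator (\<Union>i<N. B i \<inter> X) x"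
      by (rule indicator_UN_disjoint[symmetric, OF _ dj]) simp
    moreover have "(\<Union>i<N. B i \<inter> X) = X" using B(2) X(2) by blast
    ultimately have "(\<Sum>i<N. ennreal (energy x) * indicator (B i \<inter> X) x) = ennreal (energy x) * indicator X x"
      by (simp flip: sum_distrib_left)
    then show "(\<Sum>i<N. ennreal (energy x) * indicator (B i \<inter> X) x) + ennreal (energy x) * indicator (\<Sigma> - X) x
        = ennreal (energy x) * indicator \<Sigma> x"
      using x by (simp add: indicator_def)
  qed
  finally show ?thesis .
qed

text \<open>The volume is at most the sum of the Jacobian integrals \<open>L\<close>, these are at
  most their bounds \<open>F\<close>, and these add up to the energy of the contact set. If the ends
  agree, no energy lies outside the contact set and \<open>L = F\<close> almost everywhere.\<close>

lemma
  shows volume_le_energy: "measure lebesgue truncated_ball \<le> 1 / (real CARD('n) + 1) * (\<integral>x. energy x \<partial>area_measure \<Sigma>)"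
    and umbilic_dense: "measure lebesgue truncated_ball = 1 / (real CARD('n) + 1) * (\<integral>x. energy x \<partial>area_measure \<Sigma>) \<Longrightarrow>
      open V \<Longrightarrow> V \<inter> \<Sigma> \<noteq> {} \<Longrightarrow> \<exists>x\<in>V \<inter> \<Sigma>. mean_curvature \<Sigma> \<nu> x = 0 \<or> (x \<in> contact \<and> umbilic x)"
proof -
  let ?\<mu> = "area_measure \<Sigma>" and ?I = "{0<..<1::real}" and ?k = "ennreal (1 / (real CARD('n) + 1))"
  obtain N :: nat and W U :: "nat \<Rightarrow> (real^'n) set" and \<phi> :: "nat \<Rightarrow> real^'n \<Rightarrow> 'n space" and \<phi>' \<phi>'' \<psi> B
    where P: "\<And>i. i < N \<Longrightarrow> patch_normal \<Sigma> (W i) (U i) (\<phi> i) (\<phi>' i) (\<phi>'' i) (\<psi> i) \<nu>"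
    and B: "\<And>i. i < N \<Longrightarrow> B i \<in> sets borel" "\<And>i. B i \<subseteq> \<phi> i ` W i" "(\<Union>i<N. B i) = \<Sigma>" "disjoint_family_on B {..<N}"
    by (rule chart_partition, rule that)
  have c\<Sigma>: "contact \<subseteq> \<Sigma>" by (auto simp: contact_def)
  define S where "S i = W i \<inter> \<phi> i -` (B i \<inter> contact)" for i
  define L where "L i p = ennreal (jac (\<phi> i) (\<phi>' i) (\<phi>'' i) p) * indicator (S i \<times> ?I) p" for i p
  define F where "F i p = ennreal (snd p ^ CARD('n) * (area_density (\<phi> i) (fst p) * energy (\<phi> i (fst p)))) * indicator (S i \<times> ?I) p" for i p
  have Bc: "B i \<inter> contact \<in> sets borel" "B i \<inter> contact \<subseteq> \<phi> i ` W i" if "i < N" for i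
    using B(1)[OF that] B(2)[of i] contact_borel by auto
  note cm = cone_map_measurable[OF P Bc, folded S_def] cone_map_emeasure_le[OF P Bc, folded S_def L_def]
  have Lm: "L i \<in> borel_measurable lebesgue" if "i < N" for i
    using cone_map_jacobian_measurable[OF P Bc, folded S_def, OF that that that] unfolding L_def[abs_def] .
  have Fm: "F i \<in> borel_measurable lebesgue" if "i < N" for i
    using energy_cone_measurable[OF P Bc, folded S_def, OF that that that] unfolding F_def[abs_def] .
  have ctx: "q \<in> \<Sigma> \<Longrightarrow> \<nu> (\<phi> i u) \<bullet> (q - \<phi> i u) \<le> 0" "u \<in> W i" "\<phi> i u \<in> contact" "\<phi> i u \<in> \<Sigma>" if "u \<in> S i" for i u q
    using that c\<Sigma> surface_in_closure by (auto simp: S_def contact_def)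
  have LF: "L i p \<le> F i p" if "i < N" for i p
  proof (cases "p \<in> S i \<times> ?I")
    case True
    then obtain u t where p: "p = (u, t)" "u \<in> S i" "0 < t" by auto
    show ?thesis using jacobian_le_energy(1)[OF P[OF that] ctx(2)[OF p(2)] p(3) ctx(1)[OF p(2)]] True
      by (simp add: L_def F_def p(1) ennreal_leI)
  qed (simp add: L_def F_def)
  have FY: "integral\<^sup>N lebesgue (F i) = ?k * (\<integral>\<^sup>+x\<in>B i \<inter> contact. ennreal (energy x) \<partial>?\<mu>)" if "i < N" for i
    using nn_integral_energy_cone[OF P Bc, folded S_def, OF that that that] unfolding F_def[abs_def] .
  have cov: "truncated_ball \<subseteq> (\<Union>i<N. cone_map (\<phi> i) ` (S i \<times> ?I))"
  proof
    fix z assume "z \<in> truncated_ball"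
    then obtain x t where x: "x \<in> contact" "t \<in> ?I" "z = t *\<^sub>R (\<nu> x - c *\<^sub>R E_last)" using truncated_ball_covered by blast
    then obtain i where i: "i < N" "x \<in> B i" using B(3) c\<Sigma> by blast
    then obtain u where u: "u \<in> W i" "x = \<phi> i u" using B(2)[of i] by blast
    have "(u, t) \<in> S i \<times> ?I" using u x i by (auto simp: S_def)
    moreover have "z = cone_map (\<phi> i) (u, t)" using x(3) u(2) by (simp add: cone_map_def)
    ultimately show "z \<in> (\<Union>i<N. cone_map (\<phi> i) ` (S i \<times> ?I))" using i(1) by blast
  qed
  have T1: "emeasure lebesgue truncated_ball \<le> (\<Sum>i<N. integral\<^sup>N lebesgue (L i))"
  proof -
    have m: "cone_map (\<phi> i) ` (S i \<times> ?I) \<in> sets lebesgue" if "i < N" for i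
      using cone_map_measurable[OF P Bc, folded S_def, OF that that that] .
    have "emeasure lebesgue truncated_ball \<le> emeasure lebesgue (\<Union>i<N. cone_map (\<phi> i) ` (S i \<times> ?I))"
      by (rule emeasure_mono[OF cov]) (use m in auto)
    also have "\<dots> \<le> (\<Sum>i<N. emeasure lebesgue (cone_map (\<phi> i) ` (S i \<times> ?I)))"
      by (rule emeasure_subadditive_finite) (use m in auto)
    also have "\<dots> \<le> (\<Sum>i<N. integral\<^sup>N lebesgue (L i))"
    proof (rule sum_mono)
      fix i assume "i \<in> {..<N}"
      then have i: "i < N" by simp
      show "emeasure lebesgue (cone_map (\<phi> i) ` (S i \<times> ?I)) \<le> integral\<^sup>N lebesgue (L i)"
        using cone_map_emeasure_le[OF P Bc, folded S_def, OF i i i] unfolding L_def[abs_def] .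
    qed
    finally show ?thesis .
  qed
  have X_le_Y: "(\<Sum>i<N. integral\<^sup>N lebesgue (L i)) \<le> (\<Sum>i<N. integral\<^sup>N lebesgue (F i))"
    by (intro sum_mono nn_integral_mono LF) simp
  \<comment> \<open>The energy outside the contact set, which the volume bound discards and which
    equality forces to vanish.\<close>
  let ?R = "?k * (\<integral>\<^sup>+x\<in>\<Sigma> - contact. ennreal (energy x) \<partial>?\<mu>)"
  have YZ: "(\<Sum>i<N. integral\<^sup>N lebesgue (F i)) + ?R = ?k * ennreal (\<integral>x. energy x \<partial>?\<mu>)"
  proof -
    have "(\<Sum>i<N. integral\<^sup>N lebesgue (F i)) = ?k * (\<Sum>i<N. \<integral>\<^sup>+x\<in>B i \<inter> contact. ennreal (energy x) \<partial>?\<mu>)"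
      by (simp add: FY sum_distrib_left)
    then show ?thesis
      using nn_integral_energy_split[OF B(1) B(3,4) contact_borel c\<Sigma>] nn_integral_energy
      by (simp flip: distrib_left)
  qed
  have int0: "0 \<le> (\<integral>x. energy x \<partial>?\<mu>)"
    by (rule integral_nonneg_AE) (rule AE_I2, simp add: space_area_measure[OF compact_surface C2_surface] energy_nonneg)
  have Z: "?k * ennreal (\<integral>x. energy x \<partial>?\<mu>) = ennreal (1 / (real CARD('n) + 1) * (\<integral>x. energy x \<partial>?\<mu>))"
    by (rule ennreal_mult[symmetric]) (use int0 in auto)
  have eT: "emeasure lebesgue truncated_ball = ennreal (measure lebesgue truncated_ball)"
    using truncated_ball_finite by (intro emeasure_eq_ennreal_measure) (simp add: less_top[symmetric])
  have "(\<Sum>i<N. integral\<^sup>N lebesgue (F i)) \<le> ?k * ennreal (\<integral>x. energy x \<partial>?\<mu>)"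
    unfolding YZ[symmetric] by simp
  then have "emeasure lebesgue truncated_ball \<le> ennreal (1 / (real CARD('n) + 1) * (\<integral>x. energy x \<partial>?\<mu>))"
    using T1 X_le_Y unfolding Z by (meson order_trans)
  then show "measure lebesgue truncated_ball \<le> 1 / (real CARD('n) + 1) * (\<integral>x. energy x \<partial>?\<mu>)"
    unfolding eT using int0 by (subst (asm) ennreal_le_iff) auto
  assume eq: "measure lebesgue truncated_ball = 1 / (real CARD('n) + 1) * (\<integral>x. energy x \<partial>?\<mu>)"
    and V: "open V" "V \<inter> \<Sigma> \<noteq> {}"
  \<comment> \<open>Equality closes the chain of estimates: the total energy is bounded by the
    volume, hence by the Jacobian integrals.\<close>
  have YRX: "(\<Sum>i<N. integral\<^sup>N lebesgue (F i)) + ?R \<le> (\<Sum>i<N. integral\<^sup>N lebesgue (L i))"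
    using T1 unfolding YZ Z eT eq .
  have finZ: "(\<Sum>i<N. integral\<^sup>N lebesgue (F i)) + ?R < \<infinity>" unfolding YZ Z by simp
  then have finY: "(\<Sum>i<N. integral\<^sup>N lebesgue (F i)) < \<infinity>" by (meson le_less_trans le_add_same_cancel1 zero_le order_le_less_trans add_increasing2 order_refl)
  have "(\<Sum>i<N. integral\<^sup>N lebesgue (F i)) + ?R \<le> (\<Sum>i<N. integral\<^sup>N lebesgue (F i)) + 0"
    using order_trans[OF YRX X_le_Y] by simp
  then have "?R \<le> 0" using finY by (simp only: ennreal_add_left_cancel_le) (metis infinity_ennreal_def less_irrefl)
  then have R0: "?R = 0" by (simp only: le_zero_eq)
  have sumeq: "(\<Sum>i<N. integral\<^sup>N lebesgue (F i)) \<le> (\<Sum>i<N. integral\<^sup>N lebesgue (L i))"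
    using YRX R0 by simp
  have finF: "integral\<^sup>N lebesgue (F i) < \<infinity>" if "i < N" for i
    using finY that by simp
  \<comment> \<open>Inequality in every term and equal totals give equality in every term; the
    remaining summands are finite and can be cancelled.\<close>
  have eqi: "integral\<^sup>N lebesgue (L j) = integral\<^sup>N lebesgue (F j)" if j: "j < N" for j
  proof (rule antisym)
    show "integral\<^sup>N lebesgue (L j) \<le> integral\<^sup>N lebesgue (F j)" by (intro nn_integral_mono LF j)
    let ?Q = "\<Sum>i\<in>{..<N}-{j}. integral\<^sup>N lebesgue (F i)"
    have "?Q + integral\<^sup>N lebesgue (F j) = (\<Sum>i<N. integral\<^sup>N lebesgue (F i))"
      using j by (simp add: sum.remove[of "{..<N}" j] add.commute)
    also have "\<dots> \<le> (\<Sum>i<N. integral\<^sup>N lebesgue (L i))" by (rule sumeq)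
    also have "\<dots> = (\<Sum>i\<in>{..<N}-{j}. integral\<^sup>N lebesgue (L i)) + integral\<^sup>N lebesgue (L j)"
      using j by (simp add: sum.remove[of "{..<N}" j] add.commute)
    also have "\<dots> \<le> ?Q + integral\<^sup>N lebesgue (L j)"
      by (intro add_right_mono sum_mono nn_integral_mono LF) auto
    finally have "?Q + integral\<^sup>N lebesgue (F j) \<le> ?Q + integral\<^sup>N lebesgue (L j)" .
    moreover have "?Q < \<infinity>" using finF by simp
    ultimately show "integral\<^sup>N lebesgue (F j) \<le> integral\<^sup>N lebesgue (L j)"
      by (simp only: ennreal_add_left_cancel_le) (metis infinity_ennreal_def less_irrefl)
  qed
  \<comment> \<open>Without such a point, the contact part of \<open>V \<inter> \<Sigma>\<close> and
    the rest would both be null, although its area is positive.\<close>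
  show "\<exists>x\<in>V \<inter> \<Sigma>. mean_curvature \<Sigma> \<nu> x = 0 \<or> (x \<in> contact \<and> umbilic x)"
  proof (rule ccontr)
    assume "\<not> ?thesis"
    then have no: "mean_curvature \<Sigma> \<nu> x \<noteq> 0" "x \<in> contact \<Longrightarrow> \<not> umbilic x" if "x \<in> V" "x \<in> \<Sigma>" for x
      using that by blast+
    have Vb: "V \<in> sets borel" using V(1) by simp
    have s1: "V \<inter> (\<Sigma> - contact) \<in> sets ?\<mu>" using Vb surface_borel contact_borel by (auto simp: sets_area_iff)
    have n1: "emeasure ?\<mu> (V \<inter> (\<Sigma> - contact)) = 0"
    proof -
      have sc: "\<Sigma> - contact \<in> sets ?\<mu>" using surface_borel contact_borel by (auto simp: sets_area_iff)
      have "1 / (real CARD('n) + 1) \<noteq> 0" by (simp add: add_nonneg_eq_0_iff)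
      then have "(\<integral>\<^sup>+x\<in>\<Sigma> - contact. ennreal (energy x) \<partial>?\<mu>) = 0" using R0 by (simp add: ennreal_eq_0_iff)
      moreover have m: "(\<lambda>x. ennreal (energy x) * indicator (\<Sigma> - contact) x) \<in> borel_measurable ?\<mu>"
        by (intro borel_measurable_times_ennreal measurable_energy_area borel_measurable_indicator sc)
      ultimately have "AE x in ?\<mu>. ennreal (energy x) * indicator (\<Sigma> - contact) x = 0"
        using nn_integral_0_iff_AE[OF m] by simp
      then have "AE x in ?\<mu>. x \<notin> V \<inter> (\<Sigma> - contact)"
      proof eventually_elim
        case (elim x)
        show ?case
        proof
          assume x: "x \<in> V \<inter> (\<Sigma> - contact)"
          then have "energy x = 0" using elim energy_nonneg[of x] by (simp add: ennreal_eq_0_iff)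
          then show False using x no(1)[of x] energy_zero_iff[of x] by simp
        qed
      qed
      then show ?thesis using AE_iff_null_sets[OF s1] by auto
    qed
    have n2: "emeasure ?\<mu> (V \<inter> (B i \<inter> contact)) = 0" if i: "i < N" for i
    proof -
      interpret P: patch_normal \<Sigma> "W i" "U i" "\<phi> i" "\<phi>' i" "\<phi>'' i" "\<psi> i" \<nu> by (rule P[OF i])
      have VB: "V \<inter> (B i \<inter> contact) \<in> sets borel" using Vb Bc[OF i] by auto
      define Q where "Q = W i \<inter> \<phi> i -` (V \<inter> (B i \<inter> contact))"
      have Qb: "Q \<in> sets borel" unfolding Q_def by (rule P.phi_vimage_borel[OF VB])
      have QIb: "Q \<times> ?I \<in> sets borel" using Qb by (intro borel_Times) auto
      have "AE p in lebesgue. L i p = F i p"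
        by (rule AE_eq_of_nn_integral_eq[OF Lm[OF i] Fm[OF i] LF[OF i] eqi[OF i]]) (use finF[OF i] eqi[OF i] in simp)
      then have "AE p in lebesgue. p \<notin> Q \<times> ?I"
      proof eventually_elim
        case (elim p)
        show ?case
        proof
          assume "p \<in> Q \<times> ?I"
          then obtain u t where p: "p = (u, t)" "u \<in> Q" "t \<in> ?I" by auto
          have uS: "u \<in> S i" using p(2) by (auto simp: Q_def S_def)
          have t: "0 < t" using p(3) by simp
          have D0: "0 \<le> jac (\<phi> i) (\<phi>' i) (\<phi>'' i) p" by (simp add: p(1))
          have E0: "0 \<le> area_density (\<phi> i) u * energy (\<phi> i u)"
            using P.principal_curvatures[OF ctx(2)[OF uS]] energy_nonneg[OF ctx(4)[OF uS]]
            by (metis less_imp_le mult_nonneg_nonneg)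
          have "jac (\<phi> i) (\<phi>' i) (\<phi>'' i) p = t ^ CARD('n) * (area_density (\<phi> i) u * energy (\<phi> i u))"
            using elim uS p(3) E0 t D0 by (simp add: L_def F_def p(1))
          then have "umbilic (\<phi> i u)"
            using jacobian_le_energy(2,3)[OF P[OF i] ctx(2)[OF uS] t ctx(1)[OF uS]] by (simp add: p(1))
          then show False using no(2)[of "\<phi> i u"] ctx[OF uS] p(2) by (auto simp: Q_def)
        qed
      qed
      \<comment> \<open>Almost everywhere refers to pairs of a parameter and a dilation; as
        \<open>?I\<close> has positive length, a null product leaves a null set of
        parameters.\<close>
      then have "AE p in lborel. p \<notin> Q \<times> ?I" by (simp add: AE_completion_iff)
      then have "Q \<times> ?I \<in> null_sets lborel" using AE_iff_null_sets[of "Q \<times> ?I" lborel] QIb by simp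
      then have "emeasure lborel (Q \<times> ?I) = 0" by auto
      then have "emeasure (lborel \<Otimes>\<^sub>M lborel) (Q \<times> ?I) = 0" by (simp add: lborel_prod)
      then have "emeasure lborel Q * emeasure lborel ?I = 0"
        by (subst (asm) lborel.emeasure_pair_measure_Times) (use Qb in auto)
      then have Q0: "Q \<in> null_sets lborel" using Qb by (auto simp: null_sets_def)
      have "emeasure ?\<mu> (V \<inter> (B i \<inter> contact)) = (\<integral>\<^sup>+u\<in>Q. ennreal (area_density (\<phi> i) u) \<partial>lborel)"
        unfolding Q_def
        by (rule emeasure_area_measure[OF compact_surface C2_surface P.local_parametrization VB]) (use B(2)[of i] in auto)
      also have "\<dots> = 0" by (rule nn_integral_null_set[OF Q0])
      finally show ?thesis .
    qed
    have "V \<inter> \<Sigma> \<subseteq> (V \<inter> (\<Sigma> - contact)) \<union> (\<Union>i<N. V \<inter> (B i \<inter> contact))" using B(3) by blast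
    moreover have "(V \<inter> (\<Sigma> - contact)) \<union> (\<Union>i<N. V \<inter> (B i \<inter> contact)) \<in> null_sets ?\<mu>"
    proof (intro null_sets.Un null_sets.finite_UN)
      show "V \<inter> (\<Sigma> - contact) \<in> null_sets ?\<mu>" using n1 s1 by (auto simp: null_sets_def)
      show "V \<inter> (B i \<inter> contact) \<in> null_sets ?\<mu>" if "i \<in> {..<N}" for i
        using n2[of i] that Vb Bc[of i] c\<Sigma> by (auto simp: null_sets_def sets_area_iff)
    qed simp
    moreover have "V \<inter> \<Sigma> \<in> sets ?\<mu>" using Vb surface_borel by (auto simp: sets_area_iff)
    ultimately have "V \<inter> \<Sigma> \<in> null_sets ?\<mu>" by (metis null_sets_subset)
    then have "emeasure ?\<mu> (V \<inter> \<Sigma>) = 0" by auto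
    moreover obtain x where "x \<in> V" "x \<in> \<Sigma>" using V(2) by blast
    ultimately show False using area_measure_open_pos[OF V(1), of x] by simp
  qed
qed

end

section \<open>The equality case\<close>

context patch
begin

lemma sq_dist_curve_derivatives:
  assumes "u \<in> W"
  obtains d where "d > 0"
    "\<And>t. \<bar>t\<bar> < d \<Longrightarrow> ((\<lambda>t. (dist (\<phi> (u + t *\<^sub>R h)) a)^2) has_real_derivative
      2 * ((\<phi> (u + t *\<^sub>R h) - a) \<bullet> \<phi>' (u + t *\<^sub>R h) h)) (at t)"
    "((\<lambda>t. 2 * ((\<phi> (u + t *\<^sub>R h) - a) \<bullet> \<phi>' (u + t *\<^sub>R h) h)) has_real_derivative
      2 * ((\<phi> u - a) \<bullet> \<phi>'' u h h + \<phi>' u h \<bullet> \<phi>' u h)) (at 0)"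
proof -
  obtain d where d: "d > 0"
    "\<And>t. \<bar>t\<bar> < d \<Longrightarrow> ((\<lambda>t. \<phi> (u + t *\<^sub>R h)) has_vector_derivative \<phi>' (u + t *\<^sub>R h) h) (at t)"
    "((\<lambda>t. \<phi>' (u + t *\<^sub>R h) h) has_vector_derivative \<phi>'' u h h) (at 0)"
    using curve_derivatives[OF assms, of h] by metis
  have D: "((\<lambda>t. \<phi> (u + t *\<^sub>R h) - a) has_vector_derivative \<phi>' (u + t *\<^sub>R h) h) (at t)" if "\<bar>t\<bar> < d" for t
    using has_vector_derivative_diff[OF d(2)[OF that] has_vector_derivative_const[of a]] by simp
  have ip: "((\<lambda>t. f t \<bullet> g t) has_real_derivative (f t0 \<bullet> g' + f' \<bullet> g t0)) (at t0)"
    if "(f has_vector_derivative f') (at t0)" "(g has_vector_derivative g') (at t0)"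
    for f g :: "real \<Rightarrow> 'n space" and f' g' t0
    using bounded_bilinear.has_vector_derivative[OF bounded_bilinear_inner that]
    by (simp add: has_real_derivative_iff_has_vector_derivative)
  show ?thesis
  proof (rule that[OF d(1)])
    show "((\<lambda>t. (dist (\<phi> (u + t *\<^sub>R h)) a)^2) has_real_derivative
      2 * ((\<phi> (u + t *\<^sub>R h) - a) \<bullet> \<phi>' (u + t *\<^sub>R h) h)) (at t)" if "\<bar>t\<bar> < d" for t
      using ip[OF D[OF that] D[OF that]] by (simp add: dist_norm power2_norm_eq_inner inner_commute)
    show "((\<lambda>t. 2 * ((\<phi> (u + t *\<^sub>R h) - a) \<bullet> \<phi>' (u + t *\<^sub>R h) h)) has_real_derivative
      2 * ((\<phi> u - a) \<bullet> \<phi>'' u h h + \<phi>' u h \<bullet> \<phi>' u h)) (at 0)"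
      using DERIV_cmult[OF ip[OF D d(3)], of 2] d(1) by simp
  qed
qed

lemma eventually_along_segment:
  assumes "u \<in> W" "open T" "\<phi> u \<in> T"
  shows "\<forall>\<^sub>F t in at_right 0. \<phi> (u + t *\<^sub>R h) \<in> T"
proof -
  obtain d where d: "d > 0"
    "\<And>t. \<bar>t\<bar> < d \<Longrightarrow> ((\<lambda>t. \<phi> (u + t *\<^sub>R h)) has_vector_derivative \<phi>' (u + t *\<^sub>R h) h) (at t)"
    using curve_derivatives[OF assms(1), of h] by metis
  have "isCont (\<lambda>t. \<phi> (u + t *\<^sub>R h)) 0"
    using has_derivative_continuous[OF d(2)[of 0, unfolded has_vector_derivative_def]] d(1) by simp
  then have "((\<lambda>t. \<phi> (u + t *\<^sub>R h)) \<longlongrightarrow> \<phi> u) (at_right 0)"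
    using filterlim_at_split by (force simp: isCont_def)
  from topological_tendstoD[OF this assms(2,3)] show ?thesis .
qed

end

context enclosing_surface
begin

text \<open>The vector in the hypothesis is the projection of \<open>E\<close> to the tangent space, which points into \<open>\<Sigma>\<close>.\<close>

lemma farthest_point_not_on_boundary:
  assumes K: "openin (top_of_set \<Sigma>) K" and x: "x \<in> K" "snd x = 0"
    and T: "0 < (x - a) \<bullet> (E_last - snd (\<nu> x) *\<^sub>R \<nu> x)"
  shows "\<exists>y\<in>K. dist x a < dist y a"
proof (rule ccontr)
  assume "\<not> ?thesis"
  then have mx: "dist y a \<le> dist x a" if "y \<in> K" for y using that by force
  obtain T' where T': "open T'" "K = \<Sigma> \<inter> T'" using K by (auto simp: openin_open)
  have xS: "x \<in> \<Sigma>" "x \<in> T'" using x T' by auto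
  obtain W U \<phi> \<phi>' \<phi>'' \<psi> u k r where P: "patch_normal \<Sigma> W U \<phi> \<phi>' \<phi>'' \<psi> \<nu>" and u: "u \<in> W" "\<phi> u = x"
    and r: "0 < r" "\<And>v. v \<in> ball u r \<Longrightarrow> v \<in> W \<longleftrightarrow> 0 \<le> v $ k" "u $ k = 0"
    and z: "\<And>i. i \<noteq> k \<Longrightarrow> snd (\<phi>' u (axis i 1)) = 0" and pos: "0 < snd (\<phi>' u (axis k 1))"
    by (rule boundary_chart[OF xS(1) x(2)]) (rule that)
  interpret P: patch_normal \<Sigma> W U \<phi> \<phi>' \<phi>'' \<psi> \<nu> by fact
  let ?T = "E_last - snd (\<nu> x) *\<^sub>R \<nu> x"
  have "\<nu> (\<phi> u) \<bullet> ?T = 0" using nu_nu[OF xS(1)] u(2) by (simp add: inner_diff_right)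
  then obtain h where h: "?T = \<phi>' u h" using P.tangentE[OF u(1)] by blast
  have "snd (\<phi>' u h) = (\<Sum>i\<in>UNIV. h $ i * snd (\<phi>' u (axis i 1)))"
  proof -
    have "\<phi>' u h = \<phi>' u (\<Sum>i\<in>UNIV. h $ i *\<^sub>R axis i 1)"
      by (subst basis_expansion[of h, symmetric]) (simp add: scalar_mult_eq_scaleR)
    then show ?thesis by (simp add: blinfun.sum_right blinfun.scaleR_right snd_sum)
  qed
  also have "\<dots> = h $ k * snd (\<phi>' u (axis k 1))" by (subst sum.remove[of _ k]) (auto simp: z)
  finally have "snd ?T = h $ k * snd (\<phi>' u (axis k 1))" by (simp add: h)
  moreover have "snd ?T = 1 - (snd (\<nu> x))^2" by (simp add: power2_eq_square)
  \<comment> \<open>The tangential projection of \<open>E_last\<close> has positive height, so its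
    parameter direction points from the edge into the half-space.\<close>
  ultimately have hk: "0 < h $ k" using nu_not_vertical[OF xS(1) x(2)] pos by (metis diff_gt_0_iff_gt zero_less_mult_pos2)
  obtain d where d: "d > 0"
    "\<And>t. \<bar>t\<bar> < d \<Longrightarrow> ((\<lambda>t. (dist (\<phi> (u + t *\<^sub>R h)) a)^2) has_real_derivative
      2 * ((\<phi> (u + t *\<^sub>R h) - a) \<bullet> \<phi>' (u + t *\<^sub>R h) h)) (at t)"
    by (rule P.sq_dist_curve_derivatives[OF u(1), of h a]) blast
  have "((\<lambda>t. (dist (\<phi> (u + t *\<^sub>R h)) a)^2) has_real_derivative 2 * ((x - a) \<bullet> ?T)) (at 0)"
    using d(2)[of 0] d(1) u(2) h by simp
  from DERIV_pos_inc_right[OF this] T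
  obtain e where e: "e > 0" "\<And>t. 0 < t \<Longrightarrow> t < e \<Longrightarrow> (dist x a)^2 < (dist (\<phi> (u + t *\<^sub>R h)) a)^2"
    using u(2) by auto
  have "\<forall>\<^sub>F t in at_right 0. \<phi> (u + t *\<^sub>R h) \<in> T'"
    by (rule P.eventually_along_segment[OF u(1) T'(1)]) (use u xS in simp)
  moreover have "\<forall>\<^sub>F t in at_right 0. t < min e (r / (norm h + 1))"
    by (rule order_tendstoD(2)[OF tendsto_ident_at]) (use e(1) r(1) in \<open>simp add: add_nonneg_pos\<close>)
  moreover have "\<forall>\<^sub>F t in at_right 0. (0::real) < t" by (rule eventually_at_right_less)
  ultimately have "\<forall>\<^sub>F t in at_right (0::real). False"
  proof eventually_elim
    case (elim t)
    have "t * (norm h + 1) < r" using elim by (simp add: pos_less_divide_eq add_nonneg_pos)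
    then have "t * norm h < r" using elim by (simp add: algebra_simps)
    then have "u + t *\<^sub>R h \<in> W" using r(2)[of "u + t *\<^sub>R h"] r(3) hk elim by (simp add: dist_norm)
    then have "\<phi> (u + t *\<^sub>R h) \<in> K" using T'(2) elim P.phi_in by simp
    from mx[OF this] have "(dist (\<phi> (u + t *\<^sub>R h)) a)^2 \<le> (dist x a)^2" by (simp add: power_mono)
    moreover have "(dist x a)^2 < (dist (\<phi> (u + t *\<^sub>R h)) a)^2" by (rule e(2)) (use elim in auto)
    ultimately show False by linarith
  qed
  then show False by simp
qed

text \<open>The first-order condition gives \<open>x - a = m *\<^sub>R \<nu> x\<close>, the
  second-order one \<open>m * l i \<ge> 1\<close> for every principal curvature. Whatever the sign
  of \<open>m\<close>, the curvatures cannot add up to zero.\<close>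

lemma farthest_point_nonflat:
  assumes K: "openin (top_of_set \<Sigma>) K" and x: "x \<in> K" "0 < snd x"
    and mx: "\<And>y. y \<in> K \<Longrightarrow> dist y a \<le> dist x a"
  shows "mean_curvature \<Sigma> \<nu> x \<noteq> 0"
proof
  assume H0: "mean_curvature \<Sigma> \<nu> x = 0"
  obtain T where T: "open T" "K = \<Sigma> \<inter> T" using K by (auto simp: openin_open)
  have xS: "x \<in> \<Sigma>" "x \<in> T" using x T by auto
  obtain W U \<phi> \<phi>' \<phi>'' \<psi> u where P: "patch_normal \<Sigma> W U \<phi> \<phi>' \<phi>'' \<psi> \<nu>" and W: "open W" "u \<in> W" "\<phi> u = x"
    using interior_chart[OF xS(1) not_boundary[OF x(2)]] by metis
  interpret P: patch_normal \<Sigma> W U \<phi> \<phi>' \<phi>'' \<psi> \<nu> by fact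
  have mono: "\<exists>e>0. \<forall>t. 0 \<le> t \<and> t < e \<longrightarrow> (dist (\<phi> (u + t *\<^sub>R h)) a)^2 \<le> (dist (\<phi> (u + 0 *\<^sub>R h)) a)^2" for h
  proof -
    have "\<forall>\<^sub>F t in at_right 0. \<phi> (u + t *\<^sub>R h) \<in> T"
      by (rule P.eventually_along_segment[OF W(2) T(1)]) (use W xS in simp)
    moreover have "\<forall>\<^sub>F t in at_right 0. u + t *\<^sub>R h \<in> W"
    proof -
      have "((\<lambda>t. u + t *\<^sub>R h) \<longlongrightarrow> u + 0 *\<^sub>R h) (at_right 0)" by (intro tendsto_intros)
      then show ?thesis using topological_tendstoD[OF _ W(1)] W(2) by simp
    qed
    ultimately have "\<forall>\<^sub>F t in at_right 0. (dist (\<phi> (u + t *\<^sub>R h)) a)^2 \<le> (dist x a)^2"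
    proof eventually_elim
      case (elim t)
      then have "\<phi> (u + t *\<^sub>R h) \<in> K" using T(2) P.phi_in by simp
      from mx[OF this] show ?case by (simp add: power_mono)
    qed
    then obtain e where "e > 0" "\<And>t. 0 < t \<Longrightarrow> t < e \<Longrightarrow> (dist (\<phi> (u + t *\<^sub>R h)) a)^2 \<le> (dist x a)^2"
      unfolding eventually_at_right_field by auto
    then show ?thesis using W(3) by (intro exI[of _ e]) (auto simp: le_less)
  qed
  have first: "(x - a) \<bullet> \<phi>' u h \<le> 0" for h
  proof (rule ccontr)
    assume n: "\<not> (x - a) \<bullet> \<phi>' u h \<le> 0"
    obtain d where d: "d > 0"
      "\<And>t. \<bar>t\<bar> < d \<Longrightarrow> ((\<lambda>t. (dist (\<phi> (u + t *\<^sub>R h)) a)^2) has_real_derivative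
        2 * ((\<phi> (u + t *\<^sub>R h) - a) \<bullet> \<phi>' (u + t *\<^sub>R h) h)) (at t)"
      by (rule P.sq_dist_curve_derivatives[OF W(2), of h a]) blast
    have "((\<lambda>t. (dist (\<phi> (u + t *\<^sub>R h)) a)^2) has_real_derivative 2 * ((x - a) \<bullet> \<phi>' u h)) (at 0)"
      using d(2)[of 0] d(1) W(3) by simp
    from DERIV_pos_inc_right[OF this] n
    obtain e where e: "e > 0" "\<And>t. 0 < t \<Longrightarrow> t < e \<Longrightarrow> (dist x a)^2 < (dist (\<phi> (u + t *\<^sub>R h)) a)^2"
      using W(3) by auto
    obtain e' where e': "e' > 0" "\<And>t. 0 \<le> t \<Longrightarrow> t < e' \<Longrightarrow> (dist (\<phi> (u + t *\<^sub>R h)) a)^2 \<le> (dist x a)^2"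
      using mono[of h] W(3) by auto
    define t where "t = min e e' / 2"
    have t: "0 < t" "t < e" "t < e'" using e e' by (auto simp: t_def)
    show False using e(2)[OF t(1,2)] e'(2)[OF less_imp_le[OF t(1)] t(3)] by linarith
  qed
  have zero: "(x - a) \<bullet> \<phi>' u h = 0" for h using first[of h] first[of "- h"] by (simp add: blinfun.minus_right)
  define m where "m = (x - a) \<bullet> \<nu> x"
  have xa: "x - a = m *\<^sub>R \<nu> x" using P.orth_tangent_imp_multiple[OF W(2) zero] W(3) by (simp add: m_def)
  have second: "m * (\<nu> x \<bullet> \<phi>'' u h h) + \<phi>' u h \<bullet> \<phi>' u h \<le> 0" for h
  proof -
    obtain d where d: "d > 0"
      "\<And>t. \<bar>t\<bar> < d \<Longrightarrow> ((\<lambda>t. (dist (\<phi> (u + t *\<^sub>R h)) a)^2) has_real_derivative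
        2 * ((\<phi> (u + t *\<^sub>R h) - a) \<bullet> \<phi>' (u + t *\<^sub>R h) h)) (at t)"
      "((\<lambda>t. 2 * ((\<phi> (u + t *\<^sub>R h) - a) \<bullet> \<phi>' (u + t *\<^sub>R h) h)) has_real_derivative
      2 * ((\<phi> u - a) \<bullet> \<phi>'' u h h + \<phi>' u h \<bullet> \<phi>' u h)) (at 0)"
      by (rule P.sq_dist_curve_derivatives[OF W(2), of h a]) blast
    obtain e where e: "e > 0" "\<And>t. 0 \<le> t \<Longrightarrow> t < e \<Longrightarrow> (dist (\<phi> (u + t *\<^sub>R h)) a)^2 \<le> (dist (\<phi> (u + 0 *\<^sub>R h)) a)^2"
      using mono[of h] by auto
    have "2 * ((\<phi> u - a) \<bullet> \<phi>'' u h h + \<phi>' u h \<bullet> \<phi>' u h) \<le> 0"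
      by (rule second_derivative_nonpos_at_max[of "min d e", OF _ d(2) d(3)]) (use d e zero W(3) in auto)
    then show ?thesis by (simp add: W(3) xa)
  qed
  obtain l :: "'n \<Rightarrow> real" where tr: "real CARD('n) * mean_curvature \<Sigma> \<nu> (\<phi> u) = (\<Sum>i\<in>UNIV. l i)"
    and lh: "\<And>i. \<exists>h. norm (\<phi>' u h) = 1 \<and> l i = - (\<phi>'' u h h \<bullet> \<nu> (\<phi> u))"
  proof (rule P.principal_curvatures[OF W(2)], goal_cases)
    case (1 l)
    show ?case by (rule 1(1)[of l]; fact 1)
  qed
  have "1 \<le> m * l i" for i
  proof -
    obtain h where h: "norm (\<phi>' u h) = 1" "l i = - (\<phi>'' u h h \<bullet> \<nu> (\<phi> u))" using lh by blast
    have "\<phi>' u h \<bullet> \<phi>' u h = 1" using h(1) by (simp add: dot_square_norm)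
    then show ?thesis using second[of h] h(2) W(3) by (simp add: inner_commute)
  qed
  then have "(\<Sum>i\<in>(UNIV::'n set). 1) \<le> (\<Sum>i\<in>UNIV. m * l i)" by (intro sum_mono)
  also have "\<dots> = m * (real CARD('n) * mean_curvature \<Sigma> \<nu> (\<phi> u))" by (simp add: tr sum_distrib_left)
  also have "\<dots> = 0" using H0 W(3) by simp
  finally show False by simp
qed

text \<open>Used twice: with \<open>K\<close> the whole surface to find a first cap, and with
  \<open>K\<close> the complement of that cap to find another.\<close>

lemma nonflat_point:
  assumes K: "openin (top_of_set \<Sigma>) K" "closed K" "K \<noteq> {}"
  shows "\<exists>x\<in>K. 0 < snd x \<and> mean_curvature \<Sigma> \<nu> x \<noteq> 0"
proof -
  have KS: "K \<subseteq> \<Sigma>" using K(1) openin_imp_subset by blast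
  have cK: "compact K" using compact_surface K(2) KS by (metis compact_Int_closed inf.absorb2)
  let ?T = "\<lambda>x. E_last - snd (\<nu> x) *\<^sub>R \<nu> x"
  let ?K0 = "K \<inter> {x. snd x = 0}"
  \<comment> \<open>\<open>g x\<close> is the depth \<open>s\<close> for which
    \<open>(x + s *\<^sub>R E_last) \<bullet> ?T x\<close> equals 1. It is bounded on the compact
    boundary part, where the normal is never vertical; any larger depth keeps the farthest point off
    the boundary.\<close>
  define g where "g x = (1 - x \<bullet> ?T x) / (1 - (snd (\<nu> x))^2)" for x
  have cl: "closed {x :: 'n space. snd x = 0}" by (intro closed_Collect_eq continuous_intros)
  have "continuous_on ?K0 g" unfolding g_def
    by (intro continuous_intros continuous_on_subset[OF nu_facts(1)])
      (use KS nu_not_vertical in \<open>fastforce+\<close>)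
  then have "compact (g ` ?K0)" using cK cl by (intro compact_continuous_image compact_Int_closed)
  then obtain s where s: "\<And>x. x \<in> ?K0 \<Longrightarrow> \<bar>g x\<bar> \<le> s"
    using compact_imp_bounded bounded_real by (metis image_eqI)
  define a :: "'n space" where "a = - s *\<^sub>R E_last"
  have T: "0 < (x - a) \<bullet> ?T x" if x: "x \<in> ?K0" for x
  proof -
    have "(snd (\<nu> x))^2 < 1" using nu_not_vertical KS x by blast
    moreover have "g x \<le> s" using s[OF x] by simp
    ultimately have "1 - x \<bullet> ?T x \<le> s * (1 - (snd (\<nu> x))^2)" by (simp add: g_def divide_le_eq)
    moreover have "(x - a) \<bullet> ?T x = x \<bullet> ?T x + s * (1 - (snd (\<nu> x))^2)"
      by (simp add: a_def inner_diff_right inner_add_left power2_eq_square algebra_simps)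
    ultimately show ?thesis by linarith
  qed
  have "continuous_on K (\<lambda>x. dist x a)" by (intro continuous_intros)
  then obtain x where x: "x \<in> K" "\<And>y. y \<in> K \<Longrightarrow> dist y a \<le> dist x a"
    using continuous_attains_sup[OF cK K(3)] by blast
  have "snd x \<noteq> 0"
  proof
    assume "snd x = 0"
    then obtain y where "y \<in> K" "dist x a < dist y a"
      using farthest_point_not_on_boundary[OF K(1) x(1) _ T[of x]] x(1) by auto
    then show False using x(2)[of y] by linarith
  qed
  then have "0 < snd x" using snd_nonneg[of x] KS x(1) by fastforce
  then show ?thesis using farthest_point_nonflat[OF K(1) x(1) _ x(2)] x(1) by blast
qed

end

section \<open>Umbilic surfaces without a third derivative\<close>

text \<open>In at least two dimensions the \<open>i\<close>-th component of \<open>M\<close> depends on the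
  \<open>i\<close>-th coordinate only, so \<open>h\<close>, being each of its partial derivatives, is constant.\<close>

lemma conformal_factor_constant:
  fixes M :: "'a::euclidean_space \<Rightarrow> 'a" and h :: "'a \<Rightarrow> real"
  assumes dim: "2 \<le> DIM('a)" and M: "\<And>z. z \<in> ball a r \<Longrightarrow> (M has_derivative (\<lambda>k. h z *\<^sub>R k)) (at z)"
    and z: "z \<in> ball a r"
  shows "h z = h a"
proof -
  have same: "M x \<bullet> i = M y \<bullet> i" if i: "i \<in> Basis" and xy: "x \<in> ball a r" "y \<in> ball a r" "x \<bullet> i = y \<bullet> i" for x y i
  proof -
    let ?C = "ball a r \<inter> {z. i \<bullet> z = x \<bullet> i}"
    let ?f = "\<lambda>t. M (x + t *\<^sub>R (y - x)) \<bullet> i"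
    have seg: "x + t *\<^sub>R (y - x) \<in> ball a r" if "t \<in> {0..1}" for t
    proof -
      have "(1 - t) *\<^sub>R x + t *\<^sub>R y \<in> ball a r"
        using convex_ball[of a r] xy(1,2) that unfolding convex_alt by simp
      then show ?thesis by (simp add: algebra_simps)
    qed
    have "(?f has_derivative (\<lambda>_. 0)) (at t within {0..1})" if t: "t \<in> {0..1}" for t
    proof -
      have "((\<lambda>t. x + t *\<^sub>R (y - x)) has_derivative (\<lambda>s. s *\<^sub>R (y - x))) (at t within {0..1})"
        by (auto intro!: derivative_eq_intros)
      from has_derivative_compose[OF this M[OF seg[OF t]]]
      have "((\<lambda>t. M (x + t *\<^sub>R (y - x))) has_derivative
          (\<lambda>s. h (x + t *\<^sub>R (y - x)) *\<^sub>R (s *\<^sub>R (y - x)))) (at t within {0..1})" .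
      from has_derivative_inner_left[OF this, of i] show ?thesis using xy(3) by (simp add: inner_diff_left)
    qed
    from has_derivative_zero_unique[OF convex_real_interval(5)[of 0 1] this, of 0 1] show ?thesis by simp
  qed
  have cmp: "h x = h y" if i: "i \<in> Basis" and xy: "x \<in> ball a r" "y \<in> ball a r" "x \<bullet> i = y \<bullet> i" for x y i
  proof -
    have der: "((\<lambda>t. M (p + t *\<^sub>R i) \<bullet> i) has_real_derivative h p) (at 0)" if "p \<in> ball a r" for p
    proof -
      have "((\<lambda>t. p + t *\<^sub>R i) has_derivative (\<lambda>s. s *\<^sub>R i)) (at 0)" by (auto intro!: derivative_eq_intros)
      from has_derivative_compose[OF this, of M "\<lambda>k. h p *\<^sub>R k"] M[OF that]
      have "((\<lambda>t. M (p + t *\<^sub>R i)) has_derivative (\<lambda>s. h p *\<^sub>R (s *\<^sub>R i))) (at 0)" by simp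
      from has_derivative_inner_left[OF this, of i] show ?thesis
        using i by (simp add: has_field_derivative_def mult_commute_abs)
    qed
    have in_ball: "\<forall>\<^sub>F t in nhds 0. p + t *\<^sub>R i \<in> ball a r" if "p \<in> ball a r" for p
    proof -
      have "((\<lambda>t. p + t *\<^sub>R i) \<longlongrightarrow> p + 0 *\<^sub>R i) (nhds 0)" by (intro tendsto_intros filterlim_ident)
      then show ?thesis using topological_tendstoD[of _ _ _ "ball a r"] that by simp
    qed
    have "\<forall>\<^sub>F t in nhds 0. M (x + t *\<^sub>R i) \<bullet> i = M (y + t *\<^sub>R i) \<bullet> i"
      using in_ball[OF xy(1)] in_ball[OF xy(2)]
      by eventually_elim (intro same i, use xy(3) in \<open>auto simp: inner_add_left\<close>)
    from DERIV_cong_ev[OF refl this refl, of "h x"] der[OF xy(1)] have "((\<lambda>t. M (y + t *\<^sub>R i) \<bullet> i) has_real_derivative h x) (at 0)" by simp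
    from DERIV_unique[OF this der[OF xy(2)]] show ?thesis .
  qed
  have "\<not> (\<exists>i. (Basis :: 'a set) \<subseteq> {i})"
  proof
    assume "\<exists>i. (Basis :: 'a set) \<subseteq> {i}"
    then obtain i where "(Basis :: 'a set) \<subseteq> {i}" by blast
    then have "DIM('a) \<le> card {i}" by (rule card_mono[rotated]) simp
    then show False using dim by simp
  qed
  moreover obtain i :: 'a where "i \<in> Basis" using nonempty_Basis by blast
  ultimately obtain i j :: 'a where ij: "i \<in> Basis" "j \<in> Basis" "i \<noteq> j" by blast
  \<comment> \<open>\<open>w\<close> shares its \<open>i\<close>-th coordinate with \<open>z\<close>
    and all others with \<open>a\<close>, so it is compared with \<open>z\<close> through
    \<open>i\<close> and with \<open>a\<close> through \<open>j\<close>.\<close>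
  define w where "w = a + ((z - a) \<bullet> i) *\<^sub>R i"
  have "dist a w \<le> dist a z"
    using Basis_le_norm[OF ij(1), of "z - a"] ij(1) by (simp add: w_def dist_norm norm_minus_commute)
  then have w: "w \<in> ball a r" using z by simp
  have "a \<in> ball a r" using z by (auto intro: le_less_trans[OF zero_le_dist])
  then have "h a = h w" by (rule cmp[OF ij(2) _ w]) (use ij in \<open>simp add: w_def inner_add_left inner_Basis\<close>)
  moreover have "h z = h w" by (rule cmp[OF ij(1) z w]) (use ij in \<open>simp add: w_def inner_add_left inner_diff_left\<close>)
  ultimately show ?thesis by simp
qed

context patch_normal
begin

text \<open>The inverse function theorem provides the coordinate \<open>z = A (\<phi> v)\<close>. In
  it, the derivative of \<open>A \<circ> \<nu>\<close> is \<open>h\<close> times the identity, so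
  \<open>conformal_factor_constant\<close> applies although \<open>h\<close> is not known to be
  differentiable. With \<open>h\<close> constant, \<open>\<nu> - h \<phi>\<close> has derivative
  zero.\<close>

lemma umbilic_imp_locally_spherical:
  assumes n: "2 \<le> CARD('n)" and W: "open W" "u \<in> W"
    and umb: "\<And>v k. v \<in> W \<Longrightarrow> weingarten v k = h v *\<^sub>R \<phi>' v k"
  shows "\<exists>T. open T \<and> u \<in> T \<and> T \<subseteq> W \<and> (\<forall>v\<in>T. h v = h u \<and> \<nu> (\<phi> v) - h u *\<^sub>R \<phi> v = \<nu> (\<phi> u) - h u *\<^sub>R \<phi> u)"
proof -
  obtain A where A: "bounded_linear A" "\<And>k. A (\<phi>' u k) = k" using left_inverse_exists[OF W(2)] by blast
  define A' where "A' = Blinfun A"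
  have A': "blinfun_apply A' = A" unfolding A'_def using A(1) by (simp add: bounded_linear_Blinfun_apply)
  let ?f' = "\<lambda>v. A' o\<^sub>L \<phi>' v"
  have WU: "\<And>v. v \<in> W \<Longrightarrow> v \<in> U" using W_U by blast
  have d: "((\<lambda>v. A (\<phi> v)) has_derivative blinfun_apply (?f' v)) (at v)" if "v \<in> W" for v
    using bounded_linear.has_derivative[OF A(1) deriv[OF WU[OF that]]]
    by (simp add: A' blinfun_apply_blinfun_compose[abs_def] comp_def)
  have c: "continuous_on W ?f'"
    by (intro bounded_bilinear.continuous_on[OF bounded_bilinear_blinfun_compose] continuous_on_const
        continuous_on_subset[OF cont_phi' W_U])
  have id: "id_blinfun o\<^sub>L ?f' u = id_blinfun"
    by (rule blinfun_eqI) (simp add: A' A(2))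
  obtain U' V g g' where V: "open U'" "U' \<subseteq> W" "u \<in> U'" "open V" "A (\<phi> u) \<in> V" "homeomorphism U' V (\<lambda>v. A (\<phi> v)) g"
    and g: "\<And>y. y \<in> V \<Longrightarrow> (g has_derivative (g' y)) (at y)"
    "\<And>y. y \<in> V \<Longrightarrow> g' y = inv (blinfun_apply (?f' (g y)))" "\<And>y. y \<in> V \<Longrightarrow> bij (blinfun_apply (?f' (g y)))"
    by (rule inverse_function_theorem[OF W(1) d c W(2) id], assumption, rule that)
  define a where "a = A (\<phi> u)"
  obtain r where r: "r > 0" "ball a r \<subseteq> V" using V(4,5) openE unfolding a_def by blast
  have gW: "g z \<in> W" if "z \<in> ball a r" for z
  proof -
    have "g ` V = U'" using V(6) by (simp add: homeomorphism_def)
    then show ?thesis using V(2) r(2) that by blast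
  qed
  have inv: "A (\<phi>' (g z) (g' z k)) = k" if "z \<in> ball a r" for z k
  proof -
    have z: "z \<in> V" using that r(2) by blast
    have "blinfun_apply (?f' (g z)) (g' z k) = k"
      unfolding g(2)[OF z] by (rule surj_f_inv_f[OF bij_is_surj[OF g(3)[OF z]]])
    then show ?thesis by (simp add: A')
  qed
  have dphi: "((\<lambda>z. \<phi> (g z)) has_derivative (\<lambda>k. \<phi>' (g z) (g' z k))) (at z)" if "z \<in> ball a r" for z
    by (rule has_derivative_compose[OF g(1) deriv[OF WU[OF gW[OF that]]]]) (use that r(2) in blast)
  have dnu: "((\<lambda>z. \<nu> (\<phi> (g z))) has_derivative (\<lambda>k. h (g z) *\<^sub>R \<phi>' (g z) (g' z k))) (at z)" if "z \<in> ball a r" for z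
  proof -
    have "((\<lambda>v. \<nu> (\<phi> v)) has_derivative weingarten (g z)) (at (g z))"
      using nu_along_has_derivative[OF gW[OF that]] at_within_open[OF gW[OF that] W(1)] by simp
    from has_derivative_compose[OF g(1) this] show ?thesis
      unfolding umb[OF gW[OF that]] using that r(2) by blast
  qed
  \<comment> \<open>\<open>A\<close> composed with the derivative of \<open>\<phi> \<circ> g\<close>
    is the identity by \<open>inv\<close>, which leaves only the factor
    \<open>h (g z)\<close>.\<close>
  have dM: "((\<lambda>z. A (\<nu> (\<phi> (g z)))) has_derivative (\<lambda>k. h (g z) *\<^sub>R k)) (at z)" if "z \<in> ball a r" for z
    using bounded_linear.has_derivative[OF A(1) dnu[OF that]]
    by (simp add: inv[OF that] linear_scale[OF bounded_linear.linear[OF A(1)]])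
  have ga: "g a = u" using V(3,6) by (auto simp: homeomorphism_def a_def)
  have hc: "h (g z) = h u" if "z \<in> ball a r" for z
    using conformal_factor_constant[of a r _ "\<lambda>z. h (g z)", OF _ dM that] n ga by simp
  have N: "\<nu> (\<phi> (g z)) - h u *\<^sub>R \<phi> (g z) = \<nu> (\<phi> u) - h u *\<^sub>R \<phi> u" if "z \<in> ball a r" for z
  proof -
    have "((\<lambda>z. \<nu> (\<phi> (g z)) - h u *\<^sub>R \<phi> (g z)) has_derivative (\<lambda>k. 0)) (at z within ball a r)" if "z \<in> ball a r" for z
      using has_derivative_diff[OF dnu[OF that] has_derivative_scaleR_right[OF dphi[OF that], of "h u"]] hc[OF that]
      by (auto intro: has_derivative_at_withinI)
    from has_derivative_zero_unique[OF convex_ball this that, of a] r(1) show ?thesis by (simp add: ga)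
  qed
  show ?thesis
  proof (intro exI conjI ballI)
    have ca: "continuous_on U' (\<lambda>v. A (\<phi> v))" using V(6) by (simp add: homeomorphism_def)
    show "open (U' \<inter> (\<lambda>v. A (\<phi> v)) -` ball a r)" by (rule continuous_open_preimage[OF ca V(1) open_ball])
    show "u \<in> U' \<inter> (\<lambda>v. A (\<phi> v)) -` ball a r" using V(3) r(1) by (simp add: a_def)
    show "U' \<inter> (\<lambda>v. A (\<phi> v)) -` ball a r \<subseteq> W" using V(2) by blast
    fix v assume v: "v \<in> U' \<inter> (\<lambda>v. A (\<phi> v)) -` ball a r"
    then have "g (A (\<phi> v)) = v" using V(6) by (auto simp: homeomorphism_def)
    then show "h v = h u" "\<nu> (\<phi> v) - h u *\<^sub>R \<phi> v = \<nu> (\<phi> u) - h u *\<^sub>R \<phi> u"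
      using hc[of "A (\<phi> v)"] N[of "A (\<phi> v)"] v by auto
  qed
qed

end

section \<open>Local sphericity of an extremal surface\<close>

locale extremal_surface = capillary_surface \<Sigma> \<Omega> \<nu> c
  for \<Sigma> \<Omega> :: "('n::finite) space set" and \<nu> :: "'n space \<Rightarrow> 'n space" and c :: real +
  assumes dim: "2 \<le> CARD('n)"
    and equality: "measure lebesgue truncated_ball = 1 / (real CARD('n) + 1) * (\<integral>x. energy x \<partial>area_measure \<Sigma>)"
begin

abbreviation H :: "'n space \<Rightarrow> real" where "H \<equiv> mean_curvature \<Sigma> \<nu>"

lemma openin_nonflat: "openin (top_of_set \<Sigma>) {x \<in> \<Sigma>. H x \<noteq> 0}"
proof -
  have "openin (top_of_set \<Sigma>) (\<Sigma> \<inter> H -` (- {0}))"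
    by (rule continuous_openin_preimage_gen[OF cont_mean_curvature]) auto
  moreover have "\<Sigma> \<inter> H -` (- {0}) = {x \<in> \<Sigma>. H x \<noteq> 0}" by auto
  ultimately show ?thesis by simp
qed

text \<open>Umbilic contact points are dense in the open set where \<open>H\<close> is nonzero, and
  \<open>x\<close> is a limit of such points. All the properties are closed, umbilicity because
  \<open>weingarten\<close> and \<open>H\<close> are continuous in a chart; the strict bound on the
  height of the normal becomes weak.\<close>

lemma nonflat_umbilic:
  assumes x: "x \<in> \<Sigma>" "H x \<noteq> 0"
  shows "umbilic x" "0 < H x" "\<And>q. q \<in> closure \<Omega> \<Longrightarrow> \<nu> x \<bullet> (q - x) \<le> 0" "c \<le> snd (\<nu> x)"
proof -
  obtain W U \<phi> \<phi>' \<phi>'' \<psi> u where P: "patch_normal \<Sigma> W U \<phi> \<phi>' \<phi>'' \<psi> \<nu>" and u: "u \<in> W" "\<phi> u = x"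
    using chart[OF x(1)] by metis
  interpret P: patch_normal \<Sigma> W U \<phi> \<phi>' \<phi>'' \<psi> \<nu> by fact
  obtain T1 where T1: "open T1" "\<phi> ` W = \<Sigma> \<inter> T1" using P.openin_image by (auto simp: openin_open)
  obtain T2 where T2: "open T2" "{x \<in> \<Sigma>. H x \<noteq> 0} = \<Sigma> \<inter> T2" using openin_nonflat by (auto simp: openin_open)
  have xT: "x \<in> T1" "x \<in> T2" using T1 T2 u x by blast+
  have "\<exists>y\<in>\<Sigma>. dist x y < 1 / real (Suc m) \<and> y \<in> T1 \<and> y \<in> contact \<and> umbilic y" for m
  proof -
    have "open (ball x (1 / real (Suc m)) \<inter> T1 \<inter> T2)" using T1(1) T2(1) by auto
    moreover have "ball x (1 / real (Suc m)) \<inter> T1 \<inter> T2 \<inter> \<Sigma> \<noteq> {}" using x(1) xT by force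
    ultimately obtain y where "y \<in> ball x (1 / real (Suc m)) \<inter> T1 \<inter> T2 \<inter> \<Sigma>" "H y = 0 \<or> (y \<in> contact \<and> umbilic y)"
      using umbilic_dense[OF equality] by blast
    then show ?thesis using T2(2) by auto
  qed
  then obtain y where y: "\<And>m. y m \<in> \<Sigma>" "\<And>m. dist x (y m) < 1 / real (Suc m)" "\<And>m. y m \<in> T1"
    "\<And>m. y m \<in> contact" "\<And>m. umbilic (y m)" by metis
  have lim: "y \<longlonglongrightarrow> x"
  proof -
    have "dist (y m) x \<le> inverse (real (Suc m))" for m
      using y(2)[of m] by (simp add: dist_commute inverse_eq_divide less_imp_le)
    then have "(\<lambda>m. dist (y m) x) \<longlonglongrightarrow> 0"
      by (intro tendsto_sandwich[OF _ _ tendsto_const LIMSEQ_inverse_real_of_nat]) auto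
    then show ?thesis by (rule tendsto_dist_iff[THEN iffD2])
  qed
  have tends: "(\<lambda>m. f (y m)) \<longlonglongrightarrow> f x" if "continuous_on \<Sigma> f" for f :: "'n space \<Rightarrow> real"
    by (rule continuous_on_tendsto_compose[OF that lim x(1)]) (simp add: y(1))
  have "0 \<le> H x" by (rule LIMSEQ_le_const[OF tends[OF cont_mean_curvature]]) (use y(5) in blast)
  then show "0 < H x" using x(2) by simp
  have "continuous_on \<Sigma> (\<lambda>x. snd (\<nu> x))" by (intro continuous_intros nu_facts(1))
  from tends[OF this] show "c \<le> snd (\<nu> x)"
    by (rule LIMSEQ_le_const) (use y(4) in \<open>auto simp: contact_def intro: less_imp_le\<close>)
  have "x \<in> {x \<in> \<Sigma>. \<forall>q\<in>closure \<Omega>. \<nu> x \<bullet> (q - x) \<le> 0}"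
    by (rule closed_sequentially[OF closed_contact _ lim]) (use y(1,4) in \<open>auto simp: contact_def\<close>)
  then show "\<And>q. q \<in> closure \<Omega> \<Longrightarrow> \<nu> x \<bullet> (q - x) \<le> 0" by blast
  define v where "v m = \<psi> (y m)" for m
  have im: "y m \<in> \<phi> ` W" for m using T1(2) y(1,3) by auto
  have vW: "v m \<in> W" "\<phi> (v m) = y m" for m using P.psi_in[OF im] P.phi_psi[OF im] by (simp_all add: v_def)
  have "v \<longlonglongrightarrow> \<psi> x" unfolding v_def
    by (rule continuous_on_tendsto_compose[OF P.cont_psi lim]) (use u im in auto)
  then have vlim: "v \<longlonglongrightarrow> u" using u by auto
  have "P.weingarten u k = H x *\<^sub>R \<phi>' u k" for k
  proof (rule LIMSEQ_unique)
    show "(\<lambda>m. P.weingarten (v m) k) \<longlonglongrightarrow> P.weingarten u k"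
      by (rule continuous_on_tendsto_compose[OF P.cont_weingarten[OF continuous_on_const] vlim u(1)]) (simp add: vW)
    have "P.weingarten (v m) k = H (y m) *\<^sub>R \<phi>' (v m) k" for m
    proof -
      have "\<phi>' (v m) k \<in> tangent_space \<Sigma> (\<phi> (v m))" using P.tangent_space_eq[OF vW(1)] by simp
      then show ?thesis using y(5)[of m] P.shape_operator(3)[OF vW(1), of m k] vW(2)[of m] by simp
    qed
    moreover have "(\<lambda>m. H (y m) *\<^sub>R \<phi>' (v m) k) \<longlonglongrightarrow> H x *\<^sub>R \<phi>' u k"
      by (intro tendsto_scaleR tends cont_mean_curvature
          continuous_on_tendsto_compose[OF P.cont_deriv[OF continuous_on_const] vlim u(1)]) (simp add: vW)
    ultimately show "(\<lambda>m. P.weingarten (v m) k) \<longlonglongrightarrow> H x *\<^sub>R \<phi>' u k" by simp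
  qed
  then show "umbilic x"
    using \<open>0 \<le> H x\<close> P.tangent_space_eq[OF u(1)] P.shape_operator(3)[OF u(1)] u(2) by auto
qed

text \<open>The centre of the sphere of curvature \<open>H x\<close> that touches the surface at
  \<open>x\<close>; used only where \<open>H x\<close> is nonzero.\<close>

definition center :: "'n space \<Rightarrow> 'n space" where "center x = x - (1 / H x) *\<^sub>R \<nu> x"

lemma locally_spherical_interior:
  assumes P: "patch_normal \<Sigma> W U \<phi> \<phi>' \<phi>'' \<psi> \<nu>" and W: "open W" "u \<in> W" "\<And>v. v \<in> W \<Longrightarrow> H (\<phi> v) \<noteq> 0"
  shows "\<exists>T. open T \<and> u \<in> T \<and> T \<subseteq> W \<and> (\<forall>v\<in>T. H (\<phi> v) = H (\<phi> u) \<and> center (\<phi> v) = center (\<phi> u))"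
proof -
  interpret P: patch_normal \<Sigma> W U \<phi> \<phi>' \<phi>'' \<psi> \<nu> by fact
  have umb: "P.weingarten v k = H (\<phi> v) *\<^sub>R \<phi>' v k" if "v \<in> W" for v k
  proof -
    have "\<phi>' v k \<in> tangent_space \<Sigma> (\<phi> v)" using P.tangent_space_eq[OF that] by simp
    then show ?thesis using nonflat_umbilic(1)[OF P.phi_in[OF that] W(3)[OF that]] P.shape_operator(3)[OF that, of k] by simp
  qed
  obtain T where T: "open T" "u \<in> T" "T \<subseteq> W"
    "\<And>v. v \<in> T \<Longrightarrow> H (\<phi> v) = H (\<phi> u) \<and> \<nu> (\<phi> v) - H (\<phi> u) *\<^sub>R \<phi> v = \<nu> (\<phi> u) - H (\<phi> u) *\<^sub>R \<phi> u"
    using P.umbilic_imp_locally_spherical[where h = "\<lambda>v. H (\<phi> v)", OF dim W(1,2) umb] by blast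
  have "center (\<phi> v) = center (\<phi> u)" if "v \<in> T" for v
  proof -
    have c: "center (\<phi> w) = - (1 / H (\<phi> w)) *\<^sub>R (\<nu> (\<phi> w) - H (\<phi> w) *\<^sub>R \<phi> w)" if "w \<in> W" for w
      using W(3)[OF that] by (simp add: center_def algebra_simps)
    have vW: "v \<in> W" using that T(3) by blast
    show ?thesis unfolding c[OF vW] c[OF W(2)] using T(4)[OF that] by simp
  qed
  then show ?thesis using T by blast
qed

lemma cont_center: "continuous_on {x \<in> \<Sigma>. H x \<noteq> 0} center"
  unfolding center_def
  by (intro continuous_intros continuous_on_subset[OF nu_facts(1)] continuous_on_subset[OF cont_mean_curvature]) auto

text \<open>At a boundary point the interior version is applied to the open half ball of parameters.
  This is connected, so \<open>H\<close> and \<open>center\<close> are constant on it, and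
  continuity extends the values to the edge.\<close>

lemma locally_spherical:
  assumes x: "x \<in> \<Sigma>" "H x \<noteq> 0"
  shows "\<exists>X. openin (top_of_set \<Sigma>) X \<and> x \<in> X \<and> (\<forall>y\<in>X. H y = H x \<and> center y = center x)"
proof (cases "snd x = 0")
  case False
  then have sx: "0 < snd x" using snd_nonneg[OF x(1)] by simp
  obtain W U \<phi> \<phi>' \<phi>'' \<psi> u where P: "patch_normal \<Sigma> W U \<phi> \<phi>' \<phi>'' \<psi> \<nu>" and W: "open W" "u \<in> W" "\<phi> u = x"
    using interior_chart[OF x(1) not_boundary[OF sx]] by metis
  interpret P: patch_normal \<Sigma> W U \<phi> \<phi>' \<phi>'' \<psi> \<nu> by fact
  define T where "T = {v \<in> W. H (\<phi> v) \<noteq> 0}"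
  have "T = W \<inter> (\<lambda>v. H (\<phi> v)) -` (- {0})" by (auto simp: T_def)
  then have oT: "open T" using continuous_open_preimage[OF P.cont_mean_curvature W(1), of "- {0}"] by auto
  have WT: "W \<inter> T = T" by (auto simp: T_def)
  have P2: "patch_normal \<Sigma> T U \<phi> \<phi>' \<phi>'' \<psi> \<nu>"
    using patch_normalI[OF patch_restrict[OF P.patch_axioms oT]] unfolding WT .
  have uT: "u \<in> T" using W x by (simp add: T_def)
  obtain S where S: "open S" "u \<in> S" "S \<subseteq> T" "\<And>v. v \<in> S \<Longrightarrow> H (\<phi> v) = H (\<phi> u) \<and> center (\<phi> v) = center (\<phi> u)"
    using locally_spherical_interior[OF P2 oT uT] by (auto simp: T_def)
  have WS: "W \<inter> S = S" using S(3) by (auto simp: T_def)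
  interpret P3: patch \<Sigma> S U \<phi> \<phi>' \<phi>'' \<psi> using patch_restrict[OF P.patch_axioms S(1)] unfolding WS .
  show ?thesis using P3.openin_image S(2,4) W(3) by (intro exI[of _ "\<phi> ` S"]) auto
next
  case True
  obtain W U \<phi> \<phi>' \<phi>'' \<psi> u k r where P: "patch_normal \<Sigma> W U \<phi> \<phi>' \<phi>'' \<psi> \<nu>" and u: "u \<in> W" "\<phi> u = x"
    and r: "0 < r" "\<And>v. v \<in> ball u r \<Longrightarrow> v \<in> W \<longleftrightarrow> 0 \<le> v $ k" "u $ k = 0"
    by (rule boundary_chart[OF x(1) True]) (rule that)
  interpret P: patch_normal \<Sigma> W U \<phi> \<phi>' \<phi>'' \<psi> \<nu> by fact
  obtain r' where r': "0 < r'" "r' \<le> r" "\<And>v. v \<in> W \<inter> ball u r' \<Longrightarrow> H (\<phi> v) \<noteq> 0"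
  proof -
    have "0 < \<bar>H (\<phi> u)\<bar>" using x u by simp
    then obtain d where d: "d > 0" "\<And>v. v \<in> W \<Longrightarrow> dist v u < d \<Longrightarrow> dist (H (\<phi> v)) (H (\<phi> u)) < \<bar>H (\<phi> u)\<bar>"
      using P.cont_mean_curvature u(1) unfolding continuous_on_iff by blast
    show ?thesis by (rule that[of "min d r"]) (use d r(1) in \<open>fastforce simp: dist_real_def dist_commute\<close>)+
  qed
  define D where "D = ball u r' \<inter> {v. 0 < v $ k}"
  have oh: "open {v :: real^'n. 0 < v $ k}" by (intro open_Collect_less continuous_intros)
  then have oD: "open D" by (simp add: D_def open_Int)
  have DW: "D \<subseteq> W" using r(2) r'(2) by (auto simp: D_def)
  have "convex {v :: real^'n. 0 < v $ k}"
    using convex_halfspace_gt[of 0 "axis k 1 :: real^'n"] by (simp add: inner_axis')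
  then have "convex D" unfolding D_def by (intro convex_Int convex_ball)
  then have conn: "connected D" by (rule convex_connected)
  have WD: "W \<inter> D = D" using DW by blast
  have PD: "patch_normal \<Sigma> D U \<phi> \<phi>' \<phi>'' \<psi> \<nu>"
    using patch_normalI[OF patch_restrict[OF P.patch_axioms oD]] unfolding WD .
  let ?F = "\<lambda>v. (H (\<phi> v), center (\<phi> v))"
  have "?F constant_on D"
  proof (rule locally_constant_imp_constant[OF conn])
    fix a assume a: "a \<in> D"
    have "H (\<phi> v) \<noteq> 0" if "v \<in> D" for v using r'(3) that DW by (auto simp: D_def)
    from locally_spherical_interior[OF PD oD a this]
    obtain T where "open T" "a \<in> T" "T \<subseteq> D" "\<forall>v\<in>T. ?F v = ?F a" by auto
    then show "\<exists>T. openin (top_of_set D) T \<and> a \<in> T \<and> (\<forall>x\<in>T. ?F x = ?F a)"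
      by (metis open_openin_trans oD open_subset)
  qed
  then obtain b where b: "\<And>v. v \<in> D \<Longrightarrow> ?F v = b" by (auto simp: constant_on_def)
  let ?B = "W \<inter> ball u r'"
  have cont: "continuous_on ?B ?F"
  proof (rule continuous_on_Pair)
    show "continuous_on ?B (\<lambda>v. H (\<phi> v))" using P.cont_mean_curvature by (rule continuous_on_subset) auto
    show "continuous_on ?B (\<lambda>v. center (\<phi> v))"
      by (rule continuous_on_compose2[OF cont_center continuous_on_subset[OF P.cont_phi]])
        (use P.W_U P.phi_in r'(3) in auto)
  qed
  \<comment> \<open>Parameters on the edge are approached along the inward axis from inside
    \<open>D\<close>, where the pair is constantly \<open>b\<close>.\<close>
  have all: "?F v = b" if v: "v \<in> ?B" for v
  proof -
    have vk: "0 \<le> v $ k" "v \<in> ball u r'" using v r(2)[of v] r'(2) by auto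
    have lim: "((\<lambda>t. v + t *\<^sub>R axis k 1) \<longlongrightarrow> v + 0 *\<^sub>R axis k 1) (at_right 0)" by (intro tendsto_intros)
    have "\<forall>\<^sub>F t in at_right 0. v + t *\<^sub>R axis k 1 \<in> ball u r'"
      using topological_tendstoD[OF lim open_ball] vk(2) by simp
    moreover have "\<forall>\<^sub>F t in at_right 0. (0::real) < t" by (rule eventually_at_right_less)
    ultimately have ev: "\<forall>\<^sub>F t in at_right 0. v + t *\<^sub>R axis k 1 \<in> D"
      by eventually_elim (use vk(1) in \<open>auto simp: D_def intro: add_nonneg_pos\<close>)
    have "((\<lambda>t. ?F (v + t *\<^sub>R axis k 1)) \<longlongrightarrow> ?F v) (at_right 0)"
    proof (rule continuous_on_tendsto_compose[OF cont _ v])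
      show "((\<lambda>t. v + t *\<^sub>R axis k 1) \<longlongrightarrow> v) (at_right 0)" using lim by simp
      show "\<forall>\<^sub>F t in at_right 0. v + t *\<^sub>R axis k 1 \<in> ?B"
        using ev by eventually_elim (use DW in \<open>auto simp: D_def\<close>)
    qed
    moreover have "((\<lambda>t. ?F (v + t *\<^sub>R axis k 1)) \<longlongrightarrow> b) (at_right 0)"
      by (rule tendsto_eventually) (use ev b in \<open>auto elim: eventually_mono\<close>)
    ultimately show ?thesis by (rule tendsto_unique[OF trivial_limit_at_right_real])
  qed
  interpret PB: patch \<Sigma> ?B U \<phi> \<phi>' \<phi>'' \<psi> by (rule patch_restrict[OF P.patch_axioms open_ball])
  have uB: "u \<in> ?B" using u(1) r'(1) by simp
  show ?thesis
  proof (intro exI conjI ballI)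
    show "openin (top_of_set \<Sigma>) (\<phi> ` ?B)" by (rule PB.openin_image)
    show "x \<in> \<phi> ` ?B" using uB u(2) by blast
    fix y assume "y \<in> \<phi> ` ?B"
    then obtain v where "v \<in> ?B" "y = \<phi> v" by blast
    then have "?F v = ?F u" "y = \<phi> v" using all[of v] all[OF uB] by auto
    then show "H y = H x" "center y = center x" using u(2) by auto
  qed
qed

end

section \<open>Meridians and connectedness of the upper part of a sphere\<close>

text \<open>With the denominator cleared: the normalized point of the chord towards
  \<open>E_last\<close> is not lower than \<open>y\<close>. If \<open>snd y \<ge> 0\<close>, it
  suffices that the norm is at most 1; otherwise, that it is at least
  \<open>1 - 2 * t\<close>.\<close>

lemma arc_height:
  fixes y :: "('n::finite) space"
  assumes y: "norm y = 1" and t: "0 \<le> t" "t \<le> 1"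
  shows "norm ((1 - t) *\<^sub>R y + t *\<^sub>R E_last) * snd y \<le> (1 - t) * snd y + t" 
    and "0 < t \<Longrightarrow> snd y \<noteq> 1 \<Longrightarrow> snd y \<noteq> -1 \<Longrightarrow> norm ((1 - t) *\<^sub>R y + t *\<^sub>R E_last) * snd y < (1 - t) * snd y + t"
proof -
  let ?w = "(1 - t) *\<^sub>R y + t *\<^sub>R E_last"
  have s: "\<bar>snd y\<bar> \<le> 1" using Cauchy_Schwarz_ineq2[of y E_last] y by simp
  have "norm ?w \<le> norm ((1 - t) *\<^sub>R y) + norm (t *\<^sub>R (E_last :: 'n space))" by (rule norm_triangle_ineq)
  then have w1: "norm ?w \<le> 1" using y t by simp
  have "norm ((1 - t) *\<^sub>R y) - norm (t *\<^sub>R (E_last :: 'n space)) \<le> norm ?w"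
    using norm_triangle_ineq2[of "(1 - t) *\<^sub>R y" "- (t *\<^sub>R E_last)"] by simp
  then have w2: "1 - 2 * t \<le> norm ?w" using y t by simp
  have *: "norm ?w * snd y \<le> (if 0 \<le> snd y then snd y else (1 - 2 * t) * snd y)"
    using w1 w2 by (auto simp: mult_left_le_one_le intro: mult_right_mono_neg)
  have a: "0 \<le> t * (1 - snd y)" "0 \<le> t * (1 + snd y)" using s t by auto
  show "norm ?w * snd y \<le> (1 - t) * snd y + t"
    using * a by (auto simp: algebra_simps split: if_splits)
  assume "0 < t" "snd y \<noteq> 1" "snd y \<noteq> -1"
  then have "0 < t * (1 - snd y)" "0 < t * (1 + snd y)" using s by auto
  then show "norm ?w * snd y < (1 - t) * snd y + t"
    using * by (auto simp: algebra_simps split: if_splits)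
qed

lemma unit_south_iff:
  fixes y :: "('n::finite) space"
  assumes "norm y = 1" shows "snd y = -1 \<longleftrightarrow> y = - E_last" "snd y = 1 \<longleftrightarrow> y = E_last"
proof -
  have yy: "y \<bullet> y = 1" using assms by (simp add: dot_square_norm)
  have ee: "E_last \<bullet> (E_last :: 'n space) = 1" by simp
  have e: "(y + E_last) \<bullet> (y + E_last) = 2 + 2 * snd y" by (simp add: inner_add_left inner_add_right yy)
  have "snd y = -1 \<longleftrightarrow> (y + E_last) \<bullet> (y + E_last) = 0" unfolding e by auto
  then have "snd y = -1 \<longleftrightarrow> y + E_last = 0" by (simp only: inner_eq_zero_iff)
  then show "snd y = -1 \<longleftrightarrow> y = - E_last" by (simp add: eq_neg_iff_add_eq_0)
  have "(y - E_last) \<bullet> (y - E_last) = 2 - 2 * snd y" by (simp add: inner_diff_left inner_diff_right yy)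
  then have "snd y = 1 \<longleftrightarrow> (y - E_last) \<bullet> (y - E_last) = 0" by simp
  then show "snd y = 1 \<longleftrightarrow> y = E_last" by (simp only: inner_eq_zero_iff right_minus_eq)
qed

text \<open>The great arc from \<open>x\<close> to the north pole; if \<open>x\<close> is the south pole, it passes through the junk value \<open>sgn 0 = 0\<close>.\<close>

definition meridian :: "'n space \<Rightarrow> real \<Rightarrow> ('n::finite) space \<Rightarrow> real \<Rightarrow> 'n space" where
  "meridian m R x t = m + R *\<^sub>R sgn ((1 - t) *\<^sub>R ((x - m) /\<^sub>R R) + t *\<^sub>R E_last)"

text \<open>Projecting a chord radially is harmless because it misses the centre unless it starts at
  the south pole. Heights do not fall along the meridian, so it never drops below its starting
  point.\<close>

lemma meridian:
  fixes m :: "('n::finite) space"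
  assumes R: "0 < R" and x: "x \<in> sphere m R" "x \<noteq> m - R *\<^sub>R E_last"
  shows "continuous_on {0..1} (meridian m R x)" "meridian m R x 0 = x" "meridian m R x 1 = m + R *\<^sub>R E_last"
    "t \<in> {0..1} \<Longrightarrow> meridian m R x t \<in> sphere m R" "t \<in> {0..1} \<Longrightarrow> snd x \<le> snd (meridian m R x t)"
    "t \<in> {0..1} \<Longrightarrow> meridian m R x t \<noteq> m - R *\<^sub>R E_last"
    "t \<in> {0<..1} \<Longrightarrow> x \<noteq> m + R *\<^sub>R E_last \<Longrightarrow> snd x < snd (meridian m R x t)"
proof -
  define y where "y = (x - m) /\<^sub>R R"
  have y1: "norm y = 1" using R x(1) by (simp add: y_def dist_norm norm_minus_commute)
  have xy: "x = m + R *\<^sub>R y" using R by (simp add: y_def)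
  have ys: "y \<noteq> - E_last" using x(2) xy by auto
  define w where "w t = (1 - t) *\<^sub>R y + t *\<^sub>R E_last" for t
  have wsnd: "snd (w t) = (1 - t) * snd y + t" for t by (simp add: w_def)
  have w0: "w t \<noteq> 0" if "t \<in> {0..1}" for t
  proof
    assume 0: "w t = 0"
    then have e: "(1 - t) *\<^sub>R y = - (t *\<^sub>R E_last)" by (simp add: w_def eq_neg_iff_add_eq_0)
    have "1 - t = t" using arg_cong[OF e, of norm] y1 that by simp
    then have t: "t = 1/2" by simp
    have "2 *\<^sub>R ((1 - t) *\<^sub>R y) = 2 *\<^sub>R (- (t *\<^sub>R E_last))" by (simp only: e)
    then show False using ys by (simp add: t)
  qed
  have M: "meridian m R x t = m + R *\<^sub>R sgn (w t)" for t by (simp add: meridian_def w_def y_def)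
  show "continuous_on {0..1} (meridian m R x)" unfolding M
    by (intro continuous_intros continuous_on_sgn) (use w0 in \<open>auto simp: w_def intro!: continuous_intros\<close>)
  have "meridian m R x 0 = m + R *\<^sub>R y" using y1 by (simp add: M w_def sgn_div_norm)
  also have "\<dots> = x" by (rule xy[symmetric])
  finally show "meridian m R x 0 = x" .
  show "meridian m R x 1 = m + R *\<^sub>R E_last" by (simp add: M w_def sgn_div_norm)
  show "meridian m R x t \<in> sphere m R" if "t \<in> {0..1}"
    using w0[OF that] R by (simp add: M dist_norm norm_sgn)
  have sM: "snd (meridian m R x t) = snd m + R * (snd (w t) / norm (w t))" for t
    by (simp add: M sgn_div_norm divide_inverse mult.commute)
  have sx: "snd x = snd m + R * snd y" by (simp add: xy)
  show le: "snd x \<le> snd (meridian m R x t)" if "t \<in> {0..1}" for t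
  proof -
    have "snd y \<le> snd (w t) / norm (w t)"
      using arc_height(1)[OF y1, of t] w0[OF that] that unfolding wsnd by (simp add: pos_le_divide_eq mult.commute w_def)
    from mult_left_mono[OF this, of R] show ?thesis using R unfolding sM sx by simp
  qed
  show "meridian m R x t \<noteq> m - R *\<^sub>R E_last" if "t \<in> {0..1}"
  proof
    assume "meridian m R x t = m - R *\<^sub>R E_last"
    then have "snd (meridian m R x t) = snd m - R" by simp
    then have "R * snd y \<le> R * (-1)" using le[OF that] sx by simp
    then have "snd y \<le> -1" using R mult_le_cancel_left_pos by blast
    moreover have "\<bar>snd y\<bar> \<le> 1" using Cauchy_Schwarz_ineq2[of y E_last] y1 by simp
    ultimately have "snd y = -1" by simp
    then show False using unit_south_iff(1)[OF y1] ys by simp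
  qed
  show "snd x < snd (meridian m R x t)" if t: "t \<in> {0<..1}" and n: "x \<noteq> m + R *\<^sub>R E_last"
  proof -
    have "snd y \<noteq> 1" "snd y \<noteq> -1" using unit_south_iff[OF y1] ys n xy by auto
    then have "snd y < snd (w t) / norm (w t)"
      using arc_height(2)[OF y1, of t] w0[of t] t unfolding wsnd by (simp add: pos_less_divide_eq mult.commute w_def)
    from mult_strict_left_mono[OF this R] show ?thesis unfolding sM sx by simp
  qed
qed

text \<open>The meridian of each point stays in the set and ends at the north pole, so all of them
  share a point.\<close>

lemma connected_upper_sphere:
  fixes m :: "('n::finite) space"
  assumes R: "0 < R"
  shows "connected {x \<in> sphere m R - {m - R *\<^sub>R E_last}. 0 < snd x}" (is "connected ?S")
proof (cases "?S = {}")
  case False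
  let ?C = "\<lambda>x. meridian m R x ` {0..1}"
  have C: "connected (?C x)" "m + R *\<^sub>R E_last \<in> ?C x" "?C x \<subseteq> ?S" "x \<in> ?C x" if "x \<in> ?S" for x
  proof -
    have x: "x \<in> sphere m R" "x \<noteq> m - R *\<^sub>R E_last" "0 < snd x" using that by auto
    note M = meridian[OF R x(1,2)]
    show "connected (?C x)" by (rule connected_continuous_image[OF M(1)]) simp
    show "m + R *\<^sub>R E_last \<in> ?C x" using M(3) by (metis atLeastAtMost_iff image_eqI le_numeral_extra(4) zero_le_one)
    show "x \<in> ?C x" using M(2) by (metis atLeastAtMost_iff image_eqI le_numeral_extra(3) zero_le_one)
    show "?C x \<subseteq> ?S"
    proof
      fix z assume "z \<in> ?C x"
      then obtain t where t: "t \<in> {0..1}" "z = meridian m R x t" by blast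
      show "z \<in> ?S" using M(4)[OF t(1)] M(5)[OF t(1)] M(6)[OF t(1)] x(3) t(2) by auto
    qed
  qed
  have "connected (\<Union>(?C ` ?S))"
  proof (rule connected_Union)
    have "m + R *\<^sub>R E_last \<in> \<Inter>(?C ` ?S)" using C(2) by blast
    then show "\<Inter>(?C ` ?S) \<noteq> {}" by blast
    fix s assume "s \<in> ?C ` ?S"
    then obtain x where x: "s = ?C x" "x \<in> ?S" by (rule imageE)
    show "connected s" unfolding x(1) by (rule C(1)[OF x(2)])
  qed
  moreover have "\<Union>(?C ` ?S) = ?S"
  proof
    show "\<Union>(?C ` ?S) \<subseteq> ?S" by (rule UN_least) (rule C(3))
    show "?S \<subseteq> \<Union>(?C ` ?S)" by (rule subsetI) (rule UN_I, assumption, rule C(4))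
  qed
  ultimately show ?thesis by (simp only:)
qed (simp only: connected_empty)

text \<open>A meridian starting on the hyperplane rises at once, so its starting point is a limit of
  points above. The condition on \<open>m\<close> places the north pole above the hyperplane, hence
  away from \<open>x\<close>.\<close>

lemma equator_in_closed:
  fixes m :: "('n::finite) space"
  assumes R: "0 < R" and C: "closed C" "{x \<in> sphere m R - {m - R *\<^sub>R E_last}. 0 < snd x} \<subseteq> C"
    and x: "x \<in> sphere m R" "x \<noteq> m - R *\<^sub>R E_last" "snd x = 0" and m: "0 < snd m + R"
  shows "x \<in> C"
proof -
  note M = meridian[OF R x(1,2)]
  have "x \<noteq> m + R *\<^sub>R E_last" using x(3) m by auto
  then have MC: "meridian m R x t \<in> C" if "t \<in> {0<..1}" for t
    using M(4,6,7)[of t] that x(3) C(2) by auto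
  have "(meridian m R x \<longlongrightarrow> meridian m R x 0) (at 0 within {0..1})"
    using M(1) by (auto simp: continuous_on_def)
  then have "(meridian m R x \<longlongrightarrow> x) (at_right 0)" using M(2) by (simp add: at_within_Icc_at_right)
  moreover have "\<forall>\<^sub>F t in at_right 0. meridian m R x t \<in> C"
    using MC by (intro eventually_at_rightI[of 0 1]) auto
  ultimately show ?thesis by (rule Lim_in_closed_set[OF C(1), rotated 2]) simp
qed

lemma sphere_point_of_height:
  fixes m :: "('n::finite) space"
  assumes "0 < R" "\<bar>k\<bar> \<le> 1"
  obtains x where "x \<in> sphere m R" "snd x = snd m + R * k"
proof -
  define v :: "'n space" where "v = (sqrt (1 - k^2) *\<^sub>R axis undefined 1, k)"
  have "k^2 \<le> 1" using assms(2) by (simp add: abs_square_le_1)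
  then have "norm v = 1" by (simp add: v_def norm_Pair norm_axis_1)
  then have "dist m (m + R *\<^sub>R v) = R" using assms(1) by (simp add: dist_norm)
  then show ?thesis by (intro that[of "m + R *\<^sub>R v"]) (auto simp: v_def)
qed

section \<open>The extremal surface is a single cap\<close>

context extremal_surface
begin

text \<open>Instead of a component, \<open>K\<close> collects all surface points that share
  \<open>H\<close> and \<open>center\<close> with \<open>x\<close>. It is closed because both are
  continuous, open by \<open>locally_spherical\<close>, and lies on one sphere by definition of
  \<open>center\<close>.\<close>

lemma cap_through_nonflat_point:
  assumes x: "x \<in> \<Sigma>" "0 < snd x" "H x \<noteq> 0"
  obtains m R where "0 < R" "snd m = - c * R" "x \<in> sphere m R"
    "openin (top_of_set \<Sigma>) (sphere m R \<inter> closure upper_half_space)" "\<Omega> \<subseteq> ball m R"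
proof -
  define R where "R = 1 / H x"
  define m where "m = center x"
  define K where "K = {y \<in> \<Sigma>. H y = H x \<and> center y = m}"
  have R: "0 < R" "1 / R = H x" using nonflat_umbilic(2)[OF x(1,3)] by (simp_all add: R_def)
  have K_open: "openin (top_of_set \<Sigma>) K"
  proof (subst openin_subopen, intro ballI)
    fix y assume y: "y \<in> K"
    then obtain X where "openin (top_of_set \<Sigma>) X" "y \<in> X" "\<forall>z\<in>X. H z = H y \<and> center z = center y"
      using locally_spherical[of y] x(3) by (auto simp: K_def)
    moreover from this have "X \<subseteq> K" using y openin_imp_subset by (fastforce simp: K_def)
    ultimately show "\<exists>T. openin (top_of_set \<Sigma>) T \<and> y \<in> T \<and> T \<subseteq> K" by blast
  qed
  have K_closed: "closed K"
  proof -
    have 1: "closed {y \<in> \<Sigma>. H y = H x}"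
      by (rule continuous_closed_preimage_constant[OF cont_mean_curvature compact_imp_closed[OF compact_surface]])
    have "closed {y \<in> {y \<in> \<Sigma>. H y = H x}. center y = m}"
      by (rule continuous_closed_preimage_constant[OF continuous_on_subset[OF cont_center] 1]) (use x(3) in auto)
    then show ?thesis by (simp add: K_def conj_assoc)
  qed
  have xK: "x \<in> K" using x by (simp add: K_def m_def)
  have nu: "y = m + R *\<^sub>R \<nu> y" "c \<le> snd (\<nu> y)" "y \<in> sphere m R" "y \<noteq> m - R *\<^sub>R E_last" "y \<in> \<Sigma>" if "y \<in> K" for y
  proof -
    have y: "y \<in> \<Sigma>" "H y = H x" "center y = m" using that by (auto simp: K_def)
    then show "y \<in> \<Sigma>" by simp
    show e: "y = m + R *\<^sub>R \<nu> y" using y(2,3) by (simp add: center_def R_def flip: y(3))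
    show cc: "c \<le> snd (\<nu> y)" using nonflat_umbilic(4)[of y] y x(3) by simp
    have "norm (y - m) = R" using nu_facts(2)[OF y(1)] R(1) by (subst e) simp
    then show "y \<in> sphere m R" by (simp add: dist_norm norm_minus_commute)
    show "y \<noteq> m - R *\<^sub>R E_last"
    proof
      assume "y = m - R *\<^sub>R E_last"
      then have "R *\<^sub>R \<nu> y = R *\<^sub>R (- E_last)" using e by (metis add_left_cancel diff_conv_add_uminus scaleR_minus_right)
      from arg_cong[OF this, of snd] have "R * snd (\<nu> y) = R * (-1)" by simp
      then have "snd (\<nu> y) = -1" using R(1) by (simp only: mult_cancel_left) auto
      then show False using cc c by simp
    qed
  qed
  \<comment> \<open>The south pole is not in \<open>K\<close>, and the punctured sphere is a copy of \<open>real^'n\<close>, so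
    \<open>K\<close> is open in it by invariance of domain.\<close>
  let ?b = "m - R *\<^sub>R E_last"
  let ?P = "sphere m R - {?b}"
  let ?S = "{x \<in> ?P. 0 < snd x}"
  have "?b \<in> sphere m R" using R(1) by (simp add: dist_norm)
  then have "?P homeomorphic (UNIV :: (real^'n) set)"
    by (intro homeomorphic_punctured_sphere_affine R(1)) (auto simp: dim_space)
  then obtain h k where hk: "homeomorphism ?P (UNIV :: (real^'n) set) h k" unfolding homeomorphic_def by blast
  have K_S: "openin (top_of_set ?P) (K \<inter> {y. 0 < snd y})"
  proof (subst openin_subopen, intro ballI)
    fix y assume "y \<in> K \<inter> {y. 0 < snd y}"
    then have y: "y \<in> K" "0 < snd y" by auto
    obtain T where T: "open T" "K = \<Sigma> \<inter> T" using K_open by (auto simp: openin_open)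
    obtain W U \<phi> \<phi>' \<phi>'' \<psi> u where P: "patch_normal \<Sigma> W U \<phi> \<phi>' \<phi>'' \<psi> \<nu>" and W: "open W" "u \<in> W" "\<phi> u = y"
      using interior_chart[OF nu(5)[OF y(1)] not_boundary[OF y(2)]] by metis
    interpret P: patch_normal \<Sigma> W U \<phi> \<phi>' \<phi>'' \<psi> \<nu> by fact
    let ?Q = "T \<inter> {y. 0 < snd y}"
    have "open ?Q" by (intro open_Int T(1) open_Collect_less continuous_intros)
    then have oW': "open (W \<inter> \<phi> -` ?Q)"
      by (rule continuous_open_preimage[OF continuous_on_subset[OF P.cont_phi P.W_U] W(1)])
    let ?W = "W \<inter> \<phi> -` ?Q"
    have im: "\<phi> ` ?W \<subseteq> K \<inter> {y. 0 < snd y}" using T(2) P.image_subset by blast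
    then have imP: "\<phi> ` ?W \<subseteq> ?P" using nu(3,4) by blast
    have "open ((h \<circ> \<phi>) ` ?W)"
    proof (rule invariance_of_domain[OF _ oW'])
      show "continuous_on ?W (h \<circ> \<phi>)"
        using hk imP by (intro continuous_on_compose continuous_on_subset[OF P.cont_phi])
          (use P.W_U in \<open>auto simp: homeomorphism_def elim: continuous_on_subset\<close>)
      show "inj_on (h \<circ> \<phi>) ?W"
      proof (rule comp_inj_on)
        show "inj_on \<phi> ?W" by (rule inj_on_inverseI[of _ \<psi>]) auto
        show "inj_on h (\<phi> ` ?W)" using hk imP by (intro inj_on_inverseI[of _ k]) (auto simp: homeomorphism_def)
      qed
    qed
    then have "openin (top_of_set ?P) (?P \<inter> h -` ((h \<circ> \<phi>) ` ?W))"
      using hk by (intro continuous_openin_preimage_gen) (auto simp: homeomorphism_def)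
    moreover have "?P \<inter> h -` ((h \<circ> \<phi>) ` ?W) = \<phi> ` ?W"
    proof (intro equalityI subsetI)
      fix z assume "z \<in> ?P \<inter> h -` ((h \<circ> \<phi>) ` ?W)"
      then have "z \<in> ?P" "h z \<in> (h \<circ> \<phi>) ` ?W" by blast+
      then obtain v where v: "z \<in> ?P" "v \<in> ?W" "h z = h (\<phi> v)" unfolding image_comp[symmetric] by blast
      have "k (h z) = k (h (\<phi> v))" by (simp only: v(3))
      moreover have "\<phi> v \<in> ?P" using imP v(2) by blast
      moreover have "\<forall>p\<in>?P. k (h p) = p" using hk by (simp add: homeomorphism_def)
      ultimately have "z = \<phi> v" using v(1) by metis
      then show "z \<in> \<phi> ` ?W" using v(2) by blast
    next
      fix z assume "z \<in> \<phi> ` ?W"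
      then show "z \<in> ?P \<inter> h -` ((h \<circ> \<phi>) ` ?W)" using imP unfolding image_comp[symmetric] by blast
    qed
    ultimately have "openin (top_of_set ?P) (\<phi> ` ?W)" by simp
    moreover have "y \<in> \<phi> ` ?W" using W y T(2) by auto
    ultimately show "\<exists>T. openin (top_of_set ?P) T \<and> y \<in> T \<and> T \<subseteq> K \<inter> {y. 0 < snd y}" using im by blast
  qed
  have KS: "K \<inter> {y. 0 < snd y} = ?S \<inter> K" using nu(3,4) by blast
  have "openin (top_of_set ?S) (?S \<inter> K)"
    using K_S unfolding KS by (rule openin_subset_trans) auto
  moreover have "closedin (top_of_set ?S) (?S \<inter> K)" by (rule closedin_closed_Int[OF K_closed])
  moreover have "?S \<inter> K \<noteq> {}" using xK x(2) nu(3,4)[OF xK] by blast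
  ultimately have "?S \<inter> K = ?S" using connected_upper_sphere[OF R(1), of m] unfolding connected_clopen by blast
  then have SK: "?S \<subseteq> K" by blast
  have xs: "norm (\<nu> x) = 1" "snd x = snd m + R * snd (\<nu> x)"
    using nu_facts(2)[OF x(1)] arg_cong[OF nu(1)[OF xK], of snd] by simp_all
  have "\<bar>snd (\<nu> x)\<bar> \<le> 1" using Cauchy_Schwarz_ineq2[of "\<nu> x" E_last] xs(1) by simp
  then have "R * snd (\<nu> x) \<le> R" using R(1) by (simp add: mult_left_le)
  then have top: "0 < snd m + R" using xs(2) x(2) by linarith
  have eqK: "y \<in> K" if "y \<in> sphere m R" "y \<noteq> ?b" "snd y = 0" for y
    by (rule equator_in_closed[OF R(1) K_closed SK that top])
  have nuK: "snd (\<nu> y) = k" if "y \<in> K" "snd y = snd m + R * k" for y k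
    using arg_cong[OF nu(1)[OF that(1)], of snd] that(2) R(1) by simp
  \<comment> \<open>With a higher centre, the sphere would have points of \<open>K\<close> above the
    hyperplane whose normals are lower than \<open>c\<close>, which \<open>nonflat_umbilic\<close>
    forbids; \<open>k\<close> is such a normal height.\<close>
  have m1: "snd m + c * R \<le> 0"
  proof (rule ccontr)
    assume n: "\<not> snd m + c * R \<le> 0"
    have "- snd m / R < c" unfolding pos_divide_less_eq[OF R(1)] using n by simp
    then have "max (-1) (- snd m / R) < c" using c(1) by simp
    then obtain k where "max (-1) (- snd m / R) < k" and k3: "k < c" using dense by blast
    then have k: "-1 < k" "- snd m / R < k" by simp_all
    then have "\<bar>k\<bar> \<le> 1" using c k3 by simp
    then obtain y where y: "y \<in> sphere m R" "snd y = snd m + R * k" using sphere_point_of_height[OF R(1), of k m] by blast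
    have "0 < snd y" using k(2) y(2) unfolding pos_divide_less_eq[OF R(1)] by (simp add: mult.commute)
    moreover have "R * (-1) < R * k" using k(1) R(1) by (intro mult_strict_left_mono)
    then have "y \<noteq> ?b" using y(2) by auto
    ultimately have "y \<in> K" using SK y(1) by blast
    then show False using nuK[OF _ y(2)] nu(2) k3 by fastforce
  qed
  \<comment> \<open>With a lower centre, the normal where the sphere meets the hyperplane would have
    height \<open>k > c\<close>, against the angle condition.\<close>
  have m2: "0 \<le> snd m + c * R"
  proof (rule ccontr)
    assume n: "\<not> 0 \<le> snd m + c * R"
    define k where "k = - snd m / R"
    have k: "c < k" "k < 1" unfolding k_def pos_less_divide_eq[OF R(1)] pos_divide_less_eq[OF R(1)] using n top by simp_all
    then have "\<bar>k\<bar> \<le> 1" using c by simp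
    then obtain y where y: "y \<in> sphere m R" "snd y = snd m + R * k" using sphere_point_of_height[OF R(1), of k m] by blast
    have y0: "snd y = 0" using y(2) R(1) by (simp add: k_def)
    have "R * (-1) < R * k" using k(1) c R(1) by (intro mult_strict_left_mono) auto
    then have "y \<noteq> ?b" using y(2) by auto
    then have yK: "y \<in> K" using eqK y(1) y0 by blast
    have "snd (\<nu> y) \<le> c" using angle boundary_iff[OF nu(5)[OF yK]] y0 by blast
    then show False using nuK[OF yK y(2)] k(1) by simp
  qed
  have m: "snd m = - c * R" using m1 m2 by simp
  have cap: "sphere m R \<inter> closure upper_half_space = K"
  proof
    show "K \<subseteq> sphere m R \<inter> closure upper_half_space" using nu(3,5) in_half by blast
    show "sphere m R \<inter> closure upper_half_space \<subseteq> K"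
    proof
      fix y assume "y \<in> sphere m R \<inter> closure upper_half_space"
      then have y: "y \<in> sphere m R" "0 \<le> snd y" by (auto simp: closure_upper_half_space)
      have "0 < (1 + c) * R" using c R(1) by simp
      then have "snd ?b < 0" using m by (simp add: algebra_simps)
      then have yb: "y \<noteq> ?b" using y(2) by auto
      show "y \<in> K"
      proof (cases "snd y = 0")
        case True then show ?thesis using eqK y(1) yb by blast
      next
        case False then show ?thesis using SK y yb by auto
      qed
    qed
  qed
  \<comment> \<open>Above the hyperplane the sphere belongs to the frontier of
    \<open>\<Omega>\<close>, so the connected set \<open>\<Omega>\<close> lies on one side of it;
    the normal at \<open>x\<close> selects the inside.\<close>
  have "\<Omega> \<inter> frontier (ball m R) = {}"
  proof -
    have "y \<notin> \<Omega>" if "y \<in> sphere m R" for y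
    proof
      assume y: "y \<in> \<Omega>"
      have "y \<in> K" using omega_facts(5)[OF y] that by (simp add: cap[symmetric] closure_upper_half_space)
      then have "y \<in> frontier \<Omega>" using omega_facts(6) nu(5) by blast
      then show False using y omega_facts(1) by (simp add: frontier_def interior_open)
    qed
    then show ?thesis using R(1) by (auto simp: frontier_ball)
  qed
  moreover have "\<Omega> \<inter> ball m R \<noteq> {}"
  proof -
    have "\<forall>\<^sub>F t in at_right 0. x - t *\<^sub>R \<nu> x \<in> \<Omega> \<and> x + t *\<^sub>R \<nu> x \<notin> \<Omega>" by (rule nu_facts(4)[OF x(1,2)])
    moreover have "\<forall>\<^sub>F t in at_right 0. (0::real) < t" by (rule eventually_at_right_less)
    moreover have "\<forall>\<^sub>F t in at_right 0. t < R" by (rule order_tendstoD(2)[OF tendsto_ident_at R(1)])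
    ultimately have "\<forall>\<^sub>F t in at_right (0::real). \<exists>t. x - t *\<^sub>R \<nu> x \<in> \<Omega> \<inter> ball m R"
    proof eventually_elim
      case (elim t)
      have "m - (x - t *\<^sub>R \<nu> x) = - ((R - t) *\<^sub>R \<nu> x)"
        by (subst (1) nu(1)[OF xK]) (simp add: algebra_simps)
      then have "dist m (x - t *\<^sub>R \<nu> x) = R - t" using elim xs(1) by (simp add: dist_norm)
      then show ?case using elim by (intro exI[of _ t]) simp
    qed
    then have "\<exists>t. x - t *\<^sub>R \<nu> x \<in> \<Omega> \<inter> ball m R" by simp
    then show ?thesis by blast
  qed
  ultimately have "\<Omega> \<subseteq> ball m R" using connected_Int_frontier[OF omega_facts(2), of "ball m R"] by blast
  then show ?thesis using that[OF R(1) m nu(3)[OF xK]] K_open cap by simp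
qed

text \<open>Two caps coincide because each lies in the closure of \<open>\<Omega>\<close> and so in
  the closed ball of the other. Comparing the heights of their top points bounds either radius by
  the other one.\<close>

lemma surface_is_cap:
  obtains m R where "0 < R" "snd m = - c * R" "\<Sigma> = sphere m R \<inter> closure upper_half_space"
proof -
  have "norm (E_last :: 'n space) = 1" "(E_last :: 'n space) \<noteq> - E_last" by (auto simp: E_last_def)
  then have "\<Sigma> \<noteq> {}" using sup_attained_on_surface by blast
  then obtain x where x: "x \<in> \<Sigma>" "0 < snd x" "H x \<noteq> 0"
    using nonflat_point[of \<Sigma>] compact_imp_closed[OF compact_surface] by auto
  let ?cap = "\<lambda>m R. sphere m R \<inter> closure upper_half_space"
  obtain m R where m: "0 < R" "snd m = - c * R" "x \<in> sphere m R" "openin (top_of_set \<Sigma>) (?cap m R)" "\<Omega> \<subseteq> ball m R"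
    by (rule cap_through_nonflat_point[OF x], rule that)
  have cl: "closure \<Omega> \<subseteq> cball m R" if "\<Omega> \<subseteq> ball m R" for m R
    using that by (meson ball_subset_cball closed_cball closure_minimal order_trans)
  have top: "m' + r' *\<^sub>R E_last \<in> ?cap m' r'" if "0 < r'" "snd m' = - c * r'" for m' :: "'n space" and r'
  proof -
    have "0 < (1 - c) * r'" using c that by simp
    then show ?thesis using that by (simp add: closure_upper_half_space dist_norm algebra_simps)
  qed
  have le: "r' \<le> r" "r' = r \<Longrightarrow> m' = p"
    if r: "0 < r" "snd p = - c * r" "\<Omega> \<subseteq> ball p r"
      and r': "0 < r'" "snd m' = - c * r'" "openin (top_of_set \<Sigma>) (?cap m' r')" for p m' :: "'n space" and r r'
  proof -
    have "m' + r' *\<^sub>R E_last \<in> closure \<Omega>" using top[OF r'(1,2)] openin_imp_subset[OF r'(3)] surface_in_closure by blast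
    then have d: "norm (m' + r' *\<^sub>R E_last - p) \<le> r" using cl[OF r(3)] by (auto simp: dist_norm norm_minus_commute)
    let ?z = "m' + r' *\<^sub>R E_last - p"
    have sz: "snd ?z = (1 - c) * r' + c * r" using r r' by (simp add: algebra_simps)
    have "snd ?z \<le> norm ?z" using norm_cauchy_schwarz[of ?z E_last] by (simp only: inner_E_last norm_E_last mult_1_right)
    then have "(1 - c) * r' \<le> (1 - c) * r" using sz d by (simp add: algebra_simps)
    then show "r' \<le> r" using c by simp
    assume "r' = r"
    \<comment> \<open>With equal radii, the top point of one cap already has the greatest height in
      the ball of the other, so it lies straight above that centre.\<close>
    then have sr: "snd ?z = r" using sz by (simp add: algebra_simps)
    have "(norm ?z)^2 = (norm (fst ?z))^2 + (snd ?z)^2" by (simp add: norm_prod_def)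
    moreover have "(norm ?z)^2 \<le> r^2" using d by (simp add: power_mono)
    ultimately have "(norm (fst ?z))^2 \<le> 0" using sr by simp
    then have "fst ?z = 0" by simp
    then show "m' = p" using r r' \<open>r' = r\<close> by (simp add: prod_eq_iff E_last_def)
  qed
  have "\<Sigma> - ?cap m R = {}"
  proof (rule ccontr)
    assume ne: "\<Sigma> - ?cap m R \<noteq> {}"
    have "open (- ?cap m R)" by (rule open_Compl[OF closed_Int[OF closed_sphere closed_closure]])
    from openin_open_Int[OF this, of \<Sigma>] have o: "openin (top_of_set \<Sigma>) (\<Sigma> - ?cap m R)"
      unfolding Diff_eq .
    obtain T where T: "open T" "?cap m R = \<Sigma> \<inter> T" using m(4) by (auto simp: openin_open)
    have "closed (\<Sigma> - T)" using compact_imp_closed[OF compact_surface] T(1) by (rule closed_Diff)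
    moreover have "\<Sigma> - T = \<Sigma> - ?cap m R" using T(2) by blast
    ultimately have "closed (\<Sigma> - ?cap m R)" by simp
    from nonflat_point[OF o this ne] obtain y where y: "y \<in> \<Sigma>" "y \<notin> ?cap m R" "0 < snd y" "H y \<noteq> 0" by blast
    obtain m' R' where m': "0 < R'" "snd m' = - c * R'" "y \<in> sphere m' R'" "openin (top_of_set \<Sigma>) (?cap m' R')" "\<Omega> \<subseteq> ball m' R'"
      by (rule cap_through_nonflat_point[OF y(1,3,4)], rule that)
    have "R' = R" by (rule antisym[OF le(1)[OF m(1,2,5) m'(1,2,4)] le(1)[OF m'(1,2,5) m(1,2,4)]])
    moreover from this have "m' = m" by (rule le(2)[OF m(1,2,5) m'(1,2,4)])
    ultimately show False using y(2,3) m'(3) by (auto simp: closure_upper_half_space)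
  qed
  then show ?thesis using that[OF m(1,2)] openin_imp_subset[OF m(4)] by blast
qed

end

section \<open>Spherical caps\<close>

lemma horizontal_unit:
  fixes v :: "('n::finite) space"
  obtains d :: "'n space" where "norm d = 1" "snd d = 0" "0 \<le> d \<bullet> v"
proof -
  define a :: "'n space" where "a = (axis undefined 1, 0)"
  have a: "norm a = 1" "snd a = 0" by (simp_all add: a_def norm_Pair norm_axis_1)
  show ?thesis
    using a that[of a] that[of "- a"] by (cases "0 \<le> a \<bullet> v") auto
qed

context enclosing_surface
begin

text \<open>Above the hyperplane, frontier points of \<open>\<Omega>\<close> lie on the sphere. If
  \<open>\<Omega>\<close> were outside the ball, a horizontal ray directed away from the centre
  would never reach the sphere and would stay in the bounded set \<open>\<Omega>\<close>.\<close>

lemma domain_inside_cap: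
  assumes R: "0 < R" and cap: "\<Sigma> = sphere m R \<inter> closure upper_half_space"
  shows "\<Omega> \<subseteq> ball m R"
proof -
  have disj: "y \<notin> \<Omega>" if "y \<in> sphere m R" for y
  proof
    assume y: "y \<in> \<Omega>"
    have "y \<in> \<Sigma>" using omega_facts(5)[OF y] that by (simp add: cap closure_upper_half_space)
    then have "y \<in> frontier \<Omega>" using omega_facts(6) by blast
    then show False using y omega_facts(1) by (simp add: frontier_def interior_open)
  qed
  have "\<Omega> \<inter> ball m R \<noteq> {}"
  proof
    assume out: "\<Omega> \<inter> ball m R = {}"
    obtain q where q: "q \<in> \<Omega>" using omega_facts(3) by blast
    obtain d where d: "norm d = 1" "snd d = 0" "0 \<le> d \<bullet> (q - m)" by (rule horizontal_unit)
    have qR: "R < norm (q - m)" using q disj[of q] out by (force simp: dist_norm norm_minus_commute)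
    let ?C = "(\<lambda>t. q + t *\<^sub>R d) ` {0..}"
    have dd: "d \<bullet> d = 1" using d(1) by (simp add: dot_square_norm)
    have far: "R < dist m (q + t *\<^sub>R d)" if "0 \<le> t" for t
    proof -
      have "(norm (q - m))^2 \<le> (norm (q - m))^2 + 2 * (t * (d \<bullet> (q - m))) + t^2" using d(3) that by simp
      also have "\<dots> = (norm ((q - m) + t *\<^sub>R d))^2"
        unfolding power2_norm_eq_inner by (simp add: inner_add_left inner_add_right dd power2_eq_square, simp add: inner_commute algebra_simps)
      finally have "norm (q - m) \<le> norm ((q - m) + t *\<^sub>R d)" by (rule power2_le_imp_le) simp
      then show ?thesis using qR by (simp add: dist_norm norm_minus_commute algebra_simps)
    qed
    have "?C \<subseteq> \<Omega>"
    proof (rule connected_in_omega)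
      show "connected ?C" by (intro connected_continuous_image continuous_intros) simp
      show "?C \<inter> \<Omega> \<noteq> {}" using q by (force intro: image_eqI[of _ _ 0])
      show "?C \<inter> frontier \<Omega> = {}"
      proof (rule ccontr)
        assume "?C \<inter> frontier \<Omega> \<noteq> {}"
        then obtain t where t: "0 \<le> t" "q + t *\<^sub>R d \<in> frontier \<Omega>" by auto
        moreover have "0 < snd (q + t *\<^sub>R d)" using omega_facts(5)[OF q] d(2) by simp
        ultimately have "q + t *\<^sub>R d \<in> sphere m R" using frontier_upper cap by blast
        then show False using far[OF t(1)] by simp
      qed
    qed
    moreover obtain b where b: "\<And>y. y \<in> \<Omega> \<Longrightarrow> norm y \<le> b" using omega_facts(4) bounded_iff by blast
    define t where "t = b + norm q + 1"
    have "0 \<le> b" using b[OF q] norm_ge_zero order_trans by blast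
    then have t: "0 \<le> t" by (simp add: t_def)
    ultimately have "q + t *\<^sub>R d \<in> \<Omega>" by blast
    from b[OF this] have "norm (t *\<^sub>R d) \<le> b + norm q"
      using norm_triangle_ineq4[of "q + t *\<^sub>R d" q] by simp
    then show False using t d(1) by (simp add: t_def)
  qed
  moreover have "\<Omega> \<inter> frontier (ball m R) = {}" using disj R by (auto simp: frontier_ball)
  ultimately show ?thesis using connected_Int_frontier[OF omega_facts(2), of "ball m R"] by blast
qed

text \<open>The distance to \<open>m\<close> is constant along a patch, so \<open>x - m\<close> is a
  multiple of the normal. Its sign is found above the hyperplane, where \<open>\<Omega>\<close> lies
  inside the ball, and extended to the boundary by continuity.\<close>

lemma normal_of_cap:
  assumes R: "0 < R" and cap: "\<Sigma> = sphere m R \<inter> closure upper_half_space" and x: "x \<in> \<Sigma>"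
  shows "x - m = R *\<^sub>R \<nu> x"
proof -
  have multiple: "x - m = ((x - m) \<bullet> \<nu> x) *\<^sub>R \<nu> x" if x: "x \<in> \<Sigma>" for x
  proof -
    obtain W U \<phi> \<phi>' \<phi>'' \<psi> u where P: "patch_normal \<Sigma> W U \<phi> \<phi>' \<phi>'' \<psi> \<nu>" and u: "u \<in> W" "\<phi> u = x"
      using chart[OF x] by metis
    interpret P: patch_normal \<Sigma> W U \<phi> \<phi>' \<phi>'' \<psi> \<nu> by fact
    have "((\<lambda>v. (\<phi> v - m) \<bullet> (\<phi> v - m)) has_derivative (\<lambda>h. (\<phi> u - m) \<bullet> (\<phi>' u h - 0) + (\<phi>' u h - 0) \<bullet> (\<phi> u - m))) (at u within W)"
      by (intro has_derivative_inner has_derivative_diff P.deriv_within u has_derivative_const)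
    moreover have "((\<lambda>v. (\<phi> v - m) \<bullet> (\<phi> v - m)) has_derivative (\<lambda>h. 0)) (at u within W)"
    proof (rule has_derivative_transform[OF u(1) _ has_derivative_const[of "R^2"]])
      fix v assume "v \<in> W"
      then have "dist m (\<phi> v) = R" using P.phi_in cap by auto
      then show "(\<phi> v - m) \<bullet> (\<phi> v - m) = R^2" by (simp add: dist_norm norm_minus_commute dot_square_norm)
    qed
    ultimately have "(\<lambda>h. (\<phi> u - m) \<bullet> (\<phi>' u h - 0) + (\<phi>' u h - 0) \<bullet> (\<phi> u - m)) = (\<lambda>h. 0)"
      using P.derivative_unique[OF _ _ u(1)] by blast
    then have "(x - m) \<bullet> \<phi>' u h = 0" for h using u(2) by (simp add: fun_eq_iff inner_commute)
    from P.orth_tangent_imp_multiple[OF u(1) this] show ?thesis using u(2) by simp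
  qed
  have interior: "(x - m) \<bullet> \<nu> x = R" if x: "x \<in> \<Sigma>" "0 < snd x" for x
  proof -
    define \<mu> where "\<mu> = (x - m) \<bullet> \<nu> x"
    have \<mu>: "x - m = \<mu> *\<^sub>R \<nu> x" using multiple[OF x(1)] by (simp add: \<mu>_def)
    have nx: "norm (\<nu> x) = 1" using nu_facts(2)[OF x(1)] .
    have "norm (x - m) = R" using x(1) cap by (auto simp: dist_norm norm_minus_commute)
    then have a: "\<bar>\<mu>\<bar> = R" using \<mu> nx by simp
    have "\<forall>\<^sub>F t in at_right 0. x - t *\<^sub>R \<nu> x \<in> \<Omega> \<and> x + t *\<^sub>R \<nu> x \<notin> \<Omega>" by (rule nu_facts(4)[OF x])
    moreover have "\<forall>\<^sub>F t in at_right 0. (0::real) < t" by (rule eventually_at_right_less)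
    ultimately have "\<forall>\<^sub>F t in at_right (0::real). \<mu> = R"
    proof eventually_elim
      case (elim t)
      then have "x - t *\<^sub>R \<nu> x \<in> ball m R" using domain_inside_cap[OF R cap] by blast
      moreover have "(x - t *\<^sub>R \<nu> x) - m = (\<mu> - t) *\<^sub>R \<nu> x" using \<mu> by (simp add: algebra_simps)
      then have "norm ((x - t *\<^sub>R \<nu> x) - m) = \<bar>\<mu> - t\<bar>" using nx by simp
      ultimately have "\<bar>\<mu> - t\<bar> < R" by (simp add: dist_norm norm_minus_commute)
      then show ?case using a elim by (auto simp: abs_if split: if_splits)
    qed
    then show ?thesis by (simp add: \<mu>_def)
  qed
  have "(x - m) \<bullet> \<nu> x = R"
  proof (cases "snd x = 0")
    case True
    have "continuous_on \<Sigma> (\<lambda>x. (x - m) \<bullet> \<nu> x)" by (intro continuous_intros nu_facts(1))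
    then have cl: "closed {x \<in> \<Sigma>. (x - m) \<bullet> \<nu> x = R}"
      by (rule continuous_closed_preimage_constant[OF _ compact_imp_closed[OF compact_surface]])
    have "\<exists>y\<in>{x \<in> \<Sigma>. (x - m) \<bullet> \<nu> x = R}. dist y x < e" if "0 < e" for e
      using boundary_limit[OF x True that] interior by blast
    then have "x \<in> {x \<in> \<Sigma>. (x - m) \<bullet> \<nu> x = R}" using closed_approachable[OF cl] by blast
    then show ?thesis by blast
  qed (use interior x snd_nonneg[OF x] in auto)
  then show ?thesis using multiple[OF x] by simp
qed

lemma cap_umbilic:
  assumes R: "0 < R" and cap: "\<Sigma> = sphere m R \<inter> closure upper_half_space" and x: "x \<in> \<Sigma>"
  shows "mean_curvature \<Sigma> \<nu> x = 1 / R"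
    "\<And>v. v \<in> tangent_space \<Sigma> x \<Longrightarrow> frechet_derivative \<nu> (at x within \<Sigma>) v = (1 / R) *\<^sub>R v"
proof -
  obtain W U \<phi> \<phi>' \<phi>'' \<psi> u where P: "patch_normal \<Sigma> W U \<phi> \<phi>' \<phi>'' \<psi> \<nu>" and u: "u \<in> W" "\<phi> u = x"
    using chart[OF x] by metis
  interpret P: patch_normal \<Sigma> W U \<phi> \<phi>' \<phi>'' \<psi> \<nu> by fact
  have "((\<lambda>v. \<nu> (\<phi> v)) has_derivative (\<lambda>h. (1 / R) *\<^sub>R (\<phi>' u h - 0))) (at u within W)"
  proof (rule has_derivative_transform[OF u(1)])
    show "((\<lambda>v. (1 / R) *\<^sub>R (\<phi> v - m)) has_derivative (\<lambda>h. (1 / R) *\<^sub>R (\<phi>' u h - 0))) (at u within W)"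
      by (intro has_derivative_scaleR_right has_derivative_diff P.deriv_within u has_derivative_const)
    show "\<nu> (\<phi> v) = (1 / R) *\<^sub>R (\<phi> v - m)" if "v \<in> W" for v
      using normal_of_cap[OF R cap P.phi_in[OF that]] R by simp
  qed
  from P.derivative_unique[OF P.nu_along_has_derivative[OF u(1)] this u(1)]
  have w: "P.weingarten u h = (1 / R) *\<^sub>R \<phi>' u h" for h by (simp add: fun_eq_iff)
  show S: "frechet_derivative \<nu> (at x within \<Sigma>) v = (1 / R) *\<^sub>R v" if v: "v \<in> tangent_space \<Sigma> x" for v
  proof -
    obtain h where "v = \<phi>' u h" using v P.tangent_space_eq[OF u(1)] u(2) by auto
    then show ?thesis using P.shape_operator(3)[OF u(1), of h] u(2) w by simp
  qed
  obtain e :: "'n \<Rightarrow> 'n space" and l :: "'n \<Rightarrow> real"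
    where e: "\<And>i. frechet_derivative \<nu> (at (\<phi> u) within \<Sigma>) (e i) = l i *\<^sub>R e i"
      "\<And>i j. e i \<bullet> e j = (if i = j then 1 else 0)" "\<And>i. \<nu> (\<phi> u) \<bullet> e i = 0"
      "real CARD('n) * mean_curvature \<Sigma> \<nu> (\<phi> u) = (\<Sum>i\<in>UNIV. l i)"
    by (rule P.principal_frame[OF u(1)], rule that)
  have "l i = 1 / R" for i
  proof -
    have "e i \<in> tangent_space \<Sigma> x" using e(3) P.tangent_space_hyperplane[OF u(1)] u(2) by simp
    from trans[OF S[OF this, symmetric] e(1)[unfolded u(2)]] have "(1 / R) *\<^sub>R e i = l i *\<^sub>R e i" .
    from arg_cong[OF this, of "\<lambda>v. v \<bullet> e i"] show ?thesis by (simp add: e(2))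
  qed
  then have "real CARD('n) * mean_curvature \<Sigma> \<nu> x = real CARD('n) * (1 / R)" using e(4) u(2) by simp
  then show "mean_curvature \<Sigma> \<nu> x = 1 / R" unfolding mult_cancel_left by simp
qed

end

text \<open>A ray from the interior point \<open>e\<close> meets the unit sphere once. If
  \<open>b - e\<close> were \<open>l\<close> times \<open>a - e\<close> with \<open>l > 1\<close>,
  subtracting the two unit norm equations would give a product of positive numbers equal to zero;
  \<open>e \<bullet> e < 1\<close> makes the second factor positive.\<close>

lemma inj_dilated_unit_sphere:
  fixes a b e :: "'a::real_inner"
  assumes ab: "norm a = 1" "norm b = 1" and c: "norm e < 1" and st: "0 < s" "0 < t"
    and eq: "t *\<^sub>R (a - e) = s *\<^sub>R (b - e)"
  shows "a = b \<and> s = t"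
proof -
  have *: "t \<le> s" if ab: "norm a = 1" "norm b = 1" and st: "0 < s" "0 < t" and eq: "t *\<^sub>R (a - e) = s *\<^sub>R (b - e)"
    for a b :: 'a and s t
  proof (rule ccontr)
    assume "\<not> t \<le> s"
    define l where "l = t / s"
    have l: "1 < l" using \<open>\<not> t \<le> s\<close> st by (simp add: l_def)
    define p where "p = a - e"
    have "b - e = (1 / s) *\<^sub>R (s *\<^sub>R (b - e))" using st by simp
    also have "\<dots> = l *\<^sub>R p" unfolding eq[symmetric] by (simp add: l_def p_def)
    finally have b: "b = l *\<^sub>R p + e" by (simp add: algebra_simps)
    have 1: "p \<bullet> p + 2 * (p \<bullet> e) + e \<bullet> e = 1"
    proof -
      have "a \<bullet> a = 1" using ab by (simp add: dot_square_norm)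
      moreover have "a = p + e" by (simp add: p_def)
      ultimately show ?thesis by (simp add: inner_add_left inner_add_right inner_commute)
    qed
    have 2: "l^2 * (p \<bullet> p) + 2 * l * (p \<bullet> e) + e \<bullet> e = 1"
    proof -
      have "b \<bullet> b = 1" using ab by (simp add: dot_square_norm)
      then show ?thesis unfolding b by (simp add: inner_add_left inner_add_right inner_commute power2_eq_square algebra_simps)
    qed
    have "e \<bullet> e < 1" using c by (simp add: dot_square_norm power_less_one_iff)
    then have "0 < 1 - e \<bullet> e" by simp
    moreover have "0 \<le> l * (p \<bullet> p)" using l by simp
    ultimately have pos: "0 < (l + 1) * (p \<bullet> p) + 2 * (p \<bullet> e)" using 1 by (simp add: algebra_simps)
    have "(l - 1) * ((l + 1) * (p \<bullet> p) + 2 * (p \<bullet> e)) = 0"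
      using 1 2 by (simp add: algebra_simps power2_eq_square)
    then show False using l pos by simp
  qed
  have "s = t" using *[OF ab st eq] *[OF ab(2,1) st(2,1) eq[symmetric]] by simp
  then show ?thesis using eq st by simp
qed

context capillary_surface
begin

text \<open>On a cap the estimates reverse: each point is umbilic with a supporting tangent
  hyperplane, so the Jacobian equals its bound. Cones over disjoint pieces are disjoint, being
  dilations of a spherical piece about an interior point, and all of them lie in the truncated ball
  up to a null set.\<close>

lemma cap_energy_le_volume:
  assumes R: "0 < R" and m: "snd m = - c * R" and cap: "\<Sigma> = sphere m R \<inter> closure upper_half_space"
  shows "1 / (real CARD('n) + 1) * (\<integral>x. energy x \<partial>area_measure \<Sigma>) \<le> measure lebesgue truncated_ball"
proof -
  let ?\<mu> = "area_measure \<Sigma>" and ?I = "{0<..<1::real}" and ?k = "ennreal (1 / (real CARD('n) + 1))"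
  obtain N :: nat and W U :: "nat \<Rightarrow> (real^'n) set" and \<phi> :: "nat \<Rightarrow> real^'n \<Rightarrow> 'n space" and \<phi>' \<phi>'' \<psi> B
    where P: "\<And>i. i < N \<Longrightarrow> patch_normal \<Sigma> (W i) (U i) (\<phi> i) (\<phi>' i) (\<phi>'' i) (\<psi> i) \<nu>"
    and B: "\<And>i. i < N \<Longrightarrow> B i \<in> sets borel" "\<And>i. B i \<subseteq> \<phi> i ` W i" "(\<Union>i<N. B i) = \<Sigma>" "disjoint_family_on B {..<N}"
    by (rule chart_partition, rule that)
  define S where "S i = W i \<inter> \<phi> i -` B i" for i
  define C where "C i = cone_map (\<phi> i) ` (S i \<times> ?I)" for i
  have S: "u \<in> W i" "\<phi> i u \<in> \<Sigma>" "\<phi> i u \<in> B i" if "i < N" "u \<in> S i" for i u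
    using that B(3) by (auto simp: S_def)
  have nu: "x = m + R *\<^sub>R \<nu> x" if "x \<in> \<Sigma>" for x using normal_of_cap[OF R cap that] by (simp add: algebra_simps)
  have cone_inj: "x = y \<and> s = t" if "x \<in> \<Sigma>" "y \<in> \<Sigma>" "s \<in> ?I" "t \<in> ?I"
    "t *\<^sub>R (\<nu> x - c *\<^sub>R E_last) = s *\<^sub>R (\<nu> y - c *\<^sub>R E_last)" for x y s t
  proof -
    have "norm (c *\<^sub>R E_last :: 'n space) < 1" using c by simp
    from inj_dilated_unit_sphere[OF nu_facts(2)[OF that(1)] nu_facts(2)[OF that(2)] this _ _ that(5)] that(3,4)
    have "\<nu> x = \<nu> y" "s = t" by auto
    then show ?thesis using nu[OF that(1)] nu[OF that(2)] by simp
  qed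
  have inj: "inj_on (cone_map (\<phi> i)) (S i \<times> ?I)" if i: "i < N" for i
  proof (rule inj_onI)
    fix p q assume "p \<in> S i \<times> ?I" "q \<in> S i \<times> ?I" and e: "cone_map (\<phi> i) p = cone_map (\<phi> i) q"
    then obtain u t v s where p: "p = (u, t)" "q = (v, s)" "u \<in> S i" "v \<in> S i" "t \<in> ?I" "s \<in> ?I" by blast
    interpret P: patch_normal \<Sigma> "W i" "U i" "\<phi> i" "\<phi>' i" "\<phi>'' i" "\<psi> i" \<nu> by (rule P[OF i])
    have "\<phi> i u = \<phi> i v \<and> s = t"
      by (rule cone_inj[OF S(2)[OF i p(3)] S(2)[OF i p(4)] p(6,5)]) (use e p in \<open>simp add: cone_map_def\<close>)
    then show "p = q" using P.psi_phi S(1)[OF i] p by metis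
  qed
  have disj: "disjoint_family_on C {..<N}"
    unfolding disjoint_family_on_def
  proof (intro ballI impI, rule ccontr)
    fix i j assume ij: "i \<in> {..<N}" "j \<in> {..<N}" "i \<noteq> j" and "C i \<inter> C j \<noteq> {}"
    then obtain z where "z \<in> cone_map (\<phi> i) ` (S i \<times> ?I)" "z \<in> cone_map (\<phi> j) ` (S j \<times> ?I)"
      unfolding C_def by blast
    then obtain p1 p2 where p12: "p1 \<in> S i \<times> ?I" "p2 \<in> S j \<times> ?I" "cone_map (\<phi> i) p1 = cone_map (\<phi> j) p2"
      by (elim imageE) metis
    then obtain u t v s where p: "u \<in> S i" "v \<in> S j" "t \<in> ?I" "s \<in> ?I" "cone_map (\<phi> i) (u, t) = cone_map (\<phi> j) (v, s)"
      by (elim SigmaE) metis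
    have "\<phi> i u = \<phi> j v"
      using cone_inj[OF S(2) S(2) p(4,3), of i u j v] p ij by (simp add: cone_map_def)
    then show False using S(3)[of i u] S(3)[of j v] p ij B(4) by (auto simp: disjoint_family_on_def)
  qed
  have Cm: "C i \<in> sets lebesgue" and Ce: "emeasure lebesgue (C i) = ?k * (\<integral>\<^sup>+x\<in>B i. ennreal (energy x) \<partial>?\<mu>)" if i: "i < N" for i
  proof -
    note cm = cone_map_measurable[OF P[OF i] B(1)[OF i] B(2), folded S_def, folded C_def]
      cone_map_emeasure_eq[OF P[OF i] B(1)[OF i] B(2), folded S_def, folded C_def, OF inj[OF i]]
      nn_integral_energy_cone[OF P[OF i] B(1)[OF i] B(2), folded S_def]
    show "C i \<in> sets lebesgue" by (rule cm(1))
    have "emeasure lebesgue (C i) = (\<integral>\<^sup>+p\<in>S i \<times> ?I. ennreal (jac (\<phi> i) (\<phi>' i) (\<phi>'' i) p) \<partial>lebesgue)" by (rule cm(2))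
    also have "\<dots> = (\<integral>\<^sup>+p\<in>S i \<times> ?I. ennreal (snd p ^ CARD('n) * (area_density (\<phi> i) (fst p) * energy (\<phi> i (fst p)))) \<partial>lebesgue)"
    proof (rule nn_integral_cong)
      fix p :: "(real^'n) \<times> real"
      show "ennreal (jac (\<phi> i) (\<phi>' i) (\<phi>'' i) p) * indicator (S i \<times> ?I) p =
        ennreal (snd p ^ CARD('n) * (area_density (\<phi> i) (fst p) * energy (\<phi> i (fst p)))) * indicator (S i \<times> ?I) p"
      proof (cases "p \<in> S i \<times> ?I")
        case True
        then obtain u t where p: "p = (u, t)" "u \<in> S i" "0 < t" by auto
        let ?x = "\<phi> i u"
        have x: "?x \<in> \<Sigma>" by (rule S(2)[OF i p(2)])
        \<comment> \<open>On a sphere \<open>q - x\<close> is \<open>R\<close> times the difference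
          of the normals, so Cauchy-Schwarz gives the support condition.\<close>
        have mx: "\<nu> ?x \<bullet> (q - ?x) \<le> 0" if q: "q \<in> \<Sigma>" for q
        proof -
          have "\<nu> ?x \<bullet> (q - ?x) = R * (\<nu> ?x \<bullet> \<nu> q - \<nu> ?x \<bullet> \<nu> ?x)"
            by (subst nu[OF q], subst (2) nu[OF x]) (simp add: inner_diff_right algebra_simps)
          moreover have "\<nu> ?x \<bullet> \<nu> q \<le> 1"
            using norm_cauchy_schwarz[of "\<nu> ?x" "\<nu> q"] nu_facts(2)[OF x] nu_facts(2)[OF q] by simp
          ultimately show ?thesis using R nu_nu[OF x] by (simp add: mult_le_0_iff)
        qed
        have "jac (\<phi> i) (\<phi>' i) (\<phi>'' i) p = t ^ CARD('n) * (area_density (\<phi> i) u * energy ?x)"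
          unfolding p(1) case_prod_conv
          by (subst jacobian_le_energy(3)[OF P[OF i] S(1)[OF i p(2)] p(3) mx])
            (use cap_umbilic[OF R cap x] in auto)
        then show ?thesis by (simp add: p(1))
      qed simp
    qed
    also have "\<dots> = ?k * (\<integral>\<^sup>+x\<in>B i. ennreal (energy x) \<partial>?\<mu>)" by (rule cm(3))
    finally show "emeasure lebesgue (C i) = ?k * (\<integral>\<^sup>+x\<in>B i. ennreal (energy x) \<partial>?\<mu>)" .
  qed
  have B\<Sigma>: "B i \<inter> \<Sigma> = B i" if "i < N" for i using B(3) that by blast
  have int0: "0 \<le> (\<integral>x. energy x \<partial>?\<mu>)"
    by (rule integral_nonneg_AE) (rule AE_I2, simp add: space_area_measure[OF compact_surface C2_surface] energy_nonneg)
  have "ennreal (1 / (real CARD('n) + 1) * (\<integral>x. energy x \<partial>?\<mu>)) = ?k * ennreal (\<integral>x. energy x \<partial>?\<mu>)"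
    by (rule ennreal_mult) (use int0 in auto)
  also have "\<dots> = ?k * (\<Sum>i<N. \<integral>\<^sup>+x\<in>B i. ennreal (energy x) \<partial>?\<mu>)"
    using nn_integral_energy_split[OF B(1) B(3,4) surface_borel subset_refl] nn_integral_energy B\<Sigma> by simp
  also have "\<dots> = (\<Sum>i<N. emeasure lebesgue (C i))" by (simp add: Ce sum_distrib_left)
  also have "\<dots> = emeasure lebesgue (\<Union>i<N. C i)"
    by (rule sum_emeasure[OF _ disj]) (use Cm in auto)
  \<comment> \<open>Over the rim of the cap, where the normal has height exactly \<open>c\<close>,
    the cones lie in the hyperplane; this null set is added for them.\<close>
  also have "\<dots> \<le> emeasure lebesgue (truncated_ball \<union> {z. E_last \<bullet> z = 0})"
  proof (rule emeasure_mono)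
    show "(\<Union>i<N. C i) \<subseteq> truncated_ball \<union> {z. E_last \<bullet> z = 0}"
    proof
      fix z assume "z \<in> (\<Union>i<N. C i)"
      then obtain i u t where i: "i < N" "u \<in> S i" "t \<in> ?I" "z = cone_map (\<phi> i) (u, t)" by (auto simp: C_def)
      let ?x = "\<phi> i u"
      have x: "?x \<in> \<Sigma>" by (rule S(2)[OF i(1,2)])
      have z: "z = t *\<^sub>R (\<nu> ?x - c *\<^sub>R E_last)" using i(4) by (simp add: cone_map_def)
      have "snd ?x = snd m + R * snd (\<nu> ?x)" by (subst nu[OF x]) simp
      then have "0 \<le> R * (snd (\<nu> ?x) - c)" using snd_nonneg[OF x] m by (simp add: algebra_simps)
      then have "c \<le> snd (\<nu> ?x)" using R by (simp add: zero_le_mult_iff)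
      then have sz: "0 \<le> snd z" using i(3) by (simp add: z)
      \<comment> \<open>\<open>z\<close> lies strictly between the origin, an interior point of the
        ball since \<open>\<bar>c\<bar> < 1\<close>, and a point of its boundary sphere.\<close>
      have "z + c *\<^sub>R E_last = t *\<^sub>R \<nu> ?x + ((1 - t) * c) *\<^sub>R E_last" by (simp add: z algebra_simps)
      then have "norm (z + c *\<^sub>R E_last) \<le> norm (t *\<^sub>R \<nu> ?x) + norm (((1 - t) * c) *\<^sub>R (E_last :: 'n space))"
        using norm_triangle_ineq by metis
      also have "\<dots> = t + (1 - t) * \<bar>c\<bar>" using i(3) nu_facts(2)[OF x] by (simp add: abs_mult)
      also have "\<dots> < t + (1 - t) * 1" using i(3) c by (intro add_strict_left_mono mult_strict_left_mono) auto
      finally have "norm (z + c *\<^sub>R E_last) < 1" by simp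
      then have "z \<in> ball (- c *\<^sub>R E_last) 1" by (simp add: dist_norm norm_minus_commute algebra_simps)
      then show "z \<in> truncated_ball \<union> {z. E_last \<bullet> z = 0}" using sz by (auto simp: upper_half_space_eq)
    qed
  qed (use truncated_ball_finite(2) in \<open>auto intro!: sets.Un borel_closed closed_hyperplane simp del: E_last_inner\<close>)
  also have "\<dots> = emeasure lebesgue truncated_ball"
  proof (rule emeasure_Un_null_set)
    have "negligible {z :: 'n space. E_last \<bullet> z = 0}" by (rule negligible_hyperplane) (simp add: E_last_nonzero)
    then show "{z :: 'n space. E_last \<bullet> z = 0} \<in> null_sets lebesgue" by (simp only: negligible_iff_null_sets)
  qed (use truncated_ball_finite(2) in simp)
  also have "\<dots> = ennreal (measure lebesgue truncated_ball)"
    using truncated_ball_finite by (intro emeasure_eq_ennreal_measure) (simp add: less_top[symmetric])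
  finally show ?thesis by (subst (asm) ennreal_le_iff) auto
qed

end

theorem theorem1p3:
  fixes \<Sigma> \<Omega> :: "('n::finite) space set"
    and \<nu> :: "'n space \<Rightarrow> 'n space"
    and \<theta>\<^sub>0 :: real
  assumes "CARD('n) \<ge> 2"
    and "0 < \<theta>\<^sub>0" and "\<theta>\<^sub>0 < pi"
    and "\<Sigma> \<subseteq> closure upper_half_space"
    and "compact \<Sigma>"
    and "C2_hypersurface \<Sigma>"
    and "hypersurface_boundary \<Sigma> \<subseteq> frontier upper_half_space"
    and "transversal_to_hyperplane \<Sigma>"
    and "enclosed_domain \<Sigma> \<Omega>"
    and "outward_unit_normal \<Sigma> \<Omega> \<nu>"
    and "\<forall>x \<in> hypersurface_boundary \<Sigma>. \<nu> x \<bullet> (- E_last) \<ge> - cos \<theta>\<^sub>0"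
  shows
    "1 / (real CARD('n) + 1) *
       (\<integral>x. (1 - cos \<theta>\<^sub>0 * (\<nu> x \<bullet> E_last)) * \<bar>mean_curvature \<Sigma> \<nu> x\<bar> ^ CARD('n) \<partial>area_measure \<Sigma>)
       \<ge> measure lebesgue (truncated_unit_ball \<theta>\<^sub>0 :: 'n space set)
     \<and>
     (1 / (real CARD('n) + 1) *
       (\<integral>x. (1 - cos \<theta>\<^sub>0 * (\<nu> x \<bullet> E_last)) * \<bar>mean_curvature \<Sigma> \<nu> x\<bar> ^ CARD('n) \<partial>area_measure \<Sigma>)
       = measure lebesgue (truncated_unit_ball \<theta>\<^sub>0 :: 'n space set)
      \<longleftrightarrow> capillary_spherical_cap \<theta>\<^sub>0 \<Sigma>)"
proof -
  interpret capillary_surface \<Sigma> \<Omega> \<nu> "cos \<theta>\<^sub>0"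
  proof
    show "-1 < cos \<theta>\<^sub>0" "cos \<theta>\<^sub>0 < 1"
      using cos_monotone_0_pi[of \<theta>\<^sub>0 pi] cos_monotone_0_pi[of 0 \<theta>\<^sub>0] assms(2,3) by simp_all
    show "snd (\<nu> x) \<le> cos \<theta>\<^sub>0" if "x \<in> hypersurface_boundary \<Sigma>" for x
      using assms(11) that by fastforce
  qed (fact assms)+
  let ?I = "1 / (real CARD('n) + 1) * (\<integral>x. energy x \<partial>area_measure \<Sigma>)"
  have energy: "(1 - cos \<theta>\<^sub>0 * (\<nu> x \<bullet> E_last)) * \<bar>mean_curvature \<Sigma> \<nu> x\<bar> ^ CARD('n) = energy x" for x
    by (simp add: energy_def weight_def)
  have ball: "(truncated_unit_ball \<theta>\<^sub>0 :: 'n space set) = truncated_ball"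
    by (simp add: truncated_unit_ball_def)
  have "capillary_spherical_cap \<theta>\<^sub>0 \<Sigma>" if "?I = measure lebesgue truncated_ball"
  proof -
    interpret extremal_surface \<Sigma> \<Omega> \<nu> "cos \<theta>\<^sub>0"
      by unfold_locales (use assms(1) that in auto)
    obtain m R where m: "0 < R" "snd m = - cos \<theta>\<^sub>0 * R" "\<Sigma> = sphere m R \<inter> closure upper_half_space"
      by (rule surface_is_cap, rule that)
    \<comment> \<open>This quotient is \<open>cos \<theta>\<^sub>0\<close>, the height of the normal
      on the hyperplane, so the sphere really meets the hyperplane.\<close>
    have "\<bar>- snd m / R\<bar> \<le> 1" using m(1,2) by simp
    then obtain y where "y \<in> sphere m R" "snd y = snd m + R * (- snd m / R)"
      using sphere_point_of_height[OF m(1)] by blast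
    then have "y \<in> \<Sigma> \<inter> frontier upper_half_space"
      using m(1) by (simp add: m(3) closure_upper_half_space frontier_upper_half_space)
    moreover have "((x - m) /\<^sub>R R) \<bullet> (- E_last) = - cos \<theta>\<^sub>0" if "x \<in> frontier upper_half_space" for x
      using that m(1,2) by (simp add: frontier_upper_half_space)
    ultimately show ?thesis
      unfolding capillary_spherical_cap_def using m(1,3) assms(8) by blast
  qed
  \<comment> \<open>For a cap only this bound is left to prove; the opposite one is the inequality
    itself.\<close>
  moreover have "?I \<le> measure lebesgue truncated_ball" if "capillary_spherical_cap \<theta>\<^sub>0 \<Sigma>"
  proof -
    from that obtain m R x where m: "0 < R" "\<Sigma> = sphere m R \<inter> closure upper_half_space"
      and x: "x \<in> frontier upper_half_space" "((x - m) /\<^sub>R R) \<bullet> (- E_last) = - cos \<theta>\<^sub>0"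
      unfolding capillary_spherical_cap_def by blast
    have "snd m = - cos \<theta>\<^sub>0 * R" using x m(1) by (simp add: frontier_upper_half_space field_simps)
    then show ?thesis by (rule cap_energy_le_volume[OF m(1) _ m(2)])
  qed
  ultimately show ?thesis
    unfolding energy ball using volume_le_energy by (auto intro: antisym)
qed

end
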